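(* Let $0<r\leq 1$, $1\leq p,q<\infty$, and let $w$ be a submultiplicative polynomially moderate weight on $\mathbb{R}^{2n}$. The operator $f(A)$ is $r$-nuclear on $\mathcal{M}^{p,q}_w(\mathbb{R}^n)$, provided that $$\sum_{j=1}^\infty|f(\lambda_j)|^r\,\|u_j\|^r_{\mathcal{M}^{p,q}_w}\,\|u_j\|^r_{\mathcal{M}^{p',q'}_{w^{-1}}}<\infty.\qquad( * )$$ If, in particular, $( * )$ holds for $r=1$, then we have the trace formula $$\mathrm{Tr}(f(A))=\sum_{j=1}^\infty f(\lambda_j),$$ where the series $\sum_{j=1}^\infty f(\lambda_j)$ converges absolutely.
   Context: Fix integers $n,k,l\geq 1$ and let $A=A_{k,l}=(-\Delta)^l+|x|^{2k}+1$ on $\mathbb{R}^n$ (the anharmonic oscillator), where $\Delta$ is the Laplacian and $|\cdot|$ the Euclidean norm. $A$ has a unique self-adjoint extension on $L^2(\mathbb{R}^n)$ with purely discrete spectrum in $(0,\infty)$; $(u_j)_{j\in\mathbb{N}}$ is an orthonormal basis of $L^2(\mathbb{R}^n)$ consisting of eigenfunctions of $A$, with eigenvalues $(\lambda_j)_{j\in\mathbb{N}}$ repeated according to multiplicity. For a complex-valued function $f$ on the spectrum, $f(A)$ is the operator with kernel $\sum_j f(\lambda_j)u_j(x)\overline{u_j(y)}$, i.e. $f(A)h=\sum_jf(\lambda_j)(h,u_j)_{L^2}u_j$. Weights: a weight is a non-negative locally integrable function on $\mathbb{R}^{2n}$. A weight $u$ is submultiplicative if $u(x_1+x_2)\leq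 u(x_1)u(x_2)$ for all $x_1,x_2\in\mathbb{R}^{2n}$. A weight $v$ is $u$-moderate if $v(x_1+x_2)\leq u(x_1)v(x_2)$ for all $x_1,x_2\in\mathbb{R}^{2n}$. A weight is polynomially moderate if it is $v_s$-moderate for some $s$, where $v_s(x,\xi)=(1+|x|^2+|\xi|^2)^{s/2}$. Modulation spaces: for a window $g\in\mathcal{S}(\mathbb{R}^n)$ (here the Gaussian $g(x)=2^{n/4}e^{-\pi|x|^2}$), the short-time Fourier transform is $V_gh(x,\xi)=\int_{\mathbb{R}^n}h(y)\overline{g(y-x)}e^{-iy\cdot\xi}\,dy$, and $\mathcal{M}^{p,q}_w(\mathbb{R}^n)$ is the Banach space of $h\in\mathcal{S}'(\mathbb{R}^n)$ with $$\|h\|_{\mathcal{M}^{p,q}_w}=\left(\int_{\mathbb{R}^n}\left(\int_{\mathbb{R}^n}|V_gh(x,\xi)|^pw(x,\xi)^p\,dx\right)^{q/p}d\xi\right)^{1/q}<\infty,$$ with the usual modification (essential suprema) when an exponent is $\infty$. Here $p',q'$ are the conjugate exponents of $p,q$, and $\mathcal{M}^{p',q'}_{w^{-1}}=(\mathcal{M}^{p,q}_w)'$ for $1\leq p,q<\infty$, under the bilinear pairing extending $\int_{\mathbb{R}^n}h_1(x)h_2(x)\,dx$. Nuclearity and trace: a bounded linear operator $T$ on a Banach space $\mathcal{B}$ is $r$-nuclear if $T=\sum_{j=1}^\infty\varphi_j\otimes\psi_j'$ with $\varphi_j\in\mathcal{B}$, $\psi_j'\in\mathcal{B}'$ and $\sum_j\|\psi_j'\|_{\mathcal{B}'}^r\|\varphi_j\|_{\mathcal{B}}^r<\infty$;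 nuclear means $1$-nuclear. If $\mathcal{B}$ has the metric approximation property (which $\mathcal{M}^{p,q}_w(\mathbb{R}^n)$ has for $w$ as in the claim), the trace of a nuclear $T$ is $\mathrm{Tr}(T)=\sum_{j=1}^\infty\langle\varphi_j,\psi_j'\rangle_{\mathcal{B},\mathcal{B}'}$, independently of the nuclear representation. *)

theory Defs
  imports "HOL-Analysis.Analysis" "HOL-Probability.Essential_Supremum"
begin

section \<open>Schwartz functions and tempered distributions\<close>

definition pderiv_coord :: "'n \<Rightarrow> (real ^ 'n \<Rightarrow> complex) \<Rightarrow> (real ^ 'n::finite \<Rightarrow> complex)" where
  "pderiv_coord i \<phi> x = vector_derivative (\<lambda>t. \<phi> (x + t *\<^sub>R axis i 1)) (at 0)"

fun pderivs :: "'n list \<Rightarrow> (real ^ 'n \<Rightarrow> complex) \<Rightarrow> (real ^ 'n::finite \<Rightarrow> complex)" where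
  "pderivs [] \<phi> = \<phi>"
| "pderivs (i # is) \<phi> = pderiv_coord i (pderivs is \<phi>)"

text \<open>A function is smooth iff all its iterated partial derivatives are (Frechet) differentiable
  everywhere. Lists of coordinates play the role of multi-indices.\<close>

definition smooth_fn :: "(real ^ 'n::finite \<Rightarrow> complex) \<Rightarrow> bool" where
  "smooth_fn \<phi> \<longleftrightarrow> (\<forall>is x. pderivs is \<phi> differentiable (at x))"

definition schwartz :: "(real ^ 'n::finite \<Rightarrow> complex) set" where
  "schwartz = {\<phi>. smooth_fn \<phi> \<and>
     (\<forall>N is. bounded (range (\<lambda>x. (1 + norm x) ^ N * cmod (pderivs is \<phi> x))))}"

definition schwartz_norm :: "nat \<Rightarrow> (real ^ 'n::finite \<Rightarrow> complex) \<Rightarrow> real" where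
  "schwartz_norm N \<phi> = (\<Sum>is | length is \<le> N. SUP x. (1 + norm x) ^ N * cmod (pderivs is \<phi> x))"

text \<open>A tempered distribution is a linear functional on the Schwartz space that is bounded by a
  Schwartz seminorm. As it is rendered by a total function, its value outside the Schwartz space
  is normalised to 0, so that equality of distributions is equality of functions.\<close>

definition tempered :: "((real ^ 'n::finite \<Rightarrow> complex) \<Rightarrow> complex) set" where
  "tempered = {h.
     (\<forall>\<phi>. \<phi> \<notin> schwartz \<longrightarrow> h \<phi> = 0) \<and>
     (\<forall>\<phi>\<in>schwartz. \<forall>\<psi>\<in>schwartz. h (\<lambda>y. \<phi> y + \<psi> y) = h \<phi> + h \<psi>) \<and>
     (\<forall>c. \<forall>\<phi>\<in>schwartz. h (\<lambda>y. c * \<phi> y) = c * h \<phi>) \<and>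
     (\<exists>C N. \<forall>\<phi>\<in>schwartz. cmod (h \<phi>) \<le> C * schwartz_norm N \<phi>)}"

definition dist_of :: "(real ^ 'n::finite \<Rightarrow> complex) \<Rightarrow> (real ^ 'n \<Rightarrow> complex) \<Rightarrow> complex" where
  "dist_of v \<phi> = (if \<phi> \<in> schwartz then (LINT x|lebesgue. v x * \<phi> x) else 0)"


section \<open>The space of square-integrable functions\<close>

text \<open>Functions are used in place of equivalence classes modulo equality almost everywhere.\<close>

definition L2 :: "(real ^ 'n::finite \<Rightarrow> complex) set" where
  "L2 = {v. v \<in> borel_measurable lebesgue \<and> integrable lebesgue (\<lambda>x. (cmod (v x))\<^sup>2)}"

definition L2_inner :: "(real ^ 'n::finite \<Rightarrow> complex) \<Rightarrow> (real ^ 'n \<Rightarrow> complex) \<Rightarrow> complex" where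
  "L2_inner v1 v2 = (LINT x|lebesgue. v1 x * cnj (v2 x))"

definition L2_norm :: "(real ^ 'n::finite \<Rightarrow> complex) \<Rightarrow> real" where
  "L2_norm v = sqrt (LINT x|lebesgue. (cmod (v x))\<^sup>2)"

definition orthonormal_basis_L2 :: "(nat \<Rightarrow> real ^ 'n::finite \<Rightarrow> complex) \<Rightarrow> bool" where
  "orthonormal_basis_L2 u \<longleftrightarrow>
     (\<forall>j. u j \<in> L2) \<and>
     (\<forall>i j. L2_inner (u i) (u j) = (if i = j then 1 else 0)) \<and>
     (\<forall>h\<in>L2. (\<lambda>m. L2_norm (\<lambda>x. h x - (\<Sum>j<m. L2_inner h (u j) * u j x))) \<longlonglongrightarrow> 0)"


section \<open>The anharmonic oscillator\<close>

definition neg_laplacian :: "(real ^ 'n \<Rightarrow> complex) \<Rightarrow> (real ^ 'n::finite \<Rightarrow> complex)" where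
  "neg_laplacian \<phi> x = - (\<Sum>i\<in>UNIV. pderiv_coord i (pderiv_coord i \<phi>) x)"

definition anharmonic :: "nat \<Rightarrow> nat \<Rightarrow> (real ^ 'n \<Rightarrow> complex) \<Rightarrow> (real ^ 'n::finite \<Rightarrow> complex)" where
  "anharmonic k l \<phi> x =
     (neg_laplacian ^^ l) \<phi> x + complex_of_real (norm x ^ (2 * k)) * \<phi> x + \<phi> x"

text \<open>Unbounded operators on the space of square-integrable functions are given by their graphs,
  which are closed under modification on null sets. In particular, a graph that equals its own
  adjoint graph and contains \<open>(\<phi>, A \<phi>)\<close> for all Schwartz functions \<open>\<phi>\<close> is the graph of a densely
  defined self-adjoint operator extending \<open>A\<close>.\<close>

definition adjoint_graph ::
  "((real ^ 'n \<Rightarrow> complex) \<times> (real ^ 'n \<Rightarrow> complex)) set \<Rightarrow>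
   ((real ^ 'n::finite \<Rightarrow> complex) \<times> (real ^ 'n \<Rightarrow> complex)) set" where
  "adjoint_graph G =
     {(a, b). a \<in> L2 \<and> b \<in> L2 \<and> (\<forall>(c, d)\<in>G. L2_inner d a = L2_inner c b)}"

definition selfadjoint_extension ::
  "((real ^ 'n \<Rightarrow> complex) \<Rightarrow> (real ^ 'n \<Rightarrow> complex)) \<Rightarrow>
   ((real ^ 'n::finite \<Rightarrow> complex) \<times> (real ^ 'n \<Rightarrow> complex)) set \<Rightarrow> bool" where
  "selfadjoint_extension A G \<longleftrightarrow> adjoint_graph G = G \<and> (\<forall>\<phi>\<in>schwartz. (\<phi>, A \<phi>) \<in> G)"


section \<open>Weights\<close>

definition weight :: "((real ^ 'n::finite) \<times> (real ^ 'n) \<Rightarrow> real) \<Rightarrow> bool" where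
  "weight w \<longleftrightarrow> (\<forall>z. 0 \<le> w z) \<and> (\<forall>K. compact K \<longrightarrow> w absolutely_integrable_on K)"

definition submultiplicative :: "((real ^ 'n::finite) \<times> (real ^ 'n) \<Rightarrow> real) \<Rightarrow> bool" where
  "submultiplicative w \<longleftrightarrow> (\<forall>z1 z2. w (z1 + z2) \<le> w z1 * w z2)"

definition moderate ::
  "((real ^ 'n::finite) \<times> (real ^ 'n) \<Rightarrow> real) \<Rightarrow> ((real ^ 'n) \<times> (real ^ 'n) \<Rightarrow> real) \<Rightarrow> bool" where
  "moderate w v \<longleftrightarrow> (\<forall>z1 z2. v (z1 + z2) \<le> w z1 * v z2)"

definition poly_weight :: "real \<Rightarrow> (real ^ 'n::finite) \<times> (real ^ 'n) \<Rightarrow> real" where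
  "poly_weight s = (\<lambda>(x, \<xi>). (1 + (norm x)\<^sup>2 + (norm \<xi>)\<^sup>2) powr (s / 2))"

definition polynomially_moderate :: "((real ^ 'n::finite) \<times> (real ^ 'n) \<Rightarrow> real) \<Rightarrow> bool" where
  "polynomially_moderate w \<longleftrightarrow> (\<exists>s. moderate (poly_weight s) w)"


section \<open>Modulation spaces\<close>

text \<open>Real powers of extended nonnegative reals; only used with positive exponents.\<close>

definition enn_powr :: "ennreal \<Rightarrow> real \<Rightarrow> ennreal" where
  "enn_powr a s = (if a = \<infinity> then \<infinity> else ennreal (enn2real a powr s))"

definition Lp_norm :: "ennreal \<Rightarrow> 'a measure \<Rightarrow> ('a \<Rightarrow> ennreal) \<Rightarrow> ennreal" where
  "Lp_norm p M F =
     (if p = \<infinity> then esssup M F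
      else enn_powr (\<integral>\<^sup>+x. enn_powr (F x) (enn2real p) \<partial>M) (1 / enn2real p))"

text \<open>The solution of \<open>1 / p + 1 / p' = 1\<close> for \<open>p \<ge> 1\<close>. In \<^typ>\<open>ennreal\<close>, the inverse exchanges
  0 and \<open>\<infinity>\<close>, so that 1 and \<open>\<infinity>\<close> are conjugate to each other.\<close>

definition conj_exponent :: "ennreal \<Rightarrow> ennreal" where
  "conj_exponent p = inverse (1 - inverse p)"

definition gauss_window :: "real ^ 'n::finite \<Rightarrow> complex" where
  "gauss_window x = complex_of_real (2 powr (real CARD('n) / 4) * exp (- pi * (norm x)\<^sup>2))"

text \<open>The integral defining the short-time Fourier transform of a tempered distribution \<open>h\<close> is the
  value of \<open>h\<close> at a Schwartz function.\<close>

definition stft ::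
  "(real ^ 'n \<Rightarrow> complex) \<Rightarrow> ((real ^ 'n::finite \<Rightarrow> complex) \<Rightarrow> complex) \<Rightarrow>
   real ^ 'n \<Rightarrow> real ^ 'n \<Rightarrow> complex" where
  "stft g h x \<xi> = h (\<lambda>y. cnj (g (y - x)) * exp (- \<i> * complex_of_real (y \<bullet> \<xi>)))"

definition modulation_norm ::
  "ennreal \<Rightarrow> ennreal \<Rightarrow> ((real ^ 'n::finite) \<times> (real ^ 'n) \<Rightarrow> real) \<Rightarrow>
   ((real ^ 'n \<Rightarrow> complex) \<Rightarrow> complex) \<Rightarrow> ennreal" where
  "modulation_norm p q w h =
     Lp_norm q lebesgue (\<lambda>\<xi>. Lp_norm p lebesgue
       (\<lambda>x. ennreal (cmod (stft gauss_window h x \<xi>) * w (x, \<xi>))))"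

definition modulation_space ::
  "ennreal \<Rightarrow> ennreal \<Rightarrow> ((real ^ 'n::finite) \<times> (real ^ 'n) \<Rightarrow> real) \<Rightarrow>
   ((real ^ 'n \<Rightarrow> complex) \<Rightarrow> complex) set" where
  "modulation_space p q w = {h \<in> tempered. modulation_norm p q w h < \<infinity>}"

definition modulation_rnorm ::
  "ennreal \<Rightarrow> ennreal \<Rightarrow> ((real ^ 'n::finite) \<times> (real ^ 'n) \<Rightarrow> real) \<Rightarrow>
   ((real ^ 'n \<Rightarrow> complex) \<Rightarrow> complex) \<Rightarrow> real" where
  "modulation_rnorm p q w h = enn2real (modulation_norm p q w h)"


section \<open>Nuclear operators and the trace\<close>

text \<open>Here a Banach space is given by its carrier \<open>B\<close>, a set of complex-valued functions with
  pointwise operations, and its norm \<open>N\<close>, which is only meaningful on \<open>B\<close>.\<close>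

definition bounded_functional ::
  "('b \<Rightarrow> complex) set \<Rightarrow> (('b \<Rightarrow> complex) \<Rightarrow> real) \<Rightarrow> (('b \<Rightarrow> complex) \<Rightarrow> complex) \<Rightarrow> bool" where
  "bounded_functional B N \<psi> \<longleftrightarrow>
     (\<forall>h1\<in>B. \<forall>h2\<in>B. \<psi> (\<lambda>b. h1 b + h2 b) = \<psi> h1 + \<psi> h2) \<and>
     (\<forall>c. \<forall>h\<in>B. \<psi> (\<lambda>b. c * h b) = c * \<psi> h) \<and>
     (\<exists>C. \<forall>h\<in>B. cmod (\<psi> h) \<le> C * N h)"

definition dual_norm ::
  "('b \<Rightarrow> complex) set \<Rightarrow> (('b \<Rightarrow> complex) \<Rightarrow> real) \<Rightarrow> (('b \<Rightarrow> complex) \<Rightarrow> complex) \<Rightarrow> real" where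
  "dual_norm B N \<psi> = (SUP h\<in>{h \<in> B. N h \<le> 1}. cmod (\<psi> h))"

definition bounded_operator ::
  "('b \<Rightarrow> complex) set \<Rightarrow> (('b \<Rightarrow> complex) \<Rightarrow> real) \<Rightarrow>
   (('b \<Rightarrow> complex) \<Rightarrow> ('b \<Rightarrow> complex)) \<Rightarrow> bool" where
  "bounded_operator B N T \<longleftrightarrow>
     (\<forall>h\<in>B. T h \<in> B) \<and>
     (\<forall>h1\<in>B. \<forall>h2\<in>B. T (\<lambda>b. h1 b + h2 b) = (\<lambda>b. T h1 b + T h2 b)) \<and>
     (\<forall>c. \<forall>h\<in>B. T (\<lambda>b. c * h b) = (\<lambda>b. c * T h b)) \<and>
     (\<exists>C. \<forall>h\<in>B. N (T h) \<le> C * N h)"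

text \<open>The series \<open>\<Sum>j. \<phi> j \<otimes> \<psi> j\<close> represents \<open>T\<close> in the sense of convergence in \<open>B\<close> at every
  element of \<open>B\<close>; for \<open>r \<le> 1\<close> the summability condition makes it converge in operator norm too.\<close>

definition nuclear_representation ::
  "('b \<Rightarrow> complex) set \<Rightarrow> (('b \<Rightarrow> complex) \<Rightarrow> real) \<Rightarrow> real \<Rightarrow>
   (('b \<Rightarrow> complex) \<Rightarrow> ('b \<Rightarrow> complex)) \<Rightarrow>
   (nat \<Rightarrow> 'b \<Rightarrow> complex) \<Rightarrow> (nat \<Rightarrow> ('b \<Rightarrow> complex) \<Rightarrow> complex) \<Rightarrow> bool" where
  "nuclear_representation B N r T \<phi> \<psi> \<longleftrightarrow>
     (\<forall>j. \<phi> j \<in> B) \<and>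
     (\<forall>j. bounded_functional B N (\<psi> j)) \<and>
     summable (\<lambda>j. dual_norm B N (\<psi> j) powr r * N (\<phi> j) powr r) \<and>
     (\<forall>h\<in>B. (\<lambda>m. N (\<lambda>b. T h b - (\<Sum>j<m. \<psi> j h * \<phi> j b))) \<longlonglongrightarrow> 0)"

definition r_nuclear ::
  "('b \<Rightarrow> complex) set \<Rightarrow> (('b \<Rightarrow> complex) \<Rightarrow> real) \<Rightarrow> real \<Rightarrow>
   (('b \<Rightarrow> complex) \<Rightarrow> ('b \<Rightarrow> complex)) \<Rightarrow> bool" where
  "r_nuclear B N r T \<longleftrightarrow> bounded_operator B N T \<and> (\<exists>\<phi> \<psi>. nuclear_representation B N r T \<phi> \<psi>)"

text \<open>The common value of \<open>\<Sum>j. \<psi> j (\<phi> j)\<close> over all nuclear representations; the description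
  determines it only if the sum is independent of the representation.\<close>

definition nuclear_trace ::
  "('b \<Rightarrow> complex) set \<Rightarrow> (('b \<Rightarrow> complex) \<Rightarrow> real) \<Rightarrow>
   (('b \<Rightarrow> complex) \<Rightarrow> ('b \<Rightarrow> complex)) \<Rightarrow> complex" where
  "nuclear_trace B N T =
     (THE t. \<forall>\<phi> \<psi>. nuclear_representation B N 1 T \<phi> \<psi> \<longrightarrow> (\<lambda>j. \<psi> j (\<phi> j)) sums t)"


section \<open>Functions of the operator on modulation spaces\<close>

text \<open>The pairing \<open>(h, v)\<close> of an element \<open>h\<close> of a modulation space with a square-integrable
  function \<open>v\<close>: the value at \<open>h\<close> of the continuous extension of \<open>\<phi> \<mapsto> (\<phi>, v)\<close> from the Schwartz
  space, which is dense for finite \<open>p\<close> and \<open>q\<close>.\<close>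

definition modulation_pairing ::
  "ennreal \<Rightarrow> ennreal \<Rightarrow> ((real ^ 'n::finite) \<times> (real ^ 'n) \<Rightarrow> real) \<Rightarrow>
   ((real ^ 'n \<Rightarrow> complex) \<Rightarrow> complex) \<Rightarrow> (real ^ 'n \<Rightarrow> complex) \<Rightarrow> complex" where
  "modulation_pairing p q w h v =
     (THE c. \<exists>\<psi>. bounded_functional (modulation_space p q w) (modulation_rnorm p q w) \<psi> \<and>
        (\<forall>\<phi>\<in>schwartz. \<psi> (dist_of \<phi>) = L2_inner \<phi> v) \<and> c = \<psi> h)"

text \<open>\<open>f(A) h = \<Sum>j. f (\<lambda>\<^sub>j) (h, u\<^sub>j) u\<^sub>j\<close> for \<open>h\<close> in the modulation space, as a series of
  distributions. If \<open>f (\<lambda>\<^sub>j) = 0\<close>, the pairing need not exist, and the term vanishes.\<close>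

definition spectral_function ::
  "ennreal \<Rightarrow> ennreal \<Rightarrow> ((real ^ 'n::finite) \<times> (real ^ 'n) \<Rightarrow> real) \<Rightarrow>
   (real \<Rightarrow> complex) \<Rightarrow> (nat \<Rightarrow> real) \<Rightarrow> (nat \<Rightarrow> real ^ 'n \<Rightarrow> complex) \<Rightarrow>
   ((real ^ 'n \<Rightarrow> complex) \<Rightarrow> complex) \<Rightarrow> ((real ^ 'n \<Rightarrow> complex) \<Rightarrow> complex)" where
  "spectral_function p q w f lam u h =
     (\<lambda>\<phi>. \<Sum>j. f (lam j) * modulation_pairing p q w h (u j) * dist_of (u j) \<phi>)"

definition nuclearity_sum ::
  "ennreal \<Rightarrow> ennreal \<Rightarrow> ((real ^ 'n::finite) \<times> (real ^ 'n) \<Rightarrow> real) \<Rightarrow>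
   (real \<Rightarrow> complex) \<Rightarrow> (nat \<Rightarrow> real) \<Rightarrow> (nat \<Rightarrow> real ^ 'n \<Rightarrow> complex) \<Rightarrow> real \<Rightarrow> ennreal" where
  "nuclearity_sum p q w f lam u r =
     (\<Sum>j. ennreal (cmod (f (lam j)) powr r)
        * enn_powr (modulation_norm p q w (dist_of (u j))) r
        * enn_powr (modulation_norm (conj_exponent p) (conj_exponent q) (\<lambda>z. inverse (w z))
            (dist_of (u j))) r)"

end

theory Submission
  imports Defs "HOL-Complex_Analysis.Cauchy_Integral_Formula" "HOL-Real_Asymp.Real_Asymp" "HOL-Probability.Sinc_Integral"
begin

text \<open>The operator \<open>f(A)\<close> is the series of the rank one operators \<open>h \<mapsto> f(\<lambda>\<^sub>j) (h, u\<^sub>j) u\<^sub>j\<close>, and the hypothesis says that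
  this series is summable in the sense of nuclearity. What has to be shown is that \<open>(\<cdot>, u\<^sub>j)\<close> makes sense on the modulation
  space as a functional of norm at most a constant times the dual modulation norm of \<open>u\<^sub>j\<close>, and that the sum of the values
  \<open>(u\<^sub>j, u\<^sub>j) = 1\<close>, weighted by \<open>f(\<lambda>\<^sub>j)\<close>, does not depend on the chosen nuclear representation.

  Everything is read off from the transform \<open>V\<close> with the Gaussian window. The pairing with a square-integrable \<open>u\<close> is
  \<open>h \<mapsto> c \<integral> V h cnj (V u)\<close>. By Hoelder's inequality for mixed norms it is bounded, and by Moyal's identity (lemma \<open>moyal\<close>)
  it extends the inner product. Moyal's identity is Plancherel's theorem in the frequency variable, which is obtained by a
  Gaussian regularisation and the continuity of translations in the mean square. The same identity and the rapid decay
  of \<open>V \<phi>\<close> for Schwartz functions \<open>\<phi>\<close> bound a square-integrable function, as a distribution, by its modulation norm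
  (lemma \<open>dist_of_bound\<close>), so that the series defines tempered distributions.

  Uniqueness of the pairing and of the trace both rest on the bounded approximation property in an explicit form (lemma
  \<open>finite_rank_approximation\<close>). Up to a factor of Gaussian modulus, \<open>V h\<close> is an entire function on \<open>\<complex>\<^sup>n\<close>, the Bargmann
  transform of \<open>h\<close>, for every tempered distribution \<open>h\<close>. Dilating it by \<open>\<rho> < 1\<close> and truncating its Taylor series gives
  finite linear combinations of Hermite functions; their coefficients are values of \<open>h\<close> at monomials times a Gaussian.
  These finite rank operators \<open>S\<^sub>m\<close> are uniformly bounded and converge strongly to the identity as \<open>\<rho>\<close> tends to 1. For a
  nuclear representation of \<open>T\<close> by \<open>\<phi>\<^sub>j\<close> and \<open>\<psi>\<^sub>j\<close>, the sum of the \<open>\<psi>\<^sub>j (\<phi>\<^sub>j)\<close> is then the limit of the sums of the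
  \<open>\<psi>\<^sub>j (S\<^sub>m \<phi>\<^sub>j)\<close>, and these are determined by the values of \<open>T\<close> at Hermite functions (lemma \<open>nuclear_sum_limit\<close>).

  A submultiplicative polynomially moderate weight that does not vanish identically is continuous and at least 1 (lemma
  \<open>moderate_weight_properties\<close>); hence values of \<open>V h\<close> are bounded by the modulation norm, through a mean value inequality
  for entire functions.\<close>


section \<open>Mixed-norm Lebesgue spaces of extended nonnegative functions\<close>

lemma enn_powr_ennreal: "0 \<le> a \<Longrightarrow> enn_powr (ennreal a) s = ennreal (a powr s)"
  by (simp add: enn_powr_def)

lemma enn_powr_top [simp]: "enn_powr \<infinity> s = \<infinity>" "enn_powr top s = top"
  by (simp_all add: enn_powr_def)

lemma enn_powr_0 [simp]: "enn_powr 0 s = 0"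
  by (simp add: enn_powr_def)

lemma enn_powr_measurable [measurable]: "(\<lambda>a. enn_powr a s) \<in> borel_measurable borel"
  unfolding enn_powr_def by measurable

lemma enn_powr_mono: "a \<le> b \<Longrightarrow> 0 \<le> s \<Longrightarrow> enn_powr a s \<le> enn_powr b s"
  by (cases a; cases b) (auto simp: enn_powr_ennreal ennreal_le_iff2 top_unique intro!: powr_mono2)

lemma enn_powr_inverse:
  assumes "0 < s" shows "enn_powr (enn_powr a s) (1 / s) = a" "enn_powr (enn_powr a (1 / s)) s = a"
  using assms by (cases a; simp add: enn_powr_ennreal powr_powr)+

lemma enn_powr_le_iff:
  assumes "0 < s" shows "enn_powr a (1 / s) \<le> b \<longleftrightarrow> a \<le> enn_powr b s"
  using enn_powr_mono[of "enn_powr a (1 / s)" b s] enn_powr_mono[of a "enn_powr b s" "1 / s"] assms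
  by (auto simp: enn_powr_inverse)

lemma enn_powr_eq_0_iff: "enn_powr a s = 0 \<longleftrightarrow> a = 0"
  by (cases a) (auto simp: enn_powr_ennreal)

lemma enn_powr_eq_top_iff: "enn_powr a s = \<infinity> \<longleftrightarrow> a = \<infinity>"
  by (cases a) (auto simp: enn_powr_ennreal)

lemma enn_powr_mult: "enn_powr (a * b) s = enn_powr a s * enn_powr b s"
  by (cases a; cases b)
    (auto simp: enn_powr_ennreal powr_mult ennreal_mult[symmetric] ennreal_top_mult
       ennreal_mult_top enn_powr_eq_0_iff)

lemma tendsto_enn_powr_0:
  assumes "(f \<longlongrightarrow> 0) F" "0 < s" shows "((\<lambda>x. enn_powr (f x) s) \<longlongrightarrow> 0) F"
proof (rule order_tendstoI)
  fix a :: ennreal assume "0 < a"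
  then obtain b where b: "0 < b" "b < a" using dense by blast
  hence "b < \<infinity>" using less_top by fastforce
  moreover have "0 < enn_powr b (1 / s)" using b enn_powr_eq_0_iff[of b] by (simp add: zero_less_iff_neq_zero)
  ultimately have "eventually (\<lambda>x. f x < enn_powr b (1 / s)) F"
    using assms(1) by (simp add: order_tendsto_iff)
  thus "eventually (\<lambda>x. enn_powr (f x) s < a) F"
  proof eventually_elim
    case (elim x)
    from elim have "f x \<le> enn_powr b (1 / s)" by simp
    hence "enn_powr (f x) s \<le> enn_powr (enn_powr b (1 / s)) s" by (rule enn_powr_mono) (use assms in simp)
    thus ?case using b assms(2) by (simp add: enn_powr_inverse)
  qed
qed simp

text \<open>For a finite exponent, the norm is described by the sublevel sets of the integral; this form
  avoids roots.\<close>

lemma Lp_norm_finite: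
  "0 < P \<Longrightarrow> Lp_norm (ennreal P) M F = enn_powr (\<integral>\<^sup>+x. enn_powr (F x) P \<partial>M) (1 / P)"
  by (simp add: Lp_norm_def)

lemma Lp_norm_le_iff:
  assumes "0 < P"
  shows "Lp_norm (ennreal P) M F \<le> c \<longleftrightarrow> (\<integral>\<^sup>+x. enn_powr (F x) P \<partial>M) \<le> enn_powr c P"
  using assms by (simp add: Lp_norm_finite enn_powr_le_iff)

lemma Lp_norm_AE_mono:
  assumes "0 < P" "AE x in M. F x \<le> G x"
  shows "Lp_norm (ennreal P) M F \<le> Lp_norm (ennreal P) M G"
  unfolding Lp_norm_finite[OF assms(1)] using assms
  by (intro enn_powr_mono nn_integral_mono_AE) (auto elim!: eventually_mono intro: enn_powr_mono)

lemma Lp_norm_mono: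
  "0 < P \<Longrightarrow> (\<And>x. F x \<le> G x) \<Longrightarrow> Lp_norm (ennreal P) M F \<le> Lp_norm (ennreal P) M G"
  by (rule Lp_norm_AE_mono) auto

lemma Lp_norm_cmult:
  assumes "0 < P" "F \<in> borel_measurable M"
  shows "Lp_norm (ennreal P) M (\<lambda>x. c * F x) = c * Lp_norm (ennreal P) M F"
  using assms by (simp add: Lp_norm_finite enn_powr_mult nn_integral_cmult enn_powr_inverse)

lemma Lp_norm_eq_0_iff:
  assumes "0 < P" "F \<in> borel_measurable M"
  shows "Lp_norm (ennreal P) M F = 0 \<longleftrightarrow> (AE x in M. F x = 0)"
  using assms by (simp add: Lp_norm_finite enn_powr_eq_0_iff nn_integral_0_iff_AE)

lemma powr_convex_combination:
  fixes t x y P :: real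
  assumes "0 \<le> t" "t \<le> 1" "0 \<le> x" "0 \<le> y" "1 \<le> P"
  shows "(t * x + (1 - t) * y) powr P \<le> t * x powr P + (1 - t) * y powr P"
proof (cases "x = 0 \<or> y = 0 \<or> t = 0 \<or> t = 1")
  case False
  hence "convex_on {0<..} (\<lambda>x::real. x powr P)" using powr_convex assms by blast
  from convex_onD[OF this, of "1 - t" x y] show ?thesis using False assms by (simp add: algebra_simps)
next
  case True
  have A: "(s * z) powr P \<le> s * z powr P" if "0 \<le> s" "s \<le> 1" "0 \<le> z" for s z :: real
  proof -
    have "s powr P \<le> s" using that assms powr_mono'[of 1 P s] by (cases "s = 0") auto
    thus ?thesis using that by (simp add: powr_mult mult_right_mono)
  qed
  show ?thesis using True A[of t x] A[of "1 - t" y] assms by auto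
qed

text \<open>Divided by the sum of the two bounds, the sum of the functions is a convex combination of functions in the unit
  ball, and the unit ball is convex because \<open>t powr P\<close> is.\<close>

lemma Lp_norm_triangle_aux:
  assumes P: "1 \<le> P" and [measurable]: "F \<in> borel_measurable M" "G \<in> borel_measurable M"
    and a: "0 < a" "Lp_norm (ennreal P) M F \<le> ennreal a" and b: "0 < b" "Lp_norm (ennreal P) M G \<le> ennreal b"
  shows "Lp_norm (ennreal P) M (\<lambda>x. F x + G x) \<le> ennreal (a + b)"
proof -
  define t where "t = a / (a + b)"
  have t: "0 \<le> t" "t \<le> 1" "1 - t = b / (a + b)" using a b by (auto simp: t_def field_simps)
  have F: "(\<integral>\<^sup>+x. enn_powr (F x) P \<partial>M) \<le> ennreal (a powr P)"
    and G: "(\<integral>\<^sup>+x. enn_powr (G x) P \<partial>M) \<le> ennreal (b powr P)"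
    using a b P by (simp_all add: Lp_norm_le_iff enn_powr_ennreal)
  define c where "c = (a + b) powr P"
  have c: "c > 0" using a b by (simp add: c_def)
  have pt: "enn_powr (F x + G x) P \<le>
     ennreal (c * t / a powr P) * enn_powr (F x) P + ennreal (c * (1 - t) / b powr P) * enn_powr (G x) P" for x
  proof (cases "F x = \<infinity> \<or> G x = \<infinity>")
    case True
    moreover have "c * t / a powr P > 0" "c * (1 - t) / b powr P > 0" using a b c t by (auto simp: t_def)
    ultimately show ?thesis by (auto simp: ennreal_mult_top)
  next
    case False
    then obtain f g where fg: "F x = ennreal f" "G x = ennreal g" "0 \<le> f" "0 \<le> g"
      by (metis ennreal_cases infinity_ennreal_def)
    have "(f + g) powr P = c * (t * (f / a) + (1 - t) * (g / b)) powr P"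
    proof -
      have "f + g = (a + b) * (t * (f / a) + (1 - t) * (g / b))"
        using a b unfolding t(3) by (simp add: t_def divide_simps)
      thus ?thesis using a b fg t by (simp add: c_def powr_mult[symmetric])
    qed
    also have "\<dots> \<le> c * (t * (f / a) powr P + (1 - t) * (g / b) powr P)"
      using powr_convex_combination[of t "f / a" "g / b" P] t a b fg P c by (simp add: mult_left_mono)
    also have "\<dots> = (c * t / a powr P) * f powr P + (c * (1 - t) / b powr P) * g powr P"
      using a b fg by (simp add: powr_divide algebra_simps)
    finally have "enn_powr (F x + G x) P \<le>
        ennreal ((c * t / a powr P) * f powr P + (c * (1 - t) / b powr P) * g powr P)"
      using fg by (simp add: enn_powr_ennreal ennreal_plus[symmetric] ennreal_leI del: ennreal_plus)
    also have "\<dots> = ennreal (c * t / a powr P) * enn_powr (F x) P + ennreal (c * (1 - t) / b powr P) * enn_powr (G x) P"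
    proof -
      have "0 \<le> c * t / a powr P" "0 \<le> c * (1 - t) / b powr P" using c t a b by auto
      thus ?thesis using fg by (simp only: enn_powr_ennreal ennreal_mult'[symmetric] ennreal_plus mult_nonneg_nonneg powr_ge_zero ennreal_mult[symmetric])
    qed
    finally show ?thesis .
  qed
  have "(\<integral>\<^sup>+x. enn_powr (F x + G x) P \<partial>M) \<le>
     ennreal (c * t / a powr P) * (\<integral>\<^sup>+x. enn_powr (F x) P \<partial>M)
     + ennreal (c * (1 - t) / b powr P) * (\<integral>\<^sup>+x. enn_powr (G x) P \<partial>M)"
    by (subst nn_integral_cmult[symmetric], measurable)+
       (subst nn_integral_add[symmetric], measurable, intro nn_integral_mono pt)
  also have "\<dots> \<le> ennreal (c * t / a powr P) * ennreal (a powr P) + ennreal (c * (1 - t) / b powr P) * ennreal (b powr P)"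
    by (intro add_mono mult_left_mono F G) auto
  also have "\<dots> = ennreal (c * t + c * (1 - t))"
    using a b c t by (simp add: ennreal_mult[symmetric] ennreal_plus[symmetric] del: ennreal_plus)
  also have "\<dots> = enn_powr (ennreal (a + b)) P" 
    using a b by (subst enn_powr_ennreal) (auto simp: c_def distrib_left[symmetric])
  finally show ?thesis using P by (simp add: Lp_norm_le_iff)
qed

lemma ennreal_le_by_larger_reals:
  assumes "\<And>a b. 0 < a \<Longrightarrow> 0 < b \<Longrightarrow> x \<le> ennreal a \<Longrightarrow> y \<le> ennreal b \<Longrightarrow> z \<le> ennreal (a + b)"
  shows "z \<le> x + y"
proof (cases "x = \<infinity> \<or> y = \<infinity>")
  case False
  then obtain f g where fg: "x = ennreal f" "y = ennreal g" "0 \<le> f" "0 \<le> g"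
    by (metis ennreal_cases infinity_ennreal_def)
  show ?thesis
  proof (rule ennreal_le_epsilon)
    fix e :: real assume e: "0 < e"
    have "z \<le> ennreal ((f + e/2) + (g + e/2))" using assms[of "f + e/2" "g + e/2"] fg e by (simp add: ennreal_leI)
    thus "z \<le> x + y + ennreal e" using fg e by (simp add: ennreal_plus[symmetric] add_ac del: ennreal_plus)
  qed
qed auto

lemma Lp_norm_triangle:
  assumes "1 \<le> P" "F \<in> borel_measurable M" "G \<in> borel_measurable M"
  shows "Lp_norm (ennreal P) M (\<lambda>x. F x + G x) \<le> Lp_norm (ennreal P) M F + Lp_norm (ennreal P) M G"
  by (rule ennreal_le_by_larger_reals, rule Lp_norm_triangle_aux) (use assms in auto)

lemma Lp_norm_SUP:
  assumes P: "0 < P" and inc: "incseq F" and [measurable]: "\<And>i. F i \<in> borel_measurable M"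
    and le: "\<And>i. Lp_norm (ennreal P) M (F i) \<le> c"
  shows "Lp_norm (ennreal P) M (\<lambda>x. SUP i. F i x) \<le> c"
proof -
  have S: "enn_powr (SUP i. F i x) P = (SUP i. enn_powr (F i x) P)" for x
  proof (rule antisym)
    have "(SUP i. F i x) \<le> enn_powr (SUP i. enn_powr (F i x) P) (1 / P)"
    proof (rule SUP_least)
      fix i
      have "F i x = enn_powr (enn_powr (F i x) P) (1 / P)" using P by (simp add: enn_powr_inverse)
      also have "\<dots> \<le> enn_powr (SUP i. enn_powr (F i x) P) (1 / P)"
        using P by (intro enn_powr_mono SUP_upper) auto
      finally show "F i x \<le> \<dots>" .
    qed
    from enn_powr_mono[OF this, of P] P show "enn_powr (SUP i. F i x) P \<le> (SUP i. enn_powr (F i x) P)"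
      by (simp add: enn_powr_inverse)
    show "(SUP i. enn_powr (F i x) P) \<le> enn_powr (SUP i. F i x) P"
      using P by (intro SUP_least enn_powr_mono SUP_upper) auto
  qed
  have "(\<integral>\<^sup>+x. enn_powr (SUP i. F i x) P \<partial>M) = (SUP i. \<integral>\<^sup>+x. enn_powr (F i x) P \<partial>M)"
    unfolding S using inc P
    by (intro nn_integral_monotone_convergence_SUP) (auto simp: incseq_def le_fun_def intro: enn_powr_mono)
  also have "\<dots> \<le> enn_powr c P" using le P by (intro SUP_least) (simp add: Lp_norm_le_iff)
  finally show ?thesis using P by (simp add: Lp_norm_le_iff)
qed

lemma Lp_norm_tendsto_0:
  assumes P: "0 < P" and [measurable]: "\<And>i. F i \<in> borel_measurable M" "G \<in> borel_measurable M"
    and lim: "AE x in M. (\<lambda>i. F i x) \<longlonglongrightarrow> 0" and dom: "\<And>i. AE x in M. F i x \<le> G x"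
    and fin: "Lp_norm (ennreal P) M G < \<infinity>"
  shows "(\<lambda>i. Lp_norm (ennreal P) M (F i)) \<longlonglongrightarrow> 0"
proof -
  have "(\<lambda>i. \<integral>\<^sup>+x. enn_powr (F i x) P \<partial>M) \<longlonglongrightarrow> (\<integral>\<^sup>+x. 0 \<partial>M)"
  proof (rule nn_integral_dominated_convergence[where w = "\<lambda>x. enn_powr (G x) P"])
    show "AE x in M. enn_powr (F i x) P \<le> enn_powr (G x) P" for i
      using dom[of i] P by (auto elim!: eventually_mono intro: enn_powr_mono)
    show "(\<integral>\<^sup>+x. enn_powr (G x) P \<partial>M) < \<infinity>"
      using fin P by (simp add: Lp_norm_finite less_top[symmetric] enn_powr_eq_top_iff[simplified])
    show "AE x in M. (\<lambda>i. enn_powr (F i x) P) \<longlonglongrightarrow> 0"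
      using lim by eventually_elim (rule tendsto_enn_powr_0[OF _ P])
  qed simp_all
  thus ?thesis using P by (simp add: Lp_norm_finite tendsto_enn_powr_0)
qed

lemma conj_exponent_1: "conj_exponent 1 = \<infinity>"
  by (simp add: conj_exponent_def)

lemma conj_exponent_real:
  assumes "1 < P" shows "conj_exponent (ennreal P) = ennreal (P / (P - 1))"
proof -
  have "1 - inverse (ennreal P) = ennreal (1 - inverse P)"
    using assms by (subst inverse_ennreal, simp, subst ennreal_1[symmetric], subst ennreal_minus) auto
  also have "1 - inverse P = (P - 1) / P" using assms by (simp add: field_simps)
  finally show ?thesis using assms by (simp add: conj_exponent_def inverse_ennreal)
qed

text \<open>Young's inequality for functions that are normalised by their norms.\<close>

lemma Holder_aux:
  assumes P: "1 < P" and Q: "1 < Q" "1 / P + 1 / Q = 1"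
    and [measurable]: "F \<in> borel_measurable M" "G \<in> borel_measurable M"
    and a: "0 < a" "Lp_norm (ennreal P) M F \<le> ennreal a" and b: "0 < b" "Lp_norm (ennreal Q) M G \<le> ennreal b"
  shows "(\<integral>\<^sup>+x. F x * G x \<partial>M) \<le> ennreal (a * b)"
proof -
  have F: "(\<integral>\<^sup>+x. enn_powr (F x) P \<partial>M) \<le> ennreal (a powr P)"
    and G: "(\<integral>\<^sup>+x. enn_powr (G x) Q \<partial>M) \<le> ennreal (b powr Q)"
    using a b P Q by (simp_all add: Lp_norm_le_iff enn_powr_ennreal)
  define c where "c = a * b / (P * a powr P)"
  define d where "d = a * b / (Q * b powr Q)"
  have cd: "c > 0" "d > 0" using a b P Q by (auto simp: c_def d_def)
  have pt: "F x * G x \<le> ennreal c * enn_powr (F x) P + ennreal d * enn_powr (G x) Q" for x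
  proof (cases "F x = \<infinity> \<or> G x = \<infinity>")
    case True
    thus ?thesis using cd by (auto simp: ennreal_mult_top)
  next
    case False
    then obtain f g where fg: "F x = ennreal f" "G x = ennreal g" "0 \<le> f" "0 \<le> g"
      by (metis ennreal_cases infinity_ennreal_def)
    have "f * g = a * b * ((f / a) * (g / b))" using a b by simp
    also have "\<dots> \<le> a * b * ((f / a) powr P / P + (g / b) powr Q / Q)"
      using Youngs_inequality[OF P Q(1) Q(2), of "f / a" "g / b"] a b fg by (intro mult_left_mono) auto
    also have "\<dots> = c * f powr P + d * g powr Q"
      using a b fg by (simp add: powr_divide algebra_simps c_def d_def)
    finally show ?thesis using fg cd
      by (simp add: enn_powr_ennreal ennreal_plus[symmetric] ennreal_mult[symmetric] ennreal_leI del: ennreal_plus)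
  qed
  have "(\<integral>\<^sup>+x. F x * G x \<partial>M) \<le>
     ennreal c * (\<integral>\<^sup>+x. enn_powr (F x) P \<partial>M) + ennreal d * (\<integral>\<^sup>+x. enn_powr (G x) Q \<partial>M)"
    by (subst nn_integral_cmult[symmetric], measurable)+
       (subst nn_integral_add[symmetric], measurable, intro nn_integral_mono pt)
  also have "\<dots> \<le> ennreal c * ennreal (a powr P) + ennreal d * ennreal (b powr Q)"
    by (intro add_mono mult_left_mono F G) auto
  also have "\<dots> = ennreal (c * a powr P + d * b powr Q)"
    using a b cd by (simp add: ennreal_mult[symmetric] ennreal_plus[symmetric] del: ennreal_plus)
  also have "c * a powr P + d * b powr Q = a * b * (1 / P + 1 / Q)"
    using a b P Q by (simp add: c_def d_def field_simps)
  finally show ?thesis using Q by simp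
qed

lemma Holder_nn_integral:
  assumes P: "1 \<le> P" and [measurable]: "F \<in> borel_measurable M" "G \<in> borel_measurable M"
  shows "(\<integral>\<^sup>+x. F x * G x \<partial>M) \<le> Lp_norm (ennreal P) M F * Lp_norm (conj_exponent (ennreal P)) M G"
proof (cases "P = 1")
  case True
  have "(\<integral>\<^sup>+x. F x * G x \<partial>M) \<le> (\<integral>\<^sup>+x. F x * esssup M G \<partial>M)"
    using esssup_AE[of G M] by (intro nn_integral_mono_AE) (auto elim!: eventually_mono intro: mult_left_mono)
  also have "\<dots> = (\<integral>\<^sup>+x. F x \<partial>M) * esssup M G" by (simp add: nn_integral_multc)
  also have "(\<integral>\<^sup>+x. F x \<partial>M) = Lp_norm (ennreal P) M F"
  proof -
    have "enn_powr a 1 = a" for a by (cases a) (auto simp: enn_powr_ennreal)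
    thus ?thesis by (simp add: Lp_norm_def True)
  qed
  also have "esssup M G = Lp_norm (conj_exponent (ennreal P)) M G"
    by (simp add: True conj_exponent_1[simplified] Lp_norm_def)
  finally show ?thesis .
next
  case False
  with P have P1: "1 < P" by simp
  define Q where "Q = P / (P - 1)"
  have Q: "1 < Q" "1 / P + 1 / Q = 1" "conj_exponent (ennreal P) = ennreal Q"
    using P1 by (auto simp: Q_def field_simps conj_exponent_real)
  define A where "A = Lp_norm (ennreal P) M F"
  define B where "B = Lp_norm (ennreal Q) M G"
  consider "A = 0 \<or> B = 0" | "A \<noteq> 0" "B \<noteq> 0" "A = \<infinity> \<or> B = \<infinity>" | "A \<noteq> \<infinity>" "B \<noteq> \<infinity>" by blast
  hence "(\<integral>\<^sup>+x. F x * G x \<partial>M) \<le> A * B"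
  proof cases
    case 1
    hence "AE x in M. F x * G x = 0"
      using P1 Q Lp_norm_eq_0_iff[of P F M] Lp_norm_eq_0_iff[of Q G M] by (auto simp: A_def B_def elim!: eventually_mono)
    hence "(\<integral>\<^sup>+x. F x * G x \<partial>M) = 0" by (subst nn_integral_0_iff_AE) auto
    thus ?thesis by simp
  next
    case 2
    thus ?thesis by (auto simp: ennreal_mult_top ennreal_top_mult)
  next
    case 3
    then obtain a b where ab: "A = ennreal a" "B = ennreal b" "0 \<le> a" "0 \<le> b"
      by (metis ennreal_cases infinity_ennreal_def)
    have "(\<integral>\<^sup>+x. F x * G x \<partial>M) \<le> ennreal ((a + 1 / real (Suc m)) * (b + 1 / real (Suc m)))" for m
    proof (rule Holder_aux[OF P1 Q(1,2)])
      show "Lp_norm (ennreal P) M F \<le> ennreal (a + 1 / real (Suc m))"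
        using ab by (simp add: A_def[symmetric] ennreal_leI)
      show "Lp_norm (ennreal Q) M G \<le> ennreal (b + 1 / real (Suc m))"
        using ab by (simp add: B_def[symmetric] ennreal_leI)
    qed (use ab in \<open>auto intro!: add_nonneg_pos\<close>)
    moreover have "(\<lambda>m. ennreal ((a + 1 / real (Suc m)) * (b + 1 / real (Suc m)))) \<longlonglongrightarrow> ennreal ((a + 0) * (b + 0))"
      by (intro tendsto_ennrealI tendsto_mult tendsto_add tendsto_const LIMSEQ_Suc[OF lim_1_over_n])
    ultimately have "(\<integral>\<^sup>+x. F x * G x \<partial>M) \<le> ennreal ((a + 0) * (b + 0))"
      by (intro LIMSEQ_le_const) auto
    thus ?thesis using ab by (simp add: ennreal_mult)
  qed
  thus ?thesis by (simp add: A_def B_def Q)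
qed

text \<open>For Borel functions, the completed measure of the definition of the modulation norm may be replaced by the Borel
  measure, for which the theorem of Tonelli is available on product spaces.\<close>

lemma Lp_norm_lebesgue:
  fixes F :: "'a::euclidean_space \<Rightarrow> ennreal"
  assumes [measurable]: "F \<in> borel_measurable borel"
  shows "Lp_norm p lebesgue F = Lp_norm p lborel F"
proof (cases "p = \<infinity>")
  case True
  have "(AE x in lebesgue. F x \<le> z) \<longleftrightarrow> (AE x in lborel. F x \<le> z)" for z
    by (simp add: AE_completion_iff)
  thus ?thesis using True by (simp add: Lp_norm_def esssup_eq_AE measurable_completion)
next
  case False
  thus ?thesis by (simp add: Lp_norm_def nn_integral_completion)
qed

text \<open>The variable that comes first in the pair is integrated first.\<close>

definition mixed_norm ::
  "ennreal \<Rightarrow> ennreal \<Rightarrow> ('a::euclidean_space \<times> 'b::euclidean_space \<Rightarrow> ennreal) \<Rightarrow> ennreal" where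
  "mixed_norm p q F = Lp_norm q lborel (\<lambda>\<xi>. Lp_norm p lborel (\<lambda>x. F (x, \<xi>)))"

text \<open>For the exponent \<open>\<infinity>\<close>, a superlevel set of the essential supremum of the sections is the set where the measure
  of a superlevel set of the sections is positive.\<close>

lemma measurable_section_Lp_norm:
  fixes F :: "'a::euclidean_space \<times> 'b::euclidean_space \<Rightarrow> ennreal"
  assumes [measurable]: "F \<in> borel_measurable borel"
  shows "(\<lambda>\<xi>. Lp_norm p lborel (\<lambda>x. F (x, \<xi>))) \<in> borel_measurable borel"
proof (cases "p = \<infinity>")
  case True
  have F[measurable]: "(\<lambda>x. F (x, \<xi>)) \<in> borel_measurable borel" for \<xi> by measurable
  have [measurable]: "(\<lambda>\<xi>. emeasure lborel {x. t < F (x, \<xi>)}) \<in> borel_measurable borel" for t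
  proof -
    have "(\<lambda>\<xi>. \<integral>\<^sup>+x. indicator {z. t < F z} (x, \<xi>) \<partial>lborel) \<in> borel_measurable lborel"
      by measurable
    also have "(\<lambda>\<xi>. \<integral>\<^sup>+x. indicator {z. t < F z} (x, \<xi>) \<partial>lborel) = (\<lambda>\<xi>. emeasure lborel {x. t < F (x, \<xi>)})"
    proof
      fix \<xi>
      have "(\<integral>\<^sup>+x. indicator {z. t < F z} (x, \<xi>) \<partial>lborel) = (\<integral>\<^sup>+x. indicator {x. t < F (x, \<xi>)} x \<partial>lborel)"
        by (intro nn_integral_cong) (auto simp: indicator_def)
      thus "(\<integral>\<^sup>+x. indicator {z. t < F z} (x, \<xi>) \<partial>lborel) = emeasure lborel {x. t < F (x, \<xi>)}"
        by simp
    qed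
    finally show ?thesis by simp
  qed
  have "esssup lborel (\<lambda>x. F (x, \<xi>)) > t \<longleftrightarrow> emeasure lborel {x. t < F (x, \<xi>)} > 0" for \<xi> t
  proof
    assume "esssup lborel (\<lambda>x. F (x, \<xi>)) > t"
    from esssup_pos_measure[OF _ this] show "emeasure lborel {x. t < F (x, \<xi>)} > 0" by simp
  next
    assume *: "emeasure lborel {x. t < F (x, \<xi>)} > 0"
    show "esssup lborel (\<lambda>x. F (x, \<xi>)) > t"
    proof (rule ccontr)
      assume "\<not> ?thesis"
      hence "AE x in lborel. F (x, \<xi>) \<le> t" using esssup_AE[of "\<lambda>x. F (x, \<xi>)" lborel]
        by (auto elim!: eventually_mono)
      hence "emeasure lborel {x \<in> space lborel. \<not> F (x, \<xi>) \<le> t} = 0"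
        by (subst (asm) AE_iff_measurable) auto
      with * show False by (simp add: not_le)
    qed
  qed
  hence "(\<lambda>\<xi>. esssup lborel (\<lambda>x. F (x, \<xi>))) \<in> borel_measurable borel"
    by (intro borel_measurableI_greater) simp
  thus ?thesis using True by (simp add: Lp_norm_def)
next
  case False
  have "(\<lambda>\<xi>. \<integral>\<^sup>+x. enn_powr (F (x, \<xi>)) (enn2real p) \<partial>lborel) \<in> borel_measurable borel"
    by measurable
  thus ?thesis using False by (simp add: Lp_norm_def)
qed

context
  fixes P Q :: real
  assumes P: "1 \<le> P" and Q: "1 \<le> Q"
begin

lemma PQ_pos: "0 < P" "0 < Q" using P Q by auto

lemma mixed_norm_mono:
  "(\<And>z. F z \<le> G z) \<Longrightarrow> mixed_norm (ennreal P) (ennreal Q) F \<le> mixed_norm (ennreal P) (ennreal Q) G"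
  unfolding mixed_norm_def using PQ_pos by (intro Lp_norm_mono) auto

lemma mixed_norm_cmult:
  assumes [measurable]: "F \<in> borel_measurable borel"
  shows "mixed_norm (ennreal P) (ennreal Q) (\<lambda>z. c * F z) = c * mixed_norm (ennreal P) (ennreal Q) F"
  unfolding mixed_norm_def using PQ_pos
  by (simp add: Lp_norm_cmult measurable_section_Lp_norm)

lemma mixed_norm_triangle:
  assumes [measurable]: "F \<in> borel_measurable borel" "G \<in> borel_measurable borel"
  shows "mixed_norm (ennreal P) (ennreal Q) (\<lambda>z. F z + G z)
    \<le> mixed_norm (ennreal P) (ennreal Q) F + mixed_norm (ennreal P) (ennreal Q) G"
proof -
  have "mixed_norm (ennreal P) (ennreal Q) (\<lambda>z. F z + G z) \<le>
    Lp_norm (ennreal Q) lborel (\<lambda>\<xi>. Lp_norm (ennreal P) lborel (\<lambda>x. F (x, \<xi>)) + Lp_norm (ennreal P) lborel (\<lambda>x. G (x, \<xi>)))"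
    unfolding mixed_norm_def using PQ_pos P by (intro Lp_norm_mono Lp_norm_triangle) auto
  also have "\<dots> \<le> mixed_norm (ennreal P) (ennreal Q) F + mixed_norm (ennreal P) (ennreal Q) G"
    unfolding mixed_norm_def using Q by (intro Lp_norm_triangle) (auto simp: measurable_section_Lp_norm)
  finally show ?thesis .
qed

lemma mixed_norm_suminf:
  fixes F :: "nat \<Rightarrow> 'a::euclidean_space \<times> 'b::euclidean_space \<Rightarrow> ennreal"
  assumes [measurable]: "\<And>i. F i \<in> borel_measurable borel"
  shows "mixed_norm (ennreal P) (ennreal Q) (\<lambda>z. \<Sum>i. F i z) \<le> (\<Sum>i. mixed_norm (ennreal P) (ennreal Q) (F i))"
proof -
  let ?S = "\<lambda>n z. \<Sum>i<n. F i z"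
  have le: "mixed_norm (ennreal P) (ennreal Q) (?S n) \<le> (\<Sum>i<n. mixed_norm (ennreal P) (ennreal Q) (F i))" for n
  proof (induction n)
    case 0
    have "mixed_norm (ennreal P) (ennreal Q) (\<lambda>z. 0 * 0) = 0" by (subst mixed_norm_cmult) auto
    thus ?case by simp
  next
    case (Suc n)
    have "mixed_norm (ennreal P) (ennreal Q) (?S (Suc n)) \<le>
      mixed_norm (ennreal P) (ennreal Q) (?S n) + mixed_norm (ennreal P) (ennreal Q) (F n)"
      by (simp, rule mixed_norm_triangle) measurable
    with Suc show ?case by (simp add: add_right_mono order_trans)
  qed
  have inc: "incseq (\<lambda>n. ?S n z)" for z by (auto simp: incseq_def intro: sum_mono2)
  have SS: "(\<Sum>i. F i z) = (SUP n. ?S n z)" for z by (rule suminf_eq_SUP)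
  have A: "Lp_norm (ennreal P) lborel (\<lambda>x. SUP n. ?S n (x, \<xi>)) \<le> (SUP n. Lp_norm (ennreal P) lborel (\<lambda>x. ?S n (x, \<xi>)))" for \<xi>
    using PQ_pos inc by (intro Lp_norm_SUP SUP_upper) (auto simp: incseq_def le_fun_def)
  have "mixed_norm (ennreal P) (ennreal Q) (\<lambda>z. \<Sum>i. F i z) \<le>
     Lp_norm (ennreal Q) lborel (\<lambda>\<xi>. SUP n. Lp_norm (ennreal P) lborel (\<lambda>x. ?S n (x, \<xi>)))"
    unfolding mixed_norm_def SS using PQ_pos A by (intro Lp_norm_mono) auto
  also have "\<dots> \<le> (\<Sum>i. mixed_norm (ennreal P) (ennreal Q) (F i))"
  proof (rule Lp_norm_SUP)
    show "incseq (\<lambda>n \<xi>. Lp_norm (ennreal P) lborel (\<lambda>x. ?S n (x, \<xi>)))"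
      using PQ_pos inc by (auto simp: incseq_def le_fun_def intro!: Lp_norm_mono)
    show "Lp_norm (ennreal Q) lborel (\<lambda>\<xi>. Lp_norm (ennreal P) lborel (\<lambda>x. ?S n (x, \<xi>)))
       \<le> (\<Sum>i. mixed_norm (ennreal P) (ennreal Q) (F i))" for n
      using le[of n] unfolding mixed_norm_def by (rule order_trans) (intro sum_le_suminf, auto)
    show "(\<lambda>\<xi>. Lp_norm (ennreal P) lborel (\<lambda>x. ?S n (x, \<xi>))) \<in> borel_measurable lborel" for n
      using measurable_section_Lp_norm[of "?S n"] by simp
  qed (use PQ_pos in auto)
  finally show ?thesis .
qed

lemma mixed_norm_tendsto_0:
  fixes F :: "nat \<Rightarrow> 'a::euclidean_space \<times> 'b::euclidean_space \<Rightarrow> ennreal"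
  assumes [measurable]: "\<And>i. F i \<in> borel_measurable borel" "G \<in> borel_measurable borel"
    and lim: "\<And>z. (\<lambda>i. F i z) \<longlonglongrightarrow> 0" and dom: "\<And>i z. F i z \<le> G z"
    and fin: "mixed_norm (ennreal P) (ennreal Q) G < \<infinity>"
  shows "(\<lambda>i. mixed_norm (ennreal P) (ennreal Q) (F i)) \<longlonglongrightarrow> 0"
  unfolding mixed_norm_def
proof (rule Lp_norm_tendsto_0)
  let ?N = "\<lambda>\<xi>. Lp_norm (ennreal P) lborel (\<lambda>x. G (x, \<xi>))"
  have [measurable]: "?N \<in> borel_measurable borel" by (rule measurable_section_Lp_norm) measurable
  show "?N \<in> borel_measurable lborel" by simp
  show "(\<lambda>\<xi>. Lp_norm (ennreal P) lborel (\<lambda>x. F i (x, \<xi>))) \<in> borel_measurable lborel" for i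
    using measurable_section_Lp_norm[of "F i"] by simp
  show "Lp_norm (ennreal Q) lborel ?N < \<infinity>" using fin by (simp add: mixed_norm_def)
  have "(\<integral>\<^sup>+\<xi>. enn_powr (?N \<xi>) Q \<partial>lborel) \<noteq> \<infinity>"
    using fin PQ_pos by (simp add: mixed_norm_def Lp_norm_finite less_top[symmetric] enn_powr_eq_top_iff[simplified])
  hence "AE \<xi> in lborel. enn_powr (?N \<xi>) Q \<noteq> \<infinity>" by (intro nn_integral_noteq_infinite) auto
  hence "AE \<xi> in lborel. ?N \<xi> < \<infinity>"
    by eventually_elim (auto simp: enn_powr_eq_top_iff[simplified] less_top[symmetric])
  thus "AE \<xi> in lborel. (\<lambda>i. Lp_norm (ennreal P) lborel (\<lambda>x. F i (x, \<xi>))) \<longlonglongrightarrow> 0"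
  proof eventually_elim
    case (elim \<xi>)
    show ?case
      by (rule Lp_norm_tendsto_0[where G = "\<lambda>x. G (x, \<xi>)"]) (use PQ_pos lim dom elim in auto)
  qed
qed (use PQ_pos dom in \<open>auto intro!: Lp_norm_mono\<close>)

lemma mixed_Holder:
  fixes F G :: "'a::euclidean_space \<times> 'b::euclidean_space \<Rightarrow> ennreal"
  assumes [measurable]: "F \<in> borel_measurable borel" "G \<in> borel_measurable borel"
  shows "(\<integral>\<^sup>+z. F z * G z \<partial>lborel) \<le> mixed_norm (ennreal P) (ennreal Q) F
     * mixed_norm (conj_exponent (ennreal P)) (conj_exponent (ennreal Q)) G"
proof -
  have "(\<integral>\<^sup>+z. F z * G z \<partial>lborel) = (\<integral>\<^sup>+\<xi>. \<integral>\<^sup>+x. F (x, \<xi>) * G (x, \<xi>) \<partial>lborel \<partial>lborel)"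
    by (subst lborel_prod[symmetric], subst lborel_pair.nn_integral_snd[symmetric]) (auto simp: lborel_prod)
  also have "\<dots> \<le> (\<integral>\<^sup>+\<xi>. Lp_norm (ennreal P) lborel (\<lambda>x. F (x, \<xi>)) * Lp_norm (conj_exponent (ennreal P)) lborel (\<lambda>x. G (x, \<xi>)) \<partial>lborel)"
    by (intro nn_integral_mono Holder_nn_integral P) auto
  also have "\<dots> \<le> mixed_norm (ennreal P) (ennreal Q) F
     * mixed_norm (conj_exponent (ennreal P)) (conj_exponent (ennreal Q)) G"
    unfolding mixed_norm_def
    by (intro Holder_nn_integral Q) (auto simp: measurable_section_Lp_norm)
  finally show ?thesis .
qed

end

lemma nn_integral_scaleR_le:
  fixes f :: "'a::euclidean_space \<Rightarrow> ennreal"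
  assumes [measurable]: "f \<in> borel_measurable borel" and c: "1 / 2 \<le> c"
  shows "(\<integral>\<^sup>+x. f (c *\<^sub>R x) \<partial>lborel) \<le> 2 ^ DIM('a) * (\<integral>\<^sup>+x. f x \<partial>lborel)"
proof -
  have c0: "c \<noteq> 0" using c by auto
  have "(\<integral>\<^sup>+x. f x \<partial>lborel) = (\<integral>\<^sup>+x. f x \<partial>density (distr lborel borel (\<lambda>x. 0 + c *\<^sub>R x)) (\<lambda>_. ennreal (\<bar>c\<bar> ^ DIM('a))))"
    by (subst lborel_affine[OF c0, of 0]) simp
  also have "\<dots> = ennreal (\<bar>c\<bar> ^ DIM('a)) * (\<integral>\<^sup>+x. f (c *\<^sub>R x) \<partial>lborel)"
    by (subst nn_integral_density) (auto simp: nn_integral_distr nn_integral_cmult)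
  finally have eq: "(\<integral>\<^sup>+x. f x \<partial>lborel) = ennreal (\<bar>c\<bar> ^ DIM('a)) * (\<integral>\<^sup>+x. f (c *\<^sub>R x) \<partial>lborel)" .
  have "1 \<le> (2 * \<bar>c\<bar>) ^ DIM('a)" using c by (intro one_le_power) auto
  hence "ennreal 1 \<le> ennreal (2 ^ DIM('a) * \<bar>c\<bar> ^ DIM('a))"
    by (simp only: power_mult_distrib ennreal_leI)
  hence "1 \<le> ennreal (2 ^ DIM('a)) * ennreal (\<bar>c\<bar> ^ DIM('a))" by (simp only: ennreal_mult' zero_le_power ennreal_1 abs_ge_zero zero_le_numeral)
  from mult_right_mono[OF this, of "\<integral>\<^sup>+x. f (c *\<^sub>R x) \<partial>lborel"]
  have "(\<integral>\<^sup>+x. f (c *\<^sub>R x) \<partial>lborel) \<le> ennreal (2 ^ DIM('a)) * ennreal (\<bar>c\<bar> ^ DIM('a)) * (\<integral>\<^sup>+x. f (c *\<^sub>R x) \<partial>lborel)"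
    by simp
  also have "ennreal (2 ^ DIM('a)) = 2 ^ DIM('a)" by (simp add: ennreal_power[symmetric])
  finally show ?thesis by (simp only: eq mult.assoc)
qed

lemma Lp_norm_scaleR_le:
  fixes F :: "'a::euclidean_space \<Rightarrow> ennreal"
  assumes [measurable]: "F \<in> borel_measurable borel" and c: "1 / 2 \<le> c" and P: "1 \<le> P"
  shows "Lp_norm (ennreal P) lborel (\<lambda>x. F (c *\<^sub>R x)) \<le> 2 ^ DIM('a) * Lp_norm (ennreal P) lborel F"
proof -
  define d :: real where "d = 2 ^ DIM('a)"
  have d: "1 \<le> d" "2 ^ DIM('a) = ennreal d"
    by (simp_all add: d_def ennreal_power[symmetric])
  have "(\<integral>\<^sup>+x. enn_powr (F (c *\<^sub>R x)) P \<partial>lborel) \<le> ennreal d * (\<integral>\<^sup>+x. enn_powr (F x) P \<partial>lborel)"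
    using nn_integral_scaleR_le[OF _ c, of "\<lambda>x. enn_powr (F x) P"] d by simp
  also have "\<dots> \<le> ennreal (d powr P) * (\<integral>\<^sup>+x. enn_powr (F x) P \<partial>lborel)"
    using d P powr_mono[of 1 P d] by (intro mult_right_mono ennreal_leI) auto
  also have "\<dots> = enn_powr (2 ^ DIM('a) * Lp_norm (ennreal P) lborel F) P"
    using P d by (simp add: enn_powr_mult Lp_norm_finite enn_powr_inverse enn_powr_ennreal)
  finally show ?thesis using P by (simp add: Lp_norm_le_iff)
qed

lemma mixed_norm_scaleR_le:
  fixes F :: "'a::euclidean_space \<times> 'b::euclidean_space \<Rightarrow> ennreal"
  assumes [measurable]: "F \<in> borel_measurable borel" and c: "1 / 2 \<le> c" and P: "1 \<le> P" "1 \<le> Q"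
  shows "mixed_norm (ennreal P) (ennreal Q) (\<lambda>z. F (c *\<^sub>R z))
     \<le> 2 ^ (DIM('a) + DIM('b)) * mixed_norm (ennreal P) (ennreal Q) F"
proof -
  let ?N = "\<lambda>\<xi>. Lp_norm (ennreal P) lborel (\<lambda>x. F (x, \<xi>))"
  have [measurable]: "?N \<in> borel_measurable borel" by (rule measurable_section_Lp_norm) measurable
  have "mixed_norm (ennreal P) (ennreal Q) (\<lambda>z. F (c *\<^sub>R z)) \<le>
     Lp_norm (ennreal Q) lborel (\<lambda>\<xi>. 2 ^ DIM('a) * ?N (c *\<^sub>R \<xi>))"
    unfolding mixed_norm_def using P c
    by (intro Lp_norm_mono) (auto intro!: Lp_norm_scaleR_le)
  also have "\<dots> = 2 ^ DIM('a) * Lp_norm (ennreal Q) lborel (\<lambda>\<xi>. ?N (c *\<^sub>R \<xi>))"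
    using P by (intro Lp_norm_cmult) auto
  also have "\<dots> \<le> 2 ^ DIM('a) * (2 ^ DIM('b) * Lp_norm (ennreal Q) lborel ?N)"
    using P c by (intro mult_left_mono Lp_norm_scaleR_le) auto
  finally show ?thesis by (simp add: mixed_norm_def power_add mult.assoc)
qed


section \<open>Schwartz functions built from complex Gaussians\<close>

definition cdot :: "complex ^ 'n::finite \<Rightarrow> real ^ 'n \<Rightarrow> complex" where
  "cdot \<zeta> y = (\<Sum>i\<in>UNIV. \<zeta> $ i * of_real (y $ i))"

lemma cdot_simps [simp]:
  "cdot 0 y = 0" "cdot (\<zeta> + \<eta>) y = cdot \<zeta> y + cdot \<eta> y" "cdot (c *s \<zeta>) y = c * cdot \<zeta> y"
  "cdot \<zeta> (y + z) = cdot \<zeta> y + cdot \<zeta> z" "cdot \<zeta> (t *\<^sub>R y) = of_real t * cdot \<zeta> y"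
  "cdot \<zeta> (axis i 1) = \<zeta> $ i" "cdot (axis i c) y = c * of_real (y $ i)"
  by (auto simp: cdot_def sum.distrib algebra_simps sum_distrib_left axis_def if_distrib[of of_real]
      if_distrib[of "\<lambda>x. _ * x"] if_distrib[of "\<lambda>x. x * _"] cong: if_cong)

lemma norm_cdot_le: "cmod (cdot \<zeta> y) \<le> norm \<zeta> * norm y"
proof -
  have "cmod (cdot \<zeta> y) \<le> (\<Sum>i\<in>UNIV. cmod (\<zeta> $ i) * norm (y $ i))"
    unfolding cdot_def by (rule order_trans[OF norm_sum]) (simp add: norm_mult)
  also have "\<dots> \<le> norm \<zeta> * norm y"
    using L2_set_mult_ineq[of "\<lambda>i. cmod (\<zeta> $ i)" "\<lambda>i. norm (y $ i)" UNIV] by (simp add: norm_vec_def)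
  finally show ?thesis .
qed

text \<open>The remainder of order \<open>m\<close> of the exponential series. Differentiation lowers the order, and the remainders
  vanish to that order at 0.\<close>

definition exp_rem :: "nat \<Rightarrow> complex \<Rightarrow> complex" where
  "exp_rem m s = exp s - (\<Sum>k<m. s ^ k / fact k)"

lemma exp_rem_0 [simp]: "exp_rem 0 s = exp s" by (simp add: exp_rem_def)

lemma exp_rem_deriv: "(exp_rem m has_field_derivative exp_rem (m - 1) s) (at s)"
proof (cases m)
  case 0
  thus ?thesis using DERIV_exp[of s] by (simp add: exp_rem_def[abs_def])
next
  case (Suc k)
  have *: "((\<lambda>s. \<Sum>j<n. s ^ j / fact j) has_field_derivative (\<Sum>j<n - 1. s ^ j / fact j)) (at s)" for n
  proof (induction n)
    case (Suc n)
    show ?case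
    proof (cases n)
      case 0 thus ?thesis by simp
    next
      case (Suc k)
      have "((\<lambda>s. s ^ Suc k / fact (Suc k)) has_field_derivative (of_nat (Suc k) * s ^ k / fact (Suc k))) (at s)"
        by (rule DERIV_cdivide) (use DERIV_power[OF DERIV_ident, of "Suc k" s UNIV] in simp)
      also have "of_nat (Suc k) * s ^ k / fact (Suc k) = s ^ k / fact k"
        by (simp only: fact_Suc of_nat_mult of_nat_fact) (simp del: of_nat_Suc)
      finally show ?thesis using DERIV_add[OF Suc.IH] Suc by simp
    qed
  qed simp
  show ?thesis unfolding exp_rem_def[abs_def] by (rule DERIV_diff[OF DERIV_exp *])
qed

lemma exp_rem_bound: "cmod (exp_rem m s) \<le> cmod s ^ m * exp (cmod s)"
proof (cases m)
  case 0
  thus ?thesis by (simp add: norm_exp complex_Re_le_cmod)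
next
  case (Suc k)
  have "cmod (exp_rem m s) \<le> exp \<bar>Re s\<bar> * cmod s ^ Suc k / fact k"
    using Taylor_exp[of s k] by (simp add: exp_rem_def Suc lessThan_Suc_atMost)
  also have "\<dots> \<le> exp \<bar>Re s\<bar> * cmod s ^ Suc k / 1"
    by (intro divide_left_mono) auto
  also have "\<dots> \<le> exp (cmod s) * cmod s ^ Suc k"
    using abs_Re_le_cmod[of s] by (simp add: mult_right_mono)
  finally show ?thesis by (simp add: Suc mult.commute)
qed

definition gexp :: "complex ^ 'n::finite \<Rightarrow> real ^ 'n \<Rightarrow> complex" where
  "gexp \<eta> y = exp (of_real (- pi * (norm y)\<^sup>2) + cdot \<eta> y)"

lemma gexp_add: "gexp (\<eta> + \<zeta>) y = gexp \<eta> y * exp (cdot \<zeta> y)"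
  by (simp add: gexp_def exp_add[symmetric] algebra_simps)

lemma norm_gexp_le:
  assumes "norm \<eta> \<le> a" shows "cmod (gexp \<eta> y) \<le> exp (- pi * (norm y)\<^sup>2 + a * norm y)"
proof -
  have "Re (cdot \<eta> y) \<le> a * norm y"
    using complex_Re_le_cmod[of "cdot \<eta> y"] norm_cdot_le[of \<eta> y] mult_right_mono[OF assms, of "norm y"] by simp
  thus ?thesis by (simp add: gexp_def norm_exp)
qed

text \<open>The parameters of a family are the exponent \<open>\<eta>\<close> of a Gaussian and a perturbation \<open>\<zeta>\<close> of it,
  which enters through the remainder of order \<open>m\<close> of the exponential series. The factor \<open>norm \<zeta> ^ j\<close>
  records the \<open>j\<close> orders that have been lost to differentiation, so that all members of the class
  are of size \<open>norm \<zeta> ^ m\<close>.\<close>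

definition grem :: "nat \<Rightarrow> nat \<Rightarrow> (complex ^ 'n) \<times> (complex ^ 'n) \<Rightarrow> real ^ 'n::finite \<Rightarrow> complex" where
  "grem m j = (\<lambda>(\<eta>, \<zeta>) y. of_real (norm \<zeta> ^ j) * (gexp \<eta> y * exp_rem (m - j) (cdot \<zeta> y)))"

definition gdom :: "real \<Rightarrow> ((complex ^ 'n::finite) \<times> (complex ^ 'n)) set" where
  "gdom a = {(\<eta>, \<zeta>). norm \<eta> \<le> a \<and> norm \<zeta> \<le> 1}"

inductive_set gfamily ::
  "real \<Rightarrow> nat \<Rightarrow> ((complex ^ 'n) \<times> (complex ^ 'n) \<Rightarrow> real ^ 'n::finite \<Rightarrow> complex) set" for a m where
  base: "grem m j \<in> gfamily a m"
| coord: "F \<in> gfamily a m \<Longrightarrow> (\<lambda>p y. of_real (y $ i) * F p y) \<in> gfamily a m"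
| scale: "F \<in> gfamily a m \<Longrightarrow> (\<And>p. p \<in> gdom a \<Longrightarrow> cmod (c p) \<le> K) \<Longrightarrow> (\<lambda>p y. c p * F p y) \<in> gfamily a m"
| add: "F \<in> gfamily a m \<Longrightarrow> G \<in> gfamily a m \<Longrightarrow> (\<lambda>p y. F p y + G p y) \<in> gfamily a m"

lemma grem_line_derivative:
  "((\<lambda>t. grem m j (\<eta>, \<zeta>) (y + t *\<^sub>R axis i 1)) has_vector_derivative
     \<eta> $ i * grem m j (\<eta>, \<zeta>) y + (- (2 * of_real pi) * (of_real (y $ i) * grem m j (\<eta>, \<zeta>) y)
      + \<zeta> $ i / of_real (norm \<zeta>) * grem m (Suc j) (\<eta>, \<zeta>) y)) (at 0)"
proof -
  define f where "f = (\<lambda>t::complex. of_real (norm \<zeta> ^ j) *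
     (exp (- of_real pi * (of_real ((norm y)\<^sup>2) + 2 * t * of_real (y $ i) + t\<^sup>2) + (cdot \<eta> y + t * \<eta> $ i))
      * exp_rem (m - j) (cdot \<zeta> y + t * \<zeta> $ i)))"
  have eq: "grem m j (\<eta>, \<zeta>) (y + t *\<^sub>R axis i 1) = f (of_real t)" for t
  proof -
    have "(norm (y + t *\<^sub>R axis i 1))\<^sup>2 = (norm y)\<^sup>2 + 2 * t * y $ i + t\<^sup>2"
      unfolding power2_norm_eq_inner
      by (simp add: inner_add_left inner_add_right inner_axis inner_axis' algebra_simps power2_eq_square)
    from arg_cong[OF this, of complex_of_real] show ?thesis by (simp add: grem_def f_def gexp_def)
  qed
  define d where "d = of_real (norm \<zeta> ^ j) *
     (gexp \<eta> y * (- of_real pi * (2 * of_real (y $ i)) + \<eta> $ i) * exp_rem (m - j) (cdot \<zeta> y)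
       + gexp \<eta> y * (exp_rem (m - j - 1) (cdot \<zeta> y) * \<zeta> $ i))"
  have R: "((\<lambda>t. exp_rem (m - j) (cdot \<zeta> y + t * \<zeta> $ i)) has_field_derivative
      exp_rem (m - j - 1) (cdot \<zeta> y) * \<zeta> $ i) (at 0)"
  proof (rule DERIV_chain2[where f = "exp_rem (m - j)" and g = "\<lambda>t. cdot \<zeta> y + t * \<zeta> $ i"])
    show "(exp_rem (m - j) has_field_derivative exp_rem (m - j - 1) (cdot \<zeta> y)) (at (cdot \<zeta> y + 0 * \<zeta> $ i))"
      using exp_rem_deriv[of "m - j" "cdot \<zeta> y"] by simp
  qed (auto intro!: derivative_eq_intros)
  have "(f has_field_derivative d) (at 0)"
    unfolding f_def d_def gexp_def
    by (rule derivative_eq_intros R refl | simp)+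
  hence "((\<lambda>t. f (of_real t)) has_vector_derivative d) (at 0)"
    by (intro has_vector_derivative_real_field) simp
  moreover have "d = \<eta> $ i * grem m j (\<eta>, \<zeta>) y + (- (2 * of_real pi) * (of_real (y $ i) * grem m j (\<eta>, \<zeta>) y)
      + \<zeta> $ i / of_real (norm \<zeta>) * grem m (Suc j) (\<eta>, \<zeta>) y)"
    by (cases "\<zeta> = 0") (simp_all add: d_def grem_def algebra_simps)
  ultimately show ?thesis by (simp add: eq)
qed

lemma exp_rem_differentiable [derivative_intros]:
  fixes f :: "'a::real_normed_vector \<Rightarrow> complex"
  assumes "f differentiable (at y)"
  shows "(\<lambda>y. exp_rem m (f y)) differentiable (at y)"
proof -
  obtain f' where "(f has_derivative f') (at y)" using assms by (auto simp: differentiable_def)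
  from has_derivative_compose[OF this exp_rem_deriv[unfolded has_field_derivative_def]]
  show ?thesis by (auto simp: differentiable_def)
qed

lemma cdot_has_derivative: "(cdot \<zeta> has_derivative cdot \<zeta>) (at y)"
proof -
  have "linear (cdot \<zeta>)" by (intro linearI) (auto simp: scaleR_conv_of_real[where 'a = complex])
  thus ?thesis by (simp add: linear_imp_has_derivative)
qed

lemma grem_differentiable: "grem m j p differentiable (at y)"
proof -
  obtain \<eta> \<zeta> where p: "p = (\<eta>, \<zeta>)" by fastforce
  have c: "cdot \<zeta> differentiable (at y)" for \<zeta> using cdot_has_derivative by (auto simp: differentiable_def)
  have "(\<lambda>y. exp (complex_of_real (- pi * (y \<bullet> y)) + cdot \<eta> y)) differentiable (at y)"
  proof -
    obtain f' where "((\<lambda>y. complex_of_real (- pi * (y \<bullet> y)) + cdot \<eta> y) has_derivative f') (at y)"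
    proof
      show "((\<lambda>y. complex_of_real (- pi * (y \<bullet> y)) + cdot \<eta> y) has_derivative
        (\<lambda>h. complex_of_real (- pi * (y \<bullet> h + h \<bullet> y)) + cdot \<eta> h)) (at y)"
        by (rule derivative_eq_intros cdot_has_derivative has_derivative_of_real refl | simp)+
    qed
    from has_derivative_compose[OF this DERIV_exp[unfolded has_field_derivative_def]]
    show ?thesis by (auto simp: differentiable_def)
  qed
  hence "gexp \<eta> differentiable (at y)" by (simp add: gexp_def[abs_def] power2_norm_eq_inner)
  thus ?thesis unfolding p grem_def by (auto intro!: derivative_intros c differentiable_mult)
qed

text \<open>The closure rules of the class are those that Leibniz' rule needs.\<close>

lemma gfamily_derivative:
  fixes F :: "(complex ^ 'n) \<times> (complex ^ 'n) \<Rightarrow> real ^ 'n::finite \<Rightarrow> complex"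
  assumes "F \<in> gfamily a m"
  shows "(\<forall>p y. F p differentiable (at y)) \<and>
    (\<exists>F'\<in>gfamily a m. \<forall>p y. ((\<lambda>t. F p (y + t *\<^sub>R axis i 1)) has_vector_derivative F' p y) (at 0))"
  using assms
proof induction
  case (base j)
  have h1: "(\<lambda>p y. fst p $ i * grem m j p y + ((\<lambda>_. - (2 * of_real pi)) p * (of_real (y $ i) * grem m j p y)
      + (snd p $ i / of_real (norm (snd p))) * grem m (Suc j) p y)) \<in> gfamily a m" (is "?F' \<in> _")
  proof (intro gfamily.add gfamily.scale gfamily.coord gfamily.base)
    show "cmod (fst p $ i) \<le> a" if "p \<in> gdom a" for p
      using that Finite_Cartesian_Product.norm_nth_le[of "fst p" i] by (auto simp: gdom_def)
    show "cmod (- (2 * complex_of_real pi)) \<le> 2 * pi" by simp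
    show "cmod (snd p $ i / of_real (norm (snd p))) \<le> 1" for p :: "(complex ^ 'n) \<times> (complex ^ 'n)"
      using Finite_Cartesian_Product.norm_nth_le[of "snd p" i] by (auto simp: norm_divide divide_le_eq_1)
  qed
  have h2: "((\<lambda>t. grem m j p (y + t *\<^sub>R axis i 1)) has_vector_derivative ?F' p y) (at 0)" for p y
    using grem_line_derivative[of m j "fst p" "snd p" y i] by simp
  show ?case by (intro conjI bexI[of _ ?F'] allI grem_differentiable h1 h2)
next
  case (coord F k)
  then obtain F' where F': "F' \<in> gfamily a m"
    "\<And>p y. ((\<lambda>t. F p (y + t *\<^sub>R axis i 1)) has_vector_derivative F' p y) (at 0)" by blast
  have h1: "(\<lambda>p y. of_real (axis i (1::real) $ k) * F p y + of_real (y $ k) * F' p y) \<in> gfamily a m"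
    by (intro gfamily.add gfamily.scale[where c = "\<lambda>_. of_real (axis i (1::real) $ k)"] gfamily.coord coord F') auto
  have h2: "((\<lambda>t. of_real ((y + t *\<^sub>R axis i 1) $ k) * F p (y + t *\<^sub>R axis i 1)) has_vector_derivative
      of_real (axis i (1::real) $ k) * F p y + of_real (y $ k) * F' p y) (at 0)" for p y
    by (rule derivative_eq_intros F' has_vector_derivative_mult has_vector_derivative_of_real refl | simp)+
  have h3: "(\<lambda>y. complex_of_real (y $ k) * F p y) differentiable (at y)" for p y
  proof -
    have "((\<lambda>y. complex_of_real (y $ k)) has_derivative (\<lambda>y. complex_of_real (y $ k))) (at y)"
      by (intro linear_imp_has_derivative linearI) (auto simp: scaleR_conv_of_real[where 'a = complex])
    hence "(\<lambda>y. complex_of_real (y $ k)) differentiable (at y)" by (auto simp: differentiable_def)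
    thus ?thesis using coord by (intro differentiable_mult) blast+
  qed
  show ?case by (intro conjI allI h3 bexI[OF _ h1] h2)
next
  case (scale F c K)
  then obtain F' where F': "F' \<in> gfamily a m"
    "\<And>p y. ((\<lambda>t. F p (y + t *\<^sub>R axis i 1)) has_vector_derivative F' p y) (at 0)" by blast
  have h1: "(\<lambda>p y. c p * F' p y) \<in> gfamily a m" by (rule gfamily.scale[OF F'(1) scale(2)])
  have h2: "((\<lambda>t. c p * F p (y + t *\<^sub>R axis i 1)) has_vector_derivative c p * F' p y) (at 0)" for p y
    using F'(2)[of p y] by (intro has_vector_derivative_mult_right) 
  have h3: "(\<lambda>y. c p * F p y) differentiable (at y)" for p y
    using scale by (intro differentiable_mult differentiable_const) blast
  show ?case by (intro conjI allI h3 bexI[OF _ h1] h2)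
next
  case (add F G)
  then obtain F' G' where *: "F' \<in> gfamily a m" "G' \<in> gfamily a m"
    "\<And>p y. ((\<lambda>t. F p (y + t *\<^sub>R axis i 1)) has_vector_derivative F' p y) (at 0)" 
    "\<And>p y. ((\<lambda>t. G p (y + t *\<^sub>R axis i 1)) has_vector_derivative G' p y) (at 0)" by blast
  show ?case
  proof (intro conjI allI bexI)
    show "(\<lambda>p y. F' p y + G' p y) \<in> gfamily a m" by (intro gfamily.add *)
    show "((\<lambda>t. F p (y + t *\<^sub>R axis i 1) + G p (y + t *\<^sub>R axis i 1)) has_vector_derivative F' p y + G' p y) (at 0)" for p y
      by (intro has_vector_derivative_add *)
    show "(\<lambda>y. F p y + G p y) differentiable (at y)" for p y
      using add by (intro differentiable_add) blast+
  qed
qed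

lemma gfamily_pderivs:
  assumes "F \<in> gfamily a m"
  shows "\<exists>F'\<in>gfamily a m. \<forall>p. pderivs is (F p) = F' p"
proof (induction "is")
  case Nil
  thus ?case using assms by auto
next
  case (Cons i "is")
  then obtain F' where F': "F' \<in> gfamily a m" "\<And>p. pderivs is (F p) = F' p" by blast
  from gfamily_derivative[OF F'(1), of i] obtain F'' where "F'' \<in> gfamily a m"
    "\<And>p y. ((\<lambda>t. F' p (y + t *\<^sub>R axis i 1)) has_vector_derivative F'' p y) (at 0)" by blast
  hence "F'' \<in> gfamily a m" "\<And>p. pderivs (i # is) (F p) = F'' p"
    by (auto simp: F' pderiv_coord_def fun_eq_iff intro!: vector_derivative_at)
  thus ?case by blast
qed

lemma gfamily_bound:
  assumes "F \<in> gfamily a m" and a: "0 \<le> a"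
  shows "\<exists>C k. 0 \<le> C \<and> (\<forall>p\<in>gdom a. \<forall>y. cmod (F p y) \<le>
     C * (1 + norm y) ^ k * exp (- pi * (norm y)\<^sup>2 + (a + 1) * norm y) * norm (snd p) ^ m)"
  using assms(1)
proof induction
  case (base j)
  have "cmod (grem m j p y) \<le>
     1 * (1 + norm y) ^ m * exp (- pi * (norm y)\<^sup>2 + (a + 1) * norm y) * norm (snd p) ^ m"
    if "p \<in> gdom a" for p y
  proof -
    obtain \<eta> \<zeta> where p: "p = (\<eta>, \<zeta>)" by fastforce
    with that have n: "norm \<eta> \<le> a" "norm \<zeta> \<le> 1" by (auto simp: gdom_def)
    have cd: "cmod (cdot \<zeta> y) \<le> norm \<zeta> * norm y" "cmod (cdot \<zeta> y) \<le> norm y"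
      using norm_cdot_le[of \<zeta> y] n mult_right_mono[OF n(2), of "norm y"] by auto
    have "norm \<zeta> ^ j * cmod (exp_rem (m - j) (cdot \<zeta> y)) \<le> norm \<zeta> ^ m * ((1 + norm y) ^ m * exp (norm y))"
    proof -
      have "cmod (exp_rem (m - j) (cdot \<zeta> y)) \<le> (norm \<zeta> * norm y) ^ (m - j) * exp (norm y)"
        using exp_rem_bound[of "m - j" "cdot \<zeta> y"] cd
        by (elim order_trans) (intro mult_mono power_mono; simp)
      hence "norm \<zeta> ^ j * cmod (exp_rem (m - j) (cdot \<zeta> y)) \<le>
          norm \<zeta> ^ (j + (m - j)) * (norm y ^ (m - j) * exp (norm y))"
        by (simp add: power_add power_mult_distrib mult_left_mono mult.assoc)
      also have "\<dots> \<le> norm \<zeta> ^ m * ((1 + norm y) ^ m * exp (norm y))"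
      proof (intro mult_mono)
        show "norm \<zeta> ^ (j + (m - j)) \<le> norm \<zeta> ^ m" using n by (intro power_decreasing) auto
        have "norm y ^ (m - j) \<le> (1 + norm y) ^ (m - j)" by (intro power_mono) auto
        also have "\<dots> \<le> (1 + norm y) ^ m" by (intro power_increasing) auto
        finally show "norm y ^ (m - j) \<le> (1 + norm y) ^ m" .
      qed auto
      finally show ?thesis .
    qed
    hence "norm \<zeta> ^ j * cmod (exp_rem (m - j) (cdot \<zeta> y)) * cmod (gexp \<eta> y)
       \<le> norm \<zeta> ^ m * ((1 + norm y) ^ m * exp (norm y)) * exp (- pi * (norm y)\<^sup>2 + a * norm y)"
      by (rule mult_mono[OF _ norm_gexp_le[OF n(1)]]) auto
    moreover have e: "exp (- pi * (norm y)\<^sup>2 + (a + 1) * norm y) = exp (norm y) * exp (- pi * (norm y)\<^sup>2 + a * norm y)"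
      by (simp add: exp_add[symmetric] algebra_simps)
    ultimately show ?thesis unfolding p e by (simp add: grem_def norm_mult norm_power mult_ac)
  qed
  thus ?case by (intro exI[of _ 1] exI[of _ m]) auto
next
  case (coord F i)
  then obtain C k where C: "0 \<le> C" "\<And>p y. p\<in>gdom a \<Longrightarrow> cmod (F p y) \<le>
     C * (1 + norm y) ^ k * exp (- pi * (norm y)\<^sup>2 + (a + 1) * norm y) * norm (snd p) ^ m" by blast
  have "cmod (of_real (y $ i) * F p y) \<le>
     C * (1 + norm y) ^ Suc k * exp (- pi * (norm y)\<^sup>2 + (a + 1) * norm y) * norm (snd p) ^ m"
    if "p \<in> gdom a" for p y
  proof -
    have "\<bar>y $ i\<bar> \<le> 1 + norm y" using component_le_norm_cart[of y i] by simp
    from mult_mono[OF this C(2)[OF that, of y]] show ?thesis by (simp add: norm_mult mult_ac)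
  qed
  with C(1) show ?case by blast
next
  case (scale F c K)
  then obtain C k where C: "0 \<le> C" "\<And>p y. p\<in>gdom a \<Longrightarrow> cmod (F p y) \<le>
     C * (1 + norm y) ^ k * exp (- pi * (norm y)\<^sup>2 + (a + 1) * norm y) * norm (snd p) ^ m" by blast
  have "cmod (c p * F p y) \<le>
     \<bar>K\<bar> * C * (1 + norm y) ^ k * exp (- pi * (norm y)\<^sup>2 + (a + 1) * norm y) * norm (snd p) ^ m"
    if "p \<in> gdom a" for p y
  proof -
    have "cmod (c p) \<le> \<bar>K\<bar>" using scale(2)[OF that] by simp
    from mult_mono[OF this C(2)[OF that, of y]] show ?thesis by (simp add: norm_mult mult_ac)
  qed
  with C(1) show ?case by (intro exI[of _ "\<bar>K\<bar> * C"] exI[of _ k]) auto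
next
  case (add F G)
  then obtain C k C' k' where C: "0 \<le> C" "\<And>p y. p\<in>gdom a \<Longrightarrow> cmod (F p y) \<le>
     C * (1 + norm y) ^ k * exp (- pi * (norm y)\<^sup>2 + (a + 1) * norm y) * norm (snd p) ^ m"
    and C': "0 \<le> C'" "\<And>p y. p\<in>gdom a \<Longrightarrow> cmod (G p y) \<le>
     C' * (1 + norm y) ^ k' * exp (- pi * (norm y)\<^sup>2 + (a + 1) * norm y) * norm (snd p) ^ m" by blast
  have "cmod (F p y + G p y) \<le>
     (C + C') * (1 + norm y) ^ (max k k') * exp (- pi * (norm y)\<^sup>2 + (a + 1) * norm y) * norm (snd p) ^ m"
    if "p \<in> gdom a" for p y
  proof -
    let ?E = "exp (- pi * (norm y)\<^sup>2 + (a + 1) * norm y) * norm (snd p) ^ m"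
    have "cmod (F p y + G p y) \<le> C * (1 + norm y) ^ k * ?E + C' * (1 + norm y) ^ k' * ?E"
      using norm_triangle_ineq[of "F p y" "G p y"] C(2)[OF that, of y] C'(2)[OF that, of y]
      by (simp add: mult.assoc)
    also have "\<dots> \<le> C * (1 + norm y) ^ max k k' * ?E + C' * (1 + norm y) ^ max k k' * ?E"
      using C C' by (intro add_mono mult_right_mono mult_left_mono power_increasing) auto
    finally show ?thesis by (simp add: algebra_simps)
  qed
  thus ?case using C(1) C'(1) by (intro exI[of _ "C + C'"] exI[of _ "max k k'"]) auto
qed

lemma poly_gauss_bounded:
  fixes b t :: real
  assumes "0 \<le> t" "0 \<le> b"
  shows "(1 + t) ^ k * exp (- pi * t\<^sup>2 + b * t) \<le> fact k * exp (1 + (b + 1)\<^sup>2)"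
proof -
  have "(1 + t) ^ k / fact k \<le> exp (1 + t)" 
  proof -
    have "(\<Sum>i\<in>{k}. (1 + t) ^ i /\<^sub>R fact i) \<le> (\<Sum>i. (1 + t) ^ i /\<^sub>R fact i)"
      using assms by (intro sum_le_suminf summable_exp_generic) auto
    thus ?thesis by (simp add: exp_def divide_inverse mult.commute)
  qed
  hence "(1 + t) ^ k \<le> fact k * exp (1 + t)" by (simp add: field_simps)
  hence "(1 + t) ^ k * exp (- pi * t\<^sup>2 + b * t) \<le> fact k * exp (1 + t) * exp (- pi * t\<^sup>2 + b * t)"
    by (rule mult_right_mono) simp
  also have "\<dots> = fact k * exp (1 + (- pi * t\<^sup>2 + (b + 1) * t))"
    by (simp add: exp_add[symmetric] algebra_simps)
  also have "\<dots> \<le> fact k * exp (1 + (b + 1)\<^sup>2)"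
  proof -
    have "(b + 1) * t \<le> (b + 1)\<^sup>2 + t\<^sup>2" 
      using sum_squares_bound[of "b + 1" t] zero_le_power2[of "b + 1"] zero_le_power2[of t]
      unfolding mult.assoc by linarith
    moreover have "t\<^sup>2 \<le> pi * t\<^sup>2" using pi_ge_two mult_right_mono[of 1 pi "t\<^sup>2"] by simp
    ultimately show ?thesis by simp
  qed
  finally show ?thesis .
qed

lemma gfamily_weighted_bound:
  assumes "F \<in> gfamily a m" and a: "0 \<le> a"
  shows "\<exists>C. \<forall>p\<in>gdom a. \<forall>y. (1 + norm y) ^ N * cmod (pderivs is (F p) y) \<le> C * norm (snd p) ^ m"
proof -
  from gfamily_pderivs[OF assms(1)] obtain F' where F': "F' \<in> gfamily a m" "\<And>p. pderivs is (F p) = F' p"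
    by blast
  from gfamily_bound[OF F'(1) a] obtain C k where C: "0 \<le> C" "\<And>p y. p\<in>gdom a \<Longrightarrow> cmod (F' p y) \<le>
     C * (1 + norm y) ^ k * exp (- pi * (norm y)\<^sup>2 + (a + 1) * norm y) * norm (snd p) ^ m" by blast
  have "(1 + norm y) ^ N * cmod (pderivs is (F p) y) \<le>
      C * (fact (N + k) * exp (1 + (a + 1 + 1)\<^sup>2)) * norm (snd p) ^ m"
    if "p \<in> gdom a" for p y
  proof -
    have "(1 + norm y) ^ N * cmod (pderivs is (F p) y) \<le>
       (1 + norm y) ^ N * (C * (1 + norm y) ^ k * exp (- pi * (norm y)\<^sup>2 + (a + 1) * norm y) * norm (snd p) ^ m)"
      unfolding F' by (intro mult_left_mono C that) auto
    also have "\<dots> = C * ((1 + norm y) ^ (N + k) * exp (- pi * (norm y)\<^sup>2 + (a + 1) * norm y)) * norm (snd p) ^ m"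
      by (simp add: power_add mult_ac)
    also have "\<dots> \<le> C * (fact (N + k) * exp (1 + (a + 1 + 1)\<^sup>2)) * norm (snd p) ^ m"
      using a C by (intro mult_right_mono mult_left_mono poly_gauss_bounded) auto
    finally show ?thesis .
  qed
  thus ?thesis by blast
qed

lemma gfamily_schwartz:
  assumes "F \<in> gfamily a m" "p \<in> gdom a" "0 \<le> a"
  shows "F p \<in> schwartz"
proof -
  have "pderivs is (F p) differentiable (at y)" for "is" y
  proof -
    from gfamily_pderivs[OF assms(1)] obtain F' where F': "F' \<in> gfamily a m" "\<And>p. pderivs is (F p) = F' p"
      by blast
    from gfamily_derivative[OF F'(1)] have "F' p differentiable (at y)" by blast
    thus ?thesis by (simp only: F'(2))
  qed
  moreover have "bounded (range (\<lambda>y. (1 + norm y) ^ N * cmod (pderivs is (F p) y)))" for N "is"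
  proof -
    from gfamily_weighted_bound[OF assms(1,3), of N "is"] obtain C
      where "\<And>y. (1 + norm y) ^ N * cmod (pderivs is (F p) y) \<le> C * norm (snd p) ^ m"
      using assms(2) by blast
    thus ?thesis by (intro boundedI[where B = "C * norm (snd p) ^ m"]) auto
  qed
  ultimately show ?thesis by (simp add: schwartz_def smooth_fn_def)
qed

lemma finite_short_lists: "finite {is :: 'n::finite list. length is \<le> N}"
  using finite_lists_length_le[of "UNIV :: 'n set" N] by simp

text \<open>Uniform bounds in the parameters: applied to a tempered distribution, they give the differentiability of its
  values at Gaussians in the exponent.\<close>

lemma gfamily_schwartz_norm:
  assumes "F \<in> gfamily a m" "0 \<le> a"
  shows "\<exists>C. \<forall>p\<in>gdom a. schwartz_norm N (F p) \<le> C * norm (snd p) ^ m"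
proof -
  have "\<forall>is. \<exists>C. \<forall>p\<in>gdom a. \<forall>y. (1 + norm y) ^ N * cmod (pderivs is (F p) y) \<le> C * norm (snd p) ^ m"
    using gfamily_weighted_bound[OF assms] by blast
  then obtain C where C: "\<And>is p y. p\<in>gdom a \<Longrightarrow>
     (1 + norm y) ^ N * cmod (pderivs is (F p) y) \<le> C is * norm (snd p) ^ m" by metis
  have "schwartz_norm N (F p) \<le> (\<Sum>is | length is \<le> N. C is) * norm (snd p) ^ m" if "p \<in> gdom a" for p
    unfolding schwartz_norm_def sum_distrib_right
    by (intro sum_mono cSUP_least C that) auto
  thus ?thesis by blast
qed


section \<open>Tempered distributions on Gaussians\<close>

lemma pderiv_coord_has_vector_derivative:
  assumes "\<phi> differentiable (at y)"
  shows "((\<lambda>t. \<phi> (y + t *\<^sub>R axis i 1)) has_vector_derivative pderiv_coord i \<phi> y) (at 0)"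
proof -
  obtain \<phi>' where "(\<phi> has_derivative \<phi>') (at (y + 0 *\<^sub>R axis i 1))" using assms by (auto simp: differentiable_def)
  moreover have "((\<lambda>t. y + t *\<^sub>R axis i 1) has_derivative (\<lambda>t. t *\<^sub>R axis i (1::real))) (at 0)"
    by (auto intro!: derivative_eq_intros)
  ultimately have "((\<lambda>t. \<phi> (y + t *\<^sub>R axis i 1)) has_derivative (\<lambda>t. \<phi>' (t *\<^sub>R axis i 1))) (at 0)"
    by (rule has_derivative_compose[rotated])
  hence "(\<lambda>t. \<phi> (y + t *\<^sub>R axis i 1)) differentiable (at 0)" by (auto simp: differentiable_def)
  thus ?thesis unfolding pderiv_coord_def by (simp add: vector_derivative_works)
qed

lemma pderivs_linear:
  assumes "smooth_fn \<phi>" "smooth_fn \<psi>"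
  shows "pderivs is (\<lambda>y. c * \<phi> y + d * \<psi> y) = (\<lambda>y. c * pderivs is \<phi> y + d * pderivs is \<psi> y)"
proof (induction "is")
  case (Cons i "is")
  have d: "pderivs is \<phi> differentiable (at y)" "pderivs is \<psi> differentiable (at y)" for y
    using assms by (auto simp: smooth_fn_def)
  show ?case
    by (simp add: Cons fun_eq_iff pderiv_coord_def[of i "\<lambda>y. _ y + _ y"])
       (intro allI vector_derivative_at has_vector_derivative_add has_vector_derivative_mult_right
          pderiv_coord_has_vector_derivative d)
qed simp

lemma schwartz_bound:
  assumes "\<phi> \<in> schwartz"
  shows "\<exists>A. \<forall>y. (1 + norm y) ^ N * cmod (pderivs is \<phi> y) \<le> A"
proof -
  have "bounded (range (\<lambda>x. (1 + norm x) ^ N * cmod (pderivs is \<phi> x)))" using assms by (simp add: schwartz_def)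
  then obtain A where "\<forall>x\<in>range (\<lambda>x. (1 + norm x) ^ N * cmod (pderivs is \<phi> x)). norm x \<le> A"
    unfolding bounded_iff by blast
  hence "(1 + norm y) ^ N * cmod (pderivs is \<phi> y) \<le> A" for y by (auto simp: abs_mult)
  thus ?thesis by blast
qed

lemma schwartz_linear:
  assumes "\<phi> \<in> schwartz" "\<psi> \<in> schwartz"
  shows "(\<lambda>y. c * \<phi> y + d * \<psi> y) \<in> schwartz"
proof -
  have s: "smooth_fn \<phi>" "smooth_fn \<psi>" using assms by (auto simp: schwartz_def)
  note L = pderivs_linear[OF s, of _ c d]
  have "smooth_fn (\<lambda>y. c * \<phi> y + d * \<psi> y)"
    using s unfolding smooth_fn_def L by (auto intro!: differentiable_add differentiable_mult)
  moreover have "bounded (range (\<lambda>y. (1 + norm y) ^ N * cmod (pderivs is (\<lambda>y. c * \<phi> y + d * \<psi> y) y)))" for N "is"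
  proof -
    obtain A B where A: "\<And>y. (1 + norm y) ^ N * cmod (pderivs is \<phi> y) \<le> A"
      and B: "\<And>y. (1 + norm y) ^ N * cmod (pderivs is \<psi> y) \<le> B"
      using schwartz_bound[OF assms(1)] schwartz_bound[OF assms(2)] by blast
    have "(1 + norm y) ^ N * cmod (c * pderivs is \<phi> y + d * pderivs is \<psi> y) \<le> cmod c * A + cmod d * B" for y
    proof -
      have "(1 + norm y) ^ N * cmod (c * pderivs is \<phi> y + d * pderivs is \<psi> y) \<le>
        (1 + norm y) ^ N * (cmod c * cmod (pderivs is \<phi> y) + cmod d * cmod (pderivs is \<psi> y))"
        by (intro mult_left_mono) (auto simp: norm_mult[symmetric] norm_triangle_ineq)
      also have "\<dots> = cmod c * ((1 + norm y) ^ N * cmod (pderivs is \<phi> y)) + cmod d * ((1 + norm y) ^ N * cmod (pderivs is \<psi> y))"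
        by (simp add: algebra_simps)
      also have "\<dots> \<le> cmod c * A + cmod d * B" by (intro add_mono mult_left_mono A B) auto
      finally show ?thesis .
    qed
    thus ?thesis unfolding L by (intro boundedI[where B = "cmod c * A + cmod d * B"]) auto
  qed
  ultimately show ?thesis by (simp add: schwartz_def)
qed

lemma schwartz_add: "\<phi> \<in> schwartz \<Longrightarrow> \<psi> \<in> schwartz \<Longrightarrow> (\<lambda>y. \<phi> y + \<psi> y) \<in> schwartz"
  using schwartz_linear[of \<phi> \<psi> 1 1] by simp

lemma schwartz_cmult: "\<phi> \<in> schwartz \<Longrightarrow> (\<lambda>y. c * \<phi> y) \<in> schwartz"
  using schwartz_linear[of \<phi> \<phi> c 0] by simp

lemma schwartz_sum:
  assumes "finite I" "I \<noteq> {}" "\<And>i. i \<in> I \<Longrightarrow> \<phi> i \<in> schwartz"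
  shows "(\<lambda>y. \<Sum>i\<in>I. c i * \<phi> i y) \<in> schwartz"
  using assms by (induction I rule: finite_ne_induct) (auto intro!: schwartz_add schwartz_cmult)

lemma tempered_add:
  "h \<in> tempered \<Longrightarrow> \<phi> \<in> schwartz \<Longrightarrow> \<psi> \<in> schwartz \<Longrightarrow> h (\<lambda>y. \<phi> y + \<psi> y) = h \<phi> + h \<psi>"
  by (simp add: tempered_def)

lemma tempered_cmult: "h \<in> tempered \<Longrightarrow> \<phi> \<in> schwartz \<Longrightarrow> h (\<lambda>y. c * \<phi> y) = c * h \<phi>"
  by (simp add: tempered_def)

lemma tempered_sum:
  assumes "h \<in> tempered" "finite I" "I \<noteq> {}" "\<And>i. i \<in> I \<Longrightarrow> \<phi> i \<in> schwartz"
  shows "h (\<lambda>y. \<Sum>i\<in>I. c i * \<phi> i y) = (\<Sum>i\<in>I. c i * h (\<phi> i))"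
  using assms(2-4)
proof (induction I rule: finite_ne_induct)
  case (singleton i)
  thus ?case using assms(1) by (simp add: tempered_cmult)
next
  case (insert i I)
  have "h (\<lambda>y. \<Sum>i\<in>insert i I. c i * \<phi> i y) = h (\<lambda>y. c i * \<phi> i y + (\<Sum>i\<in>I. c i * \<phi> i y))"
    using insert by simp
  also have "\<dots> = h (\<lambda>y. c i * \<phi> i y) + h (\<lambda>y. \<Sum>i\<in>I. c i * \<phi> i y)"
    using insert assms(1) by (intro tempered_add schwartz_cmult schwartz_sum) auto
  finally show ?case using insert assms(1) by (simp add: tempered_cmult)
qed

definition ymono :: "'n list \<Rightarrow> real ^ 'n::finite \<Rightarrow> complex" where
  "ymono js y = prod_list (map (\<lambda>i. of_real (y $ i)) js)"

definition gmono :: "'n list \<Rightarrow> complex ^ 'n \<Rightarrow> real ^ 'n::finite \<Rightarrow> complex" where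
  "gmono js \<eta> y = ymono js y * gexp \<eta> y"

lemma ymono_simps [simp]: "ymono [] y = 1" "ymono (i # js) y = of_real (y $ i) * ymono js y"
  by (simp_all add: ymono_def)

lemma gmono_Nil: "gmono [] \<eta> = gexp \<eta>"
  by (simp add: gmono_def fun_eq_iff)

lemma ymono_grem_in_gfamily: "(\<lambda>p y. ymono js y * grem m j p y) \<in> gfamily a m"
proof (induction js)
  case Nil thus ?case using gfamily.base[of m j a] by simp
next
  case (Cons i js)
  from gfamily.coord[OF this, of i] show ?case by (simp add: mult.assoc)
qed

lemma gmono_eq_grem: "gmono js \<eta> = (\<lambda>y. ymono js y * grem 0 0 (\<eta>, 0) y)"
  by (simp add: gmono_def grem_def fun_eq_iff)

lemma gmono_schwartz: "gmono js \<eta> \<in> schwartz"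
  unfolding gmono_eq_grem
  by (rule gfamily_schwartz[OF ymono_grem_in_gfamily[of js 0 0 "norm \<eta>"]]) (auto simp: gdom_def)

lemma tempered_grem_bound:
  assumes "h \<in> tempered" "0 \<le> a"
  shows "\<exists>C. 0 \<le> C \<and> (\<forall>(\<eta>, \<zeta>)\<in>gdom a. cmod (h (\<lambda>y. ymono js y * grem m 0 (\<eta>, \<zeta>) y)) \<le> C * norm \<zeta> ^ m)"
proof -
  have "\<exists>C N. \<forall>\<phi>\<in>schwartz. cmod (h \<phi>) \<le> C * schwartz_norm N \<phi>" using assms(1) by (simp add: tempered_def)
  then obtain C N where h: "\<And>\<phi>. \<phi> \<in> schwartz \<Longrightarrow> cmod (h \<phi>) \<le> C * schwartz_norm N \<phi>" by blast
  obtain D where D: "\<And>p. p \<in> gdom a \<Longrightarrow> schwartz_norm N (\<lambda>y. ymono js y * grem m 0 p y) \<le> D * norm (snd p) ^ m"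
    using gfamily_schwartz_norm[OF ymono_grem_in_gfamily[of js m 0 a] assms(2), of N] by blast
  have nn: "0 \<le> schwartz_norm N \<phi>" if "\<phi> \<in> schwartz" for \<phi> :: "real ^ 'a \<Rightarrow> complex"
    unfolding schwartz_norm_def
  proof (rule sum_nonneg)
    fix "is" :: "'a list"
    have "bdd_above (range (\<lambda>x. (1 + norm x) ^ N * cmod (pderivs is \<phi> x)))"
      using that by (auto simp: schwartz_def intro: bounded_imp_bdd_above)
    hence "(1 + norm (0::real^'a)) ^ N * cmod (pderivs is \<phi> 0) \<le> (SUP x. (1 + norm x) ^ N * cmod (pderivs is \<phi> x))"
      by (intro cSUP_upper) auto
    thus "0 \<le> (SUP x. (1 + norm x) ^ N * cmod (pderivs is \<phi> x))" by (rule order_trans[rotated]) simp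
  qed
  have "cmod (h (\<lambda>y. ymono js y * grem m 0 p y)) \<le> \<bar>C\<bar> * \<bar>D\<bar> * norm (snd p) ^ m" if p: "p \<in> gdom a" for p
  proof -
    have s: "(\<lambda>y. ymono js y * grem m 0 p y) \<in> schwartz"
      by (rule gfamily_schwartz[OF ymono_grem_in_gfamily p assms(2)])
    have "cmod (h (\<lambda>y. ymono js y * grem m 0 p y)) \<le> \<bar>C\<bar> * schwartz_norm N (\<lambda>y. ymono js y * grem m 0 p y)"
      using h[OF s] nn[OF s] by (elim order_trans) (simp add: mult_right_mono)
    also have "\<dots> \<le> \<bar>C\<bar> * (\<bar>D\<bar> * norm (snd p) ^ m)"
      using D[OF p] by (intro mult_left_mono) (auto elim!: order_trans intro: mult_right_mono)
    finally show ?thesis by (simp add: mult.assoc)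
  qed
  thus ?thesis by (intro exI[of _ "\<bar>C\<bar> * \<bar>D\<bar>"]) auto
qed

text \<open>The difference is the value of the distribution at a remainder of the exponential series of order 1.\<close>

lemma tempered_gmono_first_order:
  assumes "h \<in> tempered" "0 \<le> a"
  shows "\<exists>C. 0 \<le> C \<and> (\<forall>(\<eta>, \<zeta>)\<in>gdom a. cmod (h (gmono js (\<eta> + \<zeta>)) - h (gmono js \<eta>)) \<le> C * norm \<zeta>)"
proof -
  obtain C where C: "0 \<le> C" "\<And>\<eta> \<zeta>. (\<eta>, \<zeta>) \<in> gdom a \<Longrightarrow> cmod (h (\<lambda>y. ymono js y * grem 1 0 (\<eta>, \<zeta>) y)) \<le> C * norm \<zeta> ^ 1"
    using tempered_grem_bound[OF assms, of js 1] by blast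
  have "cmod (h (gmono js (\<eta> + \<zeta>)) - h (gmono js \<eta>)) \<le> C * norm \<zeta>" if p: "(\<eta>, \<zeta>) \<in> gdom a" for \<eta> \<zeta>
  proof -
    have "gmono js (\<eta> + \<zeta>) = (\<lambda>y. ymono js y * grem 1 0 (\<eta>, \<zeta>) y + gmono js \<eta> y)"
      by (simp add: fun_eq_iff gmono_def grem_def gexp_add exp_rem_def algebra_simps)
    moreover have s: "(\<lambda>y. ymono js y * grem 1 0 (\<eta>, \<zeta>) y) \<in> schwartz"
      by (rule gfamily_schwartz[OF ymono_grem_in_gfamily p assms(2)])
    ultimately have "h (gmono js (\<eta> + \<zeta>)) = h (\<lambda>y. ymono js y * grem 1 0 (\<eta>, \<zeta>) y) + h (gmono js \<eta>)"
      using tempered_add[OF assms(1) s gmono_schwartz] by simp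
    thus ?thesis using C(2)[OF p] by simp
  qed
  thus ?thesis using C(1) by blast
qed

lemma tempered_gmono_second_order:
  assumes "h \<in> tempered" "0 \<le> a"
  shows "\<exists>C. 0 \<le> C \<and> (\<forall>(\<eta>, \<zeta>)\<in>gdom a. cmod (h (gmono js (\<eta> + \<zeta>)) - h (gmono js \<eta>)
     - (\<Sum>i\<in>UNIV. \<zeta> $ i * h (gmono (i # js) \<eta>))) \<le> C * (norm \<zeta>)\<^sup>2)"
proof -
  obtain C where C: "0 \<le> C" "\<And>\<eta> \<zeta>. (\<eta>, \<zeta>) \<in> gdom a \<Longrightarrow> cmod (h (\<lambda>y. ymono js y * grem 2 0 (\<eta>, \<zeta>) y)) \<le> C * (norm \<zeta>)\<^sup>2"
    using tempered_grem_bound[OF assms, of js 2] by blast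
  have "cmod (h (gmono js (\<eta> + \<zeta>)) - h (gmono js \<eta>) - (\<Sum>i\<in>UNIV. \<zeta> $ i * h (gmono (i # js) \<eta>))) \<le> C * (norm \<zeta>)\<^sup>2"
    if p: "(\<eta>, \<zeta>) \<in> gdom a" for \<eta> \<zeta>
  proof -
    have "gmono js (\<eta> + \<zeta>) = (\<lambda>y. ymono js y * grem 2 0 (\<eta>, \<zeta>) y + (gmono js \<eta> y + (\<Sum>i\<in>UNIV. \<zeta> $ i * gmono (i # js) \<eta> y)))"
      by (simp add: fun_eq_iff gmono_def grem_def gexp_add exp_rem_def numeral_2_eq_2 cdot_def sum_distrib_left sum_distrib_right algebra_simps)
    moreover have s: "(\<lambda>y. ymono js y * grem 2 0 (\<eta>, \<zeta>) y) \<in> schwartz"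
      by (rule gfamily_schwartz[OF ymono_grem_in_gfamily p assms(2)])
    moreover have s2: "(\<lambda>y. \<Sum>i\<in>UNIV. \<zeta> $ i * gmono (i # js) \<eta> y) \<in> schwartz"
      by (rule schwartz_sum) (auto simp: gmono_schwartz)
    ultimately have "h (gmono js (\<eta> + \<zeta>)) = h (\<lambda>y. ymono js y * grem 2 0 (\<eta>, \<zeta>) y)
       + (h (gmono js \<eta>) + h (\<lambda>y. \<Sum>i\<in>UNIV. \<zeta> $ i * gmono (i # js) \<eta> y))"
      using tempered_add[OF assms(1) s schwartz_add[OF gmono_schwartz[of js \<eta>] s2]]
        tempered_add[OF assms(1) gmono_schwartz[of js \<eta>] s2] by simp
    also have "h (\<lambda>y. \<Sum>i\<in>UNIV. \<zeta> $ i * gmono (i # js) \<eta> y) = (\<Sum>i\<in>UNIV. \<zeta> $ i * h (gmono (i # js) \<eta>))"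
      by (rule tempered_sum[OF assms(1)]) (auto simp: gmono_schwartz)
    finally show ?thesis using C(2)[OF p] by simp
  qed
  thus ?thesis using C(1) by blast
qed

lemma norm_vector_scalar_mult: "norm (c *s (\<zeta> :: complex ^ 'n::finite)) = cmod c * norm \<zeta>"
  by (simp add: norm_vec_def norm_mult L2_set_right_distrib)

text \<open>The remainder of order 2 in the exponent is quadratically small, uniformly for bounded exponents.\<close>

lemma tempered_gmono_derivative:
  assumes "h \<in> tempered"
  shows "((\<lambda>\<tau>. h (gmono js (\<eta> + \<tau> *s \<zeta>))) has_field_derivative
     (\<Sum>i\<in>UNIV. \<zeta> $ i * h (gmono (i # js) (\<eta> + \<tau> *s \<zeta>)))) (at \<tau>)"
proof -
  define f where "f = (\<lambda>\<tau>. h (gmono js (\<eta> + \<tau> *s \<zeta>)))"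
  define d where "d = (\<Sum>i\<in>UNIV. \<zeta> $ i * h (gmono (i # js) (\<eta> + \<tau> *s \<zeta>)))"
  obtain C where C: "0 \<le> C" "\<And>\<eta>' \<zeta>'. (\<eta>', \<zeta>') \<in> gdom (norm (\<eta> + \<tau> *s \<zeta>)) \<Longrightarrow>
     cmod (h (gmono js (\<eta>' + \<zeta>')) - h (gmono js \<eta>') - (\<Sum>i\<in>UNIV. \<zeta>' $ i * h (gmono (i # js) \<eta>'))) \<le> C * (norm \<zeta>')\<^sup>2"
    using tempered_gmono_second_order[OF assms, of "norm (\<eta> + \<tau> *s \<zeta>)" js] by force
  have bd: "cmod ((f (\<tau> + \<delta>) - f \<tau>) / \<delta> - d) \<le> C * (norm \<zeta>)\<^sup>2 * cmod \<delta>"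
    if "\<delta> \<noteq> 0" "cmod \<delta> < 1 / (1 + norm \<zeta>)" for \<delta>
  proof -
    have "cmod \<delta> * (1 + norm \<zeta>) < 1" using that(2) by (simp add: pos_less_divide_eq add_pos_nonneg)
    hence "norm (\<delta> *s \<zeta>) \<le> 1" using norm_ge_zero[of \<delta>] unfolding norm_vector_scalar_mult distrib_left by linarith
    hence "(\<eta> + \<tau> *s \<zeta>, \<delta> *s \<zeta>) \<in> gdom (norm (\<eta> + \<tau> *s \<zeta>))" by (simp add: gdom_def)
    from C(2)[OF this] have "cmod (f (\<tau> + \<delta>) - f \<tau> - \<delta> * d) \<le> C * (cmod \<delta> * norm \<zeta>)\<^sup>2"
      by (simp add: f_def d_def norm_vector_scalar_mult vector_sadd_rdistrib add.assoc sum_distrib_left mult.assoc)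
    moreover have "cmod (f (\<tau> + \<delta>) - f \<tau> - \<delta> * d) = cmod \<delta> * cmod ((f (\<tau> + \<delta>) - f \<tau>) / \<delta> - d)"
    proof -
      have "f (\<tau> + \<delta>) - f \<tau> - \<delta> * d = \<delta> * ((f (\<tau> + \<delta>) - f \<tau>) / \<delta> - d)"
        using that(1) by (simp add: field_simps)
      thus ?thesis by (simp only: norm_mult)
    qed
    ultimately have "cmod \<delta> * cmod ((f (\<tau> + \<delta>) - f \<tau>) / \<delta> - d) \<le> cmod \<delta> * (C * (norm \<zeta>)\<^sup>2 * cmod \<delta>)"
      by (simp add: power_mult_distrib power2_eq_square mult_ac)
    thus ?thesis using that(1) by simp
  qed
  have "((\<lambda>\<delta>. (f (\<tau> + \<delta>) - f \<tau>) / \<delta> - d) \<longlongrightarrow> 0) (at 0)"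
  proof (rule Lim_null_comparison)
    have "0 < 1 / (1 + norm \<zeta>)" by (simp add: add_pos_nonneg)
    thus "\<forall>\<^sub>F \<delta> in at 0. cmod ((f (\<tau> + \<delta>) - f \<tau>) / \<delta> - d) \<le> C * (norm \<zeta>)\<^sup>2 * cmod \<delta>"
      using bd unfolding eventually_at dist_norm by (intro exI[of _ "1 / (1 + norm \<zeta>)"]) auto
    show "((\<lambda>\<delta>. C * (norm \<zeta>)\<^sup>2 * cmod \<delta>) \<longlongrightarrow> 0) (at 0)"
      by (auto intro!: tendsto_eq_intros)
  qed
  hence "(f has_field_derivative d) (at \<tau>)" by (simp add: DERIV_def LIM_zero_iff)
  thus ?thesis by (simp add: f_def d_def)
qed

lemma tempered_gmono_continuous:
  assumes "h \<in> tempered" shows "continuous_on UNIV (\<lambda>\<eta>. h (gmono js \<eta>))"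
  unfolding continuous_on_eq_continuous_at[OF open_UNIV] isCont_def
proof
  fix \<eta>
  obtain C where C: "0 \<le> C" "\<And>\<zeta>. norm \<zeta> \<le> 1 \<Longrightarrow> cmod (h (gmono js (\<eta> + \<zeta>)) - h (gmono js \<eta>)) \<le> C * norm \<zeta>"
    using tempered_gmono_first_order[OF assms, of "norm \<eta>" js] unfolding gdom_def by force
  have "((\<lambda>\<eta>'. h (gmono js \<eta>') - h (gmono js \<eta>)) \<longlongrightarrow> 0) (at \<eta>)"
  proof (rule Lim_null_comparison)
    show "\<forall>\<^sub>F \<eta>' in at \<eta>. cmod (h (gmono js \<eta>') - h (gmono js \<eta>)) \<le> C * norm (\<eta>' - \<eta>)"
      using C(2)[of "_ - \<eta>"] unfolding eventually_at dist_norm by (intro exI[of _ 1]) auto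
    show "((\<lambda>\<eta>'. C * norm (\<eta>' - \<eta>)) \<longlongrightarrow> 0) (at \<eta>)"
      by (auto intro!: tendsto_eq_intros)
  qed
  thus "((\<lambda>\<eta>. h (gmono js \<eta>)) \<longlongrightarrow> h (gmono js \<eta>)) (at \<eta>)" by (simp add: LIM_zero_iff)
qed

section \<open>The short-time Fourier transform as a Bargmann transform\<close>

text \<open>Up to a nonvanishing factor, the transform with a Gaussian window at \<open>(x, \<xi>)\<close> is an entire function at the point
  \<open>2 \<pi> x - i \<xi>\<close>. After multiplication by \<open>exp (- \<zeta>\<cdot>\<zeta> / 8 \<pi>)\<close> the modulus of that factor depends only on
  \<open>norm \<zeta>\<close>.\<close>

definition zpoint :: "(real ^ 'n) \<times> (real ^ 'n) \<Rightarrow> complex ^ 'n::finite" where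
  "zpoint z = (\<chi> i. of_real (2 * pi * (fst z $ i)) - \<i> * of_real (snd z $ i))"

definition csq :: "complex ^ 'n::finite \<Rightarrow> complex" where
  "csq \<zeta> = (\<Sum>i\<in>UNIV. (\<zeta> $ i)\<^sup>2)"

definition bargmann :: "((real ^ 'n::finite \<Rightarrow> complex) \<Rightarrow> complex) \<Rightarrow> complex ^ 'n \<Rightarrow> complex" where
  "bargmann h \<zeta> = exp (- csq \<zeta> / of_real (8 * pi)) * h (gexp \<zeta>)"

definition bfactor :: "(real ^ 'n) \<times> (real ^ 'n::finite) \<Rightarrow> complex" where
  "bfactor z = of_real (2 powr (real CARD('n) / 4) * exp (- pi * (norm (fst z))\<^sup>2)) * exp (csq (zpoint z) / of_real (8 * pi))"

lemma zpoint_linear: "zpoint (z + z') = zpoint z + zpoint z'" "zpoint (c *\<^sub>R z) = of_real c *s zpoint z"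
  by (auto simp: zpoint_def vec_eq_iff algebra_simps)

lemma norm_zpoint: "(norm (zpoint z))\<^sup>2 = 4 * pi\<^sup>2 * (norm (fst z))\<^sup>2 + (norm (snd z))\<^sup>2"
  by (simp add: norm_vec_def L2_set_def sum_nonneg zpoint_def cmod_power2 sum.distrib sum_distrib_left power_mult_distrib mult.assoc)

lemma norm_bfactor: "cmod (bfactor (z :: (real ^ 'n) \<times> (real ^ 'n::finite))) =
   2 powr (real CARD('n) / 4) * exp (- (norm (zpoint z))\<^sup>2 / (8 * pi))"
proof -
  have R: "Re (csq (zpoint z)) = 4 * pi\<^sup>2 * (norm (fst z))\<^sup>2 - (norm (snd z))\<^sup>2"
    by (simp add: csq_def zpoint_def norm_vec_def L2_set_def sum_nonneg Re_power2 sum_subtractf sum_distrib_left power_mult_distrib mult.assoc)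
  have "- pi * (norm (fst z))\<^sup>2 + Re (csq (zpoint z)) / (8 * pi) = - (norm (zpoint z))\<^sup>2 / (8 * pi)"
    unfolding R norm_zpoint by (simp add: field_simps power2_eq_square)
  hence "exp (- pi * (norm (fst z))\<^sup>2) * exp (Re (csq (zpoint z)) / (8 * pi)) = exp (- (norm (zpoint z))\<^sup>2 / (8 * pi))"
    by (simp only: exp_add[symmetric])
  moreover have "cmod (exp (csq (zpoint z) / of_real (8 * pi))) = exp (Re (csq (zpoint z)) / (8 * pi))"
    unfolding norm_exp_eq_Re by (simp only: Re_divide_of_real)
  ultimately show ?thesis by (simp only: bfactor_def norm_mult norm_of_real) (simp add: abs_mult mult.assoc)
qed


text \<open>Completing the square moves the translation of the Gaussian into the exponent.\<close>

lemma window_shift: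
  "cnj (gauss_window (y - fst z)) * exp (- \<i> * complex_of_real (y \<bullet> snd z)) =
   of_real (2 powr (real CARD('n) / 4) * exp (- pi * (norm (fst z))\<^sup>2)) * gexp (zpoint z) (y :: real ^ 'n::finite)"
proof -
  define a :: complex where "a = of_real (2 powr (real CARD('n) / 4))"
  have cd: "cdot (zpoint z) y = of_real (2 * pi * (fst z \<bullet> y)) + - \<i> * of_real (y \<bullet> snd z)"
  proof -
    have "cdot (zpoint z) y =
      (\<Sum>i\<in>UNIV. of_real (2 * pi) * of_real (fst z $ i * y $ i) + - \<i> * of_real (y $ i * snd z $ i))"
      unfolding cdot_def zpoint_def by (intro sum.cong refl, simp only: vec_lambda_beta of_real_mult, algebra)
    thus ?thesis
      by (simp only: sum.distrib sum_distrib_left[symmetric] of_real_sum inner_vec_def inner_real_def of_real_mult)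
  qed
  have N: "(norm (y - fst z))\<^sup>2 = (norm y)\<^sup>2 - 2 * (fst z \<bullet> y) + (norm (fst z))\<^sup>2"
    unfolding power2_norm_eq_inner by (simp add: inner_diff_left inner_diff_right inner_commute)
  have "- pi * (norm (y - fst z))\<^sup>2 = - pi * (norm (fst z))\<^sup>2 + (- pi * (norm y)\<^sup>2 + 2 * pi * (fst z \<bullet> y))"
    unfolding N by (simp add: algebra_simps)
  hence E2: "complex_of_real (- pi * (norm (y - fst z))\<^sup>2) =
      of_real (- pi * (norm (fst z))\<^sup>2) + (of_real (- pi * (norm y)\<^sup>2) + of_real (2 * pi * (fst z \<bullet> y)))"
    by (simp only: of_real_add)
  have "cnj (gauss_window (y - fst z)) * exp (- \<i> * complex_of_real (y \<bullet> snd z)) =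
     a * exp (of_real (- pi * (norm (y - fst z))\<^sup>2) + - \<i> * complex_of_real (y \<bullet> snd z))"
    unfolding gauss_window_def complex_cnj_complex_of_real exp_add a_def of_real_exp[symmetric] of_real_mult[symmetric]
    by (simp only: of_real_mult mult.assoc)
  also have "of_real (- pi * (norm (y - fst z))\<^sup>2) + - \<i> * complex_of_real (y \<bullet> snd z) =
     of_real (- pi * (norm (fst z))\<^sup>2) + (of_real (- pi * (norm y)\<^sup>2) + cdot (zpoint z) y)"
    by (simp only: E2 cd add.assoc)
  also have "a * exp \<dots> = of_real (2 powr (real CARD('n) / 4) * exp (- pi * (norm (fst z))\<^sup>2)) * gexp (zpoint z) y"
    by (simp only: of_real_mult of_real_exp exp_add a_def gexp_def mult.assoc)
  finally show ?thesis .
qed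

lemma stft_gauss:
  fixes h :: "(real ^ 'n::finite \<Rightarrow> complex) \<Rightarrow> complex"
  assumes "h \<in> tempered"
  shows "stft gauss_window h x \<xi> = bfactor (x, \<xi>) * bargmann h (zpoint (x, \<xi>))"
proof -
  have "stft gauss_window h x \<xi> = h (\<lambda>y. of_real (2 powr (real CARD('n) / 4) * exp (- pi * (norm x)\<^sup>2)) * gexp (zpoint (x, \<xi>)) y)"
    unfolding stft_def using window_shift[of _ "(x, \<xi>)"] by simp
  also have "\<dots> = of_real (2 powr (real CARD('n) / 4) * exp (- pi * (norm x)\<^sup>2)) * h (gexp (zpoint (x, \<xi>)))"
    using tempered_cmult[OF assms gmono_schwartz[of "[]"]] by (simp add: gmono_Nil)
  also have "\<dots> = bfactor (x, \<xi>) * bargmann h (zpoint (x, \<xi>))"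
    by (simp add: bfactor_def bargmann_def exp_minus)
  finally show ?thesis .
qed

lemma csq_continuous: "continuous_on UNIV csq"
  unfolding csq_def[abs_def] by (intro continuous_intros)

lemma zpoint_continuous: "continuous_on UNIV zpoint"
  unfolding zpoint_def[abs_def] by (intro continuous_intros)

lemma bargmann_continuous:
  assumes "h \<in> tempered" shows "continuous_on UNIV (bargmann h)"
  unfolding bargmann_def[abs_def]
  using tempered_gmono_continuous[OF assms, of "[]"] csq_continuous
  by (auto simp: gmono_Nil intro!: continuous_intros)

lemma bfactor_continuous: "continuous_on UNIV bfactor"
  unfolding bfactor_def[abs_def]
  by (intro continuous_intros continuous_on_compose2[OF csq_continuous zpoint_continuous]) auto

lemma csq_scale: "csq (c *s \<zeta>) = c\<^sup>2 * csq \<zeta>"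
  by (simp add: csq_def power_mult_distrib sum_distrib_left)

lemma csq_add: "csq (\<eta> + \<zeta>) = csq \<eta> + 2 * (\<Sum>i\<in>UNIV. \<eta> $ i * \<zeta> $ i) + csq \<zeta>"
  by (simp add: csq_def power2_sum sum.distrib sum_distrib_left mult.assoc)

lemma bargmann_holomorphic:
  assumes "h \<in> tempered"
  shows "(\<lambda>\<tau>. bargmann h (\<eta> + \<tau> *s \<zeta>)) holomorphic_on UNIV"
proof -
  have "(\<lambda>\<tau>. h (gexp (\<eta> + \<tau> *s \<zeta>))) holomorphic_on UNIV"
    using tempered_gmono_derivative[OF assms, of "[]" \<eta> \<zeta>]
    by (auto simp: gmono_Nil holomorphic_on_open)
  thus ?thesis unfolding bargmann_def csq_add csq_scale by (auto intro!: holomorphic_intros)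
qed

text \<open>The \<open>k\<close>-th homogeneous component of the Bargmann transform depends on the distribution through
  finitely many values at monomial multiples of the standard Gaussian.\<close>

definition zmono :: "'n list \<Rightarrow> complex ^ 'n::finite \<Rightarrow> complex" where
  "zmono is \<zeta> = prod_list (map (($) \<zeta>) is)"

text \<open>The shape of the terms that occur in the derivatives of \<open>\<tau> \<mapsto> bargmann h (\<tau> *s \<zeta>)\<close>. Derivatives of terms are sums of
  terms, and the terms with \<open>l > 0\<close> vanish at \<open>\<tau> = 0\<close>.\<close>

definition bterm :: "((real ^ 'n::finite \<Rightarrow> complex) \<Rightarrow> complex) \<Rightarrow> complex ^ 'n \<Rightarrow> complex \<Rightarrow>
    complex \<times> 'n list \<times> 'n list \<times> nat \<Rightarrow> complex" where
  "bterm h \<zeta> \<tau> = (\<lambda>(c, is, js, l). c * zmono is \<zeta> * \<tau> ^ l *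
     (exp (- (\<tau>\<^sup>2 * csq \<zeta>) / of_real (8 * pi)) * h (gmono js (\<tau> *s \<zeta>))))"

lemma bterm_derivative:
  fixes t :: "complex \<times> 'n::finite list \<times> 'n list \<times> nat"
  shows "\<exists>L. \<forall>h\<in>tempered. \<forall>\<zeta> \<tau>. ((\<lambda>\<tau>. bterm h \<zeta> \<tau> t) has_field_derivative (\<Sum>s\<leftarrow>L. bterm h \<zeta> \<tau> s)) (at \<tau>)"
proof -
  obtain c "is" js l where t: "t = (c, is, js, l)" by (cases t) auto
  obtain xs :: "'n list" where xs: "distinct xs" "set xs = UNIV"
    using finite_distinct_list[of "UNIV :: 'n set"] by auto
  have S: "(\<Sum>i\<leftarrow>xs. F i) = (\<Sum>i\<in>UNIV. F i)" for F :: "'n \<Rightarrow> complex"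
    using xs by (simp add: sum_list_distinct_conv_sum_set)
  define L where "L = (of_nat l * c, is, js, l - 1) #
     map (\<lambda>i. (- c / of_real (4 * pi), i # i # is, js, Suc l)) xs @ map (\<lambda>i. (c, i # is, i # js, l)) xs"
  have "((\<lambda>\<tau>. bterm h \<zeta> \<tau> t) has_field_derivative (\<Sum>s\<leftarrow>L. bterm h \<zeta> \<tau> s)) (at \<tau>)"
    if h: "h \<in> tempered" for h \<zeta> \<tau>
  proof -
    define E where "E = exp (- (\<tau>\<^sup>2 * csq \<zeta>) / of_real (8 * pi))"
    define H where "H = h (gmono js (\<tau> *s \<zeta>))"
    define D where "D = (\<Sum>i\<in>UNIV. \<zeta> $ i * h (gmono (i # js) (\<tau> *s \<zeta>)))"
    have HD: "((\<lambda>\<tau>. h (gmono js (\<tau> *s \<zeta>))) has_field_derivative D) (at \<tau>)"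
      using tempered_gmono_derivative[OF h, of js 0 \<zeta> \<tau>] by (simp add: D_def)
    have ED: "((\<lambda>\<tau>. exp (- (\<tau>\<^sup>2 * csq \<zeta>) / of_real (8 * pi))) has_field_derivative E * (- (2 * \<tau> * csq \<zeta>) / of_real (8 * pi))) (at \<tau>)"
      unfolding E_def by (rule derivative_eq_intros refl | simp)+
    have PD: "((\<lambda>\<tau>. c * zmono is \<zeta> * \<tau> ^ l) has_field_derivative c * zmono is \<zeta> * (of_nat l * \<tau> ^ (l - 1))) (at \<tau>)"
      by (rule derivative_eq_intros refl | simp)+
    have "((\<lambda>\<tau>. bterm h \<zeta> \<tau> t) has_field_derivative
       c * zmono is \<zeta> * (of_nat l * \<tau> ^ (l - 1)) * (E * H) +
       c * zmono is \<zeta> * \<tau> ^ l * (E * (- (2 * \<tau> * csq \<zeta>) / of_real (8 * pi)) * H + E * D)) (at \<tau>)"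
      unfolding t bterm_def prod.case
      using DERIV_mult[OF PD DERIV_mult[OF ED HD]] by (simp add: E_def H_def mult_ac add_ac)
    also have "c * zmono is \<zeta> * (of_nat l * \<tau> ^ (l - 1)) * (E * H) +
       c * zmono is \<zeta> * \<tau> ^ l * (E * (- (2 * \<tau> * csq \<zeta>) / of_real (8 * pi)) * H + E * D) =
       (\<Sum>s\<leftarrow>L. bterm h \<zeta> \<tau> s)"
    proof -
      have "(\<Sum>i\<leftarrow>xs. bterm h \<zeta> \<tau> (- c / of_real (4 * pi), i # i # is, js, Suc l)) =
         c * zmono is \<zeta> * \<tau> ^ l * (E * (- (2 * \<tau> * csq \<zeta>) / of_real (8 * pi)) * H)"
        unfolding S by (simp add: bterm_def zmono_def csq_def sum_distrib_left sum_distrib_right E_def H_def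
            power2_eq_square sum_negf[symmetric] sum_divide_distrib mult_ac del: sum_negf)
      moreover have "(\<Sum>i\<leftarrow>xs. bterm h \<zeta> \<tau> (c, i # is, i # js, l)) = c * zmono is \<zeta> * \<tau> ^ l * (E * D)"
        unfolding S by (simp add: bterm_def zmono_def D_def sum_distrib_left sum_distrib_right E_def mult_ac)
      moreover have "bterm h \<zeta> \<tau> (of_nat l * c, is, js, l - 1) = c * zmono is \<zeta> * (of_nat l * \<tau> ^ (l - 1)) * (E * H)"
        by (simp add: bterm_def E_def H_def mult_ac)
      ultimately show ?thesis by (simp add: L_def o_def algebra_simps)
    qed
    finally show ?thesis .
  qed
  thus ?thesis by blast
qed

lemma bterm_sum_derivative:
  fixes L :: "(complex \<times> 'n::finite list \<times> 'n list \<times> nat) list"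
  shows "\<exists>L'. \<forall>h\<in>tempered. \<forall>\<zeta> \<tau>.
    ((\<lambda>\<tau>. \<Sum>t\<leftarrow>L. bterm h \<zeta> \<tau> t) has_field_derivative (\<Sum>s\<leftarrow>L'. bterm h \<zeta> \<tau> s)) (at \<tau>)"
proof (induction L)
  case Nil
  show ?case by (intro exI[of _ "[]"]) simp
next
  case (Cons t L)
  then obtain L' where L': "\<And>h \<zeta> \<tau>. h \<in> tempered \<Longrightarrow>
    ((\<lambda>\<tau>. \<Sum>t\<leftarrow>L. bterm h \<zeta> \<tau> t) has_field_derivative (\<Sum>s\<leftarrow>L'. bterm h \<zeta> \<tau> s)) (at \<tau>)" by blast
  obtain M where M: "\<And>h \<zeta> \<tau>. h \<in> tempered \<Longrightarrow>
    ((\<lambda>\<tau>. bterm h \<zeta> \<tau> t) has_field_derivative (\<Sum>s\<leftarrow>M. bterm h \<zeta> \<tau> s)) (at \<tau>)"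
    using bterm_derivative[of t] by blast
  show ?case using DERIV_add[OF M L'] by (intro exI[of _ "M @ L'"]) simp
qed

lemma bargmann_taylor_coefficient:
  "\<exists>L :: (complex \<times> 'n::finite list \<times> 'n list) list. \<forall>h\<in>tempered. \<forall>\<zeta>.
     (deriv ^^ k) (\<lambda>\<tau>. bargmann h (\<tau> *s \<zeta>)) 0 = (\<Sum>(c, is, js)\<leftarrow>L. c * zmono is \<zeta> * h (gmono js 0))"
proof -
  have "\<exists>L :: (complex \<times> 'n list \<times> 'n list \<times> nat) list. \<forall>h\<in>tempered. \<forall>\<zeta>.
     (deriv ^^ k) (\<lambda>\<tau>. bargmann h (\<tau> *s \<zeta>)) = (\<lambda>\<tau>. \<Sum>t\<leftarrow>L. bterm h \<zeta> \<tau> t)"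
  proof (induction k)
    case 0
    show ?case by (intro exI[of _ "[(1, [], [], 0)]"])
      (simp add: bterm_def bargmann_def zmono_def csq_scale gmono_Nil fun_eq_iff)
  next
    case (Suc k)
    then obtain L :: "(complex \<times> 'n list \<times> 'n list \<times> nat) list" where
      L: "\<And>h \<zeta>. h \<in> tempered \<Longrightarrow> (deriv ^^ k) (\<lambda>\<tau>. bargmann h (\<tau> *s \<zeta>)) = (\<lambda>\<tau>. \<Sum>t\<leftarrow>L. bterm h \<zeta> \<tau> t)"
      by blast
    obtain L' where L': "\<And>h \<zeta> \<tau>. h \<in> tempered \<Longrightarrow>
      ((\<lambda>\<tau>. \<Sum>t\<leftarrow>L. bterm h \<zeta> \<tau> t) has_field_derivative (\<Sum>s\<leftarrow>L'. bterm h \<zeta> \<tau> s)) (at \<tau>)"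
      using bterm_sum_derivative[of L] by blast
    show ?case by (intro exI[of _ L']) (simp add: L fun_eq_iff DERIV_imp_deriv[OF L'])
  qed
  then obtain L :: "(complex \<times> 'n list \<times> 'n list \<times> nat) list" where
    L: "\<And>h \<zeta>. h \<in> tempered \<Longrightarrow> (deriv ^^ k) (\<lambda>\<tau>. bargmann h (\<tau> *s \<zeta>)) = (\<lambda>\<tau>. \<Sum>t\<leftarrow>L. bterm h \<zeta> \<tau> t)"
    by blast
  show ?thesis
    by (intro exI[of _ "map (\<lambda>(c, is, js, l). (c * 0 ^ l, is, js)) L"] ballI allI)
       (auto simp: L bterm_def o_def case_prod_unfold mult_ac intro!: arg_cong[where f = sum_list] map_cong)
qed


section \<open>A sub-mean value property\<close>

lemma entire_mean_value_bound:
  assumes "f holomorphic_on UNIV"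
  shows "ennreal (cmod (f 0)) \<le>
    (\<integral>\<^sup>+t. indicator {0..1} t * ennreal (cmod (f (exp (2 * of_real pi * \<i> * of_real t)))) \<partial>lborel)"
proof -
  let ?e = "\<lambda>t::real. exp (2 * of_real pi * \<i> * of_real t)"
  have hf: "f holomorphic_on cball 0 1" using assms holomorphic_on_subset by blast
  have "((\<lambda>u. f u / (u - 0)) has_contour_integral 2 * of_real pi * \<i> * f 0) (circlepath 0 1)"
    by (rule Cauchy_integral_circlepath_simple[OF hf]) simp
  hence "((\<lambda>t. f (?e t) / ?e t * (2 * of_real pi * \<i> * ?e t)) has_integral 2 * of_real pi * \<i> * f 0) {0..1}"
    unfolding has_contour_integral_def
    by (rule has_integral_eq[rotated], simp add: vector_derivative_circlepath01, simp add: circlepath mult_ac)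
  hence "((\<lambda>t. (1 / (2 * of_real pi * \<i>)) * (f (?e t) / ?e t * (2 * of_real pi * \<i> * ?e t))) has_integral
      (1 / (2 * of_real pi * \<i>)) * (2 * of_real pi * \<i> * f 0)) {0..1}"
    by (rule has_integral_mult_right)
  hence I: "((\<lambda>t. f (?e t)) has_integral f 0) {0..1}" by simp
  have "continuous_on UNIV f" by (rule holomorphic_on_imp_continuous_on[OF assms])
  hence c: "continuous_on {0..1} (\<lambda>t. f (?e t))"
    by (rule continuous_on_compose2) (auto intro!: continuous_intros)
  have int: "set_integrable lborel {0..1} (\<lambda>t. f (?e t))"
    by (rule borel_integrable_compact[OF compact_Icc c, folded set_integrable_def])
  have "(LINT t:{0..1}|lborel. f (?e t)) = f 0"
    using set_borel_integral_eq_integral(2)[OF int] I by (simp add: integral_unique)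
  hence "ennreal (cmod (f 0)) = ennreal (norm (LINT t|lborel. indicator {0..1} t *\<^sub>R f (?e t)))"
    by (simp add: set_lebesgue_integral_def)
  also have "\<dots> \<le> (\<integral>\<^sup>+t. ennreal (norm (indicator {0..1} t *\<^sub>R f (?e t))) \<partial>lborel)"
    using int unfolding set_integrable_def by (rule integral_norm_bound_ennreal)
  also have "\<dots> = (\<integral>\<^sup>+t. indicator {0..1} t * ennreal (cmod (f (?e t))) \<partial>lborel)"
    by (intro nn_integral_cong) (auto simp: indicator_def)
  finally show ?thesis .
qed

lemma nn_integral_lborel_shift:
  fixes f :: "'a::euclidean_space \<Rightarrow> ennreal"
  assumes [measurable]: "f \<in> borel_measurable borel"
  shows "(\<integral>\<^sup>+x. f (x + c) \<partial>lborel) = (\<integral>\<^sup>+x. f x \<partial>lborel)"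
  by (subst (2) lborel_distr_plus[of c, symmetric]) (simp add: nn_integral_distr add.commute)

lemma nn_integral_lborel_prod_fst:
  fixes F :: "'a::euclidean_space \<times> 'b::euclidean_space \<Rightarrow> ennreal"
  assumes [measurable]: "F \<in> borel_measurable borel"
  shows "(\<integral>\<^sup>+z. F z \<partial>lborel) = (\<integral>\<^sup>+x. \<integral>\<^sup>+y. F (x, y) \<partial>lborel \<partial>lborel)"
    and "(\<integral>\<^sup>+z. F z \<partial>lborel) = (\<integral>\<^sup>+y. \<integral>\<^sup>+x. F (x, y) \<partial>lborel \<partial>lborel)"
   apply (subst lborel_prod[symmetric], subst lborel.nn_integral_fst[symmetric]; simp add: lborel_prod)
  apply (subst lborel_prod[symmetric], subst lborel_pair.nn_integral_snd[symmetric]; simp add: lborel_prod)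
  done

lemma measurable_compose_continuous:
  assumes "F \<in> borel_measurable borel" "continuous_on UNIV g"
  shows "(\<lambda>z. F (g z)) \<in> borel_measurable borel"
  using measurable_compose[OF borel_measurable_continuous_onI[OF assms(2)] assms(1)] .

text \<open>A rotation of the plane of \<open>x\<close> and \<open>\<xi>\<close> is a product of three shears, and a shear preserves the integral by
  Tonelli's theorem and translation invariance.\<close>

lemma nn_integral_shear:
  fixes F :: "'a::euclidean_space \<times> 'a \<Rightarrow> ennreal"
  assumes [measurable]: "F \<in> borel_measurable borel"
  shows "(\<integral>\<^sup>+z. F (fst z + c *\<^sub>R snd z, snd z) \<partial>lborel) = (\<integral>\<^sup>+z. F z \<partial>lborel)"
    and "(\<integral>\<^sup>+z. F (fst z, snd z + c *\<^sub>R fst z) \<partial>lborel) = (\<integral>\<^sup>+z. F z \<partial>lborel)"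
proof -
  have [measurable]: "(\<lambda>z. F (fst z + c *\<^sub>R snd z, snd z)) \<in> borel_measurable borel"
    "(\<lambda>z. F (fst z, snd z + c *\<^sub>R fst z)) \<in> borel_measurable borel"
    by (intro measurable_compose_continuous[OF assms] continuous_intros)+
  have "(\<integral>\<^sup>+z. F (fst z + c *\<^sub>R snd z, snd z) \<partial>lborel) = (\<integral>\<^sup>+y. \<integral>\<^sup>+x. F (x + c *\<^sub>R y, y) \<partial>lborel \<partial>lborel)"
    by (subst nn_integral_lborel_prod_fst(2)) auto
  also have "\<dots> = (\<integral>\<^sup>+y. \<integral>\<^sup>+x. F (x, y) \<partial>lborel \<partial>lborel)"
    by (intro nn_integral_cong nn_integral_lborel_shift) measurable
  finally show "(\<integral>\<^sup>+z. F (fst z + c *\<^sub>R snd z, snd z) \<partial>lborel) = (\<integral>\<^sup>+z. F z \<partial>lborel)"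
    by (simp add: nn_integral_lborel_prod_fst(2))
  have "(\<integral>\<^sup>+z. F (fst z, snd z + c *\<^sub>R fst z) \<partial>lborel) = (\<integral>\<^sup>+x. \<integral>\<^sup>+y. F (x, y + c *\<^sub>R x) \<partial>lborel \<partial>lborel)"
    by (subst nn_integral_lborel_prod_fst(1)) auto
  also have "\<dots> = (\<integral>\<^sup>+x. \<integral>\<^sup>+y. F (x, y) \<partial>lborel \<partial>lborel)"
    by (intro nn_integral_cong nn_integral_lborel_shift) measurable
  finally show "(\<integral>\<^sup>+z. F (fst z, snd z + c *\<^sub>R fst z) \<partial>lborel) = (\<integral>\<^sup>+z. F z \<partial>lborel)"
    by (simp add: nn_integral_lborel_prod_fst(1))
qed

text \<open>Multiplication of \<open>zpoint z\<close> by a complex number of modulus 1. As \<open>zpoint\<close> stretches \<open>x\<close> by \<open>2 \<pi>\<close>, this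
  is a rotation only after rescaling.\<close>

definition zrotate :: "real \<Rightarrow> 'a::real_vector \<times> 'a \<Rightarrow> 'a \<times> 'a" where
  "zrotate \<theta> z = (cos \<theta> *\<^sub>R fst z + (sin \<theta> / (2 * pi)) *\<^sub>R snd z, cos \<theta> *\<^sub>R snd z - (2 * pi * sin \<theta>) *\<^sub>R fst z)"

lemma zpoint_zrotate: "zpoint (zrotate \<theta> z) = cis \<theta> *s zpoint z"
  by (simp add: zpoint_def zrotate_def vec_eq_iff complex_eq_iff field_simps)

lemma nn_integral_zrotate:
  fixes F :: "'a::euclidean_space \<times> 'a \<Rightarrow> ennreal"
  assumes [measurable]: "F \<in> borel_measurable borel" and s: "sin \<theta> \<noteq> 0"
  shows "(\<integral>\<^sup>+z. F (zrotate \<theta> z) \<partial>lborel) = (\<integral>\<^sup>+z. F z \<partial>lborel)"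
proof -
  define \<alpha> where "\<alpha> = (1 - cos \<theta>) / (2 * pi * sin \<theta>)"
  define \<beta> where "\<beta> = - (2 * pi * sin \<theta>)"
  have ab: "1 + \<alpha> * \<beta> = cos \<theta>" using s by (simp add: \<alpha>_def \<beta>_def)
  have "(1 - cos \<theta>) * (1 + cos \<theta>) = sin \<theta> * sin \<theta>"
    using sin_cos_squared_add[of \<theta>] by (simp add: algebra_simps power2_eq_square)
  moreover have "\<alpha> * (1 + cos \<theta>) = (1 - cos \<theta>) * (1 + cos \<theta>) / (2 * pi * sin \<theta>)" by (simp add: \<alpha>_def)
  ultimately have "\<alpha> * (1 + cos \<theta>) = sin \<theta> / (2 * pi)" using s by simp
  hence ac: "\<alpha> + \<alpha> * cos \<theta> = sin \<theta> / (2 * pi)" by (simp add: distrib_left)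
  define S where "S = (\<lambda>c (z::'a \<times> 'a). (fst z + c *\<^sub>R snd z, snd z))"
  define U where "U = (\<lambda>c (z::'a \<times> 'a). (fst z, snd z + c *\<^sub>R fst z))"
  have [measurable]: "S c \<in> borel \<rightarrow>\<^sub>M borel" "U c \<in> borel \<rightarrow>\<^sub>M borel" for c
    unfolding S_def U_def by (intro borel_measurable_continuous_onI continuous_intros)+
  have SI: "(\<integral>\<^sup>+z. H (S c z) \<partial>lborel) = (\<integral>\<^sup>+z. H z \<partial>lborel)"
    and UI: "(\<integral>\<^sup>+z. H (U c z) \<partial>lborel) = (\<integral>\<^sup>+z. H z \<partial>lborel)"
    if "H \<in> borel_measurable borel" for H c
    unfolding S_def U_def by (rule nn_integral_shear[OF that])+
  have "zrotate \<theta> z = S \<alpha> (U \<beta> (S \<alpha> z))" for z :: "'a \<times> 'a"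
  proof (rule prod_eqI)
    have "snd (S \<alpha> (U \<beta> (S \<alpha> z))) = \<beta> *\<^sub>R fst z + (1 + \<alpha> * \<beta>) *\<^sub>R snd z"
      by (simp add: S_def U_def algebra_simps)
    thus "snd (zrotate \<theta> z) = snd (S \<alpha> (U \<beta> (S \<alpha> z)))" by (simp only: ab zrotate_def snd_conv) (simp add: \<beta>_def)
    have "fst (S \<alpha> (U \<beta> (S \<alpha> z))) = (1 + \<alpha> * \<beta>) *\<^sub>R fst z + (\<alpha> *\<^sub>R snd z + (\<alpha> * (1 + \<alpha> * \<beta>)) *\<^sub>R snd z)"
      by (simp add: S_def U_def algebra_simps)
    thus "fst (zrotate \<theta> z) = fst (S \<alpha> (U \<beta> (S \<alpha> z)))"
      by (simp add: ab zrotate_def ac[symmetric] scaleR_add_left)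
  qed
  hence "(\<integral>\<^sup>+z. F (zrotate \<theta> z) \<partial>lborel) = (\<integral>\<^sup>+z. F (S \<alpha> (U \<beta> (S \<alpha> z))) \<partial>lborel)" by simp
  also have "\<dots> = (\<integral>\<^sup>+z. F (S \<alpha> (U \<beta> z)) \<partial>lborel)" by (rule SI) measurable
  also have "\<dots> = (\<integral>\<^sup>+z. F (S \<alpha> z) \<partial>lborel)" by (rule UI) measurable
  also have "\<dots> = (\<integral>\<^sup>+z. F z \<partial>lborel)" by (rule SI) measurable
  finally show ?thesis .
qed

definition zdisc :: "((real ^ 'n) \<times> (real ^ 'n::finite)) set" where
  "zdisc = {z. norm (zpoint z) \<le> 1}"

lemma zdisc_measurable [measurable]: "zdisc \<in> sets borel"
  unfolding zdisc_def
  by (intro borel_closed closed_Collect_le continuous_intros zpoint_continuous)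

text \<open>The mean value inequality on every circle through \<open>\<zeta>\<close> around 0, averaged over the rotation invariant set.\<close>

lemma entire_zdisc_mean_value_bound:
  fixes G :: "complex ^ 'n::finite \<Rightarrow> complex"
  assumes hol: "\<And>\<zeta>. (\<lambda>\<tau>. G (\<tau> *s \<zeta>)) holomorphic_on UNIV" and cont: "continuous_on UNIV G"
  shows "ennreal (cmod (G 0)) * emeasure lborel (zdisc :: ((real ^ 'n) \<times> (real ^ 'n)) set) \<le>
     (\<integral>\<^sup>+z. indicator zdisc z * ennreal (cmod (G (zpoint z))) \<partial>lborel)"
proof -
  let ?D = "zdisc :: ((real ^ 'n) \<times> (real ^ 'n)) set"
  let ?F = "\<lambda>z. indicator ?D z * ennreal (cmod (G (zpoint z)))"
  have [measurable]: "(\<lambda>z. G (zpoint z)) \<in> borel_measurable borel"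
    by (intro borel_measurable_continuous_onI continuous_on_compose2[OF cont zpoint_continuous]) auto
  have F[measurable]: "?F \<in> borel_measurable borel" by measurable
  have zr: "(\<lambda>p. zrotate (2 * pi * snd p) (fst p)) \<in> borel_measurable (borel :: (((real ^ 'n) \<times> (real ^ 'n)) \<times> real) measure)"
    unfolding zrotate_def by (intro borel_measurable_continuous_onI continuous_intros) auto
  have [measurable]: "(\<lambda>(z, t). ?F (zrotate (2 * pi * t) z)) \<in> borel_measurable (lborel \<Otimes>\<^sub>M lborel)"
    using measurable_compose[OF zr F] by (simp add: case_prod_unfold lborel_prod)
  have e: "exp (2 * of_real pi * \<i> * of_real t) = cis (2 * pi * t)" for t
    by (simp add: cis_conv_exp mult_ac)
  have inv: "indicator ?D (zrotate \<theta> z) = (indicator ?D z :: ennreal)" for \<theta> z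
    by (simp add: zdisc_def indicator_def zpoint_zrotate norm_vector_scalar_mult)
  have "ennreal (cmod (G 0)) * emeasure lborel ?D = (\<integral>\<^sup>+z. indicator ?D z * ennreal (cmod (G 0)) \<partial>lborel)"
    by (subst nn_integral_multc) (auto simp: mult.commute)
  also have "\<dots> \<le> (\<integral>\<^sup>+z. \<integral>\<^sup>+t. indicator {0..1} t * ?F (zrotate (2 * pi * t) z) \<partial>lborel \<partial>lborel)"
  proof (rule nn_integral_mono)
    fix z :: "(real ^ 'n) \<times> (real ^ 'n)"
    have "ennreal (cmod (G 0)) \<le> (\<integral>\<^sup>+t. indicator {0..1} t * ennreal (cmod (G (zpoint (zrotate (2 * pi * t) z)))) \<partial>lborel)"
      using entire_mean_value_bound[OF hol[of "zpoint z"]] by (simp add: e zpoint_zrotate)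
    thus "indicator ?D z * ennreal (cmod (G 0)) \<le> (\<integral>\<^sup>+t. indicator {0..1} t * ?F (zrotate (2 * pi * t) z) \<partial>lborel)"
      by (cases "z \<in> ?D") (auto simp: inv)
  qed
  also have "\<dots> = (\<integral>\<^sup>+t. \<integral>\<^sup>+z. indicator {0..1} t * ?F (zrotate (2 * pi * t) z) \<partial>lborel \<partial>lborel)"
    by (rule lborel_pair.Fubini'[symmetric]) measurable
  also have "\<dots> = (\<integral>\<^sup>+t. indicator {0..1::real} t * (\<integral>\<^sup>+z. ?F z \<partial>lborel) \<partial>lborel)"
  proof (rule nn_integral_cong_AE)
    have "AE t in lborel. t \<notin> {0, 1/2, 1::real}"
      by (rule AE_not_in, rule finite_imp_null_set_lborel) simp
    thus "AE t in lborel. (\<integral>\<^sup>+z. indicator {0..1} t * ?F (zrotate (2 * pi * t) z) \<partial>lborel) =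
        indicator {0..1} t * (\<integral>\<^sup>+z. ?F z \<partial>lborel)"
    proof eventually_elim
      case (elim t)
      show ?case
      proof (cases "t \<in> {0..1}")
        case True
        have "sin (2 * pi * t) \<noteq> 0"
        proof
          assume "sin (2 * pi * t) = 0"
          then obtain i :: int where i: "2 * pi * t = of_int i * pi" by (auto simp: sin_zero_iff_int2)
          hence "2 * t = of_int i" by simp
          moreover from this True have "0 \<le> i" "i \<le> 2" by auto
          hence "i = 0 \<or> i = 1 \<or> i = 2" by auto
          ultimately show False using elim by auto
        qed
        from nn_integral_zrotate[OF F this] True show ?thesis by simp
      qed simp
    qed
  qed
  also have "\<dots> = (\<integral>\<^sup>+z. ?F z \<partial>lborel)" by (subst nn_integral_multc) auto
  finally show ?thesis .
qed

lemma norm_zpoint_bounds: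
  "norm (zpoint z) \<le> 2 * pi * norm z" "norm (fst z) \<le> norm (zpoint z)" "norm (snd z) \<le> norm (zpoint z)" "norm z \<le> norm (zpoint z)"
proof -
  have p: "1 \<le> 4 * pi\<^sup>2" using power_mono[of 2 pi 2] pi_ge_two by simp
  have n: "(norm z)\<^sup>2 = (norm (fst z))\<^sup>2 + (norm (snd z))\<^sup>2" by (cases z) (simp add: norm_Pair)
  have a: "(norm (fst z))\<^sup>2 \<le> 4 * pi\<^sup>2 * (norm (fst z))\<^sup>2" using mult_right_mono[OF p, of "(norm (fst z))\<^sup>2"] by simp
  have b: "(norm (snd z))\<^sup>2 \<le> 4 * pi\<^sup>2 * (norm (snd z))\<^sup>2" using mult_right_mono[OF p, of "(norm (snd z))\<^sup>2"] by simp
  have "(norm (zpoint z))\<^sup>2 \<le> (2 * pi * norm z)\<^sup>2"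
    unfolding norm_zpoint power_mult_distrib n using b by (simp add: algebra_simps)
  thus "norm (zpoint z) \<le> 2 * pi * norm z" by (rule power2_le_imp_le) simp
  have "(norm (fst z))\<^sup>2 \<le> (norm (zpoint z))\<^sup>2" unfolding norm_zpoint using a zero_le_power2[of "norm (snd z)"] by linarith
  thus "norm (fst z) \<le> norm (zpoint z)" by (rule power2_le_imp_le) simp
  have "(norm (snd z))\<^sup>2 \<le> (norm (zpoint z))\<^sup>2" unfolding norm_zpoint by simp
  thus "norm (snd z) \<le> norm (zpoint z)" by (rule power2_le_imp_le) simp
  have "(norm z)\<^sup>2 \<le> (norm (zpoint z))\<^sup>2" unfolding norm_zpoint n using a by simp
  thus "norm z \<le> norm (zpoint z)" by (rule power2_le_imp_le) simp
qed

lemma emeasure_zdisc: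
  "0 < emeasure lborel (zdisc :: ((real ^ 'n) \<times> (real ^ 'n::finite)) set)"
  "emeasure lborel (zdisc :: ((real ^ 'n) \<times> (real ^ 'n::finite)) set) < \<infinity>"
proof -
  have sub: "cball (0::(real ^ 'n) \<times> (real ^ 'n)) (1 / (2 * pi)) \<subseteq> zdisc"
  proof
    fix z :: "(real ^ 'n) \<times> (real ^ 'n)" assume "z \<in> cball 0 (1 / (2 * pi))"
    hence "2 * pi * norm z \<le> 1" by (simp add: field_simps)
    thus "z \<in> zdisc" using norm_zpoint_bounds(1)[of z] by (simp add: zdisc_def)
  qed
  have "0 < emeasure lborel (cball (0::(real ^ 'n) \<times> (real ^ 'n)) (1 / (2 * pi)))"
    using content_cball_pos[of "1 / (2 * pi)" "0::(real ^ 'n) \<times> (real ^ 'n)"]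
    using emeasure_lborel_cball_finite[of "0::(real ^ 'n) \<times> (real ^ 'n)" "1 / (2 * pi)"]
    by (subst emeasure_eq_ennreal_measure) auto
  also have "\<dots> \<le> emeasure lborel (zdisc :: ((real ^ 'n) \<times> (real ^ 'n)) set)"
    by (intro emeasure_mono sub) simp
  finally show "0 < emeasure lborel (zdisc :: ((real ^ 'n) \<times> (real ^ 'n)) set)" .
  have "(zdisc :: ((real ^ 'n) \<times> (real ^ 'n)) set) \<subseteq> cball 0 1"
  proof
    fix z :: "(real ^ 'n) \<times> (real ^ 'n)" assume "z \<in> zdisc"
    thus "z \<in> cball 0 1" using norm_zpoint_bounds(4)[of z] by (simp add: zdisc_def)
  qed
  hence "bounded (zdisc :: ((real ^ 'n) \<times> (real ^ 'n)) set)" using bounded_subset[OF bounded_cball] by blast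
  thus "emeasure lborel (zdisc :: ((real ^ 'n) \<times> (real ^ 'n)) set) < \<infinity>"
    by (rule emeasure_bounded_finite)
qed

lemma norm_add_complex_vec:
  fixes \<eta> \<zeta> :: "complex ^ 'n::finite"
  shows "(norm (\<eta> + \<zeta>))\<^sup>2 = (norm \<eta>)\<^sup>2 + 2 * Re (\<Sum>i\<in>UNIV. \<zeta> $ i * cnj (\<eta> $ i)) + (norm \<zeta>)\<^sup>2"
proof -
  have "\<zeta> \<bullet> \<eta> = Re (\<Sum>i\<in>UNIV. \<zeta> $ i * cnj (\<eta> $ i))"
    by (simp add: inner_vec_def inner_complex_def)
  thus ?thesis by (simp add: power2_norm_eq_inner inner_add_left inner_add_right inner_commute)
qed

abbreviation gstft :: "((real ^ 'n::finite \<Rightarrow> complex) \<Rightarrow> complex) \<Rightarrow> (real ^ 'n) \<times> (real ^ 'n) \<Rightarrow> complex" where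
  "gstft h z \<equiv> stft gauss_window h (fst z) (snd z)"

lemma norm_gstft:
  fixes h :: "(real ^ 'n::finite \<Rightarrow> complex) \<Rightarrow> complex"
  assumes "h \<in> tempered"
  shows "cmod (gstft h z) = 2 powr (real CARD('n) / 4) * exp (- (norm (zpoint z))\<^sup>2 / (8 * pi)) * cmod (bargmann h (zpoint z))"
  using stft_gauss[OF assms, of "fst z" "snd z"] by (simp add: norm_mult norm_bfactor)

lemma gstft_continuous:
  assumes "h \<in> tempered" shows "continuous_on UNIV (gstft h)"
proof -
  have "continuous_on UNIV (\<lambda>z. bfactor z * bargmann h (zpoint z))"
    by (intro continuous_intros bfactor_continuous continuous_on_compose2[OF bargmann_continuous[OF assms] zpoint_continuous]) auto
  thus ?thesis using stft_gauss[OF assms] by simp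
qed

text \<open>After multiplication by \<open>exp (- \<zeta>\<cdot>cnj \<eta> / 4 \<pi>)\<close>, the entire function \<open>\<zeta> \<mapsto> bargmann h (\<eta> + \<zeta>)\<close> has the modulus of the
  short-time Fourier transform near \<open>\<eta>\<close>, up to a factor that is bounded on bounded sets.\<close>

lemma gstft_sub_mean_value:
  fixes h :: "(real ^ 'n::finite \<Rightarrow> complex) \<Rightarrow> complex"
  assumes h: "h \<in> tempered"
  shows "ennreal (cmod (gstft h z0)) * emeasure lborel (zdisc :: ((real ^ 'n) \<times> (real ^ 'n)) set) \<le>
     ennreal (exp (1 / (8 * pi))) * (\<integral>\<^sup>+z. indicator zdisc z * ennreal (cmod (gstft h (z0 + z))) \<partial>lborel)"
proof -
  let ?D = "zdisc :: ((real ^ 'n) \<times> (real ^ 'n)) set"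
  define \<eta> where "\<eta> = zpoint z0"
  define G where "G = (\<lambda>\<zeta>. bargmann h (\<eta> + \<zeta>) * exp (- (\<Sum>i\<in>UNIV. \<zeta> $ i * cnj (\<eta> $ i)) / of_real (4 * pi)))"
  define c where "c = 2 powr (real CARD('n) / 4) * exp (- (norm \<eta>)\<^sup>2 / (8 * pi))"
  have c0: "0 \<le> c" by (simp add: c_def)
  have [measurable]: "(\<lambda>z. cmod (gstft h (z0 + z))) \<in> borel_measurable borel"
    by (intro borel_measurable_continuous_onI continuous_intros continuous_on_compose2[OF gstft_continuous[OF h]]) auto
  have hol: "(\<lambda>\<tau>. G (\<tau> *s \<zeta>)) holomorphic_on UNIV" for \<zeta>
    unfolding G_def using bargmann_holomorphic[OF h, of \<eta> \<zeta>] by (auto intro!: holomorphic_intros)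
  have cont: "continuous_on UNIV G"
    unfolding G_def by (intro continuous_intros continuous_on_compose2[OF bargmann_continuous[OF h]]) auto
  have [measurable]: "(\<lambda>z. cmod (G (zpoint z))) \<in> borel_measurable borel"
    by (intro borel_measurable_continuous_onI continuous_intros continuous_on_compose2[OF cont zpoint_continuous]) auto
  have G: "c * cmod (G (zpoint z)) = exp ((norm (zpoint z))\<^sup>2 / (8 * pi)) * cmod (gstft h (z0 + z))" for z
  proof -
    let ?R = "Re (\<Sum>i\<in>UNIV. zpoint z $ i * cnj (\<eta> $ i))"
    have "cmod (exp (- (\<Sum>i\<in>UNIV. zpoint z $ i * cnj (\<eta> $ i)) / of_real (4 * pi))) = exp (- ?R / (4 * pi))"
      unfolding norm_exp_eq_Re Re_divide_of_real uminus_complex.sel ..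
    hence "c * cmod (G (zpoint z)) = 2 powr (real CARD('n) / 4) * (exp (- (norm \<eta>)\<^sup>2 / (8 * pi)) * exp (- ?R / (4 * pi))) * cmod (bargmann h (\<eta> + zpoint z))"
      by (simp add: G_def c_def norm_mult mult_ac)
    also have "exp (- (norm \<eta>)\<^sup>2 / (8 * pi)) * exp (- ?R / (4 * pi)) =
       exp ((norm (zpoint z))\<^sup>2 / (8 * pi)) * exp (- (norm (\<eta> + zpoint z))\<^sup>2 / (8 * pi))"
      unfolding exp_add[symmetric] norm_add_complex_vec by (simp add: field_simps)
    finally show ?thesis by (simp only: norm_gstft[OF h, of "z0 + z"] zpoint_linear \<eta>_def mult_ac)
  qed
  have "ennreal (cmod (gstft h z0)) * emeasure lborel ?D = ennreal c * (ennreal (cmod (G 0)) * emeasure lborel ?D)"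
  proof -
    have "zpoint (0 :: (real ^ 'n) \<times> (real ^ 'n)) = 0" by (simp add: zpoint_def vec_eq_iff)
    thus ?thesis using G[of 0] c0 by (simp add: ennreal_mult'[symmetric] mult.assoc[symmetric])
  qed
  also have "\<dots> \<le> ennreal c * (\<integral>\<^sup>+z. indicator ?D z * ennreal (cmod (G (zpoint z))) \<partial>lborel)"
    by (intro mult_left_mono entire_zdisc_mean_value_bound hol cont) simp
  also have "\<dots> = (\<integral>\<^sup>+z. indicator ?D z * ennreal (c * cmod (G (zpoint z))) \<partial>lborel)"
    using c0 by (subst nn_integral_cmult[symmetric]) (auto simp: ennreal_mult mult_ac)
  also have "\<dots> \<le> (\<integral>\<^sup>+z. ennreal (exp (1 / (8 * pi))) * (indicator ?D z * ennreal (cmod (gstft h (z0 + z)))) \<partial>lborel)"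
  proof (rule nn_integral_mono)
    fix z
    have "exp ((norm (zpoint z))\<^sup>2 / (8 * pi)) \<le> exp (1 / (8 * pi))" if "z \<in> ?D"
      using that by (simp add: zdisc_def divide_le_cancel power_le_one)
    thus "indicator ?D z * ennreal (c * cmod (G (zpoint z))) \<le> ennreal (exp (1 / (8 * pi))) * (indicator ?D z * ennreal (cmod (gstft h (z0 + z))))"
      unfolding G by (cases "z \<in> ?D") (auto simp: ennreal_mult'[symmetric] intro!: ennreal_leI mult_right_mono)
  qed
  also have "\<dots> = ennreal (exp (1 / (8 * pi))) * (\<integral>\<^sup>+z. indicator ?D z * ennreal (cmod (gstft h (z0 + z))) \<partial>lborel)"
    by (rule nn_integral_cmult) measurable
  finally show ?thesis .
qed


lemma Lp_norm_conj_indicator_le: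
  assumes P: "1 \<le> P" and [measurable]: "S \<in> sets M"
  shows "Lp_norm (conj_exponent (ennreal P)) M (\<lambda>x. c * indicator S x) \<le> c * max 1 (emeasure M S)"
proof (cases "P = 1")
  case True
  have "esssup M (\<lambda>x. c * indicator S x) \<le> c" by (intro esssup_I) (auto simp: indicator_def)
  also have "c \<le> c * max 1 (emeasure M S)" using mult_left_mono[of 1 "max 1 (emeasure M S)" c] by simp
  finally show ?thesis using True by (simp add: Lp_norm_def conj_exponent_1[simplified])
next
  case False
  define R where "R = P / (P - 1)"
  have R: "1 < R" "conj_exponent (ennreal P) = ennreal R" using P False by (auto simp: R_def conj_exponent_real)
  have "Lp_norm (ennreal R) M (indicator S) \<le> max 1 (emeasure M S)"
  proof -
    have "enn_powr (indicator S x) R = indicator S x" for x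
      using enn_powr_ennreal[of 1 R] by (auto simp: indicator_def)
    moreover have "emeasure M S \<le> enn_powr (max 1 (emeasure M S)) R"
    proof -
      have "m \<le> enn_powr m R" if "1 \<le> m" for m
      proof (cases m)
        case (real a)
        with that have "1 \<le> a" by simp
        thus ?thesis using real R powr_mono[of 1 R a] by (simp add: enn_powr_ennreal ennreal_leI)
      qed simp
      from this[of "max 1 (emeasure M S)"] show ?thesis by (auto intro: order_trans[rotated])
    qed
    ultimately show ?thesis using R by (simp add: Lp_norm_le_iff)
  qed
  thus ?thesis using R by (simp add: Lp_norm_cmult mult_left_mono)
qed

lemma modulation_norm_mixed:
  assumes "h \<in> tempered" "continuous_on UNIV w"
  shows "modulation_norm p q w h = mixed_norm p q (\<lambda>z. ennreal (cmod (gstft h z) * w z))"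
proof -
  let ?F = "\<lambda>z. ennreal (cmod (gstft h z) * w z)"
  have "(\<lambda>z. cmod (gstft h z) * w z) \<in> borel_measurable borel"
    by (intro borel_measurable_continuous_onI continuous_intros gstft_continuous assms)
  hence m[measurable]: "?F \<in> borel_measurable borel" by measurable
  have "Lp_norm p lebesgue (\<lambda>x. ?F (x, \<xi>)) = Lp_norm p lborel (\<lambda>x. ?F (x, \<xi>))" for \<xi>
    by (rule Lp_norm_lebesgue) measurable
  moreover have "Lp_norm q lebesgue (\<lambda>\<xi>. Lp_norm p lborel (\<lambda>x. ?F (x, \<xi>))) =
     Lp_norm q lborel (\<lambda>\<xi>. Lp_norm p lborel (\<lambda>x. ?F (x, \<xi>)))"
    by (rule Lp_norm_lebesgue, rule measurable_section_Lp_norm, rule m)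
  ultimately show ?thesis by (simp add: modulation_norm_def mixed_norm_def)
qed

text \<open>The sub-mean value property and Hoelder's inequality for the indicator of the set over which the mean is taken.\<close>

lemma gstft_le_modulation_norm:
  assumes P: "1 \<le> P" "1 \<le> Q"
  shows "\<exists>K. 0 \<le> K \<and> (\<forall>(h :: (real ^ 'n::finite \<Rightarrow> complex) \<Rightarrow> complex) w z0.
     h \<in> tempered \<longrightarrow> continuous_on UNIV w \<longrightarrow> (\<forall>z. 1 \<le> w z) \<longrightarrow>
     ennreal (cmod (gstft h z0)) \<le> ennreal K * modulation_norm (ennreal P) (ennreal Q) w h)"
proof -
  let ?D = "zdisc :: ((real ^ 'n) \<times> (real ^ 'n)) set"
  define d where "d = measure lborel ?D"
  have d2: "emeasure lborel ?D = ennreal d"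
    unfolding d_def by (rule emeasure_eq_ennreal_measure) (use emeasure_zdisc(2)[where 'n = 'n] in auto)
  moreover from this have "0 < d" using emeasure_zdisc(1)[where 'n = 'n] by simp
  ultimately have d: "0 < d" "emeasure lborel ?D = ennreal d" by auto
  define b where "b = max 1 (measure lborel (cball (0::real ^ 'n) 1))"
  define e where "e = exp (1 / (8 * pi))"
  have b: "1 \<le> b" "max 1 (emeasure lborel (cball x 1)) = ennreal b" for x :: "real ^ 'n"
  proof -
    have "(\<integral>\<^sup>+y. indicator (cball x 1) (y + x) \<partial>lborel) = (\<integral>\<^sup>+y. indicator (cball x 1) y \<partial>lborel)"
      by (rule nn_integral_lborel_shift, rule borel_measurable_indicator) simp
    moreover have "indicator (cball x 1) (y + x) = (indicator (cball 0 1) y :: ennreal)" for y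
      by (auto simp: indicator_def dist_norm)
    ultimately have "measure lborel (cball x 1) = measure lborel (cball (0::real ^ 'n) 1)"
      by (simp add: measure_def)
    moreover have "emeasure lborel (cball x 1) = ennreal (measure lborel (cball x 1))"
      by (rule emeasure_eq_ennreal_measure) (use emeasure_lborel_cball_finite[of x 1] in auto)
    ultimately show "max 1 (emeasure lborel (cball x 1)) = ennreal b"
      by (simp add: b_def max_def ennreal_le_1 ennreal_ge_1)
  qed (simp add: b_def)
  have "ennreal (cmod (gstft h z0)) \<le> ennreal (e * b * b / d) * modulation_norm (ennreal P) (ennreal Q) w h"
    if h: "h \<in> tempered" and w: "continuous_on UNIV w" "\<And>z. 1 \<le> w z" for h w and z0 :: "(real ^ 'n) \<times> (real ^ 'n)"
  proof -
    have [measurable]: "(\<lambda>z. cmod (gstft h z)) \<in> borel_measurable borel" "w \<in> borel_measurable borel"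
      by (intro borel_measurable_continuous_onI continuous_intros gstft_continuous h w)+
    let ?I = "\<lambda>z. indicator (cball (fst z0) 1) (fst z) * indicator (cball (snd z0) 1) (snd z) :: ennreal"
    have [measurable]: "(\<lambda>z. indicator (cball (fst z0) 1) (fst z) :: ennreal) \<in> borel_measurable borel"
      "(\<lambda>z. indicator (cball (snd z0) 1) (snd z) :: ennreal) \<in> borel_measurable borel"
      by (rule measurable_compose_continuous, rule borel_measurable_indicator, simp, intro continuous_intros)+
    have [measurable]: "?I \<in> borel_measurable borel" by measurable
    have "(\<integral>\<^sup>+z. indicator ?D z * ennreal (cmod (gstft h (z0 + z))) \<partial>lborel) =
       (\<integral>\<^sup>+z. indicator ?D (z + - z0) * ennreal (cmod (gstft h z)) \<partial>lborel)"
      by (subst nn_integral_lborel_shift[of "\<lambda>z. indicator ?D (z + - z0) * ennreal (cmod (gstft h z))" z0, symmetric])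
         (auto simp: add.commute)
    also have "\<dots> \<le> (\<integral>\<^sup>+z. ennreal (cmod (gstft h z) * w z) * ?I z \<partial>lborel)"
    proof (rule nn_integral_mono)
      fix z
      show "indicator ?D (z + - z0) * ennreal (cmod (gstft h z)) \<le> ennreal (cmod (gstft h z) * w z) * ?I z"
      proof (cases "z + - z0 \<in> ?D")
        case True
        hence "norm (fst z - fst z0) \<le> 1" "norm (snd z - snd z0) \<le> 1"
          using norm_zpoint_bounds(2,3)[of "z + - z0"] by (auto simp: zdisc_def)
        hence "?I z = 1" by (auto simp: dist_norm norm_minus_commute)
        moreover have "cmod (gstft h z) * 1 \<le> cmod (gstft h z) * w z" using w by (intro mult_left_mono) auto
        ultimately show ?thesis using True by (simp add: ennreal_leI)
      qed simp
    qed
    also have "\<dots> \<le> mixed_norm (ennreal P) (ennreal Q) (\<lambda>z. ennreal (cmod (gstft h z) * w z))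
       * mixed_norm (conj_exponent (ennreal P)) (conj_exponent (ennreal Q)) ?I"
      by (rule mixed_Holder[OF P]) measurable
    also have "mixed_norm (conj_exponent (ennreal P)) (conj_exponent (ennreal Q)) ?I \<le> ennreal b * ennreal b"
    proof -
      have "Lp_norm (conj_exponent (ennreal P)) lborel (\<lambda>x. ?I (x, \<xi>)) = (if \<xi> \<in> cball (snd z0) 1 then Lp_norm (conj_exponent (ennreal P)) lborel (\<lambda>x. 1 * indicator (cball (fst z0) 1) x) else Lp_norm (conj_exponent (ennreal P)) lborel (\<lambda>x. 0 * indicator (cball (fst z0) 1) x))" for \<xi>
        by simp
      hence 1: "Lp_norm (conj_exponent (ennreal P)) lborel (\<lambda>x. ?I (x, \<xi>)) =
          Lp_norm (conj_exponent (ennreal P)) lborel (\<lambda>x. 1 * indicator (cball (fst z0) 1) x) * indicator (cball (snd z0) 1) \<xi>" for \<xi>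
        using Lp_norm_conj_indicator_le[OF P(1), of "cball (fst z0) 1" lborel 0] by simp
      have "Lp_norm (conj_exponent (ennreal P)) lborel (\<lambda>x. 1 * indicator (cball (fst z0) 1) x) \<le> ennreal b"
        using Lp_norm_conj_indicator_le[OF P(1), of "cball (fst z0) 1" lborel 1] b(2) by simp
      moreover have "mixed_norm (conj_exponent (ennreal P)) (conj_exponent (ennreal Q)) ?I \<le>
          Lp_norm (conj_exponent (ennreal P)) lborel (\<lambda>x. 1 * indicator (cball (fst z0) 1) x) * ennreal b"
        unfolding mixed_norm_def 1 using Lp_norm_conj_indicator_le[OF P(2), of "cball (snd z0) 1" lborel] b(2) by simp
      ultimately show ?thesis by (elim order_trans) (intro mult_right_mono, auto)
    qed
    finally have I: "(\<integral>\<^sup>+z. indicator ?D z * ennreal (cmod (gstft h (z0 + z))) \<partial>lborel) \<le>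
       modulation_norm (ennreal P) (ennreal Q) w h * (ennreal b * ennreal b)"
      by (simp add: modulation_norm_mixed[OF h w(1)] mult_left_mono)
    have "ennreal (cmod (gstft h z0)) = ennreal (1 / d) * (ennreal (cmod (gstft h z0)) * ennreal d)"
      using d by (simp add: ennreal_mult'[symmetric] ennreal_mult''[symmetric])
    also have "\<dots> \<le> ennreal (1 / d) * (ennreal e * (modulation_norm (ennreal P) (ennreal Q) w h * (ennreal b * ennreal b)))"
      using gstft_sub_mean_value[OF h, of z0] mult_left_mono[OF I, of "ennreal e"]
      unfolding d e_def by (intro mult_left_mono) (auto elim: order_trans)
    also have "\<dots> = ennreal (e * b * b / d) * modulation_norm (ennreal P) (ennreal Q) w h"
    proof -
      have "0 \<le> e" by (simp add: e_def)
      hence "ennreal (e * b * b / d) = ennreal (1 / d) * ennreal e * ennreal b * ennreal b"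
        using b d by (simp add: ennreal_mult[symmetric] mult_ac)
      thus ?thesis by (simp only: mult_ac)
    qed
    finally show ?thesis .
  qed
  moreover have "0 \<le> e * b * b / d" using b d by (simp add: e_def)
  ultimately show ?thesis by blast
qed

section \<open>Submultiplicative polynomially moderate weights\<close>

lemma poly_weight_mono: "s \<le> t \<Longrightarrow> poly_weight s z \<le> poly_weight t z"
  by (cases z) (auto simp: poly_weight_def intro!: powr_mono)

lemma poly_weight_continuous: "continuous_on UNIV (poly_weight s)"
  unfolding poly_weight_def case_prod_unfold
  by (intro continuous_intros) (auto simp: add_nonneg_eq_0_iff add.assoc)

lemma poly_weight_0: "poly_weight s 0 = 1"
  by (simp add: poly_weight_def zero_prod_def)

lemma poly_weight_pos: "0 < poly_weight s z"
  by (cases z) (auto simp: poly_weight_def add_nonneg_eq_0_iff add.assoc)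

text \<open>Submultiplicativity gives \<open>w (m z) \<le> w z ^ m\<close>, while moderateness bounds \<open>w (m z)\<close> from below by the inverse of a
  polynomial in \<open>m\<close>; this forces \<open>1 \<le> w z\<close>. Continuity follows from moderateness, as \<open>poly_weight s\<close> is continuous
  with value 1 at 0.\<close>

lemma moderate_weight_properties:
  fixes w :: "(real ^ 'n::finite) \<times> (real ^ 'n) \<Rightarrow> real"
  assumes "weight w" "submultiplicative w" "polynomially_moderate w" "\<exists>z. w z \<noteq> 0"
  obtains s where "0 \<le> s" "\<And>z z'. w (z + z') \<le> poly_weight s z * w z'" "\<And>z. 1 \<le> w z" "continuous_on UNIV w"
proof -
  have nn: "0 \<le> w z" for z using assms(1) unfolding weight_def by blast
  have sub: "w (z + z') \<le> w z * w z'" for z z' using assms(2) unfolding submultiplicative_def by blast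
  obtain s0 where s0: "\<And>z z'. w (z + z') \<le> poly_weight s0 z * w z'"
    using assms(3) unfolding polynomially_moderate_def moderate_def by blast
  define s where "s = max 0 s0"
  have s: "w (z + z') \<le> poly_weight s z * w z'" for z z'
    using s0[of z z'] mult_right_mono[OF poly_weight_mono[of s0 s z] nn[of z']] by (simp add: s_def)
  have pos: "0 < w z" for z
  proof -
    obtain z0 where "w z0 \<noteq> 0" using assms(4) by blast
    hence "0 < w z0" using nn[of z0] by simp
    also have "w z0 \<le> w (z0 - z) * w z" using sub[of "z0 - z" z] by simp
    finally show ?thesis using nn[of z] by (cases "w z = 0") auto
  qed
  have ge1: "1 \<le> w z" for z
  proof (rule ccontr)
    assume "\<not> 1 \<le> w z"
    hence z: "w z < 1" by simp
    define R where "R = (norm (fst z))\<^sup>2 + (norm (snd z))\<^sup>2"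
    have R: "0 \<le> R" by (simp add: R_def)
    define b where "b = - ln (w z)"
    have b: "0 < b" "w z = exp (- b)" using z pos[of z] by (auto simp: b_def)
    have pw: "w (real k *\<^sub>R z) \<le> w z ^ k * w 0" for k
    proof (induction k)
      case (Suc k)
      have "w (real (Suc k) *\<^sub>R z) \<le> w z * w (real k *\<^sub>R z)" using sub[of z "real k *\<^sub>R z"] by (simp add: algebra_simps)
      also have "\<dots> \<le> w z * (w z ^ k * w 0)" by (intro mult_left_mono Suc nn)
      finally show ?case by (simp add: mult.assoc)
    qed simp
    have "w 0 \<le> (1 + (real k)\<^sup>2 * R) powr (s / 2) * exp (- b) ^ k * w 0" for k
    proof -
      have "w 0 \<le> poly_weight s (- (real k *\<^sub>R z)) * w (real k *\<^sub>R z)" using s[of "- (real k *\<^sub>R z)" "real k *\<^sub>R z"] by simp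
      also have "\<dots> \<le> poly_weight s (- (real k *\<^sub>R z)) * (w z ^ k * w 0)"
        by (intro mult_left_mono pw less_imp_le[OF poly_weight_pos])
      also have "poly_weight s (- (real k *\<^sub>R z)) = (1 + (real k)\<^sup>2 * R) powr (s / 2)"
        by (cases z) (simp add: poly_weight_def R_def power_mult_distrib algebra_simps)
      finally show ?thesis using b by (simp add: mult.assoc)
    qed
    hence "1 \<le> (1 + (real k)\<^sup>2 * R) powr (s / 2) * exp (- b) ^ k" for k
      using pos[of 0] mult_le_cancel_right_pos[of "w 0" 1] by simp
    moreover have "(\<lambda>k. (1 + (real k)\<^sup>2 * R) powr (s / 2) * exp (- b) ^ k) \<longlonglongrightarrow> 0"
    proof (cases "R = 0")
      case True
      thus ?thesis using b by (simp add: LIMSEQ_power_zero)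
    next
      case False
      hence "0 < R" using R by simp
      thus ?thesis using b by real_asymp
    qed
    ultimately have "(1::real) \<le> 0" by (intro LIMSEQ_le_const) auto
    thus False by simp
  qed
  have "isCont w z" for z
  proof -
    have pt: "((\<lambda>z'. poly_weight s (z' - z)) \<longlongrightarrow> 1) (at z)" "((\<lambda>z'. poly_weight s (z - z')) \<longlongrightarrow> 1) (at z)"
    proof -
      have pc: "isCont (poly_weight s) x" for x :: "(real ^ 'n) \<times> (real ^ 'n)"
        using poly_weight_continuous[of s] continuous_on_eq_continuous_at[OF open_UNIV] by blast
      have "isCont (\<lambda>z'. poly_weight s (z' - z)) z" "isCont (\<lambda>z'. poly_weight s (z - z')) z"
        by (rule isCont_o2[OF _ pc], intro continuous_intros)+
      thus "((\<lambda>z'. poly_weight s (z' - z)) \<longlongrightarrow> 1) (at z)" "((\<lambda>z'. poly_weight s (z - z')) \<longlongrightarrow> 1) (at z)"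
        by (simp_all add: isCont_def poly_weight_0)
    qed
    show ?thesis unfolding isCont_def
    proof (rule tendsto_sandwich)
      show "\<forall>\<^sub>F z' in at z. w z / poly_weight s (z - z') \<le> w z'"
      proof (intro always_eventually allI)
        fix z'
        show "w z / poly_weight s (z - z') \<le> w z'"
          using s[of "z - z'" z'] poly_weight_pos[of s "z - z'"] by (simp add: pos_divide_le_eq mult.commute)
      qed
      show "\<forall>\<^sub>F z' in at z. w z' \<le> poly_weight s (z' - z) * w z"
      proof (intro always_eventually allI)
        fix z'
        show "w z' \<le> poly_weight s (z' - z) * w z" using s[of "z' - z" z] by simp
      qed
      show "((\<lambda>z'. w z / poly_weight s (z - z')) \<longlongrightarrow> w z) (at z)"
        using tendsto_divide[OF tendsto_const pt(2), of "w z"] by simp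
      show "((\<lambda>z'. poly_weight s (z' - z) * w z) \<longlongrightarrow> w z) (at z)"
        using tendsto_mult[OF pt(1) tendsto_const, of "w z"] by simp
    qed
  qed
  hence "continuous_on UNIV w" by (simp add: continuous_on_eq_continuous_at)
  with s ge1 show ?thesis by (intro that[of s]) (auto simp: s_def)
qed


section \<open>Integrals of rapidly decaying functions\<close>

text \<open>The exponent is a convenient one that makes the function integrable: it is dominated by a product of functions
  \<open>1 / (1 + t\<^sup>2)\<close> of the coordinates.\<close>

definition decay :: "real ^ 'n::finite \<Rightarrow> real" where
  "decay y = 1 / (1 + norm y) ^ (2 * CARD('n))"

lemma decay_pos: "0 < decay y" and decay_le_1: "decay y \<le> 1"
  by (auto simp: decay_def one_le_power add_pos_nonneg)

lemma decay_continuous: "continuous_on UNIV decay"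
  unfolding decay_def[abs_def] by (intro continuous_intros) (auto simp: add_nonneg_eq_0_iff)

lemma decay_measurable [measurable]: "decay \<in> borel_measurable borel"
  by (rule borel_measurable_continuous_onI[OF decay_continuous])

lemma integrable_decay: "integrable lborel (decay :: real ^ 'n::finite \<Rightarrow> real)"
proof (rule integrableI_bounded)
  have "integrable lborel (\<lambda>x::real. indicator (einterval (-\<infinity>) \<infinity>) x *\<^sub>R inverse (1 + x\<^sup>2))"
    using integrable_inverse_1_plus_square by (simp add: set_integrable_def)
  hence "integrable lborel (\<lambda>x::real. inverse (1 + x\<^sup>2))" by simp
  hence fin: "(\<integral>\<^sup>+x. ennreal (inverse (1 + x\<^sup>2)) \<partial>lborel) < \<infinity>"
    by (simp add: nn_integral_eq_integral less_top[symmetric])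
  have "(\<integral>\<^sup>+y. ennreal (norm (decay (y :: real ^ 'n))) \<partial>lborel) \<le>
     (\<integral>\<^sup>+(y :: real ^ 'n). (\<Prod>b\<in>Basis. ennreal (inverse (1 + (y \<bullet> b)\<^sup>2))) \<partial>lborel)"
  proof (rule nn_integral_mono)
    fix y :: "real ^ 'n"
    have "(\<Prod>b\<in>Basis. 1 + (y \<bullet> b)\<^sup>2) \<le> (\<Prod>b\<in>(Basis :: (real ^ 'n) set). (1 + norm y)\<^sup>2)"
    proof (rule prod_mono, safe)
      fix b :: "real ^ 'n" assume "b \<in> Basis"
      hence "(y \<bullet> b)\<^sup>2 \<le> (norm y)\<^sup>2" using Basis_le_norm[of b y] by (simp add: abs_le_square_iff[symmetric])
      thus "1 + (y \<bullet> b)\<^sup>2 \<le> (1 + norm y)\<^sup>2" using norm_ge_zero[of y] unfolding power2_sum by (simp del: norm_ge_zero)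
    qed simp
    also have "\<dots> = (1 + norm y) ^ (2 * CARD('n))" by (simp add: power_mult)
    finally have "decay y \<le> inverse (\<Prod>b\<in>Basis. 1 + (y \<bullet> b)\<^sup>2)"
      unfolding decay_def by (simp add: divide_inverse, intro le_imp_inverse_le) (auto intro!: prod_pos add_pos_nonneg)
    also have "\<dots> = (\<Prod>b\<in>Basis. inverse (1 + (y \<bullet> b)\<^sup>2))" by (subst prod_inversef[symmetric]) (simp add: o_def)
    finally show "ennreal (norm (decay y)) \<le> (\<Prod>b\<in>Basis. ennreal (inverse (1 + (y \<bullet> b)\<^sup>2)))"
      using decay_pos[of y] by (subst prod_ennreal) (auto intro!: ennreal_leI)
  qed
  also have "\<dots> = (\<Prod>b\<in>(Basis :: (real ^ 'n) set). \<integral>\<^sup>+x. ennreal (inverse (1 + x\<^sup>2)) \<partial>lborel)"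
    by (rule nn_integral_lborel_prod) auto
  also have "\<dots> < \<infinity>" using fin by (simp add: power_less_top_ennreal)
  finally show "(\<integral>\<^sup>+y. ennreal (norm (decay (y :: real ^ 'n))) \<partial>lborel) < \<infinity>" .
qed simp

lemma integrable_decay_bound:
  fixes f :: "real ^ 'n::finite \<Rightarrow> 'b::{banach, second_countable_topology}"
  assumes [measurable]: "f \<in> borel_measurable borel" and "\<And>y. norm (f y) \<le> A * decay y"
  shows "integrable lborel f"
  by (rule Bochner_Integration.integrable_bound[OF integrable_mult_right[OF integrable_decay, of A]])
     (use assms in \<open>auto intro!: AE_I2 intro: order_trans[OF _ abs_ge_self]\<close>)

lemma decay_shift_le:
  fixes y c :: "real ^ 'n::finite"
  assumes "norm c \<le> 1" shows "decay (y + c) \<le> 2 ^ (2 * CARD('n)) * decay y"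
proof -
  have "1 + norm y \<le> 2 * (1 + norm (y + c))" using assms by norm
  hence "(1 + norm y) ^ (2 * CARD('n)) \<le> (2 * (1 + norm (y + c))) ^ (2 * CARD('n))"
    by (intro power_mono) auto
  hence "(1 + norm y) ^ (2 * CARD('n)) \<le> 2 ^ (2 * CARD('n)) * (1 + norm (y + c)) ^ (2 * CARD('n))"
    by (simp only: power_mult_distrib)
  thus ?thesis by (simp add: decay_def field_simps add_pos_nonneg)
qed

lemma schwartz_continuous: "\<phi> \<in> schwartz \<Longrightarrow> continuous_on UNIV \<phi>"
proof -
  assume "\<phi> \<in> schwartz"
  hence "\<forall>is x. pderivs is \<phi> differentiable (at x)" by (simp add: schwartz_def smooth_fn_def)
  hence "\<phi> differentiable (at x)" for x using pderivs.simps(1)[of \<phi>] by metis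
  thus ?thesis by (auto simp: continuous_on_eq_continuous_at intro: differentiable_imp_continuous_within)
qed

lemma schwartz_measurable: "\<phi> \<in> schwartz \<Longrightarrow> \<phi> \<in> borel_measurable borel"
  by (intro borel_measurable_continuous_onI schwartz_continuous)

lemma schwartz_pderiv_coord:
  assumes "\<phi> \<in> schwartz" shows "pderiv_coord i \<phi> \<in> schwartz"
proof -
  have "pderivs is (pderiv_coord i \<phi>) = pderivs (is @ [i]) \<phi>" for "is" by (induction "is") auto
  thus ?thesis using assms by (simp add: schwartz_def smooth_fn_def)
qed

lemma schwartz_norm_bound:
  fixes \<phi> :: "real ^ 'n::finite \<Rightarrow> complex"
  assumes "\<phi> \<in> schwartz" "length is \<le> N" "M \<le> N"
  shows "(1 + norm y) ^ M * cmod (pderivs is \<phi> y) \<le> schwartz_norm N \<phi>"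
proof -
  have bdd: "bdd_above (range (\<lambda>x. (1 + norm x) ^ N * cmod (pderivs js \<phi> x)))" for js
    using assms by (auto simp: schwartz_def intro: bounded_imp_bdd_above)
  have up: "(1 + norm y) ^ N * cmod (pderivs js \<phi> y) \<le> (SUP x. (1 + norm x) ^ N * cmod (pderivs js \<phi> x))" for js y
    by (intro cSUP_upper bdd) auto
  have nn: "0 \<le> (SUP x. (1 + norm x) ^ N * cmod (pderivs js \<phi> x))" for js
    using up[of 0 js] by (rule order_trans[rotated]) simp
  have "(1 + norm y) ^ M * cmod (pderivs is \<phi> y) \<le> (1 + norm y) ^ N * cmod (pderivs is \<phi> y)"
    using assms(3) by (intro mult_right_mono power_increasing) auto
  also note up
  also have "(SUP x. (1 + norm x) ^ N * cmod (pderivs is \<phi> x)) \<le> schwartz_norm N \<phi>"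
    unfolding schwartz_norm_def using assms(2) nn finite_short_lists
    by (intro member_le_sum) auto
  finally show ?thesis .
qed

lemma schwartz_norm_nonneg: "\<phi> \<in> schwartz \<Longrightarrow> 0 \<le> schwartz_norm N \<phi>"
  using schwartz_norm_bound[of \<phi> "[]" N 0 0] by (simp add: order_trans[OF norm_ge_zero])

lemma schwartz_decay:
  fixes \<phi> :: "real ^ 'n::finite \<Rightarrow> complex"
  assumes "\<phi> \<in> schwartz" "2 * CARD('n) \<le> N"
  shows "cmod (\<phi> y) \<le> schwartz_norm N \<phi> * decay y"
  using schwartz_norm_bound[OF assms(1), of "[]" N "2 * CARD('n)" y] assms(2)
  by (simp add: decay_def field_simps add_pos_nonneg)

lemma schwartz_le_norm:
  assumes "\<phi> \<in> schwartz" shows "cmod (\<phi> y) \<le> schwartz_norm N \<phi>"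
  using schwartz_norm_bound[OF assms, of "[]" N 0 y] by simp

lemma integral_lborel_shift:
  fixes f :: "'a::euclidean_space \<Rightarrow> 'b::{banach, second_countable_topology}"
  assumes [measurable]: "f \<in> borel_measurable borel"
  shows "(LINT x|lborel. f (x + c)) = (LINT x|lborel. f x)"
  by (subst (2) lborel_distr_plus[of c, symmetric]) (simp add: integral_distr add.commute)

lemma integrable_lborel_shift:
  fixes f :: "'a::euclidean_space \<Rightarrow> 'b::{banach, second_countable_topology}"
  assumes "integrable lborel f"
  shows "integrable lborel (\<lambda>x. f (x + c))"
proof -
  have "integrable (distr lborel borel ((+) c)) f" using assms by (simp add: lborel_distr_plus)
  thus ?thesis using borel_measurable_integrable[OF assms] by (subst (asm) integrable_distr_eq) (auto simp: add.commute)
qed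

text \<open>Integration by parts: the integral of a partial derivative is a limit of integrals of difference
  quotients, which vanish by translation invariance.\<close>

lemma integral_partial_derivative_eq_0:
  fixes f :: "real ^ 'n::finite \<Rightarrow> complex"
  assumes d: "\<And>y. ((\<lambda>t. f (y + t *\<^sub>R axis i 1)) has_vector_derivative f' y) (at 0)"
    and m[measurable]: "f \<in> borel_measurable borel" "f' \<in> borel_measurable borel"
    and b: "\<And>y. cmod (f y) \<le> A * decay y" "\<And>y. cmod (f' y) \<le> A * decay y"
  shows "(LINT y|lborel. f' y) = 0"
proof -
  let ?e = "axis i 1 :: real ^ 'n"
  define s where "s = (\<lambda>k y. of_real (real (Suc k)) * (f (y + (1 / real (Suc k)) *\<^sub>R ?e) - f y))"
  have A: "0 \<le> A" using order_trans[OF norm_ge_zero b(1)[of 0]] decay_pos[of "0::real^'n"] by (simp add: zero_le_mult_iff)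
  have d': "((\<lambda>t. f (y + t *\<^sub>R ?e)) has_vector_derivative f' (y + t *\<^sub>R ?e)) (at t)" for y t
  proof -
    have "((\<lambda>h. f ((y + t *\<^sub>R ?e) + h *\<^sub>R ?e)) has_vector_derivative f' (y + t *\<^sub>R ?e)) (at (t - t))"
      using d[of "y + t *\<^sub>R ?e"] by simp
    hence "((\<lambda>h. f ((y + t *\<^sub>R ?e) + h *\<^sub>R ?e)) \<circ> (\<lambda>u. u - t) has_vector_derivative 1 *\<^sub>R f' (y + t *\<^sub>R ?e)) (at t)"
      by (intro vector_diff_chain_at) (auto intro!: derivative_eq_intros)
    thus ?thesis by (simp add: o_def algebra_simps)
  qed
  have "(\<lambda>k. LINT y|lborel. s k y) \<longlonglongrightarrow> (LINT y|lborel. f' y)"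
  proof (rule integral_dominated_convergence[where w = "\<lambda>y. A * (2 ^ (2 * CARD('n)) * decay y)"])
    show "integrable lborel (\<lambda>y::real ^ 'n. A * (2 ^ (2 * CARD('n)) * decay y))"
      by (intro integrable_mult_right integrable_decay)
    show "AE y in lborel. (\<lambda>k. s k y) \<longlonglongrightarrow> f' y"
    proof (rule AE_I2)
      fix y
      have "((\<lambda>h. norm (f (y + h *\<^sub>R ?e) - f y - h *\<^sub>R f' y) / norm h) \<longlongrightarrow> 0) (at 0)"
        using d[of y] by (simp add: has_vector_derivative_def has_derivative_at)
      hence "((\<lambda>h. norm ((f (y + h *\<^sub>R ?e) - f y) /\<^sub>R h - f' y)) \<longlongrightarrow> 0) (at 0)"
      proof (rule Lim_transform_eventually)
        have "norm (f (y + h *\<^sub>R ?e) - f y - h *\<^sub>R f' y) / norm h = norm ((f (y + h *\<^sub>R ?e) - f y) /\<^sub>R h - f' y)"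
          if "h \<noteq> 0" for h
        proof -
          have "(f (y + h *\<^sub>R ?e) - f y) /\<^sub>R h - f' y = (f (y + h *\<^sub>R ?e) - f y - h *\<^sub>R f' y) /\<^sub>R h"
            using that by (simp add: scaleR_diff_right)
          thus ?thesis by (simp add: divide_inverse mult.commute)
        qed
        thus "\<forall>\<^sub>F h in at 0. norm (f (y + h *\<^sub>R ?e) - f y - h *\<^sub>R f' y) / norm h = norm ((f (y + h *\<^sub>R ?e) - f y) /\<^sub>R h - f' y)"
          by (auto simp: eventually_at_filter)
      qed
      hence "((\<lambda>h. (f (y + h *\<^sub>R ?e) - f y) /\<^sub>R h) \<longlongrightarrow> f' y) (at 0)"
        by (rule LIM_zero_cancel[OF tendsto_norm_zero_cancel])
      hence "((\<lambda>k. (f (y + (1 / real (Suc k)) *\<^sub>R ?e) - f y) /\<^sub>R (1 / real (Suc k))) \<longlongrightarrow> f' y) sequentially"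
      proof (rule filterlim_compose)
        show "filterlim (\<lambda>k. 1 / real (Suc k)) (at 0) sequentially"
          by (rule filterlim_atI[OF LIMSEQ_Suc[OF lim_1_over_n]]) simp
      qed
      thus "(\<lambda>k. s k y) \<longlonglongrightarrow> f' y" by (simp add: s_def scaleR_conv_of_real)
    qed
    show "AE y in lborel. norm (s k y) \<le> A * (2 ^ (2 * CARD('n)) * decay y)" for k
    proof (rule AE_I2)
      fix y
      define h where "h = 1 / real (Suc k)"
      have h: "0 < h" "h \<le> 1" by (auto simp: h_def)
      have "norm (f (y + h *\<^sub>R ?e) - f (y + 0 *\<^sub>R ?e)) \<le> (A * (2 ^ (2 * CARD('n)) * decay y)) * norm (h - 0)"
      proof (rule differentiable_bound[where S = "{0..h}" and f = "\<lambda>t. f (y + t *\<^sub>R ?e)" and f' = "\<lambda>t u. u *\<^sub>R f' (y + t *\<^sub>R ?e)"])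
        fix t assume t: "t \<in> {0..h}"
        show "((\<lambda>t. f (y + t *\<^sub>R ?e)) has_derivative (\<lambda>u. u *\<^sub>R f' (y + t *\<^sub>R ?e))) (at t within {0..h})"
          using d'[of y t] by (simp add: has_vector_derivative_def has_derivative_at_withinI)
        have "norm (t *\<^sub>R ?e) \<le> 1" using t h by (simp add: norm_axis_1)
        hence "cmod (f' (y + t *\<^sub>R ?e)) \<le> A * (2 ^ (2 * CARD('n)) * decay y)"
          using b(2)[of "y + t *\<^sub>R ?e"] decay_shift_le[of "t *\<^sub>R ?e" y] A by (elim order_trans) (intro mult_left_mono)
        thus "onorm (\<lambda>u. u *\<^sub>R f' (y + t *\<^sub>R ?e)) \<le> A * (2 ^ (2 * CARD('n)) * decay y)"
          by (intro onorm_le) (simp add: mult.commute mult_left_mono)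
      qed (use h in auto)
      hence "real (Suc k) * norm (f (y + h *\<^sub>R ?e) - f y) \<le> real (Suc k) * (A * (2 ^ (2 * CARD('n)) * decay y) * h)"
        using h by (intro mult_left_mono) auto
      also have "\<dots> = A * (2 ^ (2 * CARD('n)) * decay y)" by (simp add: h_def)
      finally show "norm (s k y) \<le> A * (2 ^ (2 * CARD('n)) * decay y)"
        by (simp add: s_def h_def norm_mult del: of_nat_Suc)
    qed
  qed (simp_all add: s_def)
  moreover have "(LINT y|lborel. s k y) = 0" for k
  proof -
    have i: "integrable lborel f" by (rule integrable_decay_bound[OF m(1) b(1)])
    have "(LINT y|lborel. f (y + (1 / real (Suc k)) *\<^sub>R ?e) - f y) = 0"
      by (subst Bochner_Integration.integral_diff[OF integrable_lborel_shift[OF i] i]) (simp add: integral_lborel_shift)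
    thus ?thesis by (simp add: s_def del: of_nat_Suc)
  qed
  ultimately show ?thesis by (simp add: LIMSEQ_const_iff)
qed


section \<open>Square-integrable functions as distributions\<close>

text \<open>Borel functions, in contrast to the Lebesgue measurable members of \<open>L2\<close>, so that integrals over product spaces
  can be interchanged.\<close>

definition sq_int :: "('a::euclidean_space \<Rightarrow> complex) \<Rightarrow> bool" where
  "sq_int u \<longleftrightarrow> u \<in> borel_measurable borel \<and> integrable lborel (\<lambda>x. (cmod (u x))\<^sup>2)"

lemma sq_int_measurable: "sq_int u \<Longrightarrow> u \<in> borel_measurable borel"
  by (simp add: sq_int_def)

lemma sq_int_mult:
  assumes "sq_int u" "sq_int v" shows "integrable lborel (\<lambda>x. u x * v x)"
proof (rule Bochner_Integration.integrable_bound)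
  show "integrable lborel (\<lambda>x. (cmod (u x))\<^sup>2 + (cmod (v x))\<^sup>2)"
    using assms by (auto simp: sq_int_def)
  show "(\<lambda>x. u x * v x) \<in> borel_measurable lborel" using assms by (auto simp: sq_int_def)
  have "cmod (u x) * cmod (v x) \<le> (cmod (u x))\<^sup>2 + (cmod (v x))\<^sup>2" for x
  proof -
    have "2 * (cmod (u x) * cmod (v x)) \<le> (cmod (u x))\<^sup>2 + (cmod (v x))\<^sup>2"
      using sum_squares_bound[of "cmod (u x)" "cmod (v x)"] by (simp add: mult.assoc)
    moreover have "0 \<le> cmod (u x) * cmod (v x)" by simp
    ultimately show ?thesis by linarith
  qed
  thus "AE x in lborel. norm (u x * v x) \<le> norm ((cmod (u x))\<^sup>2 + (cmod (v x))\<^sup>2)"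
    by (auto simp: norm_mult)
qed

lemma sq_int_cnj: "sq_int u \<Longrightarrow> sq_int (\<lambda>x. cnj (u x))"
  by (auto simp: sq_int_def intro: measurable_compose[OF _ borel_measurable_continuous_onI[OF continuous_on_cnj[OF continuous_on_id]]])

lemma sq_int_schwartz: "\<phi> \<in> schwartz \<Longrightarrow> sq_int \<phi>"
proof -
  assume s: "\<phi> \<in> schwartz"
  have m[measurable]: "\<phi> \<in> borel_measurable borel" by (rule schwartz_measurable[OF s])
  have "norm ((cmod (\<phi> y))\<^sup>2) \<le> (schwartz_norm (2 * CARD('a)) \<phi>)\<^sup>2 * decay y" for y
  proof -
    have "cmod (\<phi> y) * cmod (\<phi> y) \<le> schwartz_norm (2 * CARD('a)) \<phi> * (schwartz_norm (2 * CARD('a)) \<phi> * decay y)"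
      by (intro mult_mono schwartz_le_norm schwartz_decay s schwartz_norm_nonneg) auto
    thus ?thesis by (simp add: power2_eq_square mult.assoc)
  qed
  hence "integrable lborel (\<lambda>y. (cmod (\<phi> y))\<^sup>2)" by (intro integrable_decay_bound) auto
  thus ?thesis using m by (simp add: sq_int_def)
qed

lemma dist_of_schwartz:
  assumes "\<phi> \<in> schwartz" "u \<in> borel_measurable borel"
  shows "dist_of u \<phi> = (LINT x|lborel. u x * \<phi> x)"
  using assms schwartz_measurable[OF assms(1)] by (simp add: dist_of_def integral_completion)

lemma dist_of_tempered:
  fixes u :: "real ^ 'n::finite \<Rightarrow> complex"
  assumes u: "sq_int u" shows "dist_of u \<in> tempered"
proof -
  note m = sq_int_measurable[OF u]
  have int: "integrable lborel (\<lambda>x. u x * \<phi> x)" if "\<phi> \<in> schwartz" for \<phi>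
    by (rule sq_int_mult[OF u sq_int_schwartz[OF that]])
  define A where "A = (LINT x|lborel. (cmod (u x))\<^sup>2)"
  define D where "D = (LINT x|lborel. decay (x :: real ^ 'n))"
  have "cmod (dist_of u \<phi>) \<le> (A + D) * schwartz_norm (2 * CARD('n)) \<phi>" if s: "\<phi> \<in> schwartz" for \<phi>
  proof -
    let ?N = "schwartz_norm (2 * CARD('n)) \<phi>"
    have le: "cmod (u x * \<phi> x) \<le> ?N * (cmod (u x))\<^sup>2 + ?N * decay x" for x
    proof -
      have "cmod (u x) \<le> (cmod (u x))\<^sup>2 + 1"
      proof (cases "cmod (u x) \<le> 1")
        case False
        hence "1 * cmod (u x) \<le> cmod (u x) * cmod (u x)" by (intro mult_right_mono) auto
        thus ?thesis by (simp add: power2_eq_square)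
      qed (simp add: add_increasing)
      hence "cmod (u x) * cmod (\<phi> x) \<le> ((cmod (u x))\<^sup>2 + 1) * cmod (\<phi> x)" by (intro mult_right_mono) auto
      also have "\<dots> = (cmod (u x))\<^sup>2 * cmod (\<phi> x) + cmod (\<phi> x)" by (simp add: distrib_right)
      also have "\<dots> \<le> (cmod (u x))\<^sup>2 * ?N + ?N * decay x"
        by (intro add_mono mult_left_mono schwartz_le_norm schwartz_decay s) auto
      finally show ?thesis by (simp add: norm_mult mult.commute)
    qed
    have "cmod (dist_of u \<phi>) \<le> (LINT x|lborel. ?N * (cmod (u x))\<^sup>2 + ?N * decay x)"
      unfolding dist_of_schwartz[OF s m]
      using u integrable_decay by (intro Bochner_Integration.integral_norm_bound_integral int s le) (auto simp: sq_int_def)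
    also have "\<dots> = (A + D) * ?N"
      using u integrable_decay by (subst Bochner_Integration.integral_add) (auto simp: sq_int_def A_def D_def algebra_simps)
    finally show ?thesis .
  qed
  moreover have "dist_of u (\<lambda>y. \<phi> y + \<psi> y) = dist_of u \<phi> + dist_of u \<psi>" if "\<phi> \<in> schwartz" "\<psi> \<in> schwartz" for \<phi> \<psi>
    using that by (simp add: dist_of_schwartz m schwartz_add distrib_left int)
  moreover have "dist_of u (\<lambda>y. c * \<phi> y) = c * dist_of u \<phi>" if "\<phi> \<in> schwartz" for \<phi> c
    using that by (simp add: dist_of_schwartz m schwartz_cmult mult.left_commute[of _ c])
  moreover have "dist_of u \<phi> = 0" if "\<phi> \<notin> schwartz" for \<phi>
    using that by (simp add: dist_of_def)
  ultimately show ?thesis unfolding tempered_def by blast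
qed

section \<open>Hermite functions\<close>

text \<open>The function with index \<open>is\<close> has Bargmann transform \<open>zmono is\<close>, since multiplication by a coordinate on the
  side of the transform corresponds to the creation operator \<open>2 \<pi> y\<^sub>i - \<partial>\<^sub>i\<close>.\<close>

definition gauss_mass :: "'n::finite itself \<Rightarrow> complex" where
  "gauss_mass _ = (LINT y|lborel. gexp 0 (y :: real ^ 'n) * gexp 0 y)"

fun hermite :: "'n list \<Rightarrow> real ^ 'n::finite \<Rightarrow> complex" where
  "hermite [] = (\<lambda>y. inverse (gauss_mass TYPE('n)) * gexp 0 y)"
| "hermite (i # is) = (\<lambda>y. 2 * of_real pi * (of_real (y $ i) * hermite is y) + - 1 * pderiv_coord i (hermite is) y)"

lemma gexp_schwartz: "gexp \<eta> \<in> schwartz"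
  using gmono_schwartz[of "[]" \<eta>] by (simp add: gmono_Nil)

lemma hermite_gfamily: "\<exists>F\<in>gfamily 0 0. hermite is = F (0, 0)"
proof (induction "is")
  case Nil
  have "(\<lambda>p y. (\<lambda>_. inverse (gauss_mass TYPE('a))) p * grem 0 0 p y) \<in> gfamily 0 0"
    by (rule gfamily.scale[OF gfamily.base]) auto
  thus ?case by (rule bexI[rotated]) (simp add: grem_def fun_eq_iff)
next
  case (Cons i "is")
  then obtain F where F: "F \<in> gfamily 0 0" "hermite is = F (0, 0)" by blast
  obtain F' where F': "F' \<in> gfamily 0 0"
    "\<And>p y. ((\<lambda>t. F p (y + t *\<^sub>R axis i 1)) has_vector_derivative F' p y) (at 0)"
    using gfamily_derivative[OF F(1), of i] by blast
  have "(\<lambda>p y. (\<lambda>_. 2 * of_real pi) p * (of_real (y $ i) * F p y) + (\<lambda>_. - 1) p * F' p y) \<in> gfamily 0 0"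
    by (rule gfamily.add[OF gfamily.scale[OF gfamily.coord[OF F(1)]] gfamily.scale[OF F'(1)]]) auto
  moreover have "pderiv_coord i (F (0, 0)) = F' (0, 0)"
    by (auto simp: pderiv_coord_def fun_eq_iff intro!: vector_derivative_at F')
  ultimately show ?case by (intro bexI[rotated]) (auto simp: F(2))
qed

lemma hermite_schwartz: "hermite is \<in> schwartz"
  using hermite_gfamily[of "is"] gfamily_schwartz[of _ 0 0 "(0, 0)"] by (auto simp: gdom_def)

lemma gexp_line_derivative:
  "((\<lambda>t. gexp \<zeta> (y + t *\<^sub>R axis i 1)) has_vector_derivative \<zeta> $ i * gexp \<zeta> y - 2 * of_real pi * gmono [i] \<zeta> y) (at 0)"
  using grem_line_derivative[of 0 0 \<zeta> 0 y i] by (simp add: grem_def gmono_def)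

lemma schwartz_mult_decay:
  fixes \<phi> \<psi> :: "real ^ 'n::finite \<Rightarrow> complex"
  assumes "\<phi> \<in> schwartz" "\<psi> \<in> schwartz"
  shows "cmod (\<phi> y * \<psi> y) \<le> schwartz_norm 0 \<phi> * schwartz_norm (2 * CARD('n)) \<psi> * decay y"
proof -
  have "cmod (\<phi> y) * cmod (\<psi> y) \<le> schwartz_norm 0 \<phi> * (schwartz_norm (2 * CARD('n)) \<psi> * decay y)"
    by (intro mult_mono schwartz_le_norm schwartz_decay assms schwartz_norm_nonneg) auto
  thus ?thesis by (simp add: norm_mult mult.assoc)
qed

lemma integral_by_parts_gexp:
  fixes b :: "real ^ 'n::finite \<Rightarrow> complex"
  assumes b: "b \<in> schwartz"
  shows "(LINT y|lborel. pderiv_coord i b y * gexp \<zeta> y) =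
    2 * of_real pi * (LINT y|lborel. b y * gmono [i] \<zeta> y) - \<zeta> $ i * (LINT y|lborel. b y * gexp \<zeta> y)"
proof -
  let ?b' = "pderiv_coord i b"
  note s = b schwartz_pderiv_coord[OF b, of i] gexp_schwartz[of \<zeta>] gmono_schwartz[of "[i]" \<zeta>]
  note [measurable] = s[THEN schwartz_measurable]
  have int: "integrable lborel (\<lambda>y. ?b' y * gexp \<zeta> y)" "integrable lborel (\<lambda>y. b y * gmono [i] \<zeta> y)"
    "integrable lborel (\<lambda>y. b y * gexp \<zeta> y)"
    by (intro sq_int_mult sq_int_schwartz s)+
  let ?f' = "\<lambda>y. b y * (\<zeta> $ i * gexp \<zeta> y + - (2 * of_real pi) * gmono [i] \<zeta> y) + ?b' y * gexp \<zeta> y"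
  let ?N = "2 * CARD('n)"
  have w: "(\<lambda>y. \<zeta> $ i * gexp \<zeta> y + - (2 * of_real pi) * gmono [i] \<zeta> y) \<in> schwartz" (is "?w \<in> _")
    by (rule schwartz_linear[OF s(3,4)])
  define A where "A = schwartz_norm 0 b * schwartz_norm ?N (gexp \<zeta>) + (schwartz_norm 0 b * schwartz_norm ?N ?w
     + schwartz_norm 0 ?b' * schwartz_norm ?N (gexp \<zeta>))"
  have nn: "0 \<le> schwartz_norm 0 b * schwartz_norm ?N (gexp \<zeta>)" "0 \<le> schwartz_norm 0 b * schwartz_norm ?N ?w"
     "0 \<le> schwartz_norm 0 ?b' * schwartz_norm ?N (gexp \<zeta>)"
    by (intro mult_nonneg_nonneg schwartz_norm_nonneg s w)+
  have "(LINT y|lborel. ?f' y) = 0"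
  proof (rule integral_partial_derivative_eq_0[where f = "\<lambda>y. b y * gexp \<zeta> y" and A = A and i = i])
    fix y
    have "\<forall>x. pderivs [] b differentiable (at x)" using b unfolding schwartz_def smooth_fn_def by blast
    hence "((\<lambda>t. b (y + t *\<^sub>R axis i 1)) has_vector_derivative ?b' y) (at 0)"
      by (intro pderiv_coord_has_vector_derivative) simp
    from has_vector_derivative_mult[OF this gexp_line_derivative]
    show "((\<lambda>t. b (y + t *\<^sub>R axis i 1) * gexp \<zeta> (y + t *\<^sub>R axis i 1)) has_vector_derivative ?f' y) (at 0)" by simp
    have "cmod (b y * gexp \<zeta> y) \<le> schwartz_norm 0 b * schwartz_norm ?N (gexp \<zeta>) * decay y"
      by (rule schwartz_mult_decay[OF s(1,3)])
    also have "\<dots> \<le> A * decay y" using nn decay_pos[of y] by (intro mult_right_mono) (auto simp: A_def)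
    finally show "cmod (b y * gexp \<zeta> y) \<le> A * decay y" .
    have "cmod (?f' y) \<le> schwartz_norm 0 b * schwartz_norm ?N ?w * decay y + schwartz_norm 0 ?b' * schwartz_norm ?N (gexp \<zeta>) * decay y"
      using schwartz_mult_decay[OF s(1) w, of y] schwartz_mult_decay[OF s(2,3), of y] by (intro norm_triangle_le) linarith
    also have "\<dots> \<le> A * decay y" unfolding distrib_right[symmetric]
      using nn decay_pos[of y] by (intro mult_right_mono) (auto simp: A_def)
    finally show "cmod (?f' y) \<le> A * decay y" .
  qed measurable
  moreover have "(LINT y|lborel. ?f' y) = (LINT y|lborel. \<zeta> $ i * (b y * gexp \<zeta> y) + - (2 * of_real pi) * (b y * gmono [i] \<zeta> y) + ?b' y * gexp \<zeta> y)"
    by (intro Bochner_Integration.integral_cong) (auto simp: algebra_simps)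
  moreover have "(LINT y|lborel. \<zeta> $ i * (b y * gexp \<zeta> y) + - (2 * of_real pi) * (b y * gmono [i] \<zeta> y) + ?b' y * gexp \<zeta> y) =
    \<zeta> $ i * (LINT y|lborel. b y * gexp \<zeta> y) + - (2 * of_real pi) * (LINT y|lborel. b y * gmono [i] \<zeta> y)
     + (LINT y|lborel. ?b' y * gexp \<zeta> y)"
    using int by simp
  ultimately have "\<zeta> $ i * (LINT y|lborel. b y * gexp \<zeta> y) + - (2 * of_real pi) * (LINT y|lborel. b y * gmono [i] \<zeta> y)
     + (LINT y|lborel. ?b' y * gexp \<zeta> y) = 0" by metis
  thus ?thesis by algebra
qed

lemma bargmann_creation:
  assumes b: "b \<in> schwartz" and c: "(\<lambda>y. 2 * of_real pi * (of_real (y $ i) * b y) + - 1 * pderiv_coord i b y) \<in> schwartz"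
  shows "bargmann (dist_of (\<lambda>y. 2 * of_real pi * (of_real (y $ i) * b y) + - 1 * pderiv_coord i b y)) \<zeta> =
    \<zeta> $ i * bargmann (dist_of b) \<zeta>"
proof -
  note s = b schwartz_pderiv_coord[OF b, of i] gexp_schwartz[of \<zeta>] gmono_schwartz[of "[i]" \<zeta>]
  have int: "integrable lborel (\<lambda>y. pderiv_coord i b y * gexp \<zeta> y)" "integrable lborel (\<lambda>y. b y * gmono [i] \<zeta> y)"
    by (intro sq_int_mult sq_int_schwartz s)+
  have "dist_of (\<lambda>y. 2 * of_real pi * (of_real (y $ i) * b y) + - 1 * pderiv_coord i b y) (gexp \<zeta>) =
     (LINT y|lborel. 2 * of_real pi * (b y * gmono [i] \<zeta> y) + - 1 * (pderiv_coord i b y * gexp \<zeta> y))"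
    unfolding dist_of_schwartz[OF gexp_schwartz schwartz_measurable[OF c]]
    by (intro Bochner_Integration.integral_cong) (auto simp: gmono_def algebra_simps)
  also have "\<dots> = 2 * of_real pi * (LINT y|lborel. b y * gmono [i] \<zeta> y) - (LINT y|lborel. pderiv_coord i b y * gexp \<zeta> y)"
    using int by simp
  also have "\<dots> = \<zeta> $ i * dist_of b (gexp \<zeta>)"
    by (simp add: integral_by_parts_gexp[OF b] dist_of_schwartz[OF gexp_schwartz schwartz_measurable[OF b]])
  finally show ?thesis by (simp add: bargmann_def)
qed

lemma dist_of_schwartz_tempered: "b \<in> schwartz \<Longrightarrow> dist_of b \<in> tempered"
  by (intro dist_of_tempered sq_int_schwartz)

text \<open>For the Gaussian itself, the derivative of the transform along every line vanishes, by an integration by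
  parts; this avoids the evaluation of a Gaussian integral with a complex exponent.\<close>

lemma bargmann_gauss: "bargmann (dist_of (gexp 0)) (\<zeta> :: complex ^ 'n::finite) = gauss_mass TYPE('n)"
proof -
  let ?h = "dist_of (gexp (0 :: complex ^ 'n))"
  have h: "?h \<in> tempered" by (rule dist_of_schwartz_tempered[OF gexp_schwartz])
  have ds: "?h \<phi> = (LINT y|lborel. gexp 0 y * \<phi> y)" if "\<phi> \<in> schwartz" for \<phi>
    by (rule dist_of_schwartz[OF that schwartz_measurable[OF gexp_schwartz]])
  have step: "?h (gmono [i] \<eta>) = \<eta> $ i / of_real (4 * pi) * ?h (gexp \<eta>)" for i \<eta>
  proof -
    have "pderiv_coord i (gexp 0) y = - (2 * of_real pi) * gmono [i] (0 :: complex ^ 'n) y" for y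
      unfolding pderiv_coord_def using vector_derivative_at[OF gexp_line_derivative[of 0 y i]] by simp
    moreover have "gmono [i] 0 y * gexp \<eta> y = gexp 0 y * gmono [i] \<eta> y" for y
      by (simp add: gmono_def)
    ultimately have "(LINT y|lborel. pderiv_coord i (gexp 0) y * gexp \<eta> y) =
        (LINT y|lborel. - (2 * of_real pi) * (gexp 0 y * gmono [i] \<eta> y))"
      by (intro Bochner_Integration.integral_cong) (auto simp: mult.assoc)
    hence "- (2 * of_real pi) * ?h (gmono [i] \<eta>) = 2 * of_real pi * ?h (gmono [i] \<eta>) - \<eta> $ i * ?h (gexp \<eta>)"
      using integral_by_parts_gexp[OF gexp_schwartz[of 0], of i \<eta>] by (simp add: ds gexp_schwartz gmono_schwartz)
    hence "4 * of_real pi * ?h (gmono [i] \<eta>) = \<eta> $ i * ?h (gexp \<eta>)" by (simp add: algebra_simps)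
    thus ?thesis by (simp add: field_simps)
  qed
  define f where "f = (\<lambda>\<tau>. bargmann ?h (\<tau> *s \<zeta>))"
  have "(f has_field_derivative 0) (at \<tau>)" for \<tau>
  proof -
    define E where "E = exp (- (\<tau>\<^sup>2 * csq \<zeta>) / of_real (8 * pi))"
    have HD: "((\<lambda>\<tau>. ?h (gexp (\<tau> *s \<zeta>))) has_field_derivative (\<Sum>i\<in>UNIV. \<zeta> $ i * ?h (gmono [i] (\<tau> *s \<zeta>)))) (at \<tau>)"
      using tempered_gmono_derivative[OF h, of "[]" 0 \<zeta> \<tau>] by (simp add: gmono_Nil)
    have ED: "((\<lambda>\<tau>. exp (- (\<tau>\<^sup>2 * csq \<zeta>) / of_real (8 * pi))) has_field_derivative E * (- (2 * \<tau> * csq \<zeta>) / of_real (8 * pi))) (at \<tau>)"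
      unfolding E_def by (rule derivative_eq_intros refl | simp)+
    have "(\<Sum>i\<in>UNIV. \<zeta> $ i * ?h (gmono [i] (\<tau> *s \<zeta>))) = \<tau> * csq \<zeta> / of_real (4 * pi) * ?h (gexp (\<tau> *s \<zeta>))"
      unfolding step by (simp add: csq_def sum_distrib_left sum_distrib_right sum_divide_distrib power2_eq_square mult_ac)
    moreover have "f = (\<lambda>\<tau>. exp (- (\<tau>\<^sup>2 * csq \<zeta>) / of_real (8 * pi)) * ?h (gexp (\<tau> *s \<zeta>)))"
      by (simp add: f_def bargmann_def csq_scale fun_eq_iff)
    ultimately show ?thesis using DERIV_mult[OF ED HD] by (simp add: E_def mult_ac)
  qed
  hence "\<exists>c. \<forall>\<tau>\<in>UNIV. f \<tau> = c"
    by (intro has_field_derivative_zero_constant convex_UNIV) auto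
  then obtain c where "\<And>\<tau>. f \<tau> = c" by auto
  hence "f 1 = f 0" by simp
  thus ?thesis by (simp add: f_def bargmann_def csq_def ds gexp_schwartz gauss_mass_def)
qed

lemma gauss_mass_nonzero: "gauss_mass TYPE('n::finite) \<noteq> 0"
proof -
  let ?g = "\<lambda>y :: real ^ 'n. exp (- 2 * pi * (norm y)\<^sup>2)"
  have e: "gexp 0 y * gexp 0 y = complex_of_real (?g y)" for y :: "real ^ 'n"
    unfolding gexp_def exp_of_real[symmetric] exp_add[symmetric] by (simp add: mult.assoc)
  have "integrable lborel (\<lambda>y. gexp 0 y * gexp (0 :: complex ^ 'n) y)"
    by (intro sq_int_mult sq_int_schwartz gexp_schwartz)
  hence i: "integrable lborel ?g" unfolding e by (simp add: complex_of_real_integrable_eq)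
  have "(LINT y|lborel. ?g y) \<noteq> 0"
  proof
    assume "(LINT y|lborel. ?g y) = 0"
    hence "AE y in lborel. ?g y = 0" using integral_nonneg_eq_0_iff_AE[OF i] by simp
    hence "AE y :: real ^ 'n in lborel. False" by simp
    thus False by (simp add: trivial_limit_def[symmetric] ae_filter_eq_bot_iff emeasure_lborel_UNIV)
  qed
  thus ?thesis unfolding gauss_mass_def e by (simp add: of_real_eq_0_iff)
qed

lemma bargmann_hermite: "bargmann (dist_of (hermite is)) (\<zeta> :: complex ^ 'n::finite) = zmono is \<zeta>"
proof (induction "is")
  case Nil
  let ?c = "inverse (gauss_mass TYPE('n))"
  have "(\<lambda>y. ?c * gexp (0 :: complex ^ 'n) y) \<in> schwartz" using hermite_schwartz[of "[] :: 'n list"] by simp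
  hence "dist_of (\<lambda>y. ?c * gexp (0 :: complex ^ 'n) y) (gexp \<zeta>) = (LINT y|lborel. ?c * (gexp 0 y * gexp \<zeta> y))"
    by (simp add: dist_of_schwartz[OF gexp_schwartz schwartz_measurable] mult.assoc)
  hence "bargmann (dist_of (hermite [])) \<zeta> = ?c * bargmann (dist_of (gexp 0)) \<zeta>"
    by (simp add: bargmann_def dist_of_schwartz[OF gexp_schwartz schwartz_measurable[OF gexp_schwartz]])
  thus ?case by (simp add: bargmann_gauss gauss_mass_nonzero zmono_def)
next
  case (Cons i "is")
  show ?case
    using bargmann_creation[OF hermite_schwartz[of "is"], of i \<zeta>] hermite_schwartz[of "i # is"] Cons
    by (simp add: zmono_def)
qed


section \<open>Bounds in terms of the modulation norm\<close>

lemma poly_gauss_bounded_gen: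
  fixes c :: real
  assumes "0 < c"
  shows "\<exists>C. 0 \<le> C \<and> (\<forall>t\<ge>0. (1 + t) ^ k * exp (- c * t\<^sup>2) \<le> C)"
proof -
  have "((\<lambda>t::real. (1 + t) ^ k * exp (- c * t\<^sup>2)) \<longlongrightarrow> 0) at_top" using assms by real_asymp
  hence "eventually (\<lambda>t. (1 + t) ^ k * exp (- c * t\<^sup>2) < 1) at_top" by (rule order_tendstoD) simp
  then obtain T where T: "\<And>t. T \<le> t \<Longrightarrow> (1 + t) ^ k * exp (- c * t\<^sup>2) < 1" by (auto simp: eventually_at_top_linorder)
  have "(1 + t) ^ k * exp (- c * t\<^sup>2) \<le> max 1 ((1 + max 0 T) ^ k)" if "0 \<le> t" for t
  proof (cases "T \<le> t")
    case True
    thus ?thesis using T[OF True] max.cobounded1[of 1 "(1 + max 0 T) ^ k"] by linarith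
  next
    case False
    have "(1 + t) ^ k * exp (- c * t\<^sup>2) \<le> (1 + max 0 T) ^ k * 1"
      using that False assms by (intro mult_mono power_mono) auto
    thus ?thesis by simp
  qed
  thus ?thesis by (intro exI[of _ "max 1 ((1 + max 0 T) ^ k)"]) auto
qed

lemma poly_weight_le_power:
  assumes "0 \<le> s" shows "\<exists>k. \<forall>z :: (real ^ 'n::finite) \<times> (real ^ 'n). poly_weight s z \<le> (1 + norm z) ^ k"
proof -
  obtain k where k: "s \<le> real k" using real_arch_simple by blast
  have "poly_weight s z \<le> (1 + norm z) ^ k" for z :: "(real ^ 'n) \<times> (real ^ 'n)"
  proof -
    have "(norm z)\<^sup>2 = (norm (fst z))\<^sup>2 + (norm (snd z))\<^sup>2" by (cases z) (simp add: norm_Pair)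
    hence "poly_weight s z = (1 + (norm z)\<^sup>2) powr (s / 2)" by (cases z) (simp add: poly_weight_def add.assoc)
    also have "\<dots> \<le> ((1 + norm z)\<^sup>2) powr (s / 2)"
      using assms by (intro powr_mono2) (auto simp: power2_sum)
    also have "\<dots> = (1 + norm z) powr s"
      by (simp add: powr_powr powr_numeral[symmetric] del: powr_numeral)
    also have "\<dots> \<le> (1 + norm z) powr real k" using k by (intro powr_mono) auto
    also have "\<dots> = (1 + norm z) ^ k" by (rule powr_realpow) (simp add: add_pos_nonneg)
    finally show ?thesis .
  qed
  thus ?thesis by blast
qed

lemma mixed_norm_decay_finite:
  assumes P: "1 \<le> P" "1 \<le> Q"
  shows "mixed_norm (ennreal P) (ennreal Q) (\<lambda>z :: (real ^ 'n::finite) \<times> (real ^ 'n). ennreal (decay (fst z) * decay (snd z))) < \<infinity>"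
proof -
  have L: "Lp_norm (ennreal R) lborel (\<lambda>x :: real ^ 'n. ennreal (decay x)) < \<infinity>" if R: "1 \<le> R" for R
  proof -
    have "(\<integral>\<^sup>+x. enn_powr (ennreal (decay (x :: real ^ 'n))) R \<partial>lborel) \<le> (\<integral>\<^sup>+x. ennreal (decay (x :: real ^ 'n)) \<partial>lborel)"
    proof (rule nn_integral_mono)
      fix x :: "real ^ 'n"
      have "decay x powr R \<le> decay x powr 1" using decay_pos[of x] decay_le_1[of x] R by (intro powr_mono') auto
      thus "enn_powr (ennreal (decay x)) R \<le> ennreal (decay x)"
        using decay_pos[of x] by (simp add: enn_powr_ennreal ennreal_leI)
    qed
    also have "\<dots> < \<infinity>"
      by (subst nn_integral_eq_integral[OF integrable_decay]) (auto simp: decay_pos less_imp_le)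
    finally show ?thesis using R enn_powr_eq_top_iff by (simp add: Lp_norm_finite less_top[symmetric])
  qed
  have "mixed_norm (ennreal P) (ennreal Q) (\<lambda>z :: (real ^ 'n) \<times> (real ^ 'n). ennreal (decay (fst z) * decay (snd z))) =
     Lp_norm (ennreal Q) lborel (\<lambda>\<xi> :: real ^ 'n. Lp_norm (ennreal P) lborel (\<lambda>x :: real ^ 'n. ennreal (decay x)) * ennreal (decay \<xi>))"
  proof -
    have "(\<lambda>x :: real ^ 'n. ennreal (decay x * decay \<xi>)) = (\<lambda>x. ennreal (decay \<xi>) * ennreal (decay x))" for \<xi> :: "real ^ 'n"
      by (simp add: fun_eq_iff ennreal_mult less_imp_le[OF decay_pos] mult.commute)
    thus ?thesis unfolding mixed_norm_def using P by (simp add: Lp_norm_cmult mult.commute)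
  qed
  also have "\<dots> = Lp_norm (ennreal P) lborel (\<lambda>x :: real ^ 'n. ennreal (decay x)) * Lp_norm (ennreal Q) lborel (\<lambda>x :: real ^ 'n. ennreal (decay x))"
    using P by (intro Lp_norm_cmult) auto
  also have "\<dots> < \<infinity>" using L[OF P(1)] L[OF P(2)] by (simp add: ennreal_mult_less_top)
  finally show ?thesis .
qed

text \<open>The weight has polynomial growth, which the Gaussian absorbs.\<close>

lemma mixed_norm_gauss_finite:
  fixes w :: "(real ^ 'n::finite) \<times> (real ^ 'n) \<Rightarrow> real"
  assumes P: "1 \<le> P" "1 \<le> Q" and s: "0 \<le> s" "\<And>z z'. w (z + z') \<le> poly_weight s z * w z'" and w: "\<And>z. 1 \<le> w z" and c: "0 < c"
  shows "mixed_norm (ennreal P) (ennreal Q) (\<lambda>z. ennreal ((1 + norm z) ^ k * exp (- c * (norm z)\<^sup>2) * w z)) < \<infinity>"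
proof -
  obtain l where l: "\<And>z :: (real ^ 'n) \<times> (real ^ 'n). poly_weight s z \<le> (1 + norm z) ^ l" using poly_weight_le_power[OF s(1)] by blast
  define N where "N = 2 * CARD('n)"
  obtain C where C: "0 \<le> C" "\<And>t. 0 \<le> t \<Longrightarrow> (1 + t) ^ (k + l + (N + N)) * exp (- c * t\<^sup>2) \<le> C"
    using poly_gauss_bounded_gen[OF c] by blast
  have w0: "0 \<le> w 0" using w[of 0] by simp
  have "(1 + norm z) ^ k * exp (- c * (norm z)\<^sup>2) * w z \<le> C * w 0 * (decay (fst z) * decay (snd z))" for z
  proof -
    have z1: "1 \<le> 1 + norm z" by simp
    hence z2: "1 + norm z \<noteq> 0" by linarith
    have "w z \<le> (1 + norm z) ^ l * w 0"
      using s(2)[of z 0] mult_right_mono[OF l[of z] w0] by simp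
    hence "(1 + norm z) ^ k * exp (- c * (norm z)\<^sup>2) * w z \<le> (1 + norm z) ^ k * exp (- c * (norm z)\<^sup>2) * ((1 + norm z) ^ l * w 0)"
      by (intro mult_left_mono) auto
    also have "\<dots> = ((1 + norm z) ^ (k + l + (N + N)) * exp (- c * (norm z)\<^sup>2)) * w 0 / (1 + norm z) ^ (N + N)"
      using z2 by (simp add: power_add)
    also have "\<dots> \<le> C * w 0 / (1 + norm z) ^ (N + N)"
      using z1 w0 by (intro divide_right_mono mult_right_mono C) auto
    also have "\<dots> \<le> C * w 0 * (decay (fst z) * decay (snd z))"
    proof -
      have "(1 + norm (fst z)) ^ N * (1 + norm (snd z)) ^ N \<le> (1 + norm z) ^ N * (1 + norm z) ^ N"
        using norm_fst_le[of "fst z" "snd z"] norm_snd_le[of "snd z" "fst z"] by (intro mult_mono power_mono) auto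
      hence "1 / (1 + norm z) ^ (N + N) \<le> decay (fst z) * decay (snd z)"
        by (simp add: decay_def N_def[symmetric] power_add) (intro divide_left_mono mult_pos_pos zero_less_power; simp add: add_pos_nonneg)
      from mult_left_mono[OF this, of "C * w 0"] show ?thesis using C w0 by simp
    qed
    finally show ?thesis .
  qed
  hence "mixed_norm (ennreal P) (ennreal Q) (\<lambda>z. ennreal ((1 + norm z) ^ k * exp (- c * (norm z)\<^sup>2) * w z)) \<le>
     mixed_norm (ennreal P) (ennreal Q) (\<lambda>z :: (real ^ 'n) \<times> (real ^ 'n). ennreal (C * w 0) * ennreal (decay (fst z) * decay (snd z)))"
    using C w0 decay_pos by (intro mixed_norm_mono P) (simp add: ennreal_mult'[symmetric] ennreal_leI)
  also have "\<dots> = ennreal (C * w 0) * mixed_norm (ennreal P) (ennreal Q) (\<lambda>z :: (real ^ 'n) \<times> (real ^ 'n). ennreal (decay (fst z) * decay (snd z)))"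
  proof (rule mixed_norm_cmult[OF P])
    have "continuous_on UNIV (\<lambda>z :: (real ^ 'n) \<times> (real ^ 'n). decay (fst z) * decay (snd z))"
      by (intro continuous_intros continuous_on_compose2[OF decay_continuous]) auto
    hence "(\<lambda>z :: (real ^ 'n) \<times> (real ^ 'n). decay (fst z) * decay (snd z)) \<in> borel_measurable borel"
      by (rule borel_measurable_continuous_onI)
    thus "(\<lambda>z :: (real ^ 'n) \<times> (real ^ 'n). ennreal (decay (fst z) * decay (snd z))) \<in> borel_measurable borel" by measurable
  qed
  also have "\<dots> < \<infinity>" using mixed_norm_decay_finite[OF P, where 'n = 'n] by (simp add: ennreal_mult_less_top)
  finally show ?thesis .
qed

text \<open>Values at monomial multiples of Gaussians are derivatives of values at Gaussians, which are bounded
  because they are values of the short-time Fourier transform.\<close>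

lemma tempered_gmono_bound:
  fixes js :: "'n::finite list"
  assumes K: "\<And>h z. h \<in> D \<Longrightarrow> h \<in> tempered \<and> cmod (gstft h z) \<le> N h"
  shows "\<exists>C. \<forall>h\<in>D. \<forall>\<eta> :: complex ^ 'n. norm \<eta> \<le> R \<longrightarrow> cmod (h (gmono js \<eta>)) \<le> C * N h"
proof (induction js arbitrary: R)
  case Nil
  let ?a = "2 powr (real CARD('n) / 4)"
  have "cmod (h (gmono [] \<eta>)) \<le> (exp (pi * R\<^sup>2) / ?a) * N h" if h: "h \<in> D" and \<eta>: "norm \<eta> \<le> R" for h and \<eta> :: "complex ^ 'n"
  proof -
    define z :: "(real ^ 'n) \<times> (real ^ 'n)" where "z = (\<chi> i. Re (\<eta> $ i) / (2 * pi), \<chi> i. - Im (\<eta> $ i))"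
    have z: "zpoint z = \<eta>" by (simp add: zpoint_def z_def vec_eq_iff complex_eq_iff)
    have "norm (fst z) \<le> R" using norm_zpoint_bounds(2)[of z] \<eta> z by simp
    hence "(norm (fst z))\<^sup>2 \<le> R\<^sup>2" by (intro power_mono) auto
    hence e: "exp (- (pi * R\<^sup>2)) \<le> exp (- pi * (norm (fst z))\<^sup>2)" by simp
    have "gstft h z = of_real (?a * exp (- pi * (norm (fst z))\<^sup>2)) * h (gexp \<eta>)"
      using stft_gauss[of h "fst z" "snd z"] K[OF h] by (simp add: bfactor_def bargmann_def z exp_minus)
    hence "?a * exp (- pi * (norm (fst z))\<^sup>2) * cmod (h (gexp \<eta>)) \<le> N h"
      using K[OF h, of z] by (simp add: norm_mult)
    moreover have "?a * exp (- (pi * R\<^sup>2)) * cmod (h (gexp \<eta>)) \<le> ?a * exp (- pi * (norm (fst z))\<^sup>2) * cmod (h (gexp \<eta>))"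
      using e by (intro mult_right_mono mult_left_mono) auto
    ultimately have "?a * exp (- (pi * R\<^sup>2)) * cmod (h (gexp \<eta>)) \<le> N h" by linarith
    thus ?thesis by (simp add: gmono_Nil exp_minus field_simps)
  qed
  thus ?case by blast
next
  case (Cons i js)
  then obtain C where C: "\<And>h \<eta>. h \<in> D \<Longrightarrow> norm \<eta> \<le> R + 1 \<Longrightarrow> cmod (h (gmono js \<eta>)) \<le> C * N h" by blast
  have "cmod (h (gmono (i # js) \<eta>)) \<le> C * N h" if h: "h \<in> D" and \<eta>: "norm \<eta> \<le> R" for h \<eta>
  proof -
    have t: "h \<in> tempered" using K[OF h] by blast
    let ?f = "\<lambda>\<tau>. h (gmono js (\<eta> + \<tau> *s axis i 1))"
    have d: "(?f has_field_derivative (\<Sum>j\<in>UNIV. axis i 1 $ j * h (gmono (j # js) (\<eta> + \<tau> *s axis i 1)))) (at \<tau>)" for \<tau>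
      by (rule tempered_gmono_derivative[OF t])
    hence hol: "?f holomorphic_on UNIV" by (auto simp: holomorphic_on_open)
    have "(\<Sum>j\<in>UNIV. axis i 1 $ j * h (gmono (j # js) \<eta>)) = h (gmono (i # js) \<eta>)"
      by (simp add: axis_def if_distrib[of "\<lambda>x. x * _"] cong: if_cong)
    hence der: "deriv ?f 0 = h (gmono (i # js) \<eta>)" using DERIV_imp_deriv[OF d[of 0]] by simp
    have "norm ((deriv ^^ 1) ?f 0) \<le> fact 1 * (C * N h) / 1 ^ 1"
    proof (rule Cauchy_inequality)
      show "?f holomorphic_on ball 0 1" using hol holomorphic_on_subset by blast
      show "continuous_on (cball 0 1) ?f" using holomorphic_on_imp_continuous_on[OF hol] continuous_on_subset by blast
      fix \<tau> :: complex assume "cmod (0 - \<tau>) = 1"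
      hence "norm (\<tau> *s axis i (1::complex)) = 1" by (simp add: norm_vector_scalar_mult norm_axis_1)
      hence "norm (\<eta> + \<tau> *s axis i 1) \<le> R + 1" using norm_triangle_ineq[of \<eta> "\<tau> *s axis i 1"] \<eta> by simp
      thus "cmod (?f \<tau>) \<le> C * N h" by (rule C[OF h])
    qed simp
    thus ?thesis using der by simp
  qed
  thus ?case by blast
qed


section \<open>Finite-rank approximation of the identity\<close>

text \<open>A triple stands for the rank one operator with left factor a Hermite function and right factor the value at a
  monomial times the standard Gaussian.\<close>

definition finrank :: "(complex \<times> 'n list \<times> 'n list) list \<Rightarrow> ((real ^ 'n::finite \<Rightarrow> complex) \<Rightarrow> complex) \<Rightarrow>
    (real ^ 'n \<Rightarrow> complex) \<Rightarrow> complex" where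
  "finrank M h = (\<lambda>\<phi>. \<Sum>(c, is, js)\<leftarrow>M. c * h (gmono js 0) * dist_of (hermite is) \<phi>)"

lemma tempered_linear:
  assumes h: "h1 \<in> tempered" "h2 \<in> tempered"
  shows "(\<lambda>\<phi>. a * h1 \<phi> + b * h2 \<phi>) \<in> tempered"
proof -
  have "\<exists>C N. \<forall>\<phi>\<in>schwartz. cmod (h1 \<phi>) \<le> C * schwartz_norm N \<phi>" "\<exists>C N. \<forall>\<phi>\<in>schwartz. cmod (h2 \<phi>) \<le> C * schwartz_norm N \<phi>"
    using h by (simp_all add: tempered_def)
  then obtain C1 N1 C2 N2 where C: "\<And>\<phi>. \<phi> \<in> schwartz \<Longrightarrow> cmod (h1 \<phi>) \<le> C1 * schwartz_norm N1 \<phi>"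
    "\<And>\<phi>. \<phi> \<in> schwartz \<Longrightarrow> cmod (h2 \<phi>) \<le> C2 * schwartz_norm N2 \<phi>" by blast
  have mono: "schwartz_norm N \<phi> \<le> real (card {is :: 'a list. length is \<le> N}) * schwartz_norm M \<phi>"
    if "\<phi> \<in> schwartz" "N \<le> M" for N M and \<phi> :: "real ^ 'a \<Rightarrow> complex"
  proof -
    have "schwartz_norm N \<phi> \<le> (\<Sum>is :: 'a list | length is \<le> N. schwartz_norm M \<phi>)"
      unfolding schwartz_norm_def[of N]
      by (intro sum_mono cSUP_least schwartz_norm_bound) (use that in auto)
    thus ?thesis by simp
  qed
  define M where "M = max N1 N2"
  define k1 where "k1 = real (card {is :: 'a list. length is \<le> N1})"
  define k2 where "k2 = real (card {is :: 'a list. length is \<le> N2})"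
  have "cmod (a * h1 \<phi> + b * h2 \<phi>) \<le> (cmod a * (\<bar>C1\<bar> * k1) + cmod b * (\<bar>C2\<bar> * k2)) * schwartz_norm M \<phi>"
    if s: "\<phi> \<in> schwartz" for \<phi>
  proof -
    have "C1 * schwartz_norm N1 \<phi> \<le> \<bar>C1\<bar> * (k1 * schwartz_norm M \<phi>)" "C2 * schwartz_norm N2 \<phi> \<le> \<bar>C2\<bar> * (k2 * schwartz_norm M \<phi>)"
      using mono[OF s, of N1 M] mono[OF s, of N2 M] schwartz_norm_nonneg[OF s]
      by (auto simp: M_def k1_def k2_def intro!: mult_mono)
    hence "cmod (h1 \<phi>) \<le> \<bar>C1\<bar> * (k1 * schwartz_norm M \<phi>)" "cmod (h2 \<phi>) \<le> \<bar>C2\<bar> * (k2 * schwartz_norm M \<phi>)"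
      using C[OF s] by linarith+
    hence "cmod (a * h1 \<phi>) + cmod (b * h2 \<phi>) \<le> cmod a * (\<bar>C1\<bar> * (k1 * schwartz_norm M \<phi>)) + cmod b * (\<bar>C2\<bar> * (k2 * schwartz_norm M \<phi>))"
      unfolding norm_mult by (intro add_mono mult_left_mono) auto
    thus ?thesis using norm_triangle_ineq[of "a * h1 \<phi>" "b * h2 \<phi>"] by (simp add: algebra_simps)
  qed
  hence "\<exists>C N. \<forall>\<phi>\<in>schwartz. cmod (a * h1 \<phi> + b * h2 \<phi>) \<le> C * schwartz_norm N \<phi>" by blast
  moreover have "h \<phi> = 0" if "h \<in> tempered" "\<phi> \<notin> schwartz" for h and \<phi> :: "real ^ 'a \<Rightarrow> complex"
    using that by (simp add: tempered_def)
  ultimately show ?thesis using h unfolding tempered_def[of] mem_Collect_eq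
    by (auto simp: tempered_add[OF h(1)] tempered_add[OF h(2)] tempered_cmult[OF h(1)] tempered_cmult[OF h(2)] algebra_simps)
qed

lemma tempered_zero: "(\<lambda>_. 0) \<in> tempered"
  by (auto simp: tempered_def intro!: exI[of _ 0])

lemma finrank_simps:
  "finrank [] h = (\<lambda>_. 0)"
  "finrank ((c, is, js) # M) h = (\<lambda>\<phi>. (c * h (gmono js 0)) * dist_of (hermite is) \<phi> + 1 * finrank M h \<phi>)"
  by (simp_all add: finrank_def)

lemma finrank_tempered: "finrank M h \<in> tempered"
proof (induction M)
  case Nil thus ?case by (simp add: finrank_simps tempered_zero)
next
  case (Cons t M)
  obtain c "is" js where t: "t = (c, is, js)" by (cases t)
  show ?case unfolding t finrank_simps
    by (intro tempered_linear dist_of_schwartz_tempered hermite_schwartz Cons)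
qed

lemma bargmann_linear:
  "bargmann (\<lambda>\<phi>. a * h1 \<phi> + b * h2 \<phi>) \<zeta> = a * bargmann h1 \<zeta> + b * bargmann h2 \<zeta>"
  by (simp add: bargmann_def algebra_simps)

lemma bargmann_finrank:
  "bargmann (finrank M h) \<zeta> = (\<Sum>(c, is, js)\<leftarrow>M. c * zmono is \<zeta> * h (gmono js 0))"
proof (induction M)
  case Nil thus ?case by (simp add: finrank_simps bargmann_def)
next
  case (Cons t M)
  obtain c "is" js where t: "t = (c, is, js)" by (cases t)
  show ?case unfolding t finrank_simps bargmann_linear by (simp add: Cons bargmann_hermite)
qed

text \<open>Hermite functions have monomials as Bargmann transforms, and the Taylor coefficients are values at monomials times
  the standard Gaussian.\<close>

lemma finrank_taylor_polynomial:
  "\<exists>M :: (complex \<times> 'n::finite list \<times> 'n list) list. \<forall>h\<in>tempered. \<forall>\<zeta>. bargmann (finrank M h) \<zeta> =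
     (\<Sum>k<K. (deriv ^^ k) (\<lambda>\<tau>. bargmann h (\<tau> *s \<zeta>)) 0 / fact k * \<rho> ^ k)"
proof (induction K)
  case 0
  show ?case by (intro exI[of _ "[]"]) (simp add: finrank_simps bargmann_def)
next
  case (Suc K)
  then obtain M :: "(complex \<times> 'n list \<times> 'n list) list" where M: "\<And>h \<zeta>. h \<in> tempered \<Longrightarrow> bargmann (finrank M h) \<zeta> =
     (\<Sum>k<K. (deriv ^^ k) (\<lambda>\<tau>. bargmann h (\<tau> *s \<zeta>)) 0 / fact k * \<rho> ^ k)" by blast
  obtain L :: "(complex \<times> 'n list \<times> 'n list) list" where L: "\<And>h \<zeta>. h \<in> tempered \<Longrightarrow>
     (deriv ^^ K) (\<lambda>\<tau>. bargmann h (\<tau> *s \<zeta>)) 0 = (\<Sum>(c, is, js)\<leftarrow>L. c * zmono is \<zeta> * h (gmono js 0))"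
    using bargmann_taylor_coefficient[of K] by blast
  have "bargmann (finrank (map (\<lambda>(c, is, js). (\<rho> ^ K / fact K * c, is, js)) L @ M) h) \<zeta> =
     \<rho> ^ K / fact K * (\<Sum>(c, is, js)\<leftarrow>L. c * zmono is \<zeta> * h (gmono js 0)) + bargmann (finrank M h) \<zeta>" for h \<zeta>
    unfolding bargmann_finrank by (simp add: o_def case_prod_unfold sum_list_const_mult[symmetric] mult.assoc)
  thus ?case using M L
    by (intro exI[of _ "map (\<lambda>(c, is, js). (\<rho> ^ K / fact K * c, is, js)) L @ M"]) (simp add: mult_ac)
qed

lemma zpoint_surj: "\<exists>z. zpoint z = \<zeta>"
  by (intro exI[of _ "(\<chi> i. Re (\<zeta> $ i) / (2 * pi), \<chi> i. - Im (\<zeta> $ i))"])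
     (simp add: zpoint_def vec_eq_iff complex_eq_iff)

text \<open>Cauchy's estimate on the circle of radius \<open>sqrt \<rho>\<close>, where the function still grows more slowly than the Gaussian
  that compensates it.\<close>

lemma bargmann_taylor_remainder:
  fixes h :: "(real ^ 'n::finite \<Rightarrow> complex) \<Rightarrow> complex"
  assumes h: "h \<in> tempered" and A: "\<And>z. cmod (gstft h z) \<le> A" and \<rho>: "0 < \<rho>" "\<rho> < 1"
  shows "cmod (bargmann h (of_real \<rho> *s \<zeta>) - (\<Sum>k<K. (deriv ^^ k) (\<lambda>\<tau>. bargmann h (\<tau> *s \<zeta>)) 0 / fact k * of_real \<rho> ^ k))
    \<le> A / 2 powr (real CARD('n) / 4) * exp (\<rho> * (norm \<zeta>)\<^sup>2 / (8 * pi)) * (sqrt \<rho> ^ K / (1 - sqrt \<rho>))"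
proof -
  let ?a = "2 powr (real CARD('n) / 4)"
  define f where "f = (\<lambda>\<tau>. bargmann h (\<tau> *s \<zeta>))"
  define B where "B = A / ?a * exp (\<rho> * (norm \<zeta>)\<^sup>2 / (8 * pi))"
  define q where "q = sqrt \<rho>"
  have l: "0 < q" "q < 1" "q * q = \<rho>" "q\<^sup>2 = \<rho>" using \<rho> by (auto simp: q_def)
  have hol: "f holomorphic_on UNIV" unfolding f_def using bargmann_holomorphic[OF h, of 0 \<zeta>] by simp
  have bd: "cmod (bargmann h \<eta>) \<le> A / ?a * exp ((norm \<eta>)\<^sup>2 / (8 * pi))" for \<eta>
  proof -
    obtain z where z: "zpoint z = \<eta>" using zpoint_surj by blast
    have "?a * exp (- (norm \<eta>)\<^sup>2 / (8 * pi)) * cmod (bargmann h \<eta>) \<le> A"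
      using A[of z] by (simp add: norm_gstft[OF h] z)
    thus ?thesis by (simp add: exp_minus field_simps)
  qed
  have trm: "cmod ((deriv ^^ k) f 0 / fact k * of_real \<rho> ^ k) \<le> B * q ^ k" for k
  proof -
    have "norm ((deriv ^^ k) f 0) \<le> fact k * B / q ^ k"
    proof (rule Cauchy_inequality[OF _ _ l(1)])
      show "f holomorphic_on ball 0 q" using hol holomorphic_on_subset by blast
      show "continuous_on (cball 0 q) f" using holomorphic_on_imp_continuous_on[OF hol] continuous_on_subset by blast
      fix \<tau> :: complex assume "cmod (0 - \<tau>) = q"
      hence "(norm (\<tau> *s \<zeta>))\<^sup>2 = \<rho> * (norm \<zeta>)\<^sup>2" using l by (simp add: norm_vector_scalar_mult power_mult_distrib)
      thus "cmod (f \<tau>) \<le> B" using bd[of "\<tau> *s \<zeta>"] by (simp add: f_def B_def)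
    qed
    hence "cmod ((deriv ^^ k) f 0) / fact k * \<rho> ^ k \<le> fact k * B / q ^ k / fact k * \<rho> ^ k"
      using \<rho> by (intro mult_right_mono divide_right_mono) auto
    also have "\<dots> = B * q ^ k" using l by (simp add: l(3)[symmetric] power_mult_distrib del: l(3))
    finally show ?thesis using \<rho> by (simp add: norm_mult norm_divide norm_power)
  qed
  have "((\<lambda>k. (deriv ^^ k) f 0 / fact k * (of_real \<rho> - 0) ^ k) sums f (of_real \<rho>))"
    using hol holomorphic_on_subset by (intro holomorphic_power_series[where r = 2]) (use \<rho> in auto)
  hence S: "(\<lambda>k. (deriv ^^ k) f 0 / fact k * of_real \<rho> ^ k) sums f (of_real \<rho>)" by simp
  let ?t = "\<lambda>k. (deriv ^^ k) f 0 / fact k * of_real \<rho> ^ k"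
  have eq: "f (of_real \<rho>) - (\<Sum>k<K. ?t k) = (\<Sum>k. ?t (k + K))"
    using S by (subst suminf_minus_initial_segment) (auto simp: sums_iff)
  have g: "summable (\<lambda>k. B * q ^ K * q ^ k)" using l by (intro summable_mult summable_geometric) auto
  have "cmod (\<Sum>k. ?t (k + K)) \<le> (\<Sum>k. B * q ^ K * q ^ k)"
  proof (rule norm_suminf_le[OF _ g])
    show "cmod (?t (k + K)) \<le> B * q ^ K * q ^ k" for k using trm[of "k + K"] by (simp add: power_add mult_ac)
  qed
  also have "\<dots> = B * (q ^ K / (1 - q))" using l by (simp add: suminf_mult suminf_geometric summable_geometric)
  finally show ?thesis using eq by (simp add: f_def B_def q_def)
qed

context
  fixes w :: "(real ^ 'n::finite) \<times> (real ^ 'n) \<Rightarrow> real" and P Q s :: real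
  assumes P: "1 \<le> P" "1 \<le> Q" and s: "0 \<le> s" "\<And>z z'. w (z + z') \<le> poly_weight s z * w z'"
    and w1: "\<And>z. 1 \<le> w z" and wc: "continuous_on UNIV w"
begin

abbreviation MN :: "((real ^ 'n) \<times> (real ^ 'n) \<Rightarrow> complex) \<Rightarrow> ennreal" where
  "MN F \<equiv> mixed_norm (ennreal P) (ennreal Q) (\<lambda>z. ennreal (cmod (F z) * w z))"

abbreviation dilate :: "real \<Rightarrow> ((real ^ 'n \<Rightarrow> complex) \<Rightarrow> complex) \<Rightarrow> (real ^ 'n) \<times> (real ^ 'n) \<Rightarrow> complex" where
  "dilate \<rho> h z \<equiv> bfactor z * bargmann h (of_real \<rho> *s zpoint z)"

lemma w_nonneg: "0 \<le> w z" using w1[of z] by simp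

lemma weighted_measurable:
  assumes "continuous_on UNIV F" shows "(\<lambda>z. ennreal (cmod (F z) * w z)) \<in> borel_measurable borel"
proof -
  have "(\<lambda>z. cmod (F z) * w z) \<in> borel_measurable borel"
    by (intro borel_measurable_continuous_onI continuous_intros assms wc)
  thus ?thesis by measurable
qed

lemma dilate_continuous: "h \<in> tempered \<Longrightarrow> continuous_on UNIV (dilate \<rho> h)"
  by (intro continuous_intros bfactor_continuous continuous_on_compose2[OF bargmann_continuous] zpoint_continuous)
     (auto simp: vector_scalar_mult_def intro!: continuous_intros zpoint_continuous)

lemma poly_weight_gauss_bounded:
  "\<exists>C\<ge>0. \<forall>z :: (real ^ 'n) \<times> (real ^ 'n). poly_weight s z * exp (- (norm z)\<^sup>2 / (8 * pi)) \<le> C"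
proof -
  obtain l where l: "\<And>z :: (real ^ 'n) \<times> (real ^ 'n). poly_weight s z \<le> (1 + norm z) ^ l" using poly_weight_le_power[OF s(1)] by blast
  obtain C where C: "0 \<le> C" "\<And>t::real. 0 \<le> t \<Longrightarrow> (1 + t) ^ l * exp (- (1 / (8 * pi)) * t\<^sup>2) \<le> C"
    using poly_gauss_bounded_gen[of "1 / (8 * pi)" l] by auto
  have "poly_weight s z * exp (- (norm z)\<^sup>2 / (8 * pi)) \<le> C" for z :: "(real ^ 'n) \<times> (real ^ 'n)"
  proof -
    have "poly_weight s z * exp (- (norm z)\<^sup>2 / (8 * pi)) \<le> (1 + norm z) ^ l * exp (- (norm z)\<^sup>2 / (8 * pi))"
      by (intro mult_right_mono l) auto
    also have "\<dots> \<le> C" using C(2)[of "norm z"] by simp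
    finally show ?thesis .
  qed
  thus ?thesis using C(1) by blast
qed

text \<open>The Gaussian factor that appears when the Bargmann transform is dilated by \<open>\<rho>\<close> absorbs the ratio of the weights at \<open>z\<close> and \<open>\<rho> z\<close>.\<close>

lemma dilate_bound:
  "\<exists>C\<ge>0. \<forall>h\<in>tempered. \<forall>\<rho> z. 1 / 2 \<le> \<rho> \<longrightarrow> \<rho> < 1 \<longrightarrow>
     cmod (dilate \<rho> h z) * w z \<le> C * (cmod (gstft h (\<rho> *\<^sub>R z)) * w (\<rho> *\<^sub>R z))"
proof -
  obtain C where C: "0 \<le> C" "\<And>z :: (real ^ 'n) \<times> (real ^ 'n). poly_weight s z * exp (- (norm z)\<^sup>2 / (8 * pi)) \<le> C"
    using poly_weight_gauss_bounded by blast
  have "cmod (dilate \<rho> h z) * w z \<le> C * (cmod (gstft h (\<rho> *\<^sub>R z)) * w (\<rho> *\<^sub>R z))"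
    if h: "h \<in> tempered" and \<rho>: "1 / 2 \<le> \<rho>" "\<rho> < 1" for h \<rho> z
  proof -
    let ?a = "2 powr (real CARD('n) / 4)" and ?z = "(1 - \<rho>) *\<^sub>R z"
    have e: "exp (- (norm (zpoint z))\<^sup>2 / (8 * pi)) = exp (- ((1 - \<rho>\<^sup>2) * (norm (zpoint z))\<^sup>2) / (8 * pi)) * exp (- (norm (zpoint (\<rho> *\<^sub>R z)))\<^sup>2 / (8 * pi))"
      unfolding exp_add[symmetric] zpoint_linear norm_vector_scalar_mult by (simp add: power_mult_distrib field_simps)
    have "cmod (dilate \<rho> h z) = exp (- ((1 - \<rho>\<^sup>2) * (norm (zpoint z))\<^sup>2) / (8 * pi)) * cmod (gstft h (\<rho> *\<^sub>R z))"
      unfolding norm_mult norm_bfactor norm_gstft[OF h] e zpoint_linear by (simp only: mult_ac)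
    also have "\<dots> \<le> exp (- (norm ?z)\<^sup>2 / (8 * pi)) * cmod (gstft h (\<rho> *\<^sub>R z))"
    proof (rule mult_right_mono)
      have "(1 - \<rho>)\<^sup>2 \<le> 1 - \<rho>\<^sup>2" using \<rho> mult_right_mono[of \<rho> 1 \<rho>] by (simp add: power2_eq_square algebra_simps)
      moreover have "(norm z)\<^sup>2 \<le> (norm (zpoint z))\<^sup>2" using norm_zpoint_bounds(4)[of z] by (intro power_mono) auto
      moreover have "0 \<le> 1 - \<rho>\<^sup>2" using \<rho> by (simp add: power_le_one)
      ultimately have "(1 - \<rho>)\<^sup>2 * (norm z)\<^sup>2 \<le> (1 - \<rho>\<^sup>2) * (norm (zpoint z))\<^sup>2"
        by (intro mult_mono) auto
      thus "exp (- ((1 - \<rho>\<^sup>2) * (norm (zpoint z))\<^sup>2) / (8 * pi)) \<le> exp (- (norm ?z)\<^sup>2 / (8 * pi))"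
        unfolding exp_le_cancel_iff by (intro divide_right_mono) (simp_all add: power_mult_distrib)
    qed simp
    finally have "cmod (dilate \<rho> h z) * w z \<le> exp (- (norm ?z)\<^sup>2 / (8 * pi)) * cmod (gstft h (\<rho> *\<^sub>R z)) * (poly_weight s ?z * w (\<rho> *\<^sub>R z))"
      using s(2)[of ?z "\<rho> *\<^sub>R z"] w_nonneg by (intro mult_mono) (auto simp: algebra_simps)
    also have "\<dots> = (poly_weight s ?z * exp (- (norm ?z)\<^sup>2 / (8 * pi))) * (cmod (gstft h (\<rho> *\<^sub>R z)) * w (\<rho> *\<^sub>R z))"
      by (simp only: mult_ac)
    also have "\<dots> \<le> C * (cmod (gstft h (\<rho> *\<^sub>R z)) * w (\<rho> *\<^sub>R z))"
      using w_nonneg by (intro mult_right_mono C) auto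
    finally show ?thesis .
  qed
  thus ?thesis using C(1) by blast
qed

lemma gstft_dilate_1: "h \<in> tempered \<Longrightarrow> gstft h z = dilate 1 h z"
  using stft_gauss[of h "fst z" "snd z"] by simp

lemma MN_triangle:
  assumes "continuous_on UNIV F" "continuous_on UNIV G" "\<And>z. cmod (H z) \<le> cmod (F z) + cmod (G z)"
  shows "MN H \<le> MN F + MN G"
proof -
  have "MN H \<le> mixed_norm (ennreal P) (ennreal Q) (\<lambda>z. ennreal (cmod (F z) * w z) + ennreal (cmod (G z) * w z))"
  proof (rule mixed_norm_mono[OF P])
    fix z
    have "cmod (H z) * w z \<le> cmod (F z) * w z + cmod (G z) * w z"
      using mult_right_mono[OF assms(3)[of z] w_nonneg[of z]] by (simp add: distrib_right)
    thus "ennreal (cmod (H z) * w z) \<le> ennreal (cmod (F z) * w z) + ennreal (cmod (G z) * w z)"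
      using w_nonneg by (simp add: ennreal_plus[symmetric] ennreal_leI del: ennreal_plus)
  qed
  also have "\<dots> \<le> MN F + MN G"
    by (intro mixed_norm_triangle[OF P] weighted_measurable assms)
  finally show ?thesis .
qed

text \<open>The constant is uniform in \<open>\<rho>\<close> because the mixed norm of a dilation is controlled for \<open>\<rho>\<close> away from 0.\<close>

lemma dilate_MN_bound:
  "\<exists>C\<ge>0. \<forall>h\<in>tempered. \<forall>\<rho>. 1 / 2 \<le> \<rho> \<longrightarrow> \<rho> < 1 \<longrightarrow> MN (dilate \<rho> h) \<le> ennreal C * MN (gstft h)"
proof -
  obtain C where C: "0 \<le> C" "\<And>h \<rho> z. h \<in> tempered \<Longrightarrow> 1 / 2 \<le> \<rho> \<Longrightarrow> \<rho> < 1 \<Longrightarrow>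
     cmod (dilate \<rho> h z) * w z \<le> C * (cmod (gstft h (\<rho> *\<^sub>R z)) * w (\<rho> *\<^sub>R z))" using dilate_bound by blast
  define D :: real where "D = 2 ^ (DIM(real ^ 'n) + DIM(real ^ 'n))"
  have "MN (dilate \<rho> h) \<le> ennreal (C * D) * MN (gstft h)" if h: "h \<in> tempered" and \<rho>: "1 / 2 \<le> \<rho>" "\<rho> < 1" for h \<rho>
  proof -
    have m[measurable]: "(\<lambda>z. ennreal (cmod (gstft h z) * w z)) \<in> borel_measurable borel"
      by (intro weighted_measurable gstft_continuous h)
    have "MN (dilate \<rho> h) \<le> mixed_norm (ennreal P) (ennreal Q) (\<lambda>z. ennreal C * ennreal (cmod (gstft h (\<rho> *\<^sub>R z)) * w (\<rho> *\<^sub>R z)))"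
      using C(1) C(2)[OF h \<rho>] by (intro mixed_norm_mono[OF P]) (simp add: ennreal_mult'[symmetric] ennreal_leI)
    also have "\<dots> = ennreal C * mixed_norm (ennreal P) (ennreal Q) (\<lambda>z. ennreal (cmod (gstft h (\<rho> *\<^sub>R z)) * w (\<rho> *\<^sub>R z)))"
      by (rule mixed_norm_cmult[OF P]) (intro measurable_compose_continuous[OF m] continuous_intros)
    also have "\<dots> \<le> ennreal C * (2 ^ (DIM(real ^ 'n) + DIM(real ^ 'n)) * MN (gstft h))"
      by (intro mult_left_mono mixed_norm_scaleR_le[OF m \<rho>(1) P]) auto
    also have "2 ^ (DIM(real ^ 'n) + DIM(real ^ 'n)) = ennreal D" by (simp add: D_def ennreal_power[symmetric])
    also have "ennreal C * (ennreal D * MN (gstft h)) = ennreal (C * D) * MN (gstft h)"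
      using C(1) by (simp add: ennreal_mult' mult.assoc)
    finally show ?thesis .
  qed
  moreover have "0 \<le> C * D" using C(1) by (simp add: D_def)
  ultimately show ?thesis by blast
qed

lemma MN_gauss_finite:
  assumes "0 < c" shows "mixed_norm (ennreal P) (ennreal Q) (\<lambda>z. ennreal (exp (- c * (norm z)\<^sup>2) * w z)) < \<infinity>"
  using mixed_norm_gauss_finite[OF P s w1 assms, of 0] by simp

lemma gauss_measurable: "(\<lambda>z. ennreal (exp (- c * (norm z)\<^sup>2) * w z)) \<in> borel_measurable borel"
proof -
  have "continuous_on UNIV (\<lambda>z :: (real ^ 'n) \<times> (real ^ 'n). complex_of_real (exp (- c * (norm z)\<^sup>2)))"
    by (intro continuous_intros)
  from weighted_measurable[OF this] show ?thesis by simp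
qed

text \<open>Outside a large ball, a dilation is controlled by the tail of the function that is dilated; on the ball the
  convergence is dominated.\<close>

lemma dilate_tendsto:
  assumes h: "h \<in> tempered" and fin: "MN (gstft h) < \<infinity>"
    and \<rho>: "\<And>m. 1 / 2 \<le> \<rho> m" "\<And>m. \<rho> m < 1" "\<rho> \<longlonglongrightarrow> 1"
  shows "(\<lambda>m. MN (\<lambda>z. dilate (\<rho> m) h z - gstft h z)) \<longlonglongrightarrow> 0"
proof -
  obtain C where C: "0 \<le> C" "\<And>h \<rho> z. h \<in> tempered \<Longrightarrow> 1 / 2 \<le> \<rho> \<Longrightarrow> \<rho> < 1 \<Longrightarrow>
     cmod (dilate \<rho> h z) * w z \<le> C * (cmod (gstft h (\<rho> *\<^sub>R z)) * w (\<rho> *\<^sub>R z))" using dilate_bound by blast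
  define D :: ennreal where "D = 2 ^ (DIM(real ^ 'n) + DIM(real ^ 'n))"
  define G where "G = (\<lambda>z. cmod (gstft h z) * w z)"
  define T where "T = (\<lambda>R z. ennreal (indicator (- cball 0 (R / 2)) z * G z))"
  define f where "f = (\<lambda>m z. cmod (dilate (\<rho> m) h z - gstft h z) * w z)"
  have G0: "0 \<le> G z" for z using w_nonneg by (simp add: G_def)
  have Gc: "continuous_on UNIV G" unfolding G_def by (intro continuous_intros gstft_continuous h wc)
  hence Gm[measurable]: "G \<in> borel_measurable borel" by (rule borel_measurable_continuous_onI)
  have Tm[measurable]: "T R \<in> borel_measurable borel" for R unfolding T_def by measurable
  have fc: "continuous_on UNIV (f m)" for m
    unfolding f_def by (intro continuous_intros dilate_continuous gstft_continuous h wc)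
  have fm[measurable]: "f m \<in> borel_measurable borel" for m by (rule borel_measurable_continuous_onI[OF fc])
  have fG: "f m z \<le> C * G (\<rho> m *\<^sub>R z) + G z" for m z
  proof -
    have "f m z \<le> (cmod (dilate (\<rho> m) h z) + cmod (gstft h z)) * w z"
      unfolding f_def by (intro mult_right_mono norm_triangle_ineq4 w_nonneg)
    thus ?thesis using C(2)[OF h \<rho>(1)[of m] \<rho>(2)[of m], of z] by (simp add: G_def distrib_right)
  qed
  have tail: "(\<lambda>R. mixed_norm (ennreal P) (ennreal Q) (T (real R))) \<longlonglongrightarrow> 0"
  proof (rule mixed_norm_tendsto_0[OF P, where G = "\<lambda>z. ennreal (G z)"])
    show "mixed_norm (ennreal P) (ennreal Q) (\<lambda>z. ennreal (G z)) < \<infinity>" using fin by (simp add: G_def)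
    show "T (real R) z \<le> ennreal (G z)" for R z using G0[of z] by (auto simp: T_def indicator_def intro!: ennreal_leI)
    fix z
    have "eventually (\<lambda>R. T (real R) z = 0) sequentially"
    proof (rule eventually_sequentiallyI)
      fix R assume "nat \<lceil>2 * norm z\<rceil> \<le> R"
      hence "2 * norm z \<le> real R" by linarith
      thus "T (real R) z = 0" by (simp add: T_def)
    qed
    thus "(\<lambda>R. T (real R) z) \<longlonglongrightarrow> 0" by (simp add: tendsto_eventually)
  qed measurable
  have CM: "(\<lambda>z. ennreal (indicator (cball 0 R) z * f m z)) \<in> borel_measurable borel" for m R
  proof -
    have "(\<lambda>z. indicator (cball 0 R) z * f m z) \<in> borel_measurable borel"
      by (rule borel_measurable_times[OF borel_measurable_indicator fm]) simp
    thus ?thesis by measurable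
  qed
  have core: "(\<lambda>m. mixed_norm (ennreal P) (ennreal Q) (\<lambda>z. ennreal (indicator (cball 0 R) z * f m z))) \<longlonglongrightarrow> 0" for R
  proof -
    have "compact (cball (0 :: (real ^ 'n) \<times> (real ^ 'n)) R)" by simp
    from compact_continuous_image[OF continuous_on_subset[OF Gc] this]
    have "bounded (G ` cball 0 R)" by (simp add: compact_imp_bounded)
    then obtain S0 where S0: "\<forall>x\<in>G ` cball 0 R. norm x \<le> S0" unfolding bounded_iff by blast
    define S where "S = max 0 S0"
    have S: "z \<in> cball 0 R \<Longrightarrow> G z \<le> S" "0 \<le> S" for z
      using S0 by (force simp: S_def)+
    define S' where "S' = (C + 1) * S * exp (R\<^sup>2)"
    have S'0: "0 \<le> S'" using S C by (simp add: S'_def)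
    show ?thesis
    proof (rule mixed_norm_tendsto_0[OF P, where G = "\<lambda>z. ennreal S' * ennreal (exp (- 1 * (norm z)\<^sup>2) * w z)"])
      show "mixed_norm (ennreal P) (ennreal Q) (\<lambda>z. ennreal S' * ennreal (exp (- 1 * (norm z)\<^sup>2) * w z)) < \<infinity>"
        using MN_gauss_finite[of 1] gauss_measurable[of 1]
        by (subst mixed_norm_cmult[OF P]) (simp_all add: ennreal_mult_less_top)
      show "(\<lambda>z. ennreal S' * ennreal (exp (- 1 * (norm z)\<^sup>2) * w z)) \<in> borel_measurable borel"
        using gauss_measurable[of 1] by measurable
      show "(\<lambda>z. ennreal (indicator (cball 0 R) z * f m z)) \<in> borel_measurable borel" for m by (rule CM)
      fix z :: "(real ^ 'n) \<times> (real ^ 'n)"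
      have "(\<lambda>m. cmod (bfactor z * bargmann h (of_real (\<rho> m) *s zpoint z) - gstft h z) * w z)
         \<longlonglongrightarrow> cmod (bfactor z * bargmann h (of_real 1 *s zpoint z) - gstft h z) * w z"
      proof (intro tendsto_intros)
        have "continuous_on UNIV (\<lambda>r::real. bargmann h (of_real r *s zpoint z))"
          by (rule continuous_on_compose2[OF bargmann_continuous[OF h]])
             (auto simp: vector_scalar_mult_def intro!: continuous_intros)
        hence "isCont (\<lambda>r::real. bargmann h (of_real r *s zpoint z)) 1"
          by (simp add: continuous_on_eq_continuous_at)
        from isCont_tendsto_compose[OF this \<rho>(3)]
        show "(\<lambda>m. bargmann h (of_real (\<rho> m) *s zpoint z)) \<longlonglongrightarrow> bargmann h (of_real 1 *s zpoint z)" by simp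
      qed
      hence "(\<lambda>m. f m z) \<longlonglongrightarrow> 0" by (simp add: f_def gstft_dilate_1[OF h])
      hence "(\<lambda>m. indicator (cball 0 R) z * f m z) \<longlonglongrightarrow> indicator (cball 0 R) z * 0" by (intro tendsto_mult tendsto_const)
      thus "(\<lambda>m. ennreal (indicator (cball 0 R) z * f m z)) \<longlonglongrightarrow> 0" using tendsto_ennrealI by fastforce
      fix m
      show "ennreal (indicator (cball 0 R) z * f m z) \<le> ennreal S' * ennreal (exp (- 1 * (norm z)\<^sup>2) * w z)"
      proof (cases "z \<in> cball 0 R")
        case True
        have "norm (\<rho> m *\<^sub>R z) \<le> norm z" using \<rho>(1,2)[of m] mult_right_mono[of "\<rho> m" 1 "norm z"] by simp
        hence "G (\<rho> m *\<^sub>R z) \<le> S" "G z \<le> S" using True by (auto intro!: S)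
        hence "C * G (\<rho> m *\<^sub>R z) + G z \<le> C * S + S" using C by (intro add_mono mult_left_mono) auto
        hence "f m z \<le> (C + 1) * S" using fG[of m z] by (simp add: algebra_simps)
        also have "\<dots> \<le> S' * (exp (- 1 * (norm z)\<^sup>2) * w z)"
        proof -
          have "(norm z)\<^sup>2 \<le> R\<^sup>2" using True by (intro power_mono) auto
          hence "1 * 1 \<le> exp (R\<^sup>2 - (norm z)\<^sup>2) * w z" using w1 by (intro mult_mono) auto
          hence "1 \<le> exp (R\<^sup>2) * (exp (- 1 * (norm z)\<^sup>2) * w z)" by (simp add: exp_diff exp_minus field_simps)
          from mult_left_mono[OF this, of "(C + 1) * S"] show ?thesis using C S by (simp add: S'_def mult.assoc)
        qed
        finally show ?thesis using True S'0 by (simp add: ennreal_mult'[symmetric] ennreal_leI)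
      qed simp
    qed
  qed
  have bound: "MN (\<lambda>z. dilate (\<rho> m) h z - gstft h z) \<le> mixed_norm (ennreal P) (ennreal Q) (\<lambda>z. ennreal (indicator (cball 0 R) z * f m z))
      + (ennreal C * D + 1) * mixed_norm (ennreal P) (ennreal Q) (T R)" for m R
  proof -
    have TS: "(\<lambda>z. T R (\<rho> m *\<^sub>R z)) \<in> borel_measurable borel"
      by (intro measurable_compose_continuous[OF Tm] continuous_intros)
    have "MN (\<lambda>z. dilate (\<rho> m) h z - gstft h z) \<le> mixed_norm (ennreal P) (ennreal Q)
        (\<lambda>z. ennreal (indicator (cball 0 R) z * f m z) + (ennreal C * T R (\<rho> m *\<^sub>R z) + T R z))"
    proof (rule mixed_norm_mono[OF P])
      fix z
      show "ennreal (cmod (dilate (\<rho> m) h z - gstft h z) * w z) \<le>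
        ennreal (indicator (cball 0 R) z * f m z) + (ennreal C * T R (\<rho> m *\<^sub>R z) + T R z)"
      proof (cases "z \<in> cball 0 R")
        case True thus ?thesis by (simp add: f_def)
      next
        case False
        hence z: "R < norm z" by simp
        have "1 / 2 * norm z \<le> \<rho> m * norm z" using \<rho>(1)[of m] by (intro mult_right_mono) auto
        hence "R / 2 < norm (\<rho> m *\<^sub>R z)" using z \<rho>(1)[of m] by simp
        moreover have "R / 2 < norm z" using z norm_ge_zero[of z] by linarith
        ultimately have "ennreal C * T R (\<rho> m *\<^sub>R z) + T R z = ennreal (C * G (\<rho> m *\<^sub>R z) + G z)"
          using C G0 by (simp add: T_def ennreal_mult'[symmetric])
        moreover have "ennreal (f m z) \<le> ennreal (C * G (\<rho> m *\<^sub>R z) + G z)" by (rule ennreal_leI[OF fG])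
        ultimately show ?thesis by (simp add: f_def add_increasing)
      qed
    qed
    also have "\<dots> \<le> mixed_norm (ennreal P) (ennreal Q) (\<lambda>z. ennreal (indicator (cball 0 R) z * f m z))
        + mixed_norm (ennreal P) (ennreal Q) (\<lambda>z. ennreal C * T R (\<rho> m *\<^sub>R z) + T R z)"
      by (intro mixed_norm_triangle[OF P] CM borel_measurable_add borel_measurable_times_ennreal TS Tm borel_measurable_const)
    also have "mixed_norm (ennreal P) (ennreal Q) (\<lambda>z. ennreal C * T R (\<rho> m *\<^sub>R z) + T R z) \<le>
       mixed_norm (ennreal P) (ennreal Q) (\<lambda>z. ennreal C * T R (\<rho> m *\<^sub>R z)) + mixed_norm (ennreal P) (ennreal Q) (T R)"
      by (intro mixed_norm_triangle[OF P] borel_measurable_times_ennreal TS Tm borel_measurable_const)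
    also have "mixed_norm (ennreal P) (ennreal Q) (\<lambda>z. ennreal C * T R (\<rho> m *\<^sub>R z)) =
        ennreal C * mixed_norm (ennreal P) (ennreal Q) (\<lambda>z. T R (\<rho> m *\<^sub>R z))"
      by (rule mixed_norm_cmult[OF P TS])
    also have "mixed_norm (ennreal P) (ennreal Q) (\<lambda>z. T R (\<rho> m *\<^sub>R z)) \<le> D * mixed_norm (ennreal P) (ennreal Q) (T R)"
      unfolding D_def by (rule mixed_norm_scaleR_le[OF Tm \<rho>(1) P])
    finally show ?thesis by (simp add: distrib_right mult.assoc mult_left_mono add_left_mono)
  qed
  show ?thesis
  proof (rule order_tendstoI)
    fix a :: ennreal assume "0 < a"
    then obtain b where b: "0 < b" "b < a" using dense by blast
    then obtain e where e: "b = ennreal e" "0 < e" by (cases b) auto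
    have "(\<lambda>R. (ennreal C * D + 1) * mixed_norm (ennreal P) (ennreal Q) (T (real R))) \<longlonglongrightarrow> (ennreal C * D + 1) * 0"
      by (rule ennreal_tendsto_cmult[OF _ tail]) (simp add: D_def ennreal_mult_less_top power_less_top_ennreal)
    hence "eventually (\<lambda>R. (ennreal C * D + 1) * mixed_norm (ennreal P) (ennreal Q) (T (real R)) < ennreal (e / 2)) sequentially"
      using e by (intro order_tendstoD) auto
    then obtain R where R: "(ennreal C * D + 1) * mixed_norm (ennreal P) (ennreal Q) (T (real R)) < ennreal (e / 2)"
      by (auto simp: eventually_sequentially)
    have "eventually (\<lambda>m. mixed_norm (ennreal P) (ennreal Q) (\<lambda>z. ennreal (indicator (cball 0 (real R)) z * f m z)) < ennreal (e / 2)) sequentially"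
      using core[of "real R"] e by (intro order_tendstoD) auto
    thus "eventually (\<lambda>m. MN (\<lambda>z. dilate (\<rho> m) h z - gstft h z) < a) sequentially"
    proof eventually_elim
      case (elim m)
      have "MN (\<lambda>z. dilate (\<rho> m) h z - gstft h z) \<le> ennreal (e / 2) + ennreal (e / 2)"
        using bound[of m "real R"] add_mono[OF less_imp_le[OF elim] less_imp_le[OF R]] by (rule order_trans)
      also have "\<dots> = b" using e by (simp add: ennreal_plus[symmetric] del: ennreal_plus)
      finally show ?case using b by simp
    qed
  qed simp
qed

end


text \<open>The approximations are Taylor polynomials of dilations of the Bargmann transform.\<close>

lemma finite_rank_approximation:
  fixes w :: "(real ^ 'n::finite) \<times> (real ^ 'n) \<Rightarrow> real"
  assumes P: "1 \<le> P" "1 \<le> Q" and s: "0 \<le> s" "\<And>z z'. w (z + z') \<le> poly_weight s z * w z'"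
    and w1: "\<And>z. 1 \<le> w z" and wc: "continuous_on UNIV w"
  obtains M :: "nat \<Rightarrow> (complex \<times> 'n list \<times> 'n list) list" and C where "0 \<le> C"
    "\<And>h m. h \<in> tempered \<Longrightarrow> modulation_norm (ennreal P) (ennreal Q) w h < \<infinity> \<Longrightarrow>
       modulation_norm (ennreal P) (ennreal Q) w (finrank (M m) h) \<le> ennreal C * modulation_norm (ennreal P) (ennreal Q) w h"
    "\<And>h. h \<in> tempered \<Longrightarrow> modulation_norm (ennreal P) (ennreal Q) w h < \<infinity> \<Longrightarrow>
       (\<lambda>m. modulation_norm (ennreal P) (ennreal Q) w (\<lambda>\<phi>. finrank (M m) h \<phi> - h \<phi>)) \<longlonglongrightarrow> 0"
proof -
  let ?mod = "modulation_norm (ennreal P) (ennreal Q) w"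
  let ?MN = "\<lambda>F. mixed_norm (ennreal P) (ennreal Q) (\<lambda>z. ennreal (cmod (F z) * w z))"
  let ?D = "\<lambda>\<rho> h (z :: (real ^ 'n) \<times> (real ^ 'n)). bfactor z * bargmann h (of_real \<rho> *s zpoint z)"
  let ?a = "2 powr (real CARD('n) / 4)"
  note mod = modulation_norm_mixed[OF _ wc, of _ "ennreal P" "ennreal Q"]
  note wm = weighted_measurable[OF P s w1 wc]
  obtain K where K: "0 \<le> K" "\<And>h z. h \<in> tempered \<Longrightarrow> ennreal (cmod (gstft h z)) \<le> ennreal K * ?mod h"
    using gstft_le_modulation_norm[OF P, where 'n = 'n] wc w1 by blast
  obtain C0 where C0: "0 \<le> C0" "\<And>h \<rho>. h \<in> tempered \<Longrightarrow> 1 / 2 \<le> \<rho> \<Longrightarrow> \<rho> < 1 \<Longrightarrow> ?MN (?D \<rho> h) \<le> ennreal C0 * ?MN (gstft h)"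
    using dilate_MN_bound[OF P s w1 wc] by blast
  define \<rho> where "\<rho> = (\<lambda>m. 1 - 1 / real (Suc (Suc m)))"
  have \<rho>: "1 / 2 \<le> \<rho> m" "\<rho> m < 1" "0 < \<rho> m" for m by (auto simp: \<rho>_def field_simps)
  have "(\<lambda>m. 1 - 1 / real (Suc (Suc m))) \<longlonglongrightarrow> 1 - 0"
    by (rule tendsto_diff[OF tendsto_const LIMSEQ_Suc[OF LIMSEQ_Suc[OF lim_1_over_n]]])
  hence \<rho>lim: "\<rho> \<longlonglongrightarrow> 1" by (simp add: \<rho>_def)
  define c where "c = (\<lambda>m. (1 - \<rho> m) / (8 * pi))"
  have c: "0 < c m" for m using \<rho>(2)[of m] by (simp add: c_def)
  define e where "e = (\<lambda>m. enn2real (mixed_norm (ennreal P) (ennreal Q) (\<lambda>z. ennreal (exp (- c m * (norm z)\<^sup>2) * w z))))"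
  have e: "mixed_norm (ennreal P) (ennreal Q) (\<lambda>z. ennreal (exp (- c m * (norm z)\<^sup>2) * w z)) = ennreal (e m)" "0 \<le> e m" for m
    using MN_gauss_finite[OF P s w1 wc c[of m]] by (simp_all add: e_def)
  have "\<exists>n. K * (sqrt (\<rho> m) ^ n / (1 - sqrt (\<rho> m))) * e m \<le> 1 - \<rho> m" for m
  proof -
    have q: "0 < sqrt (\<rho> m)" "sqrt (\<rho> m) < 1" using \<rho>[of m] by auto
    have "(\<lambda>n. K * (sqrt (\<rho> m) ^ n / (1 - sqrt (\<rho> m))) * e m) \<longlonglongrightarrow> K * (0 / (1 - sqrt (\<rho> m))) * e m"
      using q by (intro tendsto_intros LIMSEQ_power_zero) auto
    from order_tendstoD(2)[OF this, of "1 - \<rho> m"]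
    have "eventually (\<lambda>n. K * (sqrt (\<rho> m) ^ n / (1 - sqrt (\<rho> m))) * e m < 1 - \<rho> m) sequentially"
      using \<rho>(2)[of m] by simp
    thus ?thesis by (auto simp: eventually_sequentially intro: less_imp_le)
  qed
  then obtain n where n: "\<And>m. K * (sqrt (\<rho> m) ^ n m / (1 - sqrt (\<rho> m))) * e m \<le> 1 - \<rho> m" by metis
  have "\<exists>M :: (complex \<times> 'n list \<times> 'n list) list. \<forall>h\<in>tempered. \<forall>\<zeta>. bargmann (finrank M h) \<zeta> =
     (\<Sum>k<n m. (deriv ^^ k) (\<lambda>\<tau>. bargmann h (\<tau> *s \<zeta>)) 0 / fact k * of_real (\<rho> m) ^ k)" for m
    by (rule finrank_taylor_polynomial)
  hence "\<forall>m. \<exists>M :: (complex \<times> 'n list \<times> 'n list) list. \<forall>h\<in>tempered. \<forall>\<zeta>. bargmann (finrank M h) \<zeta> =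
     (\<Sum>k<n m. (deriv ^^ k) (\<lambda>\<tau>. bargmann h (\<tau> *s \<zeta>)) 0 / fact k * of_real (\<rho> m) ^ k)" by (rule allI)
  from choice[OF this] obtain M :: "nat \<Rightarrow> (complex \<times> 'n list \<times> 'n list) list" where
    M: "\<And>m h \<zeta>. h \<in> tempered \<Longrightarrow> bargmann (finrank (M m) h) \<zeta> =
     (\<Sum>k<n m. (deriv ^^ k) (\<lambda>\<tau>. bargmann h (\<tau> *s \<zeta>)) 0 / fact k * of_real (\<rho> m) ^ k)" by blast
  define T where "T = (\<lambda>m h z. gstft (finrank (M m) h) z - ?D (\<rho> m) h z)"
  have Dc: "continuous_on UNIV (?D \<rho> h)" if "h \<in> tempered" for h \<rho> by (rule dilate_continuous[OF P s w1 wc that])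
  have Tc: "continuous_on UNIV (T m h)" if "h \<in> tempered" for h m
    unfolding T_def by (intro continuous_on_diff Dc that gstft_continuous finrank_tempered)
  have TN: "?MN (T m h) \<le> ennreal (N * (1 - \<rho> m))" if h: "h \<in> tempered" and N: "?mod h = ennreal N" "0 \<le> N" for h m N
  proof -
    define r where "r = sqrt (\<rho> m) ^ n m / (1 - sqrt (\<rho> m))"
    have r: "0 \<le> r" using \<rho>[of m] by (simp add: r_def)
    have A: "cmod (gstft h z) \<le> K * N" for z
      using K(2)[OF h, of z] N K(1) by (simp add: ennreal_mult'[symmetric] ennreal_le_iff)
    have "cmod (T m h z) * w z \<le> K * N * r * (exp (- c m * (norm z)\<^sup>2) * w z)" for z
    proof -
      let ?Z = "(norm (zpoint z))\<^sup>2"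
      have "T m h z = - (bfactor z * (bargmann h (of_real (\<rho> m) *s zpoint z) - (\<Sum>k<n m. (deriv ^^ k) (\<lambda>\<tau>. bargmann h (\<tau> *s zpoint z)) 0 / fact k * of_real (\<rho> m) ^ k)))"
        using stft_gauss[OF finrank_tempered, of "M m" h "fst z" "snd z"] by (simp add: T_def M[OF h] algebra_simps)
      hence "cmod (T m h z) = ?a * exp (- ?Z / (8 * pi)) * cmod (bargmann h (of_real (\<rho> m) *s zpoint z) - (\<Sum>k<n m. (deriv ^^ k) (\<lambda>\<tau>. bargmann h (\<tau> *s zpoint z)) 0 / fact k * of_real (\<rho> m) ^ k))"
        by (simp add: norm_mult norm_bfactor)
      also have "\<dots> \<le> ?a * exp (- ?Z / (8 * pi)) * (K * N / ?a * exp (\<rho> m * ?Z / (8 * pi)) * r)"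
        unfolding r_def by (intro mult_left_mono bargmann_taylor_remainder[OF h A] \<rho>) auto
      also have "\<dots> = K * N * r * (exp (- ?Z / (8 * pi)) * exp (\<rho> m * ?Z / (8 * pi)))" by simp
      also have "exp (- ?Z / (8 * pi)) * exp (\<rho> m * ?Z / (8 * pi)) = exp (- (c m * ?Z))"
        unfolding exp_add[symmetric] by (simp add: c_def field_simps)
      also have "K * N * r * exp (- (c m * ?Z)) \<le> K * N * r * exp (- c m * (norm z)\<^sup>2)"
      proof -
        have "(norm z)\<^sup>2 \<le> ?Z" using norm_zpoint_bounds(4)[of z] by (intro power_mono) auto
        hence "c m * (norm z)\<^sup>2 \<le> c m * ?Z" using c[of m] by (intro mult_left_mono) auto
        thus ?thesis using K N r by (intro mult_left_mono) auto
      qed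
      finally have "cmod (T m h z) \<le> K * N * r * exp (- c m * (norm z)\<^sup>2)" .
      from mult_right_mono[OF this, of "w z"] show ?thesis using w1[of z] by (simp add: mult.assoc)
    qed
    hence "?MN (T m h) \<le> mixed_norm (ennreal P) (ennreal Q) (\<lambda>z. ennreal (K * N * r) * ennreal (exp (- c m * (norm z)\<^sup>2) * w z))"
      using K N r by (intro mixed_norm_mono[OF P]) (simp add: ennreal_mult'[symmetric] ennreal_leI)
    also have "\<dots> = ennreal (K * N * r) * ennreal (e m)"
      by (subst mixed_norm_cmult[OF P gauss_measurable[OF P s w1 wc]]) (simp only: e)
    also have "\<dots> = ennreal (N * (K * r * e m))" using K N r e(2)[of m] by (simp add: ennreal_mult'[symmetric] mult_ac)
    also have "\<dots> \<le> ennreal (N * (1 - \<rho> m))" using n[of m] N by (intro ennreal_leI mult_left_mono) (auto simp: r_def)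
    finally show ?thesis .
  qed
  show ?thesis
  proof (rule that[of "C0 + 1" M])
    show "0 \<le> C0 + 1" using C0 by simp
    fix h :: "(real ^ 'n \<Rightarrow> complex) \<Rightarrow> complex" assume h: "h \<in> tempered" and fin: "?mod h < \<infinity>"
    then obtain N where N: "?mod h = ennreal N" "0 \<le> N" by (cases "?mod h") auto
    show "?mod (finrank (M m) h) \<le> ennreal (C0 + 1) * ?mod h" for m
    proof -
      have "?mod (finrank (M m) h) \<le> ?MN (?D (\<rho> m) h) + ?MN (T m h)"
        unfolding mod[OF finrank_tempered]
      proof (rule MN_triangle[OF P s w1 wc Dc[OF h] Tc[OF h]])
        show "cmod (gstft (finrank (M m) h) z) \<le> cmod (?D (\<rho> m) h z) + cmod (T m h z)" for z
          using norm_triangle_ineq[of "?D (\<rho> m) h z" "T m h z"] by (simp add: T_def)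
      qed
      also have "\<dots> \<le> ennreal C0 * ?mod h + ennreal N"
      proof (rule add_mono)
        show "?MN (?D (\<rho> m) h) \<le> ennreal C0 * ?mod h" using C0(2)[OF h \<rho>(1,2)] by (simp add: mod[OF h])
        have "N * (1 - \<rho> m) \<le> N * 1" using \<rho>[of m] N by (intro mult_left_mono) auto
        thus "?MN (T m h) \<le> ennreal N" using TN[OF h N, of m] by (auto elim!: order_trans intro!: ennreal_leI)
      qed
      also have "\<dots> = ennreal (C0 + 1) * ?mod h"
        using C0(1) by (simp add: N distrib_right)
      finally show ?thesis .
    qed
    show "(\<lambda>m. ?mod (\<lambda>\<phi>. finrank (M m) h \<phi> - h \<phi>)) \<longlonglongrightarrow> 0"
    proof (rule tendsto_sandwich[where f = "\<lambda>_. 0"])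
      have t: "(\<lambda>\<phi>. finrank (M m) h \<phi> - h \<phi>) \<in> tempered" for m
        using tempered_linear[OF finrank_tempered h, of 1 "M m" h "-1"] by simp
      have "?mod (\<lambda>\<phi>. finrank (M m) h \<phi> - h \<phi>) \<le> ?MN (\<lambda>z. ?D (\<rho> m) h z - gstft h z) + ?MN (T m h)" for m
        unfolding mod[OF t]
      proof (rule MN_triangle[OF P s w1 wc _ Tc[OF h]])
        show "continuous_on UNIV (\<lambda>z. ?D (\<rho> m) h z - gstft h z)" by (intro continuous_on_diff Dc h gstft_continuous)
        show "cmod (gstft (\<lambda>\<phi>. finrank (M m) h \<phi> - h \<phi>) z) \<le> cmod (?D (\<rho> m) h z - gstft h z) + cmod (T m h z)" for z
        proof -
          have "gstft (\<lambda>\<phi>. finrank (M m) h \<phi> - h \<phi>) z = (?D (\<rho> m) h z - gstft h z) + T m h z"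
            by (simp add: T_def stft_def)
          thus ?thesis by (simp only: norm_triangle_ineq)
        qed
      qed
      hence "?mod (\<lambda>\<phi>. finrank (M m) h \<phi> - h \<phi>) \<le> ?MN (\<lambda>z. ?D (\<rho> m) h z - gstft h z) + ennreal (N * (1 - \<rho> m))" for m
        by (rule order_trans[OF _ add_left_mono[OF TN[OF h N]]])
      thus "\<forall>\<^sub>F m in sequentially. ?mod (\<lambda>\<phi>. finrank (M m) h \<phi> - h \<phi>) \<le>
          ?MN (\<lambda>z. ?D (\<rho> m) h z - gstft h z) + ennreal (N * (1 - \<rho> m))" by simp
      have "(\<lambda>m. N * (1 - \<rho> m)) \<longlonglongrightarrow> N * (1 - 1)" by (intro tendsto_intros \<rho>lim)
      from tendsto_ennrealI[OF this] have "(\<lambda>m. ennreal (N * (1 - \<rho> m))) \<longlonglongrightarrow> 0" by simp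
      moreover have "(\<lambda>m. ?MN (\<lambda>z. ?D (\<rho> m) h z - gstft h z)) \<longlonglongrightarrow> 0"
        using fin by (intro dilate_tendsto[OF P s w1 wc h] \<rho> \<rho>lim) (simp add: mod[OF h])
      ultimately show "(\<lambda>m. ?MN (\<lambda>z. ?D (\<rho> m) h z - gstft h z) + ennreal (N * (1 - \<rho> m))) \<longlonglongrightarrow> 0"
        using tendsto_add[of "\<lambda>m. ?MN (\<lambda>z. ?D (\<rho> m) h z - gstft h z)" 0 sequentially] by fastforce
    qed auto
  qed
qed


section \<open>Continuity of translations\<close>

definition translation_cont :: "('a::euclidean_space \<Rightarrow> complex) \<Rightarrow> bool" where
  "translation_cont f \<longleftrightarrow> (\<forall>t. t \<longlonglongrightarrow> 0 \<longrightarrow> (\<lambda>m::nat. \<integral>\<^sup>+y. ennreal (cmod (f (y + t m) - f y)) \<partial>lborel) \<longlonglongrightarrow> 0)"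

text \<open>Translation continuity passes to limits in the mean, since translations are isometries.\<close>

lemma translation_cont_approx:
  fixes f :: "'a::euclidean_space \<Rightarrow> complex"
  assumes f[measurable]: "f \<in> borel_measurable borel"
    and ap: "\<And>e::real. 0 < e \<Longrightarrow> \<exists>g. g \<in> borel_measurable borel \<and> translation_cont g \<and> (\<integral>\<^sup>+y. ennreal (cmod (f y - g y)) \<partial>lborel) < ennreal e"
  shows "translation_cont f"
  unfolding translation_cont_def
proof (intro allI impI order_tendstoI)
  fix t :: "nat \<Rightarrow> 'a" and a :: ennreal assume t: "t \<longlonglongrightarrow> 0" and "0 < a"
  then obtain b where b: "0 < b" "b < a" using dense by blast
  then obtain e where e: "b = ennreal e" "0 < e" by (cases b) auto
  obtain g where g[measurable]: "g \<in> borel_measurable borel" and gt: "translation_cont g"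
    and d: "(\<integral>\<^sup>+y. ennreal (cmod (f y - g y)) \<partial>lborel) < ennreal (e / 3)" using ap[of "e / 3"] e by auto
  have "eventually (\<lambda>m. (\<integral>\<^sup>+y. ennreal (cmod (g (y + t m) - g y)) \<partial>lborel) < ennreal (e / 3)) sequentially"
    using gt t e unfolding translation_cont_def by (intro order_tendstoD) auto
  thus "eventually (\<lambda>m. (\<integral>\<^sup>+y. ennreal (cmod (f (y + t m) - f y)) \<partial>lborel) < a) sequentially"
  proof eventually_elim
    case (elim m)
    have "(\<integral>\<^sup>+y. ennreal (cmod (f (y + t m) - f y)) \<partial>lborel) \<le>
      (\<integral>\<^sup>+y. (ennreal (cmod (f (y + t m) - g (y + t m))) + ennreal (cmod (g (y + t m) - g y))) + ennreal (cmod (f y - g y)) \<partial>lborel)"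
    proof (rule nn_integral_mono)
      fix y
      have "cmod (f (y + t m) - f y) \<le> cmod (f (y + t m) - g (y + t m)) + cmod (g (y + t m) - g y) + cmod (f y - g y)"
        by norm
      thus "ennreal (cmod (f (y + t m) - f y)) \<le> (ennreal (cmod (f (y + t m) - g (y + t m))) + ennreal (cmod (g (y + t m) - g y))) + ennreal (cmod (f y - g y))"
        by (simp add: ennreal_plus[symmetric] ennreal_leI del: ennreal_plus)
    qed
    also have "\<dots> = (\<integral>\<^sup>+y. ennreal (cmod (f (y + t m) - g (y + t m))) \<partial>lborel) + (\<integral>\<^sup>+y. ennreal (cmod (g (y + t m) - g y)) \<partial>lborel)
       + (\<integral>\<^sup>+y. ennreal (cmod (f y - g y)) \<partial>lborel)"
      by (subst nn_integral_add, measurable)+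
    also have "(\<integral>\<^sup>+y. ennreal (cmod (f (y + t m) - g (y + t m))) \<partial>lborel) = (\<integral>\<^sup>+y. ennreal (cmod (f y - g y)) \<partial>lborel)"
      by (rule nn_integral_lborel_shift[of "\<lambda>y. ennreal (cmod (f y - g y))"]) measurable
    also have "(\<integral>\<^sup>+y. ennreal (cmod (f y - g y)) \<partial>lborel) + (\<integral>\<^sup>+y. ennreal (cmod (g (y + t m) - g y)) \<partial>lborel)
       + (\<integral>\<^sup>+y. ennreal (cmod (f y - g y)) \<partial>lborel) \<le> ennreal (e / 3) + ennreal (e / 3) + ennreal (e / 3)"
      using d elim by (intro add_mono) auto
    also have "\<dots> = b" using e by (simp add: ennreal_plus[symmetric] del: ennreal_plus)
    finally show ?case using b by simp
  qed
qed simp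

text \<open>An open set contains all small translates of each of its points. The symmetric difference of the set and a translate
  consists of two parts of the same measure.\<close>

lemma translation_cont_open:
  fixes U :: "'a::euclidean_space set"
  assumes U: "open U" and fin: "emeasure lborel U < \<infinity>"
  shows "translation_cont (\<lambda>y. indicator U y *\<^sub>R c)"
  unfolding translation_cont_def
proof (intro allI impI)
  fix t :: "nat \<Rightarrow> 'a" assume t: "t \<longlonglongrightarrow> 0"
  have [measurable]: "U \<in> sets borel" using U by simp
  let ?I = "indicator U :: 'a \<Rightarrow> ennreal"
  have im[measurable]: "?I \<in> borel_measurable borel" by (rule borel_measurable_indicator) simp
  have sm[measurable]: "(\<lambda>y. ?I (y + s)) \<in> borel_measurable borel" for s
    by (intro measurable_compose_continuous[OF im] continuous_intros)
  have A: "(\<lambda>m. \<integral>\<^sup>+y. ?I y * (1 - ?I (y + t m)) \<partial>lborel) \<longlonglongrightarrow> (\<integral>\<^sup>+y. 0 \<partial>(lborel :: 'a measure))"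
  proof (rule nn_integral_dominated_convergence[where w = ?I])
    show "AE y in lborel. (\<lambda>m. ?I y * (1 - ?I (y + t m))) \<longlonglongrightarrow> 0"
    proof (rule AE_I2)
      fix y :: 'a
      show "(\<lambda>m. ?I y * (1 - ?I (y + t m))) \<longlonglongrightarrow> 0"
      proof (cases "y \<in> U")
        case True
        have "(\<lambda>m. y + t m) \<longlonglongrightarrow> y + 0" by (intro tendsto_intros t)
        hence "eventually (\<lambda>m. y + t m \<in> U) sequentially" using U True by (intro topological_tendstoD) auto
        hence "eventually (\<lambda>m. ?I y * (1 - ?I (y + t m)) = 0) sequentially" by eventually_elim simp
        thus ?thesis by (rule tendsto_eventually)
      qed simp
    qed
    show "AE y in lborel. ?I y * (1 - ?I (y + t m)) \<le> ?I y" for m by (auto simp: indicator_def)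
    show "integral\<^sup>N lborel ?I < \<infinity>" using fin by simp
  qed measurable
  have B: "(\<integral>\<^sup>+y. ?I (y + s) * (1 - ?I y) \<partial>lborel) = (\<integral>\<^sup>+y. ?I y * (1 - ?I (y + s)) \<partial>lborel)" for s
  proof -
    have fs: "(\<integral>\<^sup>+y. ?I (y + s) * ?I y \<partial>lborel) < \<infinity>"
    proof -
      have "(\<integral>\<^sup>+y. ?I (y + s) * ?I y \<partial>lborel) \<le> (\<integral>\<^sup>+y. ?I y \<partial>lborel)"
        by (intro nn_integral_mono) (auto simp: indicator_def)
      also have "\<dots> < \<infinity>" using fin by simp
      finally show ?thesis .
    qed
    let ?W = "\<integral>\<^sup>+y. ?I (y + s) * ?I y \<partial>lborel"
    have pt: "?I (y + s) * (1 - ?I y) + ?I (y + s) * ?I y = ?I (y + s)" "?I y * (1 - ?I (y + s)) + ?I (y + s) * ?I y = ?I y" for y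
      by (auto simp: indicator_def)
    have "(\<integral>\<^sup>+y. ?I (y + s) * (1 - ?I y) \<partial>lborel) + ?W = (\<integral>\<^sup>+y. ?I (y + s) * (1 - ?I y) + ?I (y + s) * ?I y \<partial>lborel)"
      by (rule nn_integral_add[symmetric]) measurable
    also have "\<dots> = (\<integral>\<^sup>+y. ?I (y + s) \<partial>lborel)" by (simp only: pt)
    also have "\<dots> = (\<integral>\<^sup>+y. ?I y \<partial>lborel)" by (rule nn_integral_lborel_shift) measurable
    also have "\<dots> = (\<integral>\<^sup>+y. ?I y * (1 - ?I (y + s)) + ?I (y + s) * ?I y \<partial>lborel)" by (simp only: pt)
    also have "\<dots> = (\<integral>\<^sup>+y. ?I y * (1 - ?I (y + s)) \<partial>lborel) + ?W"
      by (rule nn_integral_add) measurable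
    finally have "?W + (\<integral>\<^sup>+y. ?I (y + s) * (1 - ?I y) \<partial>lborel) = ?W + (\<integral>\<^sup>+y. ?I y * (1 - ?I (y + s)) \<partial>lborel)"
      by (simp only: add.commute)
    thus ?thesis using fs unfolding ennreal_add_left_cancel by auto
  qed
  have "(\<integral>\<^sup>+y. ennreal (cmod (indicator U (y + s) *\<^sub>R c - indicator U y *\<^sub>R c)) \<partial>lborel) =
     (\<integral>\<^sup>+y. ennreal (cmod c) * (?I (y + s) * (1 - ?I y) + ?I y * (1 - ?I (y + s))) \<partial>lborel)" for s
    by (intro nn_integral_cong) (auto simp: indicator_def)
  also have "(\<integral>\<^sup>+y. ennreal (cmod c) * (?I (y + s) * (1 - ?I y) + ?I y * (1 - ?I (y + s))) \<partial>lborel) =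
     ennreal (cmod c) * (2 * (\<integral>\<^sup>+y. ?I y * (1 - ?I (y + s)) \<partial>lborel))" for s
    by (subst nn_integral_cmult, measurable, subst nn_integral_add, measurable) (simp add: B mult_2)
  finally have E: "(\<integral>\<^sup>+y. ennreal (cmod (indicator U (y + s) *\<^sub>R c - indicator U y *\<^sub>R c)) \<partial>lborel) =
     ennreal (cmod c) * (2 * (\<integral>\<^sup>+y. ?I y * (1 - ?I (y + s)) \<partial>lborel))" for s .
  have "(\<lambda>m. ennreal (cmod c) * (2 * (\<integral>\<^sup>+y. ?I y * (1 - ?I (y + t m)) \<partial>lborel))) \<longlonglongrightarrow> ennreal (cmod c) * (2 * 0)"
    using A by (intro ennreal_tendsto_cmult) (auto simp: less_top[symmetric])
  thus "(\<lambda>m. \<integral>\<^sup>+y. ennreal (cmod (indicator U (y + t m) *\<^sub>R c - indicator U y *\<^sub>R c)) \<partial>lborel) \<longlonglongrightarrow> 0"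
    unfolding E by simp
qed

text \<open>Simple functions are approximated by combinations of indicators of open sets, by outer regularity.\<close>

lemma translation_cont_integrable:
  fixes f :: "'a::euclidean_space \<Rightarrow> complex"
  assumes "integrable lborel f"
  shows "translation_cont f"
  using assms
proof (induction rule: integrable_induct)
  case (base A c)
  have A[measurable]: "A \<in> sets borel" using base by simp
  show ?case
  proof (rule translation_cont_approx)
    show "(\<lambda>y. indicator A y *\<^sub>R c) \<in> borel_measurable borel" by measurable
    fix e :: real assume e: "0 < e"
    define d where "d = e / (cmod c + 1)"
    have p: "0 < cmod c + 1" by (simp add: add_nonneg_pos)
    hence d0: "0 < d" "d * (cmod c + 1) = e" using e by (auto simp: d_def)
    hence d: "0 < d" "d * cmod c < e" unfolding distrib_left by linarith+
    have "A \<in> sets lebesgue" using A by simp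
    from sets_lebesgue_outer_open[OF this d(1)] obtain U where U: "open U" "A \<subseteq> U" "U - A \<in> lmeasurable" "emeasure lebesgue (U - A) < ennreal d"
      by blast
    have [measurable]: "U \<in> sets borel" using U by simp
    have UA: "emeasure lborel (U - A) < ennreal d" using U(4) by simp
    have "emeasure lborel U \<le> emeasure lborel A + emeasure lborel (U - A)"
      using emeasure_subadditive[of A lborel "U - A"] U(2) by (simp add: Un_absorb1)
    also have "\<dots> < \<infinity>" using base(2) UA by (auto simp: less_top[symmetric] top_unique)
    finally have fin: "emeasure lborel U < \<infinity>" .
    have "(\<integral>\<^sup>+y. ennreal (cmod (indicator A y *\<^sub>R c - indicator U y *\<^sub>R c)) \<partial>lborel) = (\<integral>\<^sup>+y. ennreal (cmod c) * indicator (U - A) y \<partial>lborel)"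
      using U(2) by (intro nn_integral_cong) (auto simp: indicator_def)
    also have "\<dots> = ennreal (cmod c) * emeasure lborel (U - A)" by (rule nn_integral_cmult_indicator) measurable
    also have "\<dots> \<le> ennreal (cmod c) * ennreal d" using UA by (intro mult_left_mono) auto
    also have "\<dots> < ennreal e" using d e by (simp add: ennreal_mult'[symmetric] mult.commute ennreal_lessI)
    finally have "(\<integral>\<^sup>+y. ennreal (cmod (indicator A y *\<^sub>R c - indicator U y *\<^sub>R c)) \<partial>lborel) < ennreal e" .
    moreover have "(\<lambda>y. indicator U y *\<^sub>R c) \<in> borel_measurable borel" by measurable
    ultimately show "\<exists>g. g \<in> borel_measurable borel \<and> translation_cont g \<and> (\<integral>\<^sup>+y. ennreal (cmod (indicator A y *\<^sub>R c - g y)) \<partial>lborel) < ennreal e"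
      using translation_cont_open[OF U(1) fin, of c] by (intro exI[of _ "\<lambda>y. indicator U y *\<^sub>R c"]) auto
  qed
next
  case (add f g)
  note [measurable] = borel_measurable_integrable[OF add.hyps(1), simplified] borel_measurable_integrable[OF add.hyps(2), simplified]
  show ?case unfolding translation_cont_def
  proof (intro allI impI)
    fix t :: "nat \<Rightarrow> 'a" assume t: "t \<longlonglongrightarrow> 0"
    let ?D = "\<lambda>f m. \<integral>\<^sup>+y. ennreal (cmod (f (y + t m) - f y)) \<partial>lborel"
    show "(\<lambda>m. ?D (\<lambda>y. f y + g y) m) \<longlonglongrightarrow> 0"
    proof (rule tendsto_sandwich[where f = "\<lambda>_. 0"])
      show "\<forall>\<^sub>F m in sequentially. ?D (\<lambda>y. f y + g y) m \<le> ?D f m + ?D g m"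
      proof (intro always_eventually allI)
        fix m
        have "?D (\<lambda>y. f y + g y) m \<le> (\<integral>\<^sup>+y. ennreal (cmod (f (y + t m) - f y)) + ennreal (cmod (g (y + t m) - g y)) \<partial>lborel)"
        proof (rule nn_integral_mono)
          fix y
          have "cmod (f (y + t m) + g (y + t m) - (f y + g y)) \<le> cmod (f (y + t m) - f y) + cmod (g (y + t m) - g y)" by norm
          thus "ennreal (cmod (f (y + t m) + g (y + t m) - (f y + g y))) \<le> ennreal (cmod (f (y + t m) - f y)) + ennreal (cmod (g (y + t m) - g y))"
            by (simp add: ennreal_plus[symmetric] ennreal_leI del: ennreal_plus)
        qed
        also have "\<dots> = ?D f m + ?D g m" by (rule nn_integral_add) measurable
        finally show "?D (\<lambda>y. f y + g y) m \<le> ?D f m + ?D g m" .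
      qed
      have "?D f \<longlonglongrightarrow> 0" "?D g \<longlonglongrightarrow> 0" using add.IH t unfolding translation_cont_def by blast+
      from tendsto_add[OF this] show "(\<lambda>m. ?D f m + ?D g m) \<longlonglongrightarrow> 0" by simp
    qed auto
  qed
next
  case (lim f s)
  note [measurable] = borel_measurable_integrable[OF lim.hyps(1), simplified] borel_measurable_integrable[OF lim.hyps(4), simplified]
  show ?case
  proof (rule translation_cont_approx)
    show "f \<in> borel_measurable borel" by measurable
    fix e :: real assume e: "0 < e"
    have "(\<lambda>i. \<integral>\<^sup>+y. ennreal (cmod (f y - s i y)) \<partial>lborel) \<longlonglongrightarrow> (\<integral>\<^sup>+y. 0 \<partial>(lborel :: 'a measure))"
    proof (rule nn_integral_dominated_convergence[where w = "\<lambda>y. ennreal (3 * cmod (f y))"])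
      show "AE y in lborel. ennreal (cmod (f y - s i y)) \<le> ennreal (3 * cmod (f y))" for i
      proof (rule AE_I2)
        fix y
        have "cmod (f y - s i y) \<le> cmod (f y) + cmod (s i y)" by (rule norm_triangle_ineq4)
        also have "\<dots> \<le> 3 * cmod (f y)" using lim.hyps(3)[of y i] by simp
        finally show "ennreal (cmod (f y - s i y)) \<le> ennreal (3 * cmod (f y))" by (rule ennreal_leI)
      qed
      have "integrable lborel (\<lambda>y. 3 * cmod (f y))" using lim.hyps(4) by auto
      thus "(\<integral>\<^sup>+y. ennreal (3 * cmod (f y)) \<partial>lborel) < \<infinity>" by (subst nn_integral_eq_integral) auto
      show "AE y in lborel. (\<lambda>i. ennreal (cmod (f y - s i y))) \<longlonglongrightarrow> 0"
      proof (rule AE_I2)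
        fix y
        have "(\<lambda>i. cmod (f y - s i y)) \<longlonglongrightarrow> cmod (f y - f y)" using lim.hyps(2)[of y] by (intro tendsto_intros) auto
        from tendsto_ennrealI[OF this] show "(\<lambda>i. ennreal (cmod (f y - s i y))) \<longlonglongrightarrow> 0" by simp
      qed
    qed measurable
    hence "eventually (\<lambda>i. (\<integral>\<^sup>+y. ennreal (cmod (f y - s i y)) \<partial>lborel) < ennreal e) sequentially"
      using e by (intro order_tendstoD) auto
    then obtain i where "(\<integral>\<^sup>+y. ennreal (cmod (f y - s i y)) \<partial>lborel) < ennreal e" by (auto simp: eventually_sequentially)
    moreover have "s i \<in> borel_measurable borel" by measurable
    ultimately show "\<exists>g. g \<in> borel_measurable borel \<and> translation_cont g \<and> (\<integral>\<^sup>+y. ennreal (cmod (f y - g y)) \<partial>lborel) < ennreal e"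
      using lim.IH[of i] by blast
  qed
qed

text \<open>For square-integrable functions, truncation to a bounded function on a bounded set reduces the
  continuity in the mean square to that in the mean.\<close>

lemma translation_cont_sq_int:
  fixes f :: "'a::euclidean_space \<Rightarrow> complex"
  assumes f: "sq_int f" and t: "t \<longlonglongrightarrow> 0"
  shows "(\<lambda>m::nat. \<integral>\<^sup>+y. ennreal ((cmod (f (y + t m) - f y))\<^sup>2) \<partial>lborel) \<longlonglongrightarrow> 0"
proof (rule order_tendstoI)
  have fm[measurable]: "f \<in> borel_measurable borel" and fi: "integrable lborel (\<lambda>y. (cmod (f y))\<^sup>2)" using f by (auto simp: sq_int_def)
  have ff: "(\<integral>\<^sup>+y. ennreal ((cmod (f y))\<^sup>2) \<partial>lborel) < \<infinity>" using fi by (subst nn_integral_eq_integral) auto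
  fix a :: ennreal assume "0 < a"
  then obtain b where b: "0 < b" "b < a" using dense by blast
  then obtain e where e: "b = ennreal e" "0 < e" by (cases b) auto
  define S where "S = (\<lambda>k::nat. {y. cmod (f y) \<le> real k} \<inter> cball 0 (real k))"
  define g where "g = (\<lambda>k y. indicator (S k) y *\<^sub>R f y)"
  have [measurable]: "S k \<in> sets borel" for k 
  proof -
    have "{y \<in> space borel. cmod (f y) \<le> real k} \<in> sets borel" by measurable
    thus ?thesis unfolding S_def by (intro sets.Int) simp_all
  qed
  have gm[measurable]: "g k \<in> borel_measurable borel" for k unfolding g_def by measurable
  have gb: "cmod (g k y) \<le> real k" for k y by (auto simp: g_def S_def indicator_def)
  have "(\<lambda>k. \<integral>\<^sup>+y. ennreal ((cmod (f y - g k y))\<^sup>2) \<partial>lborel) \<longlonglongrightarrow> (\<integral>\<^sup>+y. 0 \<partial>(lborel :: 'a measure))"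
  proof (rule nn_integral_dominated_convergence[OF _ _ _ _ ff])
    show "AE y in lborel. ennreal ((cmod (f y - g k y))\<^sup>2) \<le> ennreal ((cmod (f y))\<^sup>2)" for k
      by (auto simp: g_def indicator_def)
    show "AE y in lborel. (\<lambda>k. ennreal ((cmod (f y - g k y))\<^sup>2)) \<longlonglongrightarrow> 0"
    proof (rule AE_I2)
      fix y
      obtain K where K: "max (cmod (f y)) (norm y) \<le> real K" using real_arch_simple by blast
      have "eventually (\<lambda>k. ennreal ((cmod (f y - g k y))\<^sup>2) = 0) sequentially"
        by (rule eventually_sequentiallyI[of K]) (use K in \<open>auto simp: g_def S_def indicator_def\<close>)
      thus "(\<lambda>k. ennreal ((cmod (f y - g k y))\<^sup>2)) \<longlonglongrightarrow> 0" by (rule tendsto_eventually)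
    qed
  qed measurable
  hence "eventually (\<lambda>k. (\<integral>\<^sup>+y. ennreal ((cmod (f y - g k y))\<^sup>2) \<partial>lborel) < ennreal (e / 9)) sequentially"
    using e by (intro order_tendstoD) auto
  then obtain k where k: "(\<integral>\<^sup>+y. ennreal ((cmod (f y - g k y))\<^sup>2) \<partial>lborel) < ennreal (e / 9)" by (auto simp: eventually_sequentially)
  have "integrable lborel (g k)"
  proof (rule Bochner_Integration.integrable_bound[of _ "\<lambda>y. indicator (cball 0 (real k)) y * real k"])
    show "integrable lborel (\<lambda>y :: 'a. indicator (cball 0 (real k)) y * real k)"
      using emeasure_lborel_cball_finite[of "0::'a" "real k"] by (intro integrable_mult_left) (simp add: integrable_indicator_iff)
    show "AE y in lborel. norm (g k y) \<le> norm (indicator (cball 0 (real k)) y * real k)"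
      by (auto simp: g_def S_def indicator_def)
  qed measurable
  from translation_cont_integrable[OF this] t
  have "(\<lambda>m. \<integral>\<^sup>+y. ennreal (cmod (g k (y + t m) - g k y)) \<partial>lborel) \<longlonglongrightarrow> 0" unfolding translation_cont_def by blast
  hence "(\<lambda>m. ennreal (6 * real k) * (\<integral>\<^sup>+y. ennreal (cmod (g k (y + t m) - g k y)) \<partial>lborel)) \<longlonglongrightarrow> ennreal (6 * real k) * 0"
    by (intro ennreal_tendsto_cmult) auto
  hence "eventually (\<lambda>m. ennreal (6 * real k) * (\<integral>\<^sup>+y. ennreal (cmod (g k (y + t m) - g k y)) \<partial>lborel) < ennreal (e / 3)) sequentially"
    using e by (intro order_tendstoD) auto
  thus "eventually (\<lambda>m. (\<integral>\<^sup>+y. ennreal ((cmod (f (y + t m) - f y))\<^sup>2) \<partial>lborel) < a) sequentially"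
  proof eventually_elim
    case (elim m)
    let ?x = "\<lambda>y. (cmod (f y - g k y))\<^sup>2" and ?z = "\<lambda>y. cmod (g k (y + t m) - g k y)"
    have "(\<integral>\<^sup>+y. ennreal ((cmod (f (y + t m) - f y))\<^sup>2) \<partial>lborel) \<le>
      (\<integral>\<^sup>+y. (3 * ennreal (?x (y + t m)) + ennreal (6 * real k) * ennreal (?z y)) + 3 * ennreal (?x y) \<partial>lborel)"
    proof (rule nn_integral_mono)
      fix y
      let ?p = "cmod (f (y + t m) - g k (y + t m))" and ?q = "cmod (f y - g k y)"
      have "cmod (f (y + t m) - f y) \<le> ?p + ?z y + ?q" by norm
      hence "(cmod (f (y + t m) - f y))\<^sup>2 \<le> (?p + ?z y + ?q)\<^sup>2" by (intro power_mono) auto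
      also have "\<dots> \<le> 3 * ?p\<^sup>2 + 3 * (?z y)\<^sup>2 + 3 * ?q\<^sup>2"
        using sum_squares_bound[of ?p "?z y"] sum_squares_bound[of ?p ?q] sum_squares_bound[of "?z y" ?q]
        by (simp add: power2_eq_square algebra_simps)
      also have "(?z y)\<^sup>2 \<le> 2 * real k * ?z y"
      proof -
        have "?z y \<le> 2 * real k" using gb[of k "y + t m"] gb[of k y] norm_triangle_ineq4[of "g k (y + t m)" "g k y"] by linarith
        from mult_right_mono[OF this, of "?z y"] show ?thesis by (simp add: power2_eq_square)
      qed
      finally have "(cmod (f (y + t m) - f y))\<^sup>2 \<le> 3 * ?p\<^sup>2 + 6 * real k * ?z y + 3 * ?q\<^sup>2" by simp
      hence "ennreal ((cmod (f (y + t m) - f y))\<^sup>2) \<le> ennreal (3 * ?p\<^sup>2 + 6 * real k * ?z y + 3 * ?q\<^sup>2)" by (rule ennreal_leI)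
      also have "\<dots> = (3 * ennreal (?x (y + t m)) + ennreal (6 * real k) * ennreal (?z y)) + 3 * ennreal (?x y)"
        by (simp add: ennreal_mult)
      finally show "ennreal ((cmod (f (y + t m) - f y))\<^sup>2) \<le> \<dots>" .
    qed
    also have "\<dots> = 3 * (\<integral>\<^sup>+y. ennreal (?x (y + t m)) \<partial>lborel) + ennreal (6 * real k) * (\<integral>\<^sup>+y. ennreal (?z y) \<partial>lborel) + 3 * (\<integral>\<^sup>+y. ennreal (?x y) \<partial>lborel)"
      by (subst nn_integral_add, measurable)+ (simp add: nn_integral_cmult)
    also have "(\<integral>\<^sup>+y. ennreal (?x (y + t m)) \<partial>lborel) = (\<integral>\<^sup>+y. ennreal (?x y) \<partial>lborel)"
      by (rule nn_integral_lborel_shift[of "\<lambda>y. ennreal (?x y)"]) measurable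
    also have "3 * (\<integral>\<^sup>+y. ennreal (?x y) \<partial>lborel) + ennreal (6 * real k) * (\<integral>\<^sup>+y. ennreal (?z y) \<partial>lborel) + 3 * (\<integral>\<^sup>+y. ennreal (?x y) \<partial>lborel)
       \<le> 3 * ennreal (e / 9) + ennreal (e / 3) + 3 * ennreal (e / 9)"
      using k elim by (intro add_mono mult_left_mono) auto
    also have "\<dots> = b"
    proof -
      have "3 * ennreal (e / 9) = ennreal (e / 3)" using e by (simp flip: ennreal_numeral ennreal_mult')
      thus ?thesis using e by (simp add: ennreal_plus[symmetric] del: ennreal_plus)
    qed
    finally show ?case using b by simp
  qed
qed simp


section \<open>Plancherel's theorem and Moyal's identity\<close>

lemma integrable_gauss:
  assumes "0 < c" shows "integrable lborel (\<lambda>y :: real ^ 'n::finite. exp (- c * (norm y)\<^sup>2))"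
proof -
  obtain C where C: "\<And>t. 0 \<le> t \<Longrightarrow> (1 + t) ^ (2 * CARD('n)) * exp (- c * t\<^sup>2) \<le> C"
    using poly_gauss_bounded_gen[OF assms] by blast
  show ?thesis
  proof (rule integrable_decay_bound[where A = C])
    show "norm (exp (- c * (norm y)\<^sup>2)) \<le> C * decay y" for y :: "real ^ 'n"
      using C[of "norm y"] by (simp add: decay_def field_simps add_pos_nonneg)
  qed measurable
qed

lemma lborel_product_integrable:
  fixes F :: "real ^ 'n::finite \<Rightarrow> real ^ 'n \<Rightarrow> complex"
  assumes m: "(\<lambda>z. F (fst z) (snd z)) \<in> borel_measurable borel"
    and f: "(\<integral>\<^sup>+x. \<integral>\<^sup>+y. ennreal (cmod (F x y)) \<partial>lborel \<partial>lborel) < \<infinity>"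
  shows "integrable (lborel \<Otimes>\<^sub>M lborel) (\<lambda>(x, y). F x y)"
proof -
  have "integrable lborel (\<lambda>z. F (fst z) (snd z))"
  proof (rule integrableI_bounded)
    show "(\<lambda>z. F (fst z) (snd z)) \<in> borel_measurable lborel" using m by simp
    have M: "(\<lambda>z. ennreal (norm (F (fst z) (snd z)))) \<in> borel_measurable borel" using m by measurable
    show "(\<integral>\<^sup>+z. ennreal (norm (F (fst z) (snd z))) \<partial>lborel) < \<infinity>"
      using f unfolding nn_integral_lborel_prod_fst(1)[OF M] fst_conv snd_conv .
  qed
  thus ?thesis by (simp add: lborel_prod case_prod_unfold)
qed

lemma integral_lborel_scale:
  fixes f :: "'a::euclidean_space \<Rightarrow> 'b::{banach, second_countable_topology}"
  assumes [measurable]: "f \<in> borel_measurable borel" and c: "0 < c"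
  shows "(LINT x|lborel. f x) = c ^ DIM('a) *\<^sub>R (LINT x|lborel. f (c *\<^sub>R x))"
proof -
  have "(LINT x|lborel. f x) = (LINT x|density (distr lborel borel (\<lambda>x. 0 + c *\<^sub>R x)) (\<lambda>_. ennreal (\<bar>c\<bar> ^ DIM('a))). f x)"
    by (subst lborel_affine[of c 0]) (use c in auto)
  also have "\<dots> = (LINT x|lborel. (c ^ DIM('a)) *\<^sub>R f (c *\<^sub>R x))"
    using c by (subst integral_density) (auto simp: integral_distr)
  finally show ?thesis by simp
qed

lemma integrable_lborel_scale:
  fixes f :: "'a::euclidean_space \<Rightarrow> 'b::{banach, second_countable_topology}"
  assumes [measurable]: "f \<in> borel_measurable borel" and c: "0 < c" and i: "integrable lborel f"
  shows "integrable lborel (\<lambda>x. f (c *\<^sub>R x))"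
proof -
  have "integrable (density (distr lborel borel (\<lambda>x. 0 + c *\<^sub>R x)) (\<lambda>_. ennreal (\<bar>c\<bar> ^ DIM('a)))) f"
    using i c by (subst (asm) lborel_affine[of c 0]) auto
  hence "integrable lborel (\<lambda>x. c ^ DIM('a) *\<^sub>R f (c *\<^sub>R x))"
    using c by (subst (asm) integrable_density) (auto simp: integrable_distr_eq)
  from integrable_scaleR_right[OF this, of "inverse (c ^ DIM('a))"] show ?thesis using c by simp
qed

text \<open>The normalisation of the short-time Fourier transform.\<close>

definition fourier :: "(real ^ 'n::finite \<Rightarrow> complex) \<Rightarrow> real ^ 'n \<Rightarrow> complex" where
  "fourier f \<xi> = (LINT y|lborel. f y * exp (- \<i> * of_real (y \<bullet> \<xi>)))"

text \<open>The integral is not evaluated, as only the positivity of the constants enters; the same holds for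
  \<open>plancherel_const\<close> and \<open>moyal_const\<close> below. The value of \<open>plancherel_const\<close> is \<open>(2 \<pi>)\<^sup>n\<close>.\<close>

definition gauss_const :: "'n::finite itself \<Rightarrow> real" where
  "gauss_const _ = (LINT y|lborel. exp (- (2 * pi) * (norm (y :: real ^ 'n))\<^sup>2))"

text \<open>The Bargmann transform of the Gaussian is constant; its values at imaginary points are the Fourier transform of the
  squared Gaussian.\<close>

lemma gauss_fourier:
  fixes t :: "real ^ 'n::finite"
  shows "(LINT \<eta>|lborel. of_real (exp (- (2 * pi) * (norm \<eta>)\<^sup>2)) * exp (\<i> * of_real (t \<bullet> \<eta>)))
    = complex_of_real (gauss_const TYPE('n) * exp (- (norm t)\<^sup>2 / (8 * pi)))"
proof -
  have e: "gexp 0 y * gexp \<zeta> y = of_real (exp (- (2 * pi) * (norm y)\<^sup>2)) * exp (cdot \<zeta> y)" for y :: "real ^ 'n" and \<zeta>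
  proof -
    have "complex_of_real (- pi * (norm y)\<^sup>2) + (of_real (- pi * (norm y)\<^sup>2) + cdot \<zeta> y) = of_real (- (2 * pi) * (norm y)\<^sup>2) + cdot \<zeta> y"
      by simp
    thus ?thesis unfolding gexp_def by (simp only: exp_add[symmetric] cdot_simps add_0_right exp_of_real[symmetric])
  qed
  define \<zeta> :: "complex ^ 'n" where "\<zeta> = (\<chi> i. \<i> * of_real (t $ i))"
  have z: "cdot \<zeta> \<eta> = \<i> * of_real (t \<bullet> \<eta>)" for \<eta>
    by (simp add: cdot_def \<zeta>_def inner_vec_def sum_distrib_left mult.assoc)
  have csq: "csq \<zeta> = - of_real ((norm t)\<^sup>2)"
  proof -
    have "(\<i> * complex_of_real (t $ i))\<^sup>2 = - of_real ((t $ i)\<^sup>2)" for i by (simp add: power_mult_distrib)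
    moreover have "(norm t)\<^sup>2 = (\<Sum>i\<in>UNIV. (t $ i)\<^sup>2)" unfolding power2_norm_eq_inner by (simp add: inner_vec_def power2_eq_square)
    ultimately show ?thesis unfolding csq_def \<zeta>_def by (simp add: sum_negf)
  qed
  have gm: "gauss_mass TYPE('n) = of_real (gauss_const TYPE('n))"
    unfolding gauss_mass_def gauss_const_def e by (simp flip: integral_complex_of_real)
  have "exp (- csq \<zeta> / of_real (8 * pi)) * (LINT \<eta>|lborel. gexp 0 \<eta> * gexp \<zeta> \<eta>) = gauss_mass TYPE('n)"
    using bargmann_gauss[of \<zeta>] by (simp add: bargmann_def dist_of_schwartz[OF gexp_schwartz schwartz_measurable[OF gexp_schwartz]])
  hence "(LINT \<eta>|lborel. gexp 0 \<eta> * gexp \<zeta> \<eta>) = gauss_mass TYPE('n) * exp (csq \<zeta> / of_real (8 * pi))"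
    by (simp add: exp_minus field_simps)
  also have "exp (csq \<zeta> / of_real (8 * pi)) = of_real (exp (- (norm t)\<^sup>2 / (8 * pi)))"
    unfolding csq exp_of_real[symmetric] by simp
  finally show ?thesis unfolding e z by (simp add: gm)
qed

lemma gauss_const_pos: "0 < gauss_const TYPE('n::finite)"
proof -
  have "gauss_const TYPE('n) \<noteq> 0"
    using gauss_fourier[of "0 :: real ^ 'n"] gauss_mass_nonzero[where 'n = 'n]
  proof -
    have "gauss_mass TYPE('n) = of_real (gauss_const TYPE('n))"
    proof -
      have "gexp 0 y * gexp 0 y = complex_of_real (exp (- (2 * pi) * (norm y)\<^sup>2))" for y :: "real ^ 'n"
        unfolding gexp_def exp_of_real[symmetric] exp_add[symmetric] by (simp add: mult.assoc)
      thus ?thesis unfolding gauss_mass_def gauss_const_def by (simp flip: integral_complex_of_real)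
    qed
    thus ?thesis using gauss_mass_nonzero[where 'n = 'n] by auto
  qed
  moreover have "0 \<le> gauss_const TYPE('n)" unfolding gauss_const_def by (intro Bochner_Integration.integral_nonneg) auto
  ultimately show ?thesis by simp
qed

definition plancherel_const :: "'n::finite itself \<Rightarrow> real" where
  "plancherel_const _ = (LINT s|lborel. gauss_const TYPE('n) * exp (- (1 / (8 * pi)) * (norm (s :: real ^ 'n))\<^sup>2))"

lemma plancherel_const_pos: "0 < plancherel_const TYPE('n::finite)"
proof -
  let ?g = "\<lambda>s :: real ^ 'n. exp (- (1 / (8 * pi)) * (norm s)\<^sup>2)"
  have i: "integrable lborel ?g" by (rule integrable_gauss) simp
  have "(LINT s|lborel. ?g s) \<noteq> 0"
  proof
    assume "(LINT s|lborel. ?g s) = 0"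
    hence "AE y in lborel. ?g y = 0" using integral_nonneg_eq_0_iff_AE[OF i] by simp
    hence "AE y :: real ^ 'n in lborel. False" by simp
    thus False by (simp add: trivial_limit_def[symmetric] ae_filter_eq_bot_iff emeasure_lborel_UNIV)
  qed
  moreover have "0 \<le> (LINT s|lborel. ?g s)" by (intro Bochner_Integration.integral_nonneg) auto
  ultimately have "0 < (LINT s|lborel. ?g s)" by (simp only: less_le simp_thms not_sym)
  thus ?thesis using gauss_const_pos[where 'n = 'n] by (simp add: plancherel_const_def)
qed

text \<open>Regularised by a Gaussian, the integral of the squared Fourier transform is an average of the autocorrelation
  of the function near 0.\<close>

lemma plancherel_regularised:
  fixes f :: "real ^ 'n::finite \<Rightarrow> complex"
  assumes f: "integrable lborel f" "sq_int f" and \<epsilon>: "0 < \<epsilon>"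
  defines "A \<equiv> (LINT y|lborel. (cmod (f y))\<^sup>2)" and "N \<equiv> \<lambda>t. LINT y|lborel. (cmod (f (y + t) - f y))\<^sup>2"
  shows "integrable lborel (\<lambda>\<xi>. (cmod (fourier f \<xi>))\<^sup>2 * exp (- (2 * pi) * (norm (\<epsilon> *\<^sub>R \<xi>))\<^sup>2))"
    and "(LINT \<xi>|lborel. (cmod (fourier f \<xi>))\<^sup>2 * exp (- (2 * pi) * (norm (\<epsilon> *\<^sub>R \<xi>))\<^sup>2)) =
     (LINT s|lborel. gauss_const TYPE('n) * exp (- (1 / (8 * pi)) * (norm s)\<^sup>2) * (A - N (\<epsilon> *\<^sub>R s) / 2))"
    and "(\<lambda>t. A - N t / 2) \<in> borel_measurable borel"
    and "\<And>t. \<bar>A - N t / 2\<bar> \<le> A"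
    and "\<And>t. ennreal (N t) = (\<integral>\<^sup>+y. ennreal ((cmod (f (y + t) - f y))\<^sup>2) \<partial>lborel)"
proof -
  have fm[measurable]: "f \<in> borel_measurable borel" using f by (simp add: sq_int_def)
  have fi: "integrable lborel (\<lambda>y. (cmod (f y))\<^sup>2)" using f by (simp add: sq_int_def)
  define F1 where "F1 = (LINT y|lborel. cmod (f y))"
  have F1: "(\<integral>\<^sup>+y. ennreal (cmod (f y)) \<partial>lborel) = ennreal F1" unfolding F1_def
    using f(1) by (intro nn_integral_eq_integral) auto
  have sh: "sq_int (\<lambda>y. f (y + t))" for t
    using integrable_lborel_shift[OF fi, of t] by (simp add: sq_int_def)
  have ic: "integrable lborel (\<lambda>y. f y * cnj (f (y + t)))" for t
    by (rule sq_int_mult[OF f(2) sq_int_cnj[OF sh]])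
  define a where "a = (\<lambda>t. LINT y|lborel. f y * cnj (f (y + t)))"
  have id: "integrable lborel (\<lambda>y. (cmod (f (y + t) - f y))\<^sup>2)" for t
  proof (rule Bochner_Integration.integrable_bound)
    show "integrable lborel (\<lambda>y. 2 * (cmod (f (y + t)))\<^sup>2 + 2 * (cmod (f y))\<^sup>2)"
      using fi integrable_lborel_shift[OF fi, of t] by auto
    have "(cmod (f (y + t) - f y))\<^sup>2 \<le> 2 * (cmod (f (y + t)))\<^sup>2 + 2 * (cmod (f y))\<^sup>2" for y
    proof -
      have "(cmod (f (y + t) - f y))\<^sup>2 \<le> (cmod (f (y + t)) + cmod (f y))\<^sup>2" by (intro power_mono norm_triangle_ineq4) auto
      also have "\<dots> \<le> 2 * (cmod (f (y + t)))\<^sup>2 + 2 * (cmod (f y))\<^sup>2"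
        using sum_squares_bound[of "cmod (f (y + t))" "cmod (f y)"] by (simp add: power2_sum)
      finally show ?thesis .
    qed
    thus "AE y in lborel. norm ((cmod (f (y + t) - f y))\<^sup>2) \<le> norm (2 * (cmod (f (y + t)))\<^sup>2 + 2 * (cmod (f y))\<^sup>2)" by auto
  qed measurable
  show Nn: "ennreal (N t) = (\<integral>\<^sup>+y. ennreal ((cmod (f (y + t) - f y))\<^sup>2) \<partial>lborel)" for t
    unfolding N_def using id by (subst nn_integral_eq_integral) auto
  have Ash: "(LINT y|lborel. (cmod (f (y + t)))\<^sup>2) = A" for t
    unfolding A_def by (rule integral_lborel_shift[of "\<lambda>y. (cmod (f y))\<^sup>2"]) measurable
  have Rea: "Re (a t) = A - N t / 2" for t
  proof -
    have "2 * Re (f y * cnj (f (y + t))) = (cmod (f y))\<^sup>2 + (cmod (f (y + t)))\<^sup>2 - (cmod (f (y + t) - f y))\<^sup>2" for y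
      unfolding cmod_power2 by (simp add: power2_eq_square algebra_simps)
    hence pw: "Re (f y * cnj (f (y + t))) = ((cmod (f y))\<^sup>2 + (cmod (f (y + t)))\<^sup>2 - (cmod (f (y + t) - f y))\<^sup>2) / 2" for y
      by (metis nonzero_mult_div_cancel_left zero_neq_numeral)
    have "Re (a t) = (LINT y|lborel. Re (f y * cnj (f (y + t))))"
      unfolding a_def by (rule integral_Re[OF ic, symmetric])
    also have "\<dots> = (LINT y|lborel. ((cmod (f y))\<^sup>2 + (cmod (f (y + t)))\<^sup>2 - (cmod (f (y + t) - f y))\<^sup>2) / 2)"
      unfolding pw ..
    also have "\<dots> = (A + A - N t) / 2"
      using fi integrable_lborel_shift[OF fi, of t] id[of t] Ash[of t] by (simp add: A_def[symmetric]) (simp add: N_def)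
    finally show ?thesis by simp
  qed
  have ab: "cmod (a t) \<le> A" for t
  proof -
    have "cmod (a t) \<le> (LINT y|lborel. ((cmod (f y))\<^sup>2 + (cmod (f (y + t)))\<^sup>2) / 2)"
      unfolding a_def
    proof (rule Bochner_Integration.integral_norm_bound_integral[OF ic])
      show "integrable lborel (\<lambda>y. ((cmod (f y))\<^sup>2 + (cmod (f (y + t)))\<^sup>2) / 2)"
        using fi integrable_lborel_shift[OF fi, of t] by auto
      show "cmod (f y * cnj (f (y + t))) \<le> ((cmod (f y))\<^sup>2 + (cmod (f (y + t)))\<^sup>2) / 2" for y
        using sum_squares_bound[of "cmod (f y)" "cmod (f (y + t))"] by (simp add: norm_mult)
    qed
    also have "\<dots> = A" using fi integrable_lborel_shift[OF fi, of t] Ash[of t] by (simp add: A_def[symmetric])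
    finally show ?thesis .
  qed
  show "\<bar>A - N t / 2\<bar> \<le> A" for t using abs_Re_le_cmod[of "a t"] ab[of t] by (simp add: Rea)
  have prod: "integrable (lborel \<Otimes>\<^sub>M lborel) (\<lambda>(y, t). f y * cnj (f (y + t)) * exp (\<i> * of_real (t \<bullet> \<xi>)))" for \<xi>
  proof (rule lborel_product_integrable)
    have "(\<lambda>z :: (real ^ 'n) \<times> (real ^ 'n). f (fst z)) \<in> borel_measurable borel"
      "(\<lambda>z :: (real ^ 'n) \<times> (real ^ 'n). f (fst z + snd z)) \<in> borel_measurable borel"
      by (intro measurable_compose_continuous[OF fm] continuous_intros)+
    moreover have "(\<lambda>z :: (real ^ 'n) \<times> (real ^ 'n). exp (\<i> * of_real (snd z \<bullet> \<xi>))) \<in> borel_measurable borel"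
      by (intro borel_measurable_continuous_onI continuous_intros)
    ultimately show "(\<lambda>z. f (fst z) * cnj (f (fst z + snd z)) * exp (\<i> * of_real (snd z \<bullet> \<xi>))) \<in> borel_measurable borel"
      using measurable_compose[OF _ borel_measurable_continuous_onI[OF continuous_on_cnj[OF continuous_on_id]]]
      by (intro borel_measurable_times) auto
    have "(\<integral>\<^sup>+y. \<integral>\<^sup>+t. ennreal (cmod (f y * cnj (f (y + t)) * exp (\<i> * of_real (t \<bullet> \<xi>)))) \<partial>lborel \<partial>lborel) =
       (\<integral>\<^sup>+y. ennreal (cmod (f y)) * (\<integral>\<^sup>+t. ennreal (cmod (f (t + y))) \<partial>lborel) \<partial>lborel)"
    proof (rule nn_integral_cong)
      fix y
      have "(\<integral>\<^sup>+t. ennreal (cmod (f y * cnj (f (y + t)) * exp (\<i> * of_real (t \<bullet> \<xi>)))) \<partial>lborel) =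
        (\<integral>\<^sup>+t. ennreal (cmod (f y)) * ennreal (cmod (f (t + y))) \<partial>lborel)"
        by (intro nn_integral_cong) (simp add: norm_mult norm_exp_eq_Re ennreal_mult add.commute)
      also have "\<dots> = ennreal (cmod (f y)) * (\<integral>\<^sup>+t. ennreal (cmod (f (t + y))) \<partial>lborel)"
        by (rule nn_integral_cmult) measurable
      finally show "(\<integral>\<^sup>+t. ennreal (cmod (f y * cnj (f (y + t)) * exp (\<i> * of_real (t \<bullet> \<xi>)))) \<partial>lborel) = \<dots>" .
    qed
    also have "\<dots> = (\<integral>\<^sup>+y. ennreal (cmod (f y)) * ennreal F1 \<partial>lborel)"
      using nn_integral_lborel_shift[of "\<lambda>y. ennreal (cmod (f y))"] by (simp add: F1)
    also have "\<dots> = ennreal F1 * ennreal F1" by (subst nn_integral_multc) (auto simp: F1)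
    also have "\<dots> < \<infinity>" by (simp add: ennreal_mult_less_top)
    finally show "(\<integral>\<^sup>+y. \<integral>\<^sup>+t. ennreal (cmod (f y * cnj (f (y + t)) * exp (\<i> * of_real (t \<bullet> \<xi>)))) \<partial>lborel \<partial>lborel) < \<infinity>" .
  qed
  have ae: "(LINT y|lborel. f y * cnj (f (y + t)) * exp (\<i> * of_real (t \<bullet> \<xi>))) = a t * exp (\<i> * of_real (t \<bullet> \<xi>))" for t \<xi>
    unfolding a_def by simp
  have aint: "integrable lborel a"
    using lborel_pair.integrable_snd[OF prod[of 0]] by (simp add: a_def)
  hence am[measurable]: "a \<in> borel_measurable borel" using borel_measurable_integrable by fastforce
  have "(\<lambda>t. Re (a t)) \<in> borel_measurable borel" by measurable
  thus "(\<lambda>t. A - N t / 2) \<in> borel_measurable borel" by (simp add: Rea)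
  have FF: "fourier f \<xi> * cnj (fourier f \<xi>) = (LINT t|lborel. a t * exp (\<i> * of_real (t \<bullet> \<xi>)))" for \<xi>
  proof -
    have e: "exp (- \<i> * of_real (y \<bullet> \<xi>)) * exp (\<i> * of_real ((t + y) \<bullet> \<xi>)) = exp (\<i> * of_real (t \<bullet> \<xi>))" for y t
      unfolding exp_add[symmetric] by (simp add: inner_add_left algebra_simps)
    have m2: "(\<lambda>y. cnj (f y) * exp (\<i> * of_real (y \<bullet> \<xi>))) \<in> borel_measurable borel"
    proof -
      have "(\<lambda>y. cnj (f y)) \<in> borel_measurable borel" using sq_int_cnj[OF f(2)] by (simp add: sq_int_def)
      moreover have "(\<lambda>y :: real ^ 'n. exp (\<i> * of_real (y \<bullet> \<xi>))) \<in> borel_measurable borel"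
        by (intro borel_measurable_continuous_onI continuous_intros)
      ultimately show ?thesis by (rule borel_measurable_times)
    qed
    have "cnj (fourier f \<xi>) = (LINT y|lborel. cnj (f y) * exp (\<i> * of_real (y \<bullet> \<xi>)))"
    proof -
      have "cnj (fourier f \<xi>) = (LINT y|lborel. cnj (f y * exp (- \<i> * of_real (y \<bullet> \<xi>))))"
        unfolding fourier_def by (simp only: Bochner_Integration.integral_cnj)
      thus ?thesis by (simp add: exp_cnj)
    qed
    also have "\<dots> = (LINT t|lborel. cnj (f (t + y)) * exp (\<i> * of_real ((t + y) \<bullet> \<xi>)))" for y
      by (rule integral_lborel_shift[OF m2, symmetric])
    finally have c: "cnj (fourier f \<xi>) = (LINT t|lborel. cnj (f (t + y)) * exp (\<i> * of_real ((t + y) \<bullet> \<xi>)))" for y .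
    have "fourier f \<xi> * cnj (fourier f \<xi>) = (LINT y|lborel. f y * exp (- \<i> * of_real (y \<bullet> \<xi>)) * cnj (fourier f \<xi>))"
      by (simp add: fourier_def)
    also have "\<dots> = (LINT y|lborel. LINT t|lborel. f y * cnj (f (y + t)) * exp (\<i> * of_real (t \<bullet> \<xi>)))"
    proof (intro Bochner_Integration.integral_cong refl)
      fix y
      have "f y * exp (- \<i> * of_real (y \<bullet> \<xi>)) * cnj (fourier f \<xi>) =
        (LINT t|lborel. f y * exp (- \<i> * of_real (y \<bullet> \<xi>)) * (cnj (f (t + y)) * exp (\<i> * of_real ((t + y) \<bullet> \<xi>))))"
        unfolding c[of y] by simp
      also have "\<dots> = (LINT t|lborel. f y * cnj (f (y + t)) * exp (\<i> * of_real (t \<bullet> \<xi>)))"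
      proof (intro Bochner_Integration.integral_cong refl)
        fix t
        have "f y * exp (- \<i> * of_real (y \<bullet> \<xi>)) * (cnj (f (t + y)) * exp (\<i> * of_real ((t + y) \<bullet> \<xi>))) =
          f y * cnj (f (t + y)) * (exp (- \<i> * of_real (y \<bullet> \<xi>)) * exp (\<i> * of_real ((t + y) \<bullet> \<xi>)))" by (simp only: mult_ac)
        thus "f y * exp (- \<i> * of_real (y \<bullet> \<xi>)) * (cnj (f (t + y)) * exp (\<i> * of_real ((t + y) \<bullet> \<xi>))) =
          f y * cnj (f (y + t)) * exp (\<i> * of_real (t \<bullet> \<xi>))" unfolding e by (simp only: add.commute)
      qed
      finally show "f y * exp (- \<i> * of_real (y \<bullet> \<xi>)) * cnj (fourier f \<xi>) = \<dots>" .
    qed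
    also have "\<dots> = (LINT t|lborel. LINT y|lborel. f y * cnj (f (y + t)) * exp (\<i> * of_real (t \<bullet> \<xi>)))"
      by (rule lborel_pair.Fubini_integral[OF prod, symmetric])
    finally show ?thesis unfolding ae .
  qed
  let ?k = "\<lambda>\<eta> :: real ^ 'n. exp (- (2 * pi) * (norm \<eta>)\<^sup>2)"
  let ?J = "\<lambda>s :: real ^ 'n. gauss_const TYPE('n) * exp (- (1 / (8 * pi)) * (norm s)\<^sup>2)"
  have ki: "integrable lborel ?k" by (rule integrable_gauss) simp
  have kie: "integrable lborel (\<lambda>\<xi>. ?k (\<epsilon> *\<^sub>R \<xi>))" by (rule integrable_lborel_scale[OF _ \<epsilon> ki]) measurable
  have prod2: "integrable (lborel \<Otimes>\<^sub>M lborel) (\<lambda>(\<xi>, t). a t * exp (\<i> * of_real (t \<bullet> \<xi>)) * of_real (?k (\<epsilon> *\<^sub>R \<xi>)))"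
  proof (rule lborel_product_integrable)
    have "(\<lambda>z :: (real ^ 'n) \<times> (real ^ 'n). a (snd z)) \<in> borel_measurable borel"
      by (intro measurable_compose_continuous[OF am] continuous_intros)
    moreover have "(\<lambda>z :: (real ^ 'n) \<times> (real ^ 'n). exp (\<i> * of_real (snd z \<bullet> fst z)) * complex_of_real (?k (\<epsilon> *\<^sub>R fst z))) \<in> borel_measurable borel"
      by (intro borel_measurable_continuous_onI continuous_intros)
    ultimately show "(\<lambda>z. a (snd z) * exp (\<i> * of_real (snd z \<bullet> fst z)) * complex_of_real (?k (\<epsilon> *\<^sub>R fst z))) \<in> borel_measurable borel"
      unfolding mult.assoc by (rule borel_measurable_times)
    have "(\<integral>\<^sup>+\<xi>. \<integral>\<^sup>+t. ennreal (cmod (a t * exp (\<i> * of_real (t \<bullet> \<xi>)) * of_real (?k (\<epsilon> *\<^sub>R \<xi>)))) \<partial>lborel \<partial>lborel) =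
      (\<integral>\<^sup>+\<xi>. \<integral>\<^sup>+t. ennreal (cmod (a t)) * ennreal (?k (\<epsilon> *\<^sub>R \<xi>)) \<partial>lborel \<partial>lborel)"
      by (intro nn_integral_cong) (simp add: norm_mult norm_exp_eq_Re ennreal_mult)
    also have "\<dots> = (\<integral>\<^sup>+t. ennreal (cmod (a t)) \<partial>lborel) * (\<integral>\<^sup>+\<xi>. ennreal (?k (\<epsilon> *\<^sub>R \<xi>)) \<partial>lborel)"
      by (subst nn_integral_multc, measurable, subst nn_integral_cmult, measurable)
    also have "\<dots> < \<infinity>"
    proof -
      have "(\<integral>\<^sup>+t. ennreal (cmod (a t)) \<partial>lborel) < \<infinity>" using aint by (simp add: integrable_iff_bounded)
      moreover have "(\<integral>\<^sup>+\<xi>. ennreal (?k (\<epsilon> *\<^sub>R \<xi>)) \<partial>lborel) < \<infinity>" using kie by (subst nn_integral_eq_integral) auto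
      ultimately show ?thesis by (simp add: ennreal_mult_less_top)
    qed
    finally show "(\<integral>\<^sup>+\<xi>. \<integral>\<^sup>+t. ennreal (cmod (a t * exp (\<i> * of_real (t \<bullet> \<xi>)) * of_real (?k (\<epsilon> *\<^sub>R \<xi>)))) \<partial>lborel \<partial>lborel) < \<infinity>" .
  qed
  have inner: "(LINT t|lborel. a t * exp (\<i> * of_real (t \<bullet> \<xi>)) * of_real (?k (\<epsilon> *\<^sub>R \<xi>))) = of_real ((cmod (fourier f \<xi>))\<^sup>2 * ?k (\<epsilon> *\<^sub>R \<xi>))" for \<xi>
  proof -
    have "(LINT t|lborel. a t * exp (\<i> * of_real (t \<bullet> \<xi>)) * of_real (?k (\<epsilon> *\<^sub>R \<xi>))) = fourier f \<xi> * cnj (fourier f \<xi>) * of_real (?k (\<epsilon> *\<^sub>R \<xi>))"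
      unfolding FF by simp
    thus ?thesis by (simp only: complex_norm_square[symmetric] of_real_mult)
  qed
  have li: "integrable lborel (\<lambda>\<xi>. complex_of_real ((cmod (fourier f \<xi>))\<^sup>2 * ?k (\<epsilon> *\<^sub>R \<xi>)))"
    using lborel_pair.integrable_fst[OF prod2] unfolding inner .
  thus li': "integrable lborel (\<lambda>\<xi>. (cmod (fourier f \<xi>))\<^sup>2 * ?k (\<epsilon> *\<^sub>R \<xi>))" by (simp only: complex_of_real_integrable_eq)
  let ?e = "\<epsilon> ^ DIM(real ^ 'n)"
  have J: "(LINT \<xi>|lborel. a t * exp (\<i> * of_real (t \<bullet> \<xi>)) * of_real (?k (\<epsilon> *\<^sub>R \<xi>))) = a t * (of_real (?J (t /\<^sub>R \<epsilon>)) / of_real ?e)" for t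
  proof -
    have "of_real (?J (t /\<^sub>R \<epsilon>)) = (LINT \<eta>|lborel. of_real (?k \<eta>) * exp (\<i> * of_real ((t /\<^sub>R \<epsilon>) \<bullet> \<eta>)))"
      unfolding gauss_fourier by simp
    also have "\<dots> = ?e *\<^sub>R (LINT \<xi>|lborel. of_real (?k (\<epsilon> *\<^sub>R \<xi>)) * exp (\<i> * of_real ((t /\<^sub>R \<epsilon>) \<bullet> (\<epsilon> *\<^sub>R \<xi>))))"
      by (rule integral_lborel_scale[OF _ \<epsilon>]) (intro borel_measurable_continuous_onI continuous_intros)
    also have "(\<lambda>\<xi>. of_real (?k (\<epsilon> *\<^sub>R \<xi>)) * exp (\<i> * of_real ((t /\<^sub>R \<epsilon>) \<bullet> (\<epsilon> *\<^sub>R \<xi>)))) = (\<lambda>\<xi>. exp (\<i> * of_real (t \<bullet> \<xi>)) * of_real (?k (\<epsilon> *\<^sub>R \<xi>)))"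
    proof -
      have "(t /\<^sub>R \<epsilon>) \<bullet> (\<epsilon> *\<^sub>R \<xi>) = t \<bullet> \<xi>" for \<xi> using \<epsilon> by simp
      thus ?thesis by (simp only: mult.commute)
    qed
    finally have "(LINT \<xi>|lborel. exp (\<i> * of_real (t \<bullet> \<xi>)) * of_real (?k (\<epsilon> *\<^sub>R \<xi>))) = of_real (?J (t /\<^sub>R \<epsilon>)) / of_real ?e"
      using \<epsilon> by (simp add: scaleR_conv_of_real)
    thus ?thesis by (simp add: mult.assoc)
  qed
  have "complex_of_real (LINT \<xi>|lborel. (cmod (fourier f \<xi>))\<^sup>2 * ?k (\<epsilon> *\<^sub>R \<xi>)) = (LINT \<xi>|lborel. of_real ((cmod (fourier f \<xi>))\<^sup>2 * ?k (\<epsilon> *\<^sub>R \<xi>)))"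
    by (rule integral_complex_of_real[symmetric])
  also have "\<dots> = (LINT \<xi>|lborel. LINT t|lborel. a t * exp (\<i> * of_real (t \<bullet> \<xi>)) * of_real (?k (\<epsilon> *\<^sub>R \<xi>)))" by (simp only: inner)
  also have "\<dots> = (LINT t|lborel. LINT \<xi>|lborel. a t * exp (\<i> * of_real (t \<bullet> \<xi>)) * of_real (?k (\<epsilon> *\<^sub>R \<xi>)))"
    by (rule lborel_pair.Fubini_integral[OF prod2, symmetric])
  also have "\<dots> = (LINT t|lborel. a t * (of_real (?J (t /\<^sub>R \<epsilon>)) / of_real ?e))" by (simp only: J)
  also have "\<dots> = ?e *\<^sub>R (LINT s|lborel. a (\<epsilon> *\<^sub>R s) * (of_real (?J ((\<epsilon> *\<^sub>R s) /\<^sub>R \<epsilon>)) / of_real ?e))"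
    by (rule integral_lborel_scale[OF _ \<epsilon>]) measurable
  also have "\<dots> = (LINT s|lborel. a (\<epsilon> *\<^sub>R s) * of_real (?J s))"
  proof -
    have "(LINT s|lborel. a (\<epsilon> *\<^sub>R s) * (of_real (?J ((\<epsilon> *\<^sub>R s) /\<^sub>R \<epsilon>)) / of_real ?e)) = (LINT s|lborel. (a (\<epsilon> *\<^sub>R s) * of_real (?J s)) / of_real ?e)"
      using \<epsilon> by (intro Bochner_Integration.integral_cong) auto
    thus ?thesis using \<epsilon> by (simp add: scaleR_conv_of_real)
  qed
  finally have E: "complex_of_real (LINT \<xi>|lborel. (cmod (fourier f \<xi>))\<^sup>2 * ?k (\<epsilon> *\<^sub>R \<xi>)) = (LINT s|lborel. a (\<epsilon> *\<^sub>R s) * of_real (?J s))" .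
  have Ji: "integrable lborel ?J" by (intro integrable_mult_right integrable_gauss) simp
  have "integrable lborel (\<lambda>s. a (\<epsilon> *\<^sub>R s) * of_real (?J s))"
  proof (rule Bochner_Integration.integrable_bound[OF integrable_mult_right[OF Ji, of A]])
    show "AE s in lborel. norm (a (\<epsilon> *\<^sub>R s) * of_real (?J s)) \<le> norm (A * ?J s)"
    proof (rule AE_I2)
      fix s
      have "cmod (a (\<epsilon> *\<^sub>R s)) * \<bar>?J s\<bar> \<le> \<bar>A\<bar> * \<bar>?J s\<bar>" using ab[of "\<epsilon> *\<^sub>R s"] by (intro mult_right_mono) auto
      thus "norm (a (\<epsilon> *\<^sub>R s) * of_real (?J s)) \<le> norm (A * ?J s)" by (simp only: norm_mult norm_of_real real_norm_def abs_mult)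
    qed
  qed measurable
  hence "Re (LINT s|lborel. a (\<epsilon> *\<^sub>R s) * of_real (?J s)) = (LINT s|lborel. Re (a (\<epsilon> *\<^sub>R s) * of_real (?J s)))"
    by (rule integral_Re[symmetric])
  also have "\<dots> = (LINT s|lborel. ?J s * (A - N (\<epsilon> *\<^sub>R s) / 2))"
    by (intro Bochner_Integration.integral_cong) (auto simp: Rea mult.commute)
  finally show "(LINT \<xi>|lborel. (cmod (fourier f \<xi>))\<^sup>2 * ?k (\<epsilon> *\<^sub>R \<xi>)) = (LINT s|lborel. ?J s * (A - N (\<epsilon> *\<^sub>R s) / 2))"
    using arg_cong[OF E, of Re] by simp
qed


text \<open>As the regularisation is removed, the average of the autocorrelation tends to its value at 0, by the continuity of
  translations in the mean square.\<close>

theorem plancherel: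
  fixes f :: "real ^ 'n::finite \<Rightarrow> complex"
  assumes f: "integrable lborel f" "sq_int f"
  shows "(\<integral>\<^sup>+\<xi>. ennreal ((cmod (fourier f \<xi>))\<^sup>2) \<partial>lborel) = ennreal (plancherel_const TYPE('n) * (LINT y|lborel. (cmod (f y))\<^sup>2))"
proof -
  define A where "A = (LINT y|lborel. (cmod (f y))\<^sup>2)"
  define N where "N = (\<lambda>t. LINT y|lborel. (cmod (f (y + t) - f y))\<^sup>2)"
  define e where "e = (\<lambda>m::nat. inverse (real (Suc m)))"
  have e0: "0 < e m" for m by (simp add: e_def)
  note R = plancherel_regularised[OF f e0, folded A_def N_def]
  note B = plancherel_regularised(3-5)[OF f zero_less_one, folded A_def N_def]
  let ?k = "\<lambda>m (\<xi> :: real ^ 'n). exp (- (2 * pi) * (norm (e m *\<^sub>R \<xi>))\<^sup>2)"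
  let ?J = "\<lambda>s :: real ^ 'n. gauss_const TYPE('n) * exp (- (1 / (8 * pi)) * (norm s)\<^sup>2)"
  have N0: "0 \<le> N t" for t unfolding N_def by (intro Bochner_Integration.integral_nonneg) auto
  have et: "e \<longlonglongrightarrow> 0" unfolding e_def by (rule LIMSEQ_inverse_real_of_nat)
  have "(\<lambda>m. \<integral>\<^sup>+\<xi>. ennreal ((cmod (fourier f \<xi>))\<^sup>2 * ?k m \<xi>) \<partial>lborel) \<longlonglongrightarrow> (\<integral>\<^sup>+\<xi>. ennreal ((cmod (fourier f \<xi>))\<^sup>2) \<partial>lborel)"
  proof (rule nn_integral_LIMSEQ)
    show "incseq (\<lambda>m \<xi>. ennreal ((cmod (fourier f \<xi>))\<^sup>2 * ?k m \<xi>))"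
    proof (intro incseq_SucI le_funI ennreal_leI mult_left_mono)
      fix m and \<xi> :: "real ^ 'n"
      have "e (Suc m) \<le> e m" unfolding e_def by (simp add: field_simps)
      hence "(norm (e (Suc m) *\<^sub>R \<xi>))\<^sup>2 \<le> (norm (e m *\<^sub>R \<xi>))\<^sup>2"
        using e0[of m] e0[of "Suc m"] by (intro power_mono) (auto intro: mult_right_mono)
      thus "?k m \<xi> \<le> ?k (Suc m) \<xi>" by (simp add: mult_left_mono)
    qed simp
    show "(\<lambda>\<xi>. ennreal ((cmod (fourier f \<xi>))\<^sup>2 * ?k m \<xi>)) \<in> borel_measurable lborel" for m
      using borel_measurable_integrable[OF R(1)[of m]] by measurable
    fix \<xi> :: "real ^ 'n"
    have "(\<lambda>m. (cmod (fourier f \<xi>))\<^sup>2 * ?k m \<xi>) \<longlonglongrightarrow> (cmod (fourier f \<xi>))\<^sup>2 * exp (- (2 * pi) * (norm (0 *\<^sub>R \<xi>))\<^sup>2)"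
      by (intro tendsto_intros et)
    from tendsto_ennrealI[OF this] show "(\<lambda>m. ennreal ((cmod (fourier f \<xi>))\<^sup>2 * ?k m \<xi>)) \<longlonglongrightarrow> ennreal ((cmod (fourier f \<xi>))\<^sup>2)" by simp
  qed
  moreover have "(\<integral>\<^sup>+\<xi>. ennreal ((cmod (fourier f \<xi>))\<^sup>2 * ?k m \<xi>) \<partial>lborel) = ennreal (LINT s|lborel. ?J s * (A - N (e m *\<^sub>R s) / 2))" for m
    using R(1,2)[of m] by (subst nn_integral_eq_integral) (auto simp: N_def)
  moreover have "(\<lambda>m. ennreal (LINT s|lborel. ?J s * (A - N (e m *\<^sub>R s) / 2))) \<longlonglongrightarrow> ennreal (LINT s|lborel. ?J s * A)"
  proof (rule tendsto_ennrealI, rule integral_dominated_convergence)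
    have Ji: "integrable lborel ?J" by (intro integrable_mult_right integrable_gauss) simp
    show "integrable lborel (\<lambda>s. ?J s * A)" using Ji by (rule integrable_mult_left)
    show "(\<lambda>s. ?J s * A) \<in> borel_measurable lborel" by measurable
    have "(\<lambda>t. A - N t / 2) \<in> borel_measurable borel" using B(1) by (simp only: N_def)
    hence "(\<lambda>s. A - N (e m *\<^sub>R s) / 2) \<in> borel_measurable borel" for m
      by (rule measurable_compose_continuous) (intro continuous_intros)
    thus "(\<lambda>s. ?J s * (A - N (e m *\<^sub>R s) / 2)) \<in> borel_measurable lborel" for m by measurable
    show "AE s in lborel. norm (?J s * (A - N (e m *\<^sub>R s) / 2)) \<le> ?J s * A" for m
    proof (rule AE_I2)
      fix s
      have "\<bar>?J s\<bar> = ?J s" using gauss_const_pos[where 'n = 'n] by simp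
      thus "norm (?J s * (A - N (e m *\<^sub>R s) / 2)) \<le> ?J s * A"
        unfolding real_norm_def abs_mult using B(2)[of "e m *\<^sub>R s"] gauss_const_pos[where 'n = 'n]
        by (intro mult_mono) (auto simp: N_def)
    qed
    show "AE s in lborel. (\<lambda>m. ?J s * (A - N (e m *\<^sub>R s) / 2)) \<longlonglongrightarrow> ?J s * A"
    proof (rule AE_I2)
      fix s :: "real ^ 'n"
      have "(\<lambda>m. e m *\<^sub>R s) \<longlonglongrightarrow> 0 *\<^sub>R s" by (intro tendsto_intros et)
      hence "(\<lambda>m. e m *\<^sub>R s) \<longlonglongrightarrow> 0" by simp
      from translation_cont_sq_int[OF f(2) this] have "(\<lambda>m. ennreal (N (e m *\<^sub>R s))) \<longlonglongrightarrow> ennreal 0" by (simp add: N_def B(3))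
      hence "(\<lambda>m. N (e m *\<^sub>R s)) \<longlonglongrightarrow> 0" using N0 by (subst (asm) tendsto_ennreal_iff) auto
      hence "(\<lambda>m. ?J s * (A - N (e m *\<^sub>R s) / 2)) \<longlonglongrightarrow> ?J s * (A - 0 / 2)" by (intro tendsto_intros) auto
      thus "(\<lambda>m. ?J s * (A - N (e m *\<^sub>R s) / 2)) \<longlonglongrightarrow> ?J s * A" by simp
    qed
  qed
  ultimately have "(\<integral>\<^sup>+\<xi>. ennreal ((cmod (fourier f \<xi>))\<^sup>2) \<partial>lborel) = ennreal (LINT s|lborel. ?J s * A)"
    by (simp only: LIMSEQ_unique)
  thus "(\<integral>\<^sup>+\<xi>. ennreal ((cmod (fourier f \<xi>))\<^sup>2) \<partial>lborel) = ennreal (plancherel_const TYPE('n) * (LINT y|lborel. (cmod (f y))\<^sup>2))"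
    by (simp add: plancherel_const_def A_def)
qed

lemma gauss_window_schwartz: "(gauss_window :: real ^ 'n::finite \<Rightarrow> complex) \<in> schwartz"
proof -
  have eq: "(gauss_window :: real ^ 'n \<Rightarrow> complex) = (\<lambda>y. of_real (2 powr (real CARD('n) / 4)) * gexp 0 y)"
    by (auto simp: gauss_window_def gexp_def fun_eq_iff exp_of_real[symmetric])
  show ?thesis by (subst eq) (rule schwartz_cmult[OF gexp_schwartz])
qed

lemma cnj_gauss_window: "cnj (gauss_window y) = gauss_window y"
  by (simp add: gauss_window_def)

lemma gauss_window_shift_schwartz:
  "(\<lambda>y :: real ^ 'n::finite. cnj (gauss_window (y - x)) * exp (- \<i> * complex_of_real (y \<bullet> \<xi>))) \<in> schwartz"
  using window_shift[of _ "(x, \<xi>)"] schwartz_cmult[OF gexp_schwartz[of "zpoint (x, \<xi>)"]] by simp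

lemma gstft_dist_of:
  assumes u: "sq_int u"
  shows "gstft (dist_of u) (x, \<xi>) = fourier (\<lambda>y. u y * gauss_window (y - x)) (\<xi> :: real ^ 'n::finite)"
  unfolding stft_def fst_conv snd_conv fourier_def
  by (subst dist_of_schwartz[OF gauss_window_shift_schwartz sq_int_measurable[OF u]]) (simp add: cnj_gauss_window mult.assoc)

definition moyal_const :: "'n::finite itself \<Rightarrow> real" where
  "moyal_const _ = plancherel_const TYPE('n) * (LINT y|lborel. (cmod (gauss_window (y :: real ^ 'n)))\<^sup>2)"

lemma moyal_const_pos: "0 < moyal_const TYPE('n::finite)"
proof -
  let ?g = "\<lambda>y :: real ^ 'n. (cmod (gauss_window y))\<^sup>2"
  have i: "integrable lborel ?g" using sq_int_schwartz[OF gauss_window_schwartz[where 'n = 'n]] by (simp add: sq_int_def)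
  have n0: "?g y \<noteq> 0" for y by (simp add: gauss_window_def)
  have "(LINT s|lborel. ?g s) \<noteq> 0"
  proof
    assume "(LINT s|lborel. ?g s) = 0"
    hence "AE y in lborel. ?g y = 0" using integral_nonneg_eq_0_iff_AE[OF i] by simp
    hence "AE y :: real ^ 'n in lborel. False" using n0 by simp
    thus False by (simp add: trivial_limit_def[symmetric] ae_filter_eq_bot_iff emeasure_lborel_UNIV)
  qed
  moreover have "0 \<le> (LINT s|lborel. ?g s)" by (intro Bochner_Integration.integral_nonneg) auto
  ultimately have "0 < (LINT s|lborel. ?g s)" by (simp only: less_le simp_thms not_sym)
  thus ?thesis using plancherel_const_pos[where 'n = 'n] by (simp add: moyal_const_def)
qed

text \<open>Plancherel's theorem in \<open>\<xi>\<close> for every \<open>x\<close>, and then integration over \<open>x\<close>, which only affects the window.\<close>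

lemma moyal_norm:
  fixes u :: "real ^ 'n::finite \<Rightarrow> complex"
  assumes u: "sq_int u"
  shows "(\<integral>\<^sup>+z. ennreal ((cmod (gstft (dist_of u) z))\<^sup>2) \<partial>lborel) = ennreal (moyal_const TYPE('n) * (LINT y|lborel. (cmod (u y))\<^sup>2))"
proof -
  let ?g = "gauss_window :: real ^ 'n \<Rightarrow> complex"
  have um[measurable]: "u \<in> borel_measurable borel" and ui: "integrable lborel (\<lambda>y. (cmod (u y))\<^sup>2)" using u by (auto simp: sq_int_def)
  have gm[measurable]: "?g \<in> borel_measurable borel" by (rule schwartz_measurable[OF gauss_window_schwartz])
  have gi: "integrable lborel (\<lambda>y. (cmod (?g y))\<^sup>2)" using sq_int_schwartz[OF gauss_window_schwartz[where 'n = 'n]] by (simp add: sq_int_def)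
  have gs: "sq_int (\<lambda>y. ?g (y - x))" for x
    using integrable_lborel_shift[OF gi, of "- x"] by (simp add: sq_int_def)
  have i1: "integrable lborel (\<lambda>y. u y * ?g (y - x))" for x by (rule sq_int_mult[OF u gs])
  have "integrable lborel (\<lambda>y. (cmod (u y * ?g (y - x)))\<^sup>2)" for x
  proof (rule Bochner_Integration.integrable_bound)
    show "integrable lborel (\<lambda>y. (2 powr (real CARD('n) / 4))\<^sup>2 * (cmod (u y))\<^sup>2)" using ui by (rule integrable_mult_right)
    have "cmod (?g y) \<le> 2 powr (real CARD('n) / 4)" for y
      by (simp add: gauss_window_def norm_mult mult_left_le)
    hence "(cmod (u y * ?g (y - x)))\<^sup>2 \<le> (2 powr (real CARD('n) / 4))\<^sup>2 * (cmod (u y))\<^sup>2" for y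
      unfolding norm_mult power_mult_distrib mult.commute[of "(cmod (u y))\<^sup>2"] by (intro mult_right_mono power_mono) auto
    thus "AE y in lborel. norm ((cmod (u y * ?g (y - x)))\<^sup>2) \<le> norm ((2 powr (real CARD('n) / 4))\<^sup>2 * (cmod (u y))\<^sup>2)" by auto
  qed measurable
  hence s1: "sq_int (\<lambda>y. u y * ?g (y - x))" for x by (simp add: sq_int_def)
  let ?p = "plancherel_const TYPE('n)"
  have p0: "0 \<le> ?p" using plancherel_const_pos[where 'n = 'n] by simp
  let ?G = "LINT y|lborel. (cmod (?g y))\<^sup>2"
  have G0: "0 \<le> ?G" by (intro Bochner_Integration.integral_nonneg) auto
  have Vm: "(\<lambda>z. ennreal ((cmod (gstft (dist_of u) z))\<^sup>2)) \<in> borel_measurable borel"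
    by (intro measurable_compose[OF _ measurable_ennreal] borel_measurable_continuous_onI continuous_intros gstft_continuous dist_of_tempered u)
  have "(\<integral>\<^sup>+z. ennreal ((cmod (gstft (dist_of u) z))\<^sup>2) \<partial>lborel) =
    (\<integral>\<^sup>+x. \<integral>\<^sup>+\<xi>. ennreal ((cmod (fourier (\<lambda>y. u y * ?g (y - x)) \<xi>))\<^sup>2) \<partial>lborel \<partial>lborel)"
    unfolding nn_integral_lborel_prod_fst(1)[OF Vm] gstft_dist_of[OF u] ..
  also have "\<dots> = (\<integral>\<^sup>+x. ennreal ?p * (\<integral>\<^sup>+y. ennreal ((cmod (u y))\<^sup>2) * ennreal ((cmod (?g (y - x)))\<^sup>2) \<partial>lborel) \<partial>lborel)"
  proof (rule nn_integral_cong)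
    fix x :: "real ^ 'n"
    have "ennreal (LINT y|lborel. (cmod (u y * ?g (y - x)))\<^sup>2) = (\<integral>\<^sup>+y. ennreal ((cmod (u y * ?g (y - x)))\<^sup>2) \<partial>lborel)"
      using s1[of x] by (subst nn_integral_eq_integral) (auto simp: sq_int_def)
    thus "(\<integral>\<^sup>+\<xi>. ennreal ((cmod (fourier (\<lambda>y. u y * ?g (y - x)) \<xi>))\<^sup>2) \<partial>lborel) =
      ennreal ?p * (\<integral>\<^sup>+y. ennreal ((cmod (u y))\<^sup>2) * ennreal ((cmod (?g (y - x)))\<^sup>2) \<partial>lborel)"
      unfolding plancherel[OF i1 s1] using p0 by (simp add: ennreal_mult' norm_mult power_mult_distrib)
  qed
  also have "\<dots> = ennreal ?p * (\<integral>\<^sup>+x. \<integral>\<^sup>+y. ennreal ((cmod (u y))\<^sup>2) * ennreal ((cmod (?g (y - x)))\<^sup>2) \<partial>lborel \<partial>lborel)"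
    by (rule nn_integral_cmult) measurable
  also have "(\<integral>\<^sup>+x. \<integral>\<^sup>+y. ennreal ((cmod (u y))\<^sup>2) * ennreal ((cmod (?g (y - x)))\<^sup>2) \<partial>lborel \<partial>lborel) =
      (\<integral>\<^sup>+y. \<integral>\<^sup>+x. ennreal ((cmod (u y))\<^sup>2) * ennreal ((cmod (?g (y - x)))\<^sup>2) \<partial>lborel \<partial>lborel)"
    by (rule lborel_pair.Fubini'[symmetric]) measurable
  also have "\<dots> = (\<integral>\<^sup>+y. ennreal ((cmod (u y))\<^sup>2) * ennreal ?G \<partial>lborel)"
  proof (rule nn_integral_cong)
    fix y
    have "(\<integral>\<^sup>+x. ennreal ((cmod (u y))\<^sup>2) * ennreal ((cmod (?g (y - x)))\<^sup>2) \<partial>lborel) =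
       ennreal ((cmod (u y))\<^sup>2) * (\<integral>\<^sup>+x. ennreal ((cmod (?g (x + (- y))))\<^sup>2) \<partial>lborel)"
      by (subst nn_integral_cmult) (auto simp: gauss_window_def norm_minus_commute)
    also have "(\<integral>\<^sup>+x. ennreal ((cmod (?g (x + (- y))))\<^sup>2) \<partial>lborel) = (\<integral>\<^sup>+x. ennreal ((cmod (?g x))\<^sup>2) \<partial>lborel)"
      by (rule nn_integral_lborel_shift) measurable
    also have "\<dots> = ennreal ?G" using gi by (intro nn_integral_eq_integral) auto
    finally show "(\<integral>\<^sup>+x. ennreal ((cmod (u y))\<^sup>2) * ennreal ((cmod (?g (y - x)))\<^sup>2) \<partial>lborel) = ennreal ((cmod (u y))\<^sup>2) * ennreal ?G" .
  qed
  also have "\<dots> = (\<integral>\<^sup>+y. ennreal ((cmod (u y))\<^sup>2) \<partial>lborel) * ennreal ?G" by (rule nn_integral_multc) measurable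
  also have "(\<integral>\<^sup>+y. ennreal ((cmod (u y))\<^sup>2) \<partial>lborel) = ennreal (LINT y|lborel. (cmod (u y))\<^sup>2)"
    using ui by (intro nn_integral_eq_integral) auto
  finally show ?thesis using p0 G0 by (simp add: moyal_const_def ennreal_mult' mult_ac)
qed

lemma sq_int_add_cmult:
  assumes "sq_int u" "sq_int v" shows "sq_int (\<lambda>y. u y + c * v y)"
proof -
  have [measurable]: "u \<in> borel_measurable borel" "v \<in> borel_measurable borel" using assms by (auto simp: sq_int_def)
  have i: "integrable lborel (\<lambda>y. 2 * (cmod (u y))\<^sup>2 + 2 * ((cmod c)\<^sup>2 * (cmod (v y))\<^sup>2))" using assms by (auto simp: sq_int_def)
  have "(cmod (u y + c * v y))\<^sup>2 \<le> 2 * (cmod (u y))\<^sup>2 + 2 * ((cmod c)\<^sup>2 * (cmod (v y))\<^sup>2)" for y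
  proof -
    have "(cmod (u y + c * v y))\<^sup>2 \<le> (cmod (u y) + cmod c * cmod (v y))\<^sup>2"
      using norm_triangle_ineq[of "u y" "c * v y"] by (intro power_mono) (auto simp: norm_mult)
    also have "\<dots> \<le> 2 * (cmod (u y))\<^sup>2 + 2 * ((cmod c)\<^sup>2 * (cmod (v y))\<^sup>2)"
      using sum_squares_bound[of "cmod (u y)" "cmod c * cmod (v y)"] by (simp add: power2_sum power_mult_distrib)
    finally show ?thesis .
  qed
  hence "integrable lborel (\<lambda>y. (cmod (u y + c * v y))\<^sup>2)"
    by (intro Bochner_Integration.integrable_bound[OF i]) auto
  thus ?thesis by (simp add: sq_int_def)
qed

text \<open>The two combinations \<open>u + v\<close> and \<open>u + \<i> v\<close> give real and imaginary part.\<close>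

lemma sq_int_polarization:
  fixes u v :: "'a::euclidean_space \<Rightarrow> complex"
  assumes u: "sq_int u" and v: "sq_int v"
  defines "Q \<equiv> \<lambda>f :: 'a \<Rightarrow> complex. LINT y|lborel. (cmod (f y))\<^sup>2"
  shows "Re (LINT y|lborel. u y * cnj (v y)) = (Q (\<lambda>y. u y + 1 * v y) - Q u - Q v) / 2"
    and "Im (LINT y|lborel. u y * cnj (v y)) = (Q (\<lambda>y. u y + \<i> * v y) - Q u - Q v) / 2"
proof -
  have ic: "integrable lborel (\<lambda>y. u y * cnj (v y))" by (rule sq_int_mult[OF u sq_int_cnj[OF v]])
  have iu: "integrable lborel (\<lambda>y. (cmod (u y))\<^sup>2)" "integrable lborel (\<lambda>y. (cmod (v y))\<^sup>2)"
    "integrable lborel (\<lambda>y. (cmod (u y + c * v y))\<^sup>2)" for c using u v sq_int_add_cmult[OF u v, of c] by (auto simp: sq_int_def)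
  have a: "Re (u y * cnj (v y)) = ((cmod (u y + 1 * v y))\<^sup>2 - (cmod (u y))\<^sup>2 - (cmod (v y))\<^sup>2) / 2" for y
    unfolding cmod_power2 by (simp add: power2_eq_square field_simps)
  have b: "Im (u y * cnj (v y)) = ((cmod (u y + \<i> * v y))\<^sup>2 - (cmod (u y))\<^sup>2 - (cmod (v y))\<^sup>2) / 2" for y
    unfolding cmod_power2 by (simp add: power2_eq_square field_simps)
  show "Re (LINT y|lborel. u y * cnj (v y)) = (Q (\<lambda>y. u y + 1 * v y) - Q u - Q v) / 2"
    unfolding integral_Re[OF ic, symmetric] a Q_def using iu(1,2) iu(3)[of 1] by simp
  show "Im (LINT y|lborel. u y * cnj (v y)) = (Q (\<lambda>y. u y + \<i> * v y) - Q u - Q v) / 2"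
    unfolding integral_Im[OF ic, symmetric] b Q_def using iu(1,2) iu(3)[of \<i>] by simp
qed

lemma sq_int_gstft: "sq_int u \<Longrightarrow> sq_int (gstft (dist_of (u :: real ^ 'n::finite \<Rightarrow> complex)))"
  using gstft_continuous[OF dist_of_tempered, of u] moyal_norm[of u]
  by (auto simp: sq_int_def integrable_iff_bounded intro!: borel_measurable_continuous_onI continuous_intros)

lemma moyal_norm_real:
  fixes u :: "real ^ 'n::finite \<Rightarrow> complex"
  assumes "sq_int u"
  shows "(LINT z|lborel. (cmod (gstft (dist_of u) z))\<^sup>2) = moyal_const TYPE('n) * (LINT y|lborel. (cmod (u y))\<^sup>2)"
proof -
  have "ennreal (LINT z|lborel. (cmod (gstft (dist_of u) z))\<^sup>2) = ennreal (moyal_const TYPE('n) * (LINT y|lborel. (cmod (u y))\<^sup>2))"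
    unfolding moyal_norm[OF assms, symmetric] using sq_int_gstft[OF assms]
    by (subst nn_integral_eq_integral) (auto simp: sq_int_def)
  moreover have "0 \<le> (LINT z|lborel. (cmod (gstft (dist_of u) z))\<^sup>2)" "0 \<le> (LINT y|lborel. (cmod (u y))\<^sup>2)"
    by (intro Bochner_Integration.integral_nonneg; simp)+
  ultimately show ?thesis using moyal_const_pos[where 'n = 'n] by (simp add: ennreal_inj)
qed

lemma gstft_add_cmult:
  fixes u v :: "real ^ 'n::finite \<Rightarrow> complex"
  assumes u: "sq_int u" and v: "sq_int v"
  shows "gstft (dist_of (\<lambda>y. u y + c * v y)) z = gstft (dist_of u) z + c * gstft (dist_of v) z"
proof -
  let ?\<phi> = "\<lambda>y. cnj (gauss_window (y - fst z)) * exp (- \<i> * complex_of_real (y \<bullet> snd z))"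
  have s: "?\<phi> \<in> schwartz" by (rule gauss_window_shift_schwartz)
  have i: "integrable lborel (\<lambda>y. u y * ?\<phi> y)" "integrable lborel (\<lambda>y. v y * ?\<phi> y)"
    by (rule sq_int_mult[OF u sq_int_schwartz[OF s]], rule sq_int_mult[OF v sq_int_schwartz[OF s]])
  have "(\<lambda>y. (u y + c * v y) * ?\<phi> y) = (\<lambda>y. u y * ?\<phi> y + c * (v y * ?\<phi> y))" by (simp only: ring_distribs mult.assoc)
  moreover have "(LINT y|lborel. u y * ?\<phi> y + c * (v y * ?\<phi> y)) = (LINT y|lborel. u y * ?\<phi> y) + c * (LINT y|lborel. v y * ?\<phi> y)"
    by (subst Bochner_Integration.integral_add[OF i(1) integrable_mult_right[OF i(2)]]) (simp only: integral_mult_right_zero)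
  ultimately show ?thesis unfolding stft_def
    by (simp only: dist_of_schwartz[OF s] sq_int_measurable u v sq_int_add_cmult)
qed

text \<open>Polarisation of the identity for norms.\<close>

theorem moyal:
  fixes u v :: "real ^ 'n::finite \<Rightarrow> complex"
  assumes u: "sq_int u" and v: "sq_int v"
  shows "integrable lborel (\<lambda>z. gstft (dist_of u) z * cnj (gstft (dist_of v) z))"
    and "(LINT z|lborel. gstft (dist_of u) z * cnj (gstft (dist_of v) z)) = of_real (moyal_const TYPE('n)) * (LINT y|lborel. u y * cnj (v y))"
proof -
  show "integrable lborel (\<lambda>z. gstft (dist_of u) z * cnj (gstft (dist_of v) z))"
    by (rule sq_int_mult[OF sq_int_gstft[OF u] sq_int_cnj[OF sq_int_gstft[OF v]]])
  note P = sq_int_polarization[OF sq_int_gstft[OF u] sq_int_gstft[OF v], unfolded gstft_add_cmult[OF u v, symmetric]]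
  note p = sq_int_polarization[OF u v]
  show "(LINT z|lborel. gstft (dist_of u) z * cnj (gstft (dist_of v) z)) = of_real (moyal_const TYPE('n)) * (LINT y|lborel. u y * cnj (v y))"
    by (rule complex_eqI)
      (simp_all only: P p moyal_norm_real u v sq_int_add_cmult Re_complex_of_real Im_complex_of_real times_complex.sel mult_zero_left diff_zero add_0_right
         right_diff_distrib times_divide_eq_right)
qed


section \<open>Decay of the short-time Fourier transform of Schwartz functions\<close>

text \<open>The multi-indices that arise when one occurrence of \<open>i\<close> is deleted.\<close>

fun drop_coord :: "'n \<Rightarrow> 'n list \<Rightarrow> 'n list list" where
  "drop_coord i [] = []"
| "drop_coord i (j # is) = (if j = i then [is] else []) @ map ((#) j) (drop_coord i is)"

lemma drop_coord_length: "js \<in> set (drop_coord i is) \<Longrightarrow> length js \<le> length is" "length (drop_coord i is) \<le> length is"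
  by (induction "is" arbitrary: js) (auto split: if_splits)

lemma pderivs_differentiable: "\<phi> \<in> schwartz \<Longrightarrow> pderivs is \<phi> differentiable (at y)"
  by (simp add: schwartz_def smooth_fn_def)

lemma sum_list_pderivs:
  assumes "\<phi> \<in> schwartz"
  shows "(\<lambda>y. \<Sum>js\<leftarrow>L. pderivs js \<phi> y) differentiable (at y) \<and>
    pderiv_coord j (\<lambda>y. \<Sum>js\<leftarrow>L. pderivs js \<phi> y) y = (\<Sum>js\<leftarrow>map ((#) j) L. pderivs js \<phi> y)"
proof (induction L)
  case Nil
  show ?case by (simp add: pderiv_coord_def)
next
  case (Cons js L)
  note d = pderivs_differentiable[OF assms, of js y]
  have "((\<lambda>t. pderivs js \<phi> (y + t *\<^sub>R axis j 1) + (\<Sum>js\<leftarrow>L. pderivs js \<phi> (y + t *\<^sub>R axis j 1)))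
      has_vector_derivative pderiv_coord j (pderivs js \<phi>) y + pderiv_coord j (\<lambda>y. \<Sum>js\<leftarrow>L. pderivs js \<phi> y) y) (at 0)"
    by (intro has_vector_derivative_add pderiv_coord_has_vector_derivative[OF d] pderiv_coord_has_vector_derivative[OF conjunct1[OF Cons.IH]])
  hence "pderiv_coord j (\<lambda>y. \<Sum>js\<leftarrow>js # L. pderivs js \<phi> y) y = pderiv_coord j (pderivs js \<phi>) y + pderiv_coord j (\<lambda>y. \<Sum>js\<leftarrow>L. pderivs js \<phi> y) y"
    unfolding pderiv_coord_def by (simp add: vector_derivative_at)
  thus ?case using Cons.IH d by (auto intro!: differentiable_add)
qed

lemma coord_differentiable: "(\<lambda>y :: real ^ 'n::finite. complex_of_real (y $ i)) differentiable (at y)"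
  unfolding differentiable_def
  by (rule exI, rule bounded_linear_imp_has_derivative[OF bounded_linear_compose[OF bounded_linear_of_real bounded_linear_vec_nth]])

lemma pderiv_coord_mult:
  fixes F :: "real ^ 'n::finite \<Rightarrow> complex"
  assumes F: "F differentiable (at y)" and S: "S differentiable (at y)"
  shows "pderiv_coord j (\<lambda>y. of_real (y $ i) * F y + S y) y = of_real (y $ i) * pderiv_coord j F y + ((if j = i then F y else 0) + pderiv_coord j S y)"
proof -
  have "((\<lambda>t. y $ i + t * axis j 1 $ i) has_real_derivative (axis j 1 :: real ^ 'n) $ i) (at 0)"
    by (auto intro!: derivative_eq_intros)
  from has_vector_derivative_of_real[OF this]
  have c: "((\<lambda>t. complex_of_real ((y + t *\<^sub>R axis j 1) $ i)) has_vector_derivative of_real ((axis j 1 :: real ^ 'n) $ i)) (at 0)"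
    by simp
  have "((\<lambda>t. complex_of_real ((y + t *\<^sub>R axis j 1) $ i) * F (y + t *\<^sub>R axis j 1) + S (y + t *\<^sub>R axis j 1)) has_vector_derivative
     (of_real ((y + 0 *\<^sub>R axis j 1) $ i) * pderiv_coord j F y + of_real (axis j 1 $ i) * F (y + 0 *\<^sub>R axis j 1)) + pderiv_coord j S y) (at 0)"
    by (intro has_vector_derivative_add has_vector_derivative_mult c pderiv_coord_has_vector_derivative F S)
  thus ?thesis unfolding pderiv_coord_def by (simp add: vector_derivative_at axis_def)
qed

text \<open>Leibniz' rule for multiplication by a coordinate.\<close>

lemma pderivs_coord_mult:
  fixes \<phi> :: "real ^ 'n::finite \<Rightarrow> complex"
  assumes s: "\<phi> \<in> schwartz"
  shows "pderivs is (\<lambda>y. of_real (y $ i) * \<phi> y) = (\<lambda>y. of_real (y $ i) * pderivs is \<phi> y + (\<Sum>js\<leftarrow>drop_coord i is. pderivs js \<phi> y))"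
proof (induction "is")
  case (Cons j "is")
  show ?case
  proof
    fix y
    note S = sum_list_pderivs[OF s, of "drop_coord i is" y j]
    show "pderivs (j # is) (\<lambda>y. of_real (y $ i) * \<phi> y) y =
        of_real (y $ i) * pderivs (j # is) \<phi> y + (\<Sum>js\<leftarrow>drop_coord i (j # is). pderivs js \<phi> y)"
      unfolding pderivs.simps Cons pderiv_coord_mult[OF pderivs_differentiable[OF s] conjunct1[OF S]] conjunct2[OF S]
      by simp
  qed
qed simp

lemma coord_mult_schwartz_bound:
  fixes \<phi> :: "real ^ 'n::finite \<Rightarrow> complex"
  assumes s: "\<phi> \<in> schwartz" and K: "length is \<le> K" "N \<le> K"
  shows "(1 + norm y) ^ N * cmod (pderivs is (\<lambda>y. of_real (y $ i) * \<phi> y) y) \<le> (1 + K) * schwartz_norm (Suc K) \<phi>"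
proof -
  let ?A = "schwartz_norm (Suc K) \<phi>" and ?p = "(1 + norm y) ^ N"
  have "?p * cmod (of_real (y $ i) * pderivs is \<phi> y) \<le> (1 + norm y) ^ Suc N * cmod (pderivs is \<phi> y)"
  proof -
    have "\<bar>y $ i\<bar> \<le> 1 + norm y" using component_le_norm_cart[of y i] by simp
    hence "?p * (\<bar>y $ i\<bar> * cmod (pderivs is \<phi> y)) \<le> ?p * ((1 + norm y) * cmod (pderivs is \<phi> y))"
      by (intro mult_left_mono mult_right_mono) auto
    thus ?thesis by (simp add: norm_mult mult_ac)
  qed
  also have "\<dots> \<le> ?A" by (rule schwartz_norm_bound[OF s]) (use K in auto)
  finally have a: "?p * cmod (of_real (y $ i) * pderivs is \<phi> y) \<le> ?A" .
  have b: "?p * cmod (\<Sum>js\<leftarrow>L. pderivs js \<phi> y) \<le> length L * ?A" if "\<And>js. js \<in> set L \<Longrightarrow> length js \<le> K" for L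
    using that
  proof (induction L)
    case (Cons js L)
    have "?p * cmod (pderivs js \<phi> y) \<le> ?A" by (rule schwartz_norm_bound[OF s]) (use K Cons.prems[of js] in auto)
    moreover have "?p * cmod (\<Sum>js\<leftarrow>L. pderivs js \<phi> y) \<le> length L * ?A" using Cons by auto
    moreover have "?p * cmod (pderivs js \<phi> y + (\<Sum>js\<leftarrow>L. pderivs js \<phi> y)) \<le> ?p * (cmod (pderivs js \<phi> y) + cmod (\<Sum>js\<leftarrow>L. pderivs js \<phi> y))"
      by (intro mult_left_mono norm_triangle_ineq) auto
    ultimately show ?case by (simp add: distrib_left distrib_right)
  qed simp
  have "?p * cmod (\<Sum>js\<leftarrow>drop_coord i is. pderivs js \<phi> y) \<le> length (drop_coord i is) * ?A"
    using drop_coord_length(1)[of _ i "is"] K by (intro b) fastforce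
  also have "\<dots> \<le> K * ?A" using drop_coord_length(2)[of i "is"] K schwartz_norm_nonneg[OF s] by (intro mult_right_mono) auto
  finally have "?p * cmod (\<Sum>js\<leftarrow>drop_coord i is. pderivs js \<phi> y) \<le> K * ?A" .
  moreover have "?p * cmod (of_real (y $ i) * pderivs is \<phi> y + (\<Sum>js\<leftarrow>drop_coord i is. pderivs js \<phi> y)) \<le>
     ?p * (cmod (of_real (y $ i) * pderivs is \<phi> y) + cmod (\<Sum>js\<leftarrow>drop_coord i is. pderivs js \<phi> y))"
    by (intro mult_left_mono norm_triangle_ineq) auto
  ultimately show ?thesis using a unfolding pderivs_coord_mult[OF s] by (simp add: distrib_left distrib_right)
qed

lemma coord_mult_schwartz:
  assumes s: "\<phi> \<in> schwartz"
  shows "(\<lambda>y :: real ^ 'n::finite. of_real (y $ i) * \<phi> y) \<in> schwartz"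
proof -
  have "smooth_fn (\<lambda>y. of_real (y $ i) * \<phi> y)"
    unfolding smooth_fn_def pderivs_coord_mult[OF s]
    using sum_list_pderivs[OF s] pderivs_differentiable[OF s] by (auto intro!: differentiable_add differentiable_mult coord_differentiable)
  moreover have "bounded (range (\<lambda>y. (1 + norm y) ^ N * cmod (pderivs is (\<lambda>y. of_real (y $ i) * \<phi> y) y)))" for N "is"
    using coord_mult_schwartz_bound[OF s, of "is" "max N (length is)" N _ i]
    by (intro boundedI[where B = "(1 + max N (length is)) * schwartz_norm (Suc (max N (length is))) \<phi>"]) (auto simp: abs_mult)
  ultimately show ?thesis by (simp add: schwartz_def)
qed

lemma schwartz_norm_le:
  fixes \<phi> :: "real ^ 'n::finite \<Rightarrow> complex" and A :: real
  assumes "\<And>is y. length is \<le> N \<Longrightarrow> (1 + norm y) ^ N * cmod (pderivs is \<phi> y) \<le> A"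
  shows "schwartz_norm N \<phi> \<le> card {is :: 'n list. length is \<le> N} * A"
proof -
  have "schwartz_norm N \<phi> \<le> (\<Sum>is :: 'n list | length is \<le> N. A)"
    unfolding schwartz_norm_def by (intro sum_mono cSUP_least assms) auto
  thus ?thesis by simp
qed

text \<open>The creation operator of the recursion for Hermite functions.\<close>

definition creation :: "'n \<Rightarrow> (real ^ 'n::finite \<Rightarrow> complex) \<Rightarrow> real ^ 'n \<Rightarrow> complex" where
  "creation i \<phi> = (\<lambda>y. 2 * of_real pi * (of_real (y $ i) * \<phi> y) + - 1 * pderiv_coord i \<phi> y)"

lemma creation_schwartz: "\<phi> \<in> schwartz \<Longrightarrow> creation i \<phi> \<in> schwartz"
  unfolding creation_def by (intro schwartz_linear coord_mult_schwartz schwartz_pderiv_coord)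

lemma schwartz_norm_creation:
  "\<exists>C\<ge>0. \<forall>\<phi>\<in>schwartz. \<forall>i. schwartz_norm N (creation i \<phi>) \<le> C * schwartz_norm (Suc N) (\<phi> :: real ^ 'n::finite \<Rightarrow> complex)"
proof -
  let ?c = "real (card {is :: 'n list. length is \<le> N})"
  have "schwartz_norm N (creation i \<phi>) \<le> ?c * ((2 * pi * (1 + N) + 1) * schwartz_norm (Suc N) \<phi>)"
    if s: "\<phi> \<in> schwartz" for \<phi> :: "real ^ 'n \<Rightarrow> complex" and i
  proof (rule schwartz_norm_le)
    fix "is" :: "'n list" and y :: "real ^ 'n" assume l: "length is \<le> N"
    let ?p = "(1 + norm y) ^ N" and ?a = "pderivs is (\<lambda>y. of_real (y $ i) * \<phi> y) y" and ?b = "pderivs is (pderiv_coord i \<phi>) y"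
    have sm: "smooth_fn (\<lambda>y. of_real (y $ i) * \<phi> y)" "smooth_fn (pderiv_coord i \<phi>)"
      using coord_mult_schwartz[OF s] schwartz_pderiv_coord[OF s] by (auto simp: schwartz_def)
    have e: "?b = pderivs (is @ [i]) \<phi> y"
    proof -
      have "pderivs is (pderiv_coord i \<phi>) = pderivs (is @ [i]) \<phi>" by (induction "is") auto
      thus ?thesis by simp
    qed
    have b: "?p * cmod ?b \<le> schwartz_norm (Suc N) \<phi>" unfolding e by (rule schwartz_norm_bound[OF s]) (use l in auto)
    have a: "?p * cmod ?a \<le> (1 + N) * schwartz_norm (Suc N) \<phi>" using coord_mult_schwartz_bound[OF s l, of N] by simp
    have "pderivs is (creation i \<phi>) y = 2 * of_real pi * ?a + - 1 * ?b"
      unfolding creation_def by (simp only: pderivs_linear[OF sm])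
    hence "cmod (pderivs is (creation i \<phi>) y) \<le> 2 * pi * cmod ?a + cmod ?b"
      using norm_triangle_ineq4[of "2 * of_real pi * ?a" ?b] by (simp add: norm_mult)
    hence "?p * cmod (pderivs is (creation i \<phi>) y) \<le> ?p * (2 * pi * cmod ?a + cmod ?b)" by (intro mult_left_mono) auto
    also have "\<dots> = 2 * pi * (?p * cmod ?a) + ?p * cmod ?b" by (simp add: algebra_simps)
    also have "\<dots> \<le> 2 * pi * ((1 + N) * schwartz_norm (Suc N) \<phi>) + schwartz_norm (Suc N) \<phi>"
      using a b by (intro add_mono mult_left_mono) auto
    also have "\<dots> = (2 * pi * (1 + N) + 1) * schwartz_norm (Suc N) \<phi>" by (simp add: algebra_simps)
    finally show "?p * cmod (pderivs is (creation i \<phi>) y) \<le> \<dots>" .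
  qed
  thus ?thesis by (intro exI[of _ "?c * (2 * pi * (1 + N) + 1)"]) (auto simp: mult.assoc)
qed

lemma schwartz_norm_mono:
  fixes \<phi> :: "real ^ 'n::finite \<Rightarrow> complex"
  assumes "\<phi> \<in> schwartz" "N \<le> M"
  shows "schwartz_norm N \<phi> \<le> card {is :: 'n list. length is \<le> N} * schwartz_norm M \<phi>"
  by (rule schwartz_norm_le, rule schwartz_norm_bound) (use assms in auto)

text \<open>The creation operators turn into multiplication by the coordinates of \<open>zpoint z\<close>.\<close>

lemma gstft_creation:
  fixes \<phi> :: "real ^ 'n::finite \<Rightarrow> complex"
  assumes s: "\<phi> \<in> schwartz"
  shows "gstft (dist_of (creation i \<phi>)) z = zpoint z $ i * gstft (dist_of \<phi>) z"
proof -
  have "bargmann (dist_of (creation i \<phi>)) (zpoint z) = zpoint z $ i * bargmann (dist_of \<phi>) (zpoint z)"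
    unfolding creation_def by (rule bargmann_creation[OF s creation_schwartz[OF s, unfolded creation_def]])
  thus ?thesis
    using stft_gauss[OF dist_of_schwartz_tempered[OF creation_schwartz[OF s]], where x = "fst z" and \<xi> = "snd z"]
      stft_gauss[OF dist_of_schwartz_tempered[OF s], where x = "fst z" and \<xi> = "snd z"] by (simp add: mult_ac)
qed

lemma gstft_schwartz_bounded:
  fixes \<phi> :: "real ^ 'n::finite \<Rightarrow> complex"
  assumes s: "\<phi> \<in> schwartz"
  shows "cmod (gstft (dist_of \<phi>) z) \<le> 2 powr (real CARD('n) / 4) * (LINT y|lborel. decay (y :: real ^ 'n)) * schwartz_norm (2 * CARD('n)) \<phi>"
proof -
  let ?N = "schwartz_norm (2 * CARD('n)) \<phi>" and ?c = "2 powr (real CARD('n) / 4)"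
  let ?f = "\<lambda>y. \<phi> y * gauss_window (y - fst z) * exp (- \<i> * of_real (y \<bullet> snd z))"
  have "cmod (?f y) \<le> ?N * ?c * decay y" for y
  proof -
    have w: "cmod (gauss_window (y - fst z)) \<le> ?c" by (simp add: gauss_window_def norm_mult mult_left_le)
    have "cmod (\<phi> y) * cmod (gauss_window (y - fst z)) \<le> (?N * decay y) * ?c"
      by (intro mult_mono schwartz_decay s w) (use schwartz_norm_nonneg[OF s] decay_pos[of y] in auto)
    thus ?thesis by (simp add: norm_mult norm_exp_eq_Re mult_ac)
  qed
  note le = this
  have "(\<lambda>y. \<phi> y * (cnj (gauss_window (y - fst z)) * exp (- \<i> * complex_of_real (y \<bullet> snd z)))) = ?f"
    by (simp add: cnj_gauss_window mult.assoc)
  hence "integrable lborel ?f"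
    using sq_int_mult[OF sq_int_schwartz[OF s] sq_int_schwartz[OF gauss_window_shift_schwartz[of "fst z" "snd z"]]] by simp
  hence "cmod (LINT y|lborel. ?f y) \<le> (LINT y|lborel. ?N * ?c * decay (y :: real ^ 'n))"
    by (rule Bochner_Integration.integral_norm_bound_integral) (use le integrable_decay in auto)
  moreover have "gstft (dist_of \<phi>) z = (LINT y|lborel. ?f y)"
    using gstft_dist_of[OF sq_int_schwartz[OF s], of "fst z" "snd z"] by (simp add: fourier_def)
  ultimately show ?thesis by (simp add: mult_ac)
qed

text \<open>Each factor \<open>zpoint z $ i\<close> is absorbed by a creation operator, at the cost of one order of the Schwartz norm. In
  this way decay in \<open>x\<close> and in \<open>\<xi>\<close> come at the same time.\<close>

lemma gstft_schwartz_power_decay: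
  "\<exists>C\<ge>0. \<exists>N. \<forall>\<phi>\<in>schwartz. \<forall>z. (1 + norm (zpoint z)) ^ k * cmod (gstft (dist_of \<phi>) z) \<le> C * schwartz_norm N (\<phi> :: real ^ 'n::finite \<Rightarrow> complex)"
proof (induction k)
  case 0
  have "0 \<le> (LINT y|lborel. decay (y :: real ^ 'n))"
    by (intro Bochner_Integration.integral_nonneg) (simp add: less_imp_le[OF decay_pos])
  thus ?case using gstft_schwartz_bounded[where 'n = 'n]
    by (intro exI[of _ "2 powr (real CARD('n) / 4) * (LINT y|lborel. decay (y :: real ^ 'n))"] conjI exI[of _ "2 * CARD('n)"]) auto
next
  case (Suc k)
  then obtain C N where C: "0 \<le> C" and le: "\<And>\<phi> z. \<phi> \<in> schwartz \<Longrightarrow> (1 + norm (zpoint z)) ^ k * cmod (gstft (dist_of \<phi>) z) \<le> C * schwartz_norm N (\<phi> :: real ^ 'n \<Rightarrow> complex)"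
    by blast
  obtain D where D: "0 \<le> D" and Dle: "\<And>\<phi> i. \<phi> \<in> schwartz \<Longrightarrow> schwartz_norm N (creation i \<phi>) \<le> D * schwartz_norm (Suc N) (\<phi> :: real ^ 'n \<Rightarrow> complex)"
    using schwartz_norm_creation[of N] by blast
  let ?c = "real (card {is :: 'n list. length is \<le> N})"
  have "(1 + norm (zpoint z)) ^ Suc k * cmod (gstft (dist_of \<phi>) z) \<le> (C * ?c + real CARD('n) * (C * D)) * schwartz_norm (Suc N) \<phi>"
    if s: "\<phi> \<in> schwartz" for \<phi> :: "real ^ 'n \<Rightarrow> complex" and z
  proof -
    let ?p = "(1 + norm (zpoint z)) ^ k" and ?V = "cmod (gstft (dist_of \<phi>) z)" and ?S = "schwartz_norm (Suc N) \<phi>"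
    have "norm (zpoint z) \<le> (\<Sum>i\<in>UNIV. cmod (zpoint z $ i))" unfolding norm_vec_def by (rule L2_set_le_sum) simp
    hence "norm (zpoint z) * (?p * ?V) \<le> (\<Sum>i\<in>UNIV. cmod (zpoint z $ i)) * (?p * ?V)" by (intro mult_right_mono) auto
    also have "\<dots> = (\<Sum>i\<in>UNIV. ?p * cmod (gstft (dist_of (creation i \<phi>)) z))"
      unfolding sum_distrib_right by (intro sum.cong refl) (simp add: gstft_creation[OF s] norm_mult mult_ac)
    also have "\<dots> \<le> (\<Sum>i\<in>(UNIV :: 'n set). C * (D * ?S))"
      by (intro sum_mono order_trans[OF le[OF creation_schwartz[OF s]]] mult_left_mono[OF Dle[OF s] C])
    also have "\<dots> = real CARD('n) * (C * D) * ?S" by simp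
    finally have a: "norm (zpoint z) * (?p * ?V) \<le> \<dots>" .
    have "?p * ?V \<le> C * schwartz_norm N \<phi>" by (rule le[OF s])
    also have "\<dots> \<le> C * (?c * ?S)" using schwartz_norm_mono[OF s, of N "Suc N"] C by (intro mult_left_mono) auto
    finally have b: "?p * ?V \<le> C * (?c * ?S)" .
    have "(1 + norm (zpoint z)) ^ Suc k * ?V = ?p * ?V + norm (zpoint z) * (?p * ?V)" by (simp add: algebra_simps)
    also have "\<dots> \<le> (C * ?c + real CARD('n) * (C * D)) * ?S" using a b by (simp add: distrib_right mult.assoc)
    finally show ?thesis .
  qed
  moreover have "0 \<le> C * ?c + real CARD('n) * (C * D)" using C D by simp
  ultimately show ?case by blast
qed

lemma gstft_schwartz_decay:
  "\<exists>C\<ge>0. \<exists>N. \<forall>\<phi>\<in>schwartz. \<forall>z. cmod (gstft (dist_of \<phi>) z) \<le> C * schwartz_norm N (\<phi> :: real ^ 'n::finite \<Rightarrow> complex) * (decay (fst z) * decay (snd z))"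
proof -
  obtain C N where C: "0 \<le> C" and le: "\<And>\<phi> z. \<phi> \<in> schwartz \<Longrightarrow>
      (1 + norm (zpoint z)) ^ (4 * CARD('n)) * cmod (gstft (dist_of \<phi>) z) \<le> C * schwartz_norm N (\<phi> :: real ^ 'n \<Rightarrow> complex)"
    using gstft_schwartz_power_decay[of "4 * CARD('n)", where 'n = 'n] by blast
  have "cmod (gstft (dist_of \<phi>) z) \<le> C * schwartz_norm N \<phi> * (decay (fst z) * decay (snd z))" if s: "\<phi> \<in> schwartz" for \<phi> :: "real ^ 'n \<Rightarrow> complex" and z
  proof -
    let ?x = "(1 + norm (fst z)) ^ (2 * CARD('n))" and ?y = "(1 + norm (snd z)) ^ (2 * CARD('n))"
    have "?x * ?y \<le> (1 + norm (zpoint z)) ^ (2 * CARD('n)) * (1 + norm (zpoint z)) ^ (2 * CARD('n))"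
      using norm_zpoint_bounds(2,3)[of z] by (intro mult_mono power_mono) auto
    also have "\<dots> = (1 + norm (zpoint z)) ^ (4 * CARD('n))" by (simp flip: power_add)
    finally have "(?x * ?y) * cmod (gstft (dist_of \<phi>) z) \<le> (1 + norm (zpoint z)) ^ (4 * CARD('n)) * cmod (gstft (dist_of \<phi>) z)"
      by (intro mult_right_mono) auto
    also note le[OF s]
    finally have "cmod (gstft (dist_of \<phi>) z) * (?x * ?y) \<le> C * schwartz_norm N \<phi>" by (simp only: mult.commute)
    moreover have "0 < ?x * ?y" by (intro mult_pos_pos zero_less_power) (auto intro: add_pos_nonneg)
    ultimately show ?thesis unfolding decay_def times_divide_times_eq times_divide_eq_right mult_1_right by (simp add: pos_le_divide_eq)
  qed
  thus ?thesis using C by blast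
qed

lemma integrable_decay_product: "integrable lborel (\<lambda>z :: (real ^ 'n::finite) \<times> (real ^ 'n). decay (fst z) * decay (snd z))"
proof (rule integrableI_bounded)
  have c: "continuous_on UNIV (\<lambda>z :: (real ^ 'n) \<times> (real ^ 'n). decay (fst z) * decay (snd z))"
    by (intro continuous_intros continuous_on_compose2[OF decay_continuous]) auto
  show "(\<lambda>z :: (real ^ 'n) \<times> (real ^ 'n). decay (fst z) * decay (snd z)) \<in> borel_measurable lborel"
    using borel_measurable_continuous_onI[OF c] by simp
  have M: "(\<lambda>z :: (real ^ 'n) \<times> (real ^ 'n). ennreal (norm (decay (fst z) * decay (snd z)))) \<in> borel_measurable borel"
    by (intro measurable_compose[OF _ measurable_ennreal] borel_measurable_continuous_onI continuous_on_norm c)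
  have d0: "0 \<le> decay x" for x :: "real ^ 'n" using decay_pos[of x] by simp
  have fin: "(\<integral>\<^sup>+x. ennreal (decay (x :: real ^ 'n)) \<partial>lborel) < \<infinity>" using integrable_decay[where 'n = 'n] d0 by (simp add: integrable_iff_bounded)
  have "(\<integral>\<^sup>+(z :: (real ^ 'n) \<times> (real ^ 'n)). ennreal (norm (decay (fst z) * decay (snd z :: real ^ 'n))) \<partial>lborel) =
     (\<integral>\<^sup>+x. \<integral>\<^sup>+y. ennreal (decay (x :: real ^ 'n)) * ennreal (decay (y :: real ^ 'n)) \<partial>lborel \<partial>lborel)"
    unfolding nn_integral_lborel_prod_fst(1)[OF M] using d0 by (simp add: ennreal_mult abs_mult)
  also have "\<dots> = (\<integral>\<^sup>+x. ennreal (decay (x :: real ^ 'n)) \<partial>lborel) * (\<integral>\<^sup>+y. ennreal (decay (y :: real ^ 'n)) \<partial>lborel)"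
    by (subst nn_integral_cmult, measurable, subst nn_integral_multc, measurable)
  also have "\<dots> < \<infinity>" using fin by (simp add: ennreal_mult_less_top)
  finally show "(\<integral>\<^sup>+(z :: (real ^ 'n) \<times> (real ^ 'n)). ennreal (norm (decay (fst z) * decay (snd z :: real ^ 'n))) \<partial>lborel) < \<infinity>" .
qed

lemma gstft_dist_of_cnj:
  fixes u :: "real ^ 'n::finite \<Rightarrow> complex"
  assumes u: "sq_int u"
  shows "gstft (dist_of (\<lambda>y. cnj (u y))) z = cnj (gstft (dist_of u) (fst z, - snd z))"
proof -
  have "gstft (dist_of (\<lambda>y. cnj (u y))) z = (LINT y|lborel. cnj (u y * gauss_window (y - fst z) * exp (- \<i> * of_real (y \<bullet> - snd z))))"
    using gstft_dist_of[OF sq_int_cnj[OF u], of "fst z" "snd z"] by (simp add: fourier_def exp_cnj cnj_gauss_window)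
  thus ?thesis unfolding gstft_dist_of[OF u] fourier_def by (simp only: Bochner_Integration.integral_cnj)
qed

text \<open>By Moyal's identity, a bound for the short-time Fourier transform of \<open>u\<close> controls \<open>u\<close> as a distribution.\<close>

lemma dist_of_bound:
  "\<exists>C\<ge>0. \<exists>N. \<forall>(u :: real ^ 'n::finite \<Rightarrow> complex) \<phi> A. sq_int u \<longrightarrow> \<phi> \<in> schwartz \<longrightarrow> (\<forall>z. cmod (gstft (dist_of u) z) \<le> A) \<longrightarrow>
    cmod (dist_of u \<phi>) \<le> C * schwartz_norm N \<phi> * A"
proof -
  obtain C N where C: "0 \<le> C" and le: "\<And>\<phi> z. \<phi> \<in> schwartz \<Longrightarrow> cmod (gstft (dist_of \<phi>) z) \<le> C * schwartz_norm N (\<phi> :: real ^ 'n \<Rightarrow> complex) * (decay (fst z) * decay (snd z))"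
    using gstft_schwartz_decay[where 'n = 'n] by blast
  let ?I = "LINT z|lborel. decay (fst z :: real ^ 'n) * decay (snd z :: real ^ 'n)"
  let ?c = "moyal_const TYPE('n)"
  have c: "0 < ?c" by (rule moyal_const_pos)
  have d0: "0 \<le> decay x" for x :: "real ^ 'n" using decay_pos[of x] by simp
  have I0: "0 \<le> ?I" by (intro Bochner_Integration.integral_nonneg) (simp add: d0)
  have "cmod (dist_of u \<phi>) \<le> (C * ?I / ?c) * schwartz_norm N \<phi> * A"
    if u: "sq_int u" and s: "\<phi> \<in> schwartz" and A: "\<And>z. cmod (gstft (dist_of u) z) \<le> A" for u \<phi> :: "real ^ 'n \<Rightarrow> complex" and A :: real
  proof -
    have sc: "sq_int (\<lambda>y. cnj (\<phi> y))" by (rule sq_int_cnj[OF sq_int_schwartz[OF s]])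
    have "?c * cmod (dist_of u \<phi>) = cmod (of_real ?c * (LINT y|lborel. u y * cnj (cnj (\<phi> y))))"
      using c by (simp add: dist_of_schwartz[OF s sq_int_measurable[OF u]] norm_mult)
    also have "\<dots> = cmod (LINT z|lborel. gstft (dist_of u) z * cnj (gstft (dist_of (\<lambda>y. cnj (\<phi> y))) z))"
      by (simp only: moyal(2)[OF u sc])
    also have "\<dots> \<le> (LINT z|lborel. A * (C * schwartz_norm N \<phi>) * (decay (fst z :: real ^ 'n) * decay (snd z :: real ^ 'n)))"
    proof (rule Bochner_Integration.integral_norm_bound_integral[OF moyal(1)[OF u sc]])
      show "integrable lborel (\<lambda>z. A * (C * schwartz_norm N \<phi>) * (decay (fst z :: real ^ 'n) * decay (snd z :: real ^ 'n)))"
        by (intro integrable_mult_right integrable_decay_product)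
      fix z :: "(real ^ 'n) \<times> (real ^ 'n)"
      have "decay (- snd z) = decay (snd z)" by (simp add: decay_def)
      hence "cmod (cnj (gstft (dist_of (\<lambda>y. cnj (\<phi> y))) z)) \<le> C * schwartz_norm N \<phi> * (decay (fst z) * decay (snd z))"
        using le[OF s, of "(fst z, - snd z)"] by (simp add: gstft_dist_of_cnj[OF sq_int_schwartz[OF s]])
      moreover have "0 \<le> A" using order_trans[OF norm_ge_zero[of "gstft (dist_of u) z"] A[of z]] .
      ultimately have "cmod (gstft (dist_of u) z) * cmod (cnj (gstft (dist_of (\<lambda>y. cnj (\<phi> y))) z)) \<le> A * (C * schwartz_norm N \<phi> * (decay (fst z) * decay (snd z)))"
        using A by (intro mult_mono) auto
      thus "cmod (gstft (dist_of u) z * cnj (gstft (dist_of (\<lambda>y. cnj (\<phi> y))) z)) \<le> A * (C * schwartz_norm N \<phi>) * (decay (fst z) * decay (snd z))"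
        by (simp only: norm_mult mult.assoc)
    qed
    also have "\<dots> = A * (C * schwartz_norm N \<phi>) * ?I" by simp
    finally show ?thesis using c by (simp add: field_simps)
  qed
  moreover have "0 \<le> C * ?I / ?c" using C I0 c by simp
  ultimately show ?thesis by blast
qed


section \<open>The trace of nuclear operators\<close>

text \<open>The conditions on a space of functions under which the notions of nuclear operator and trace behave as for
  normed spaces.\<close>

locale normed_function_space =
  fixes B :: "('b \<Rightarrow> complex) set" and R :: "('b \<Rightarrow> complex) \<Rightarrow> real"
  assumes zero_mem: "(\<lambda>_. 0) \<in> B"
    and lin_mem: "h1 \<in> B \<Longrightarrow> h2 \<in> B \<Longrightarrow> (\<lambda>x. a * h1 x + b * h2 x) \<in> B"
    and R_nonneg: "0 \<le> R h"
    and R_lin: "h1 \<in> B \<Longrightarrow> h2 \<in> B \<Longrightarrow> R (\<lambda>x. a * h1 x + b * h2 x) \<le> cmod a * R h1 + cmod b * R h2"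
begin

lemma cmult_mem: "h \<in> B \<Longrightarrow> (\<lambda>x. a * h x) \<in> B"
  using lin_mem[of h h a 0] by simp

lemma R_cmult: "h \<in> B \<Longrightarrow> R (\<lambda>x. a * h x) \<le> cmod a * R h"
  using R_lin[of h h a 0] by simp

lemma R_zero: "R (\<lambda>_. 0) = 0"
  using R_cmult[OF zero_mem, of 0] R_nonneg[of "\<lambda>_. 0"] by simp

lemma diff_mem: "h1 \<in> B \<Longrightarrow> h2 \<in> B \<Longrightarrow> (\<lambda>x. h1 x - h2 x) \<in> B"
  using lin_mem[of h1 h2 1 "-1"] by simp

lemma R_diff_commute:
  assumes "h1 \<in> B" "h2 \<in> B" shows "R (\<lambda>x. h1 x - h2 x) = R (\<lambda>x. h2 x - h1 x)"
  using R_cmult[OF diff_mem[OF assms], of "-1"] R_cmult[OF diff_mem[OF assms(2,1)], of "-1"] by simp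

lemma functional_lin:
  assumes "bounded_functional B R \<psi>" "h1 \<in> B" "h2 \<in> B"
  shows "\<psi> (\<lambda>x. a * h1 x + b * h2 x) = a * \<psi> h1 + b * \<psi> h2"
proof -
  have add: "\<forall>h1\<in>B. \<forall>h2\<in>B. \<psi> (\<lambda>b. h1 b + h2 b) = \<psi> h1 + \<psi> h2" and cm: "\<forall>c. \<forall>h\<in>B. \<psi> (\<lambda>b. c * h b) = c * \<psi> h"
    using assms(1) unfolding bounded_functional_def by blast+
  show ?thesis
    using add[rule_format, OF cmult_mem[OF assms(2), of a] cmult_mem[OF assms(3), of b]] cm assms(2,3) by simp
qed

lemma functional_zero: "bounded_functional B R \<psi> \<Longrightarrow> \<psi> (\<lambda>_. 0) = 0"
  using functional_lin[of \<psi> "\<lambda>_. 0" "\<lambda>_. 0" 0 0] zero_mem by simp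

lemma functional_bound:
  assumes "bounded_functional B R \<psi>"
  obtains C where "0 \<le> C" "\<And>h. h \<in> B \<Longrightarrow> cmod (\<psi> h) \<le> C * R h"
proof -
  obtain C where C: "\<And>h. h \<in> B \<Longrightarrow> cmod (\<psi> h) \<le> C * R h" using assms unfolding bounded_functional_def by blast
  show thesis
  proof (rule that[of "max 0 C"])
    fix h assume "h \<in> B"
    hence "cmod (\<psi> h) \<le> C * R h" by (rule C)
    also have "\<dots> \<le> max 0 C * R h" by (intro mult_right_mono R_nonneg) auto
    finally show "cmod (\<psi> h) \<le> max 0 C * R h" .
  qed simp
qed

lemma dual_norm_bdd:
  assumes "bounded_functional B R \<psi>" shows "bdd_above ((\<lambda>h. cmod (\<psi> h)) ` {h \<in> B. R h \<le> 1})"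
proof -
  obtain C where C: "0 \<le> C" "\<And>h. h \<in> B \<Longrightarrow> cmod (\<psi> h) \<le> C * R h" using functional_bound[OF assms] by blast
  have "cmod (\<psi> h) \<le> C" if "h \<in> B" "R h \<le> 1" for h
    using C(2)[OF that(1)] mult_left_le[OF that(2) C(1)] by simp
  thus ?thesis by (auto intro!: bdd_aboveI2[where M = C])
qed

lemma dual_norm_nonneg: "bounded_functional B R \<psi> \<Longrightarrow> 0 \<le> dual_norm B R \<psi>"
  unfolding dual_norm_def by (rule cSUP_upper2[OF dual_norm_bdd, of _ "\<lambda>_. 0"]) (auto simp: zero_mem R_zero)

lemma dual_norm_bound:
  assumes \<psi>: "bounded_functional B R \<psi>" and h: "h \<in> B"
  shows "cmod (\<psi> h) \<le> dual_norm B R \<psi> * R h"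
proof (cases "R h = 0")
  case True
  obtain C where "\<And>h. h \<in> B \<Longrightarrow> cmod (\<psi> h) \<le> C * R h" using functional_bound[OF \<psi>] by blast
  from this[OF h] True show ?thesis by simp
next
  case False
  hence R: "0 < R h" using R_nonneg[of h] by simp
  let ?c = "complex_of_real (inverse (R h))"
  have "R (\<lambda>x. ?c * h x) \<le> 1" using R_cmult[OF h, of ?c] R by (simp add: norm_inverse)
  hence "cmod (\<psi> (\<lambda>x. ?c * h x)) \<le> dual_norm B R \<psi>"
    unfolding dual_norm_def using cmult_mem[OF h] by (intro cSUP_upper dual_norm_bdd[OF \<psi>]) auto
  moreover have "\<psi> (\<lambda>x. ?c * h x) = ?c * \<psi> h" using functional_lin[OF \<psi> h h, of ?c 0] by simp
  moreover have "cmod (?c * \<psi> h) = inverse (R h) * cmod (\<psi> h)" using R unfolding norm_mult norm_of_real by simp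
  ultimately have "inverse (R h) * cmod (\<psi> h) \<le> dual_norm B R \<psi>" by (simp only:)
  thus ?thesis using R by (simp add: field_simps)
qed

lemma dual_norm_le:
  assumes "0 \<le> b" "\<And>h. h \<in> B \<Longrightarrow> cmod (\<psi> h) \<le> b * R h"
  shows "dual_norm B R \<psi> \<le> b"
  unfolding dual_norm_def
proof (rule cSUP_least)
  show "{h \<in> B. R h \<le> 1} \<noteq> {}" using zero_mem R_zero by auto
  fix h assume "h \<in> {h \<in> B. R h \<le> 1}"
  thus "cmod (\<psi> h) \<le> b" using assms(2)[of h] mult_left_le[OF _ assms(1), of "R h"] by auto
qed

lemma functional_tendsto:
  assumes \<psi>: "bounded_functional B R \<psi>" and h: "h \<in> B" "\<And>m. k m \<in> B"
    and lim: "(\<lambda>m. R (\<lambda>x. h x - k m x)) \<longlonglongrightarrow> 0"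
  shows "(\<lambda>m. \<psi> (k m)) \<longlonglongrightarrow> \<psi> h"
proof -
  obtain C where C: "\<And>h. h \<in> B \<Longrightarrow> cmod (\<psi> h) \<le> C * R h" using functional_bound[OF \<psi>] by blast
  have "\<psi> (\<lambda>x. h x - k m x) = \<psi> h - \<psi> (k m)" for m using functional_lin[OF \<psi> h, of 1 "-1" m] by simp
  hence le: "cmod (\<psi> (k m) - \<psi> h) \<le> C * R (\<lambda>x. h x - k m x)" for m
    using C[OF diff_mem[OF h], of m] by (simp add: norm_minus_commute)
  have l0: "(\<lambda>m. C * R (\<lambda>x. h x - k m x)) \<longlonglongrightarrow> 0" using tendsto_mult_left[OF lim, of C] by simp
  have "(\<lambda>m. \<psi> (k m) - \<psi> h) \<longlonglongrightarrow> 0"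
    by (rule Lim_null_comparison[OF always_eventually l0]) (simp add: le)
  thus ?thesis by (rule LIM_zero_cancel)
qed

lemma sum_mem:
  fixes m :: nat
  assumes "\<And>j. \<phi> j \<in> B" shows "(\<lambda>x. \<Sum>j<m. a j * \<phi> j x) \<in> B"
proof (induction m)
  case (Suc m)
  from lin_mem[OF Suc assms[of m], of 1 "a m"] show ?case by (simp add: mult.commute)
qed (simp add: zero_mem)

lemma functional_sum:
  fixes m :: nat
  assumes "bounded_functional B R \<epsilon>" "\<And>j. \<phi> j \<in> B"
  shows "\<epsilon> (\<lambda>x. \<Sum>j<m. a j * \<phi> j x) = (\<Sum>j<m. a j * \<epsilon> (\<phi> j))"
proof (induction m)
  case (Suc m)
  have "(\<lambda>x. \<Sum>j<Suc m. a j * \<phi> j x) = (\<lambda>x. 1 * (\<Sum>j<m. a j * \<phi> j x) + a m * \<phi> m x)" by simp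
  thus ?case using functional_lin[OF assms(1) sum_mem[of \<phi> a m, OF assms(2)] assms(2)[of m], of 1 "a m"] Suc by simp
qed (simp add: functional_zero assms)

definition finite_rank :: "((('b \<Rightarrow> complex) \<Rightarrow> complex) \<times> ('b \<Rightarrow> complex)) list \<Rightarrow> ('b \<Rightarrow> complex) \<Rightarrow> 'b \<Rightarrow> complex" where
  "finite_rank M h = (\<lambda>x. \<Sum>(\<epsilon>, g)\<leftarrow>M. \<epsilon> h * g x)"

lemma finite_rank_mem:
  "(\<And>\<epsilon> g. (\<epsilon>, g) \<in> set M \<Longrightarrow> g \<in> B) \<Longrightarrow> finite_rank M h \<in> B"
proof (induction M)
  case (Cons a M)
  obtain \<epsilon> g where a: "a = (\<epsilon>, g)" by (cases a)
  have "finite_rank M h \<in> B" "g \<in> B" using Cons a by auto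
  from lin_mem[OF this, of 1 "\<epsilon> h"] show ?case by (simp add: finite_rank_def a add.commute)
qed (simp add: finite_rank_def zero_mem)

lemma functional_finite_rank:
  assumes "bounded_functional B R \<psi>" "\<And>\<epsilon> g. (\<epsilon>, g) \<in> set M \<Longrightarrow> g \<in> B"
  shows "\<psi> (finite_rank M h) = (\<Sum>(\<epsilon>, g)\<leftarrow>M. \<epsilon> h * \<psi> g)"
  using assms(2)
proof (induction M)
  case (Cons a M)
  obtain \<epsilon> g where a: "a = (\<epsilon>, g)" by (cases a)
  have m: "finite_rank M h \<in> B" "g \<in> B" using Cons a by (auto intro: finite_rank_mem)
  have "finite_rank (a # M) h = (\<lambda>x. 1 * finite_rank M h x + \<epsilon> h * g x)" by (simp add: finite_rank_def a add.commute)
  moreover have "\<psi> (finite_rank M h) = (\<Sum>(\<epsilon>, g)\<leftarrow>M. \<epsilon> h * \<psi> g)"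
    by (rule Cons.IH, rule Cons.prems, rule list.set_intros(2))
  ultimately show ?case using functional_lin[OF assms(1) m, of 1 "\<epsilon> h"] by (simp add: a add.commute)
qed (simp add: finite_rank_def functional_zero assms)

lemma nuclear_functional_sums:
  assumes "nuclear_representation B R 1 T \<phi> \<psi>" "bounded_functional B R \<epsilon>" "g \<in> B" "T g \<in> B"
  shows "(\<lambda>j. \<epsilon> (\<phi> j) * \<psi> j g) sums \<epsilon> (T g)"
proof -
  have \<phi>: "\<phi> j \<in> B" for j using assms(1) unfolding nuclear_representation_def by blast
  have "(\<lambda>m. R (\<lambda>b. T g b - (\<Sum>j<m. \<psi> j g * \<phi> j b))) \<longlonglongrightarrow> 0" using assms(1,3) unfolding nuclear_representation_def by blast
  from functional_tendsto[OF assms(2,4) sum_mem[of \<phi> "\<lambda>j. \<psi> j g", OF \<phi>] this]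
  show ?thesis unfolding functional_sum[OF assms(2) \<phi>] sums_def by (simp add: mult.commute)
qed

lemma sums_sum_list:
  fixes F :: "'c \<Rightarrow> nat \<Rightarrow> complex"
  assumes "\<And>x. x \<in> set L \<Longrightarrow> F x sums G x"
  shows "(\<lambda>k. \<Sum>x\<leftarrow>L. F x k) sums (\<Sum>x\<leftarrow>L. G x)"
  using assms
proof (induction L)
  case (Cons x L)
  have "(\<lambda>k. F x k + (\<Sum>x\<leftarrow>L. F x k)) sums (G x + (\<Sum>x\<leftarrow>L. G x))"
    by (rule sums_add[OF Cons.prems Cons.IH]) (use Cons.prems in auto)
  thus ?case by simp
qed simp

text \<open>Applying finite rank operators that approximate the identity to the left factors turns the trace into a limit of
  numbers that only depend on the operator.\<close>

lemma nuclear_sum_limit: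
  assumes rep: "nuclear_representation B R 1 T \<phi> \<psi>" and T: "\<And>h. h \<in> B \<Longrightarrow> T h \<in> B"
    and M: "\<And>m \<epsilon> g. (\<epsilon>, g) \<in> set (M m) \<Longrightarrow> bounded_functional B R \<epsilon>" "\<And>m \<epsilon> g. (\<epsilon>, g) \<in> set (M m) \<Longrightarrow> g \<in> B"
    and C: "\<And>h m. h \<in> B \<Longrightarrow> R (finite_rank (M m) h) \<le> C * R h"
    and lim: "\<And>h. h \<in> B \<Longrightarrow> (\<lambda>m. R (\<lambda>x. finite_rank (M m) h x - h x)) \<longlonglongrightarrow> 0"
  shows "summable (\<lambda>j. \<psi> j (\<phi> j))"
    and "(\<lambda>m. \<Sum>(\<epsilon>, g)\<leftarrow>M m. \<epsilon> (T g)) \<longlonglongrightarrow> (\<Sum>j. \<psi> j (\<phi> j))"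
proof -
  have \<phi>: "\<phi> j \<in> B" and \<psi>: "bounded_functional B R (\<psi> j)" for j using rep unfolding nuclear_representation_def by blast+
  have "summable (\<lambda>j. dual_norm B R (\<psi> j) powr 1 * R (\<phi> j) powr 1)" using rep unfolding nuclear_representation_def by blast
  hence S: "summable (\<lambda>j. dual_norm B R (\<psi> j) * R (\<phi> j))" using R_nonneg dual_norm_nonneg[OF \<psi>] by simp
  define a where "a = (\<lambda>k m. \<psi> k (finite_rank (M m) (\<phi> k)))"
  have mem: "finite_rank (M m) h \<in> B" for m h by (rule finite_rank_mem[OF M(2)])
  have l: "(\<lambda>m. a k m) \<longlonglongrightarrow> \<psi> k (\<phi> k)" for k
    unfolding a_def by (rule functional_tendsto[OF \<psi> \<phi> mem]) (use lim[OF \<phi>[of k]] R_diff_commute[OF mem \<phi>] in simp)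
  have b: "norm (a k m) \<le> C * (dual_norm B R (\<psi> k) * R (\<phi> k))" for k m
  proof -
    have "norm (a k m) \<le> dual_norm B R (\<psi> k) * R (finite_rank (M m) (\<phi> k))" unfolding a_def by (rule dual_norm_bound[OF \<psi> mem])
    also have "\<dots> \<le> dual_norm B R (\<psi> k) * (C * R (\<phi> k))" by (intro mult_left_mono C \<phi> dual_norm_nonneg \<psi>)
    finally show ?thesis by (simp add: mult_ac)
  qed
  have e: "eventually (\<lambda>(k, m). norm (a k m) \<le> C * (dual_norm B R (\<psi> k) * R (\<phi> k))) (at_top \<times>\<^sub>F sequentially)"
    by (rule always_eventually) (use b in auto)
  note tan = tannerys_theorem[OF l e summable_mult[OF S] sequentially_bot]
  from tan have t2: "summable (\<lambda>k. norm (\<psi> k (\<phi> k)))" and t3: "(\<lambda>m. \<Sum>k. a k m) \<longlonglongrightarrow> (\<Sum>k. \<psi> k (\<phi> k))" by simp_all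
  show "summable (\<lambda>j. \<psi> j (\<phi> j))" using t2 by (rule summable_norm_cancel)
  have "(\<lambda>k. a k m) sums (\<Sum>(\<epsilon>, g)\<leftarrow>M m. \<epsilon> (T g))" for m
  proof -
    have "(\<lambda>k. \<Sum>x\<leftarrow>M m. fst x (\<phi> k) * \<psi> k (snd x)) sums (\<Sum>x\<leftarrow>M m. fst x (T (snd x)))"
      by (rule sums_sum_list, rule nuclear_functional_sums[OF rep]) (use M[of _ _ m] T in auto)
    moreover have "\<psi> k (finite_rank (M m) h) = (\<Sum>(\<epsilon>, g)\<leftarrow>M m. \<epsilon> h * \<psi> k g)" for k h
      by (rule functional_finite_rank[OF \<psi>]) (rule M(2))
    ultimately show ?thesis unfolding a_def by (simp add: case_prod_unfold)
  qed
  hence "(\<Sum>k. a k m) = (\<Sum>(\<epsilon>, g)\<leftarrow>M m. \<epsilon> (T g))" for m by (rule sums_unique[symmetric])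
  thus "(\<lambda>m. \<Sum>(\<epsilon>, g)\<leftarrow>M m. \<epsilon> (T g)) \<longlonglongrightarrow> (\<Sum>j. \<psi> j (\<phi> j))" using t3 by simp
qed

text \<open>The limits of two representations agree, which makes the description in the definition of the trace unique.\<close>

theorem nuclear_trace_eq:
  assumes rep: "nuclear_representation B R 1 T \<phi> \<psi>" and T: "\<And>h. h \<in> B \<Longrightarrow> T h \<in> B"
    and M: "\<And>m \<epsilon> g. (\<epsilon>, g) \<in> set (M m) \<Longrightarrow> bounded_functional B R \<epsilon>" "\<And>m \<epsilon> g. (\<epsilon>, g) \<in> set (M m) \<Longrightarrow> g \<in> B"
    and C: "\<And>h m. h \<in> B \<Longrightarrow> R (finite_rank (M m) h) \<le> C * R h"
    and lim: "\<And>h. h \<in> B \<Longrightarrow> (\<lambda>m. R (\<lambda>x. finite_rank (M m) h x - h x)) \<longlonglongrightarrow> 0"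
  shows "nuclear_trace B R T = (\<Sum>j. \<psi> j (\<phi> j))"
  unfolding nuclear_trace_def
proof (rule the_equality)
  note L = nuclear_sum_limit[OF _ T M C lim]
  show "\<forall>\<phi>' \<psi>'. nuclear_representation B R 1 T \<phi>' \<psi>' \<longrightarrow> (\<lambda>j. \<psi>' j (\<phi>' j)) sums (\<Sum>j. \<psi> j (\<phi> j))"
  proof (intro allI impI)
    fix \<phi>' \<psi>' assume r: "nuclear_representation B R 1 T \<phi>' \<psi>'"
    have "(\<Sum>j. \<psi>' j (\<phi>' j)) = (\<Sum>j. \<psi> j (\<phi> j))" by (rule LIMSEQ_unique[OF L(2)[OF r] L(2)[OF rep]])
    thus "(\<lambda>j. \<psi>' j (\<phi>' j)) sums (\<Sum>j. \<psi> j (\<phi> j))" using summable_sums[OF L(1)[OF r]] by simp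
  qed
  show "t = (\<Sum>j. \<psi> j (\<phi> j))" if "\<forall>\<phi>' \<psi>'. nuclear_representation B R 1 T \<phi>' \<psi>' \<longrightarrow> (\<lambda>j. \<psi>' j (\<phi>' j)) sums t" for t
    using that[rule_format, OF rep] by (rule sums_unique)
qed

end


section \<open>Modulation spaces as normed spaces\<close>

lemma norm_zmono_le: "cmod (zmono is \<zeta>) \<le> norm \<zeta> ^ length is"
  by (induction "is") (auto simp: zmono_def norm_mult intro!: mult_mono Finite_Cartesian_Product.norm_nth_le)

text \<open>The exponents are real, and the hypotheses on the weight are those that hold for a submultiplicative polynomially
  moderate weight that is not identically 0.\<close>

locale modulation_setting =
  fixes P Q s :: real and w :: "(real ^ 'n::finite) \<times> (real ^ 'n) \<Rightarrow> real"
  assumes P: "1 \<le> P" and Q: "1 \<le> Q" and s: "0 \<le> s"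
    and w_mod: "w (z + z') \<le> poly_weight s z * w z'"
    and w1: "1 \<le> w z" and wc: "continuous_on UNIV w"
begin

abbreviation "Mnorm \<equiv> modulation_norm (ennreal P) (ennreal Q) w"
abbreviation "Mspace \<equiv> modulation_space (ennreal P) (ennreal Q) w"
abbreviation "Mrnorm \<equiv> modulation_rnorm (ennreal P) (ennreal Q) w"
abbreviation "Mdual \<equiv> modulation_norm (conj_exponent (ennreal P)) (conj_exponent (ennreal Q)) (\<lambda>z. inverse (w z))"

lemma w_pos: "0 < w z"
  using w1[of z] by simp

lemma Mnorm_mixed: "h \<in> tempered \<Longrightarrow> Mnorm h = mixed_norm (ennreal P) (ennreal Q) (\<lambda>z. ennreal (cmod (gstft h z) * w z))"
  by (rule modulation_norm_mixed[OF _ wc])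

lemma integrand_measurable: "h \<in> tempered \<Longrightarrow> (\<lambda>z. ennreal (cmod (gstft h z) * w z)) \<in> borel_measurable borel"
  by (intro measurable_compose[OF _ measurable_ennreal] borel_measurable_continuous_onI continuous_intros gstft_continuous wc)

lemma Mnorm_lin:
  assumes h: "h1 \<in> tempered" "h2 \<in> tempered"
  shows "Mnorm (\<lambda>\<phi>. a * h1 \<phi> + b * h2 \<phi>) \<le> ennreal (cmod a) * Mnorm h1 + ennreal (cmod b) * Mnorm h2"
proof -
  let ?F = "\<lambda>h z. ennreal (cmod (gstft h z) * w z)"
  note m[measurable] = integrand_measurable[OF h(1)] integrand_measurable[OF h(2)]
  have "ennreal (cmod (gstft (\<lambda>\<phi>. a * h1 \<phi> + b * h2 \<phi>) z) * w z) \<le> ennreal (cmod a) * ?F h1 z + ennreal (cmod b) * ?F h2 z" for z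
  proof -
    have "cmod (gstft (\<lambda>\<phi>. a * h1 \<phi> + b * h2 \<phi>) z) * w z \<le> (cmod a * cmod (gstft h1 z) + cmod b * cmod (gstft h2 z)) * w z"
      using w_pos[of z] unfolding stft_def norm_mult[symmetric] by (intro mult_right_mono norm_triangle_ineq) auto
    also have "\<dots> = cmod a * (cmod (gstft h1 z) * w z) + cmod b * (cmod (gstft h2 z) * w z)" by (simp add: algebra_simps)
    finally have "ennreal (cmod (gstft (\<lambda>\<phi>. a * h1 \<phi> + b * h2 \<phi>) z) * w z) \<le> ennreal \<dots>" by (rule ennreal_leI)
    thus ?thesis using w_pos[of z] by (simp add: ennreal_mult)
  qed
  hence "Mnorm (\<lambda>\<phi>. a * h1 \<phi> + b * h2 \<phi>) \<le> mixed_norm (ennreal P) (ennreal Q) (\<lambda>z. ennreal (cmod a) * ?F h1 z + ennreal (cmod b) * ?F h2 z)"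
    unfolding Mnorm_mixed[OF tempered_linear[OF h]] by (rule mixed_norm_mono[OF P Q])
  also have "\<dots> \<le> mixed_norm (ennreal P) (ennreal Q) (\<lambda>z. ennreal (cmod a) * ?F h1 z) + mixed_norm (ennreal P) (ennreal Q) (\<lambda>z. ennreal (cmod b) * ?F h2 z)"
    by (intro mixed_norm_triangle[OF P Q]) measurable
  also have "\<dots> = ennreal (cmod a) * Mnorm h1 + ennreal (cmod b) * Mnorm h2"
    unfolding mixed_norm_cmult[OF P Q m(1)] mixed_norm_cmult[OF P Q m(2)] Mnorm_mixed[OF h(1)] Mnorm_mixed[OF h(2)] ..
  finally show ?thesis .
qed

lemma Mspace_iff: "h \<in> Mspace \<longleftrightarrow> h \<in> tempered \<and> Mnorm h < \<infinity>"
  by (simp add: modulation_space_def)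

lemma Mspace_tempered: "h \<in> Mspace \<Longrightarrow> h \<in> tempered"
  by (simp add: Mspace_iff)

lemma Mnorm_Mrnorm: "h \<in> Mspace \<Longrightarrow> Mnorm h = ennreal (Mrnorm h)"
  by (simp add: Mspace_iff modulation_rnorm_def)

lemma Mrnorm_le: "Mnorm h \<le> ennreal c \<Longrightarrow> 0 \<le> c \<Longrightarrow> Mrnorm h \<le> c"
  unfolding modulation_rnorm_def by (rule enn2real_leI)

lemma Mnorm_zero: "Mnorm (\<lambda>_. 0) = 0"
  using Mnorm_lin[OF tempered_zero tempered_zero, of 0 0] by simp

sublocale normed_function_space Mspace Mrnorm
proof
  show "(\<lambda>_. 0) \<in> Mspace" by (simp add: Mspace_iff tempered_zero Mnorm_zero)
  show nn: "0 \<le> Mrnorm h" for h by (simp add: modulation_rnorm_def)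
  fix h1 h2 :: "(real ^ 'n \<Rightarrow> complex) \<Rightarrow> complex" and a b assume h: "h1 \<in> Mspace" "h2 \<in> Mspace"
  have le: "Mnorm (\<lambda>\<phi>. a * h1 \<phi> + b * h2 \<phi>) \<le> ennreal (cmod a * Mrnorm h1 + cmod b * Mrnorm h2)"
    using Mnorm_lin[OF h[THEN Mspace_tempered], of a b] nn unfolding Mnorm_Mrnorm[OF h(1)] Mnorm_Mrnorm[OF h(2)] by (simp add: ennreal_mult)
  show "(\<lambda>\<phi>. a * h1 \<phi> + b * h2 \<phi>) \<in> Mspace"
    unfolding Mspace_iff using tempered_linear[OF h[THEN Mspace_tempered]] le_less_trans[OF le] by simp
  show "Mrnorm (\<lambda>\<phi>. a * h1 \<phi> + b * h2 \<phi>) \<le> cmod a * Mrnorm h1 + cmod b * Mrnorm h2"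
    using nn by (intro Mrnorm_le[OF le]) simp
qed

lemma gstft_le_Mrnorm:
  obtains K where "0 \<le> K" "\<And>h z. h \<in> Mspace \<Longrightarrow> cmod (gstft h z) \<le> K * Mrnorm h"
proof -
  obtain K where K: "0 \<le> K" "\<And>(h :: (real ^ 'n \<Rightarrow> complex) \<Rightarrow> complex) w z0. h \<in> tempered \<Longrightarrow> continuous_on UNIV w \<Longrightarrow> (\<forall>z. 1 \<le> w z) \<Longrightarrow>
     ennreal (cmod (gstft h z0)) \<le> ennreal K * modulation_norm (ennreal P) (ennreal Q) w h"
    using gstft_le_modulation_norm[OF P Q, where 'n = 'n] by blast
  show thesis
  proof (rule that[OF K(1)])
    fix h z assume h: "h \<in> Mspace"
    have "ennreal (cmod (gstft h z)) \<le> ennreal K * Mnorm h" using w1 by (intro K(2) Mspace_tempered[OF h] wc) simp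
    also have "\<dots> = ennreal (K * Mrnorm h)" using K(1) R_nonneg by (simp add: Mnorm_Mrnorm[OF h] ennreal_mult)
    finally show "cmod (gstft h z) \<le> K * Mrnorm h" using K(1) R_nonneg by simp
  qed
qed

text \<open>These functionals serve as the right factors of the finite rank approximations.\<close>

lemma evaluation_functional: "bounded_functional Mspace Mrnorm (\<lambda>h. c * h (gmono js 0))"
proof -
  obtain K where K: "\<And>h z. h \<in> Mspace \<Longrightarrow> cmod (gstft h z) \<le> K * Mrnorm h" using gstft_le_Mrnorm by blast
  have "\<exists>C. \<forall>h\<in>Mspace. \<forall>\<eta> :: complex ^ 'n. norm \<eta> \<le> 0 \<longrightarrow> cmod (h (gmono js \<eta>)) \<le> C * (K * Mrnorm h)"
    by (rule tempered_gmono_bound[where N = "\<lambda>h. K * Mrnorm h"]) (use K Mspace_tempered in blast)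
  then obtain C where C: "\<And>h. h \<in> Mspace \<Longrightarrow> cmod (h (gmono js 0)) \<le> C * (K * Mrnorm h)" by fastforce
  have "cmod (c * h (gmono js 0)) \<le> (cmod c * C * K) * Mrnorm h" if "h \<in> Mspace" for h
    using mult_left_mono[OF C[OF that], of "cmod c"] by (simp add: norm_mult mult_ac)
  thus ?thesis unfolding bounded_functional_def by (auto simp: algebra_simps intro!: exI[of _ "cmod c * C * K"])
qed

lemma hermite_mem: "dist_of (hermite is) \<in> Mspace"
proof -
  let ?h = "dist_of (hermite is) :: (real ^ 'n \<Rightarrow> complex) \<Rightarrow> complex" and ?k = "length is" and ?c = "1 / (8 * pi)"
  let ?G = "\<lambda>z :: (real ^ 'n) \<times> (real ^ 'n). ennreal ((1 + norm z) ^ ?k * exp (- ?c * (norm z)\<^sup>2) * w z)"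
  let ?A = "2 powr (real CARD('n) / 4) * (2 * pi) ^ ?k"
  have t: "?h \<in> tempered" by (rule dist_of_schwartz_tempered[OF hermite_schwartz])
  have "ennreal (cmod (gstft ?h z) * w z) \<le> ennreal ?A * ?G z" for z
  proof -
    have "cmod (zmono is (zpoint z)) \<le> norm (zpoint z) ^ ?k" by (rule norm_zmono_le)
    also have "\<dots> \<le> (2 * pi * (1 + norm z)) ^ ?k"
    proof (rule power_mono)
      have "norm (zpoint z) \<le> 2 * pi * norm z" by (rule norm_zpoint_bounds(1))
      also have "\<dots> \<le> 2 * pi * (1 + norm z)" by simp
      finally show "norm (zpoint z) \<le> 2 * pi * (1 + norm z)" .
    qed simp
    finally have a: "cmod (zmono is (zpoint z)) \<le> (2 * pi) ^ ?k * (1 + norm z) ^ ?k" by (simp only: power_mult_distrib)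
    have "(norm z)\<^sup>2 \<le> (norm (zpoint z))\<^sup>2" using norm_zpoint_bounds(4)[of z] by (intro power_mono) auto
    hence "- (norm (zpoint z))\<^sup>2 / (8 * pi) \<le> - ?c * (norm z)\<^sup>2" by (simp add: field_simps)
    hence b: "exp (- (norm (zpoint z))\<^sup>2 / (8 * pi)) \<le> exp (- ?c * (norm z)\<^sup>2)" by (rule exp_mono)
    have "cmod (gstft ?h z) = 2 powr (real CARD('n) / 4) * exp (- (norm (zpoint z))\<^sup>2 / (8 * pi)) * cmod (zmono is (zpoint z))"
      unfolding norm_gstft[OF t] bargmann_hermite ..
    also have "\<dots> \<le> 2 powr (real CARD('n) / 4) * exp (- ?c * (norm z)\<^sup>2) * ((2 * pi) ^ ?k * (1 + norm z) ^ ?k)"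
      using a b by (intro mult_mono) auto
    finally have "cmod (gstft ?h z) * w z \<le> 2 powr (real CARD('n) / 4) * exp (- ?c * (norm z)\<^sup>2) * ((2 * pi) ^ ?k * (1 + norm z) ^ ?k) * w z"
      using w_pos[of z] by (intro mult_right_mono) auto
    also have "\<dots> = ?A * ((1 + norm z) ^ ?k * exp (- ?c * (norm z)\<^sup>2) * w z)" by (simp only: mult_ac)
    finally have "ennreal (cmod (gstft ?h z) * w z) \<le> ennreal (?A * ((1 + norm z) ^ ?k * exp (- ?c * (norm z)\<^sup>2) * w z))" by (rule ennreal_leI)
    also have "\<dots> = ennreal ?A * ?G z" by (rule ennreal_mult') simp
    finally show ?thesis .
  qed
  hence "Mnorm ?h \<le> mixed_norm (ennreal P) (ennreal Q) (\<lambda>z. ennreal ?A * ?G z)"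
    unfolding Mnorm_mixed[OF t] by (rule mixed_norm_mono[OF P Q])
  also have "\<dots> = ennreal ?A * mixed_norm (ennreal P) (ennreal Q) ?G"
    by (rule mixed_norm_cmult[OF P Q])
      (intro measurable_compose[OF _ measurable_ennreal] borel_measurable_continuous_onI continuous_intros wc)
  also have "\<dots> < \<infinity>"
    using mixed_norm_gauss_finite[OF P Q s w_mod w1, of ?c ?k] by (simp add: ennreal_mult_less_top)
  finally show ?thesis using t by (simp add: Mspace_iff)
qed

text \<open>The finite rank approximation of the identity in the form that the trace formula needs.\<close>

lemma approximation_property:
  obtains M C where "\<And>m \<epsilon> g. (\<epsilon>, g) \<in> set (M m) \<Longrightarrow> bounded_functional Mspace Mrnorm \<epsilon>"
    "\<And>m \<epsilon> g. (\<epsilon>, g) \<in> set (M m) \<Longrightarrow> g \<in> dist_of ` schwartz \<inter> Mspace"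
    "\<And>h m. h \<in> Mspace \<Longrightarrow> Mrnorm (finite_rank (M m) h) \<le> C * Mrnorm h"
    "\<And>h. h \<in> Mspace \<Longrightarrow> (\<lambda>m::nat. Mrnorm (\<lambda>\<phi>. finite_rank (M m) h \<phi> - h \<phi>)) \<longlonglongrightarrow> 0"
proof -
  obtain M0 :: "nat \<Rightarrow> (complex \<times> 'n list \<times> 'n list) list" and C where C: "0 \<le> C"
    and le: "\<And>h m. h \<in> tempered \<Longrightarrow> Mnorm h < \<infinity> \<Longrightarrow> Mnorm (finrank (M0 m) h) \<le> ennreal C * Mnorm h"
    and lim: "\<And>h. h \<in> tempered \<Longrightarrow> Mnorm h < \<infinity> \<Longrightarrow> (\<lambda>m. Mnorm (\<lambda>\<phi>. finrank (M0 m) h \<phi> - h \<phi>)) \<longlonglongrightarrow> 0"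
    by (rule finite_rank_approximation[OF P Q s w_mod w1 wc]) blast
  define M where "M = (\<lambda>m. map (\<lambda>(c, is, js). (\<lambda>h :: (real ^ 'n \<Rightarrow> complex) \<Rightarrow> complex. c * h (gmono js 0), dist_of (hermite is) :: (real ^ 'n \<Rightarrow> complex) \<Rightarrow> complex)) (M0 m))"
  have fr: "finite_rank (M m) h = finrank (M0 m) h" for m h
    unfolding finite_rank_def finrank_def M_def by (simp add: o_def case_prod_unfold)
  show thesis
  proof (rule that[of M C])
    show "bounded_functional Mspace Mrnorm \<epsilon>" if "(\<epsilon>, g) \<in> set (M m)" for m \<epsilon> g
      using that evaluation_functional by (auto simp: M_def)
    show "g \<in> dist_of ` schwartz \<inter> Mspace" if "(\<epsilon>, g) \<in> set (M m)" for m \<epsilon> g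
      using that hermite_mem hermite_schwartz by (auto simp: M_def)
    fix h assume h: "h \<in> Mspace"
    hence t: "h \<in> tempered" "Mnorm h < \<infinity>" by (auto simp: Mspace_iff)
    show "Mrnorm (finite_rank (M m) h) \<le> C * Mrnorm h" for m
      using le[OF t, of m] C R_nonneg unfolding fr Mnorm_Mrnorm[OF h] by (intro Mrnorm_le) (auto simp: ennreal_mult)
    have "(\<lambda>m. Mnorm (\<lambda>\<phi>. finrank (M0 m) h \<phi> - h \<phi>)) \<longlonglongrightarrow> ennreal 0" using lim[OF t] by simp
    from tendsto_enn2real[OF this] show "(\<lambda>m. Mrnorm (\<lambda>\<phi>. finite_rank (M m) h \<phi> - h \<phi>)) \<longlonglongrightarrow> 0" unfolding fr modulation_rnorm_def by simp
  qed
qed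

text \<open>The finite rank approximations of an element are combinations of Schwartz functions that converge to it.\<close>

lemma functional_unique:
  assumes \<psi>: "bounded_functional Mspace Mrnorm \<psi>1" "bounded_functional Mspace Mrnorm \<psi>2"
    and eq: "\<And>\<phi>. \<phi> \<in> schwartz \<Longrightarrow> \<psi>1 (dist_of \<phi>) = \<psi>2 (dist_of \<phi>)" and h: "h \<in> Mspace"
  shows "\<psi>1 h = \<psi>2 h"
proof -
  obtain M C where g: "\<And>m \<epsilon> g. (\<epsilon>, g) \<in> set (M m) \<Longrightarrow> g \<in> dist_of ` schwartz \<inter> Mspace"
    and lim: "\<And>h. h \<in> Mspace \<Longrightarrow> (\<lambda>m::nat. Mrnorm (\<lambda>\<phi>. finite_rank (M m) h \<phi> - h \<phi>)) \<longlonglongrightarrow> 0"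
    by (rule approximation_property) blast
  have mem: "finite_rank (M m) h \<in> Mspace" for m by (rule finite_rank_mem) (use g in blast)
  have l: "(\<lambda>m. Mrnorm (\<lambda>\<phi>. h \<phi> - finite_rank (M m) h \<phi>)) \<longlonglongrightarrow> 0" using lim[OF h] R_diff_commute[OF mem h] by simp
  have v: "\<psi> (finite_rank (M m) h) = (\<Sum>x\<leftarrow>M m. fst x h * \<psi> (snd x))" if "bounded_functional Mspace Mrnorm \<psi>" for \<psi> m
    using functional_finite_rank[OF that, of "M m" h] g by (auto simp: case_prod_unfold)
  have "\<psi>1 (snd x) = \<psi>2 (snd x)" if "x \<in> set (M m)" for x m
    using g[of "fst x" "snd x" m] that eq by auto
  hence "\<psi>1 (finite_rank (M m) h) = \<psi>2 (finite_rank (M m) h)" for m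
    unfolding v[OF \<psi>(1)] v[OF \<psi>(2)] by (simp cong: map_cong)
  thus ?thesis using functional_tendsto[OF \<psi>(1) h mem l] functional_tendsto[OF \<psi>(2) h mem l] LIMSEQ_unique by simp
qed

section \<open>The pairing with square-integrable functions\<close>

text \<open>Conjugate linear in \<open>u\<close>. By Moyal's identity it extends the inner product of square-integrable functions.\<close>

definition pairing :: "(real ^ 'n \<Rightarrow> complex) \<Rightarrow> ((real ^ 'n \<Rightarrow> complex) \<Rightarrow> complex) \<Rightarrow> complex" where
  "pairing u h = (LINT z|lborel. gstft h z * cnj (gstft (dist_of u) z)) / of_real (moyal_const TYPE('n))"

lemma pairing_dist_of:
  assumes "sq_int u" "sq_int v" shows "pairing u (dist_of v) = (LINT y|lborel. v y * cnj (u y))"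
  unfolding pairing_def moyal(2)[OF assms(2,1)] using moyal_const_pos[where 'n = 'n] by simp

text \<open>The weight is distributed onto the two factors.\<close>

lemma Holder_gstft:
  assumes h: "h \<in> tempered" and g: "g \<in> tempered"
  shows "(\<integral>\<^sup>+z. ennreal (cmod (gstft h z * cnj (gstft g z))) \<partial>lborel) \<le> Mnorm h * Mdual g"
proof -
  have wi: "continuous_on UNIV (\<lambda>z. inverse (w z))" using w_pos by (intro continuous_intros wc) (simp add: less_imp_neq[THEN not_sym])
  have m: "(\<lambda>z. ennreal (cmod (gstft g z) * inverse (w z))) \<in> borel_measurable borel"
    by (intro measurable_compose[OF _ measurable_ennreal] borel_measurable_continuous_onI continuous_on_mult continuous_on_norm gstft_continuous wi g)
  have e: "ennreal (cmod (gstft h z * cnj (gstft g z))) = ennreal (cmod (gstft h z) * w z) * ennreal (cmod (gstft g z) * inverse (w z))" for z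
    using w_pos[of z] by (simp add: norm_mult flip: ennreal_mult)
  show ?thesis unfolding e Mnorm_mixed[OF h] modulation_norm_mixed[OF g wi]
    by (rule mixed_Holder[OF P Q integrand_measurable[OF h] m])
qed

lemma pairing_bound:
  assumes u: "sq_int u" and fin: "Mdual (dist_of u) < \<infinity>" and h: "h \<in> Mspace"
  shows "integrable lborel (\<lambda>z. gstft h z * cnj (gstft (dist_of u) z))"
    and "cmod (pairing u h) \<le> enn2real (Mdual (dist_of u)) / moyal_const TYPE('n) * Mrnorm h"
proof -
  let ?d = "enn2real (Mdual (dist_of u))"
  obtain d where d: "Mdual (dist_of u) = ennreal d" "0 \<le> d" using fin by (cases "Mdual (dist_of u)") auto
  hence d': "?d = d" by simp
  note t = Mspace_tempered[OF h] dist_of_tempered[OF u]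
  have le: "(\<integral>\<^sup>+z. ennreal (cmod (gstft h z * cnj (gstft (dist_of u) z))) \<partial>lborel) \<le> ennreal (Mrnorm h * ?d)"
    using Holder_gstft[OF t] d(2) R_nonneg[of h] unfolding Mnorm_Mrnorm[OF h] d(1) d' by (simp add: ennreal_mult)
  show i: "integrable lborel (\<lambda>z. gstft h z * cnj (gstft (dist_of u) z))"
  proof (rule integrableI_bounded)
    have "(\<lambda>z. gstft h z * cnj (gstft (dist_of u) z)) \<in> borel_measurable borel"
      by (intro borel_measurable_continuous_onI continuous_intros gstft_continuous t)
    thus "(\<lambda>z. gstft h z * cnj (gstft (dist_of u) z)) \<in> borel_measurable lborel" by simp
    show "(\<integral>\<^sup>+z. ennreal (cmod (gstft h z * cnj (gstft (dist_of u) z))) \<partial>lborel) < \<infinity>"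
      using le_less_trans[OF le] by simp
  qed
  have "ennreal (cmod (LINT z|lborel. gstft h z * cnj (gstft (dist_of u) z))) \<le> ennreal (Mrnorm h * ?d)"
    by (rule order_trans[OF integral_norm_bound_ennreal[OF i] le])
  hence "cmod (LINT z|lborel. gstft h z * cnj (gstft (dist_of u) z)) \<le> Mrnorm h * ?d" using R_nonneg[of h] by simp
  thus "cmod (pairing u h) \<le> ?d / moyal_const TYPE('n) * Mrnorm h"
    using moyal_const_pos[where 'n = 'n] by (simp add: pairing_def norm_divide divide_right_mono mult.commute)
qed

lemma pairing_functional:
  assumes u: "sq_int u" and fin: "Mdual (dist_of u) < \<infinity>"
  shows "bounded_functional Mspace Mrnorm (pairing u)"
  unfolding bounded_functional_def
proof (intro conjI ballI allI)
  note i = pairing_bound(1)[OF assms]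
  show "pairing u (\<lambda>b. h1 b + h2 b) = pairing u h1 + pairing u h2" if "h1 \<in> Mspace" "h2 \<in> Mspace" for h1 h2
  proof -
    have "gstft (\<lambda>b. h1 b + h2 b) z * cnj (gstft (dist_of u) z) = gstft h1 z * cnj (gstft (dist_of u) z) + gstft h2 z * cnj (gstft (dist_of u) z)" for z
      by (simp add: stft_def algebra_simps)
    thus ?thesis using i[OF that(1)] i[OF that(2)] by (simp add: pairing_def add_divide_distrib)
  qed
  show "pairing u (\<lambda>b. c * h b) = c * pairing u h" if "h \<in> Mspace" for h c
    by (simp add: pairing_def stft_def mult.assoc)
  show "\<exists>C. \<forall>h\<in>Mspace. cmod (pairing u h) \<le> C * Mrnorm h" using pairing_bound(2)[OF assms] by blast
qed

lemma modulation_pairing_eq: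
  assumes u: "sq_int u" and fin: "Mdual (dist_of u) < \<infinity>" and h: "h \<in> Mspace"
    and v: "\<And>\<phi>. \<phi> \<in> schwartz \<Longrightarrow> L2_inner \<phi> v = (LINT y|lborel. \<phi> y * cnj (u y))"
  shows "modulation_pairing (ennreal P) (ennreal Q) w h v = pairing u h"
  unfolding modulation_pairing_def
proof (rule the_equality)
  have e: "pairing u (dist_of \<phi>) = L2_inner \<phi> v" if "\<phi> \<in> schwartz" for \<phi>
    using pairing_dist_of[OF u sq_int_schwartz[OF that]] v[OF that] by simp
  show "\<exists>\<psi>. bounded_functional Mspace Mrnorm \<psi> \<and> (\<forall>\<phi>\<in>schwartz. \<psi> (dist_of \<phi>) = L2_inner \<phi> v) \<and> pairing u h = \<psi> h"
    using pairing_functional[OF u fin] e by blast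
  fix c assume "\<exists>\<psi>. bounded_functional Mspace Mrnorm \<psi> \<and> (\<forall>\<phi>\<in>schwartz. \<psi> (dist_of \<phi>) = L2_inner \<phi> v) \<and> c = \<psi> h"
  then obtain \<psi> where \<psi>: "bounded_functional Mspace Mrnorm \<psi>" "\<And>\<phi>. \<phi> \<in> schwartz \<Longrightarrow> \<psi> (dist_of \<phi>) = L2_inner \<phi> v" "c = \<psi> h" by blast
  show "c = pairing u h"
    unfolding \<psi>(3) by (rule functional_unique[OF \<psi>(1) pairing_functional[OF u fin] _ h]) (simp add: \<psi>(2) e)
qed

text \<open>The embedding of the square-integrable members of the modulation space into the tempered distributions is bounded.\<close>

lemma dist_of_le_Mrnorm:
  obtains C N where "0 \<le> C" "\<And>u \<phi>. sq_int u \<Longrightarrow> dist_of u \<in> Mspace \<Longrightarrow> \<phi> \<in> schwartz \<Longrightarrow> cmod (dist_of u \<phi>) \<le> C * schwartz_norm N \<phi> * Mrnorm (dist_of u)"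
proof -
  obtain C N where C: "0 \<le> C" and le: "\<And>(u :: real ^ 'n \<Rightarrow> complex) \<phi> A. sq_int u \<Longrightarrow> \<phi> \<in> schwartz \<Longrightarrow> (\<forall>z. cmod (gstft (dist_of u) z) \<le> A) \<Longrightarrow>
      cmod (dist_of u \<phi>) \<le> C * schwartz_norm N \<phi> * A"
    using dist_of_bound[where 'n = 'n] by blast
  obtain K where K: "0 \<le> K" "\<And>h z. h \<in> Mspace \<Longrightarrow> cmod (gstft h z) \<le> K * Mrnorm h" using gstft_le_Mrnorm by blast
  show thesis
  proof (rule that[of "C * K" N])
    show "cmod (dist_of u \<phi>) \<le> C * K * schwartz_norm N \<phi> * Mrnorm (dist_of u)" if "sq_int u" "dist_of u \<in> Mspace" "\<phi> \<in> schwartz" for u \<phi>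
      using le[OF that(1,3), of "K * Mrnorm (dist_of u)"] K(2)[OF that(2)] by (simp add: mult_ac)
  qed (use C K in simp)
qed

end


section \<open>Series of rank one operators\<close>

lemma summable_of_summable_powr:
  fixes y :: "nat \<Rightarrow> real"
  assumes "\<And>j. 0 \<le> y j" "0 < r" "r \<le> 1" and s: "summable (\<lambda>j. y j powr r)"
  shows "summable y"
proof (rule summable_comparison_test_ev[OF _ s])
  have "eventually (\<lambda>j. y j powr r < 1) sequentially"
    using summable_LIMSEQ_zero[OF s] by (rule order_tendstoD) simp
  thus "eventually (\<lambda>j. norm (y j) \<le> y j powr r) sequentially"
  proof eventually_elim
    case (elim j)
    have "y j < 1"
    proof (rule ccontr)
      assume "\<not> y j < 1"
      hence "1 \<le> y j powr r" using assms(2) by (intro ge_one_powr_ge_zero) auto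
      thus False using elim by simp
    qed
    hence "y j powr 1 \<le> y j powr r" using assms(1)[of j] assms(3) by (intro powr_mono') auto
    thus ?case using assms(1)[of j] by simp
  qed
qed

text \<open>The left factors are functions rather than distributions because Moyal's identity controls the series as a
  distribution only for square-integrable terms.\<close>

definition rank_one_series :: "(nat \<Rightarrow> real ^ 'n::finite \<Rightarrow> complex) \<Rightarrow> (nat \<Rightarrow> ((real ^ 'n \<Rightarrow> complex) \<Rightarrow> complex) \<Rightarrow> complex) \<Rightarrow>
    ((real ^ 'n \<Rightarrow> complex) \<Rightarrow> complex) \<Rightarrow> (real ^ 'n \<Rightarrow> complex) \<Rightarrow> complex" where
  "rank_one_series v \<Psi> h = (\<lambda>\<phi>. \<Sum>j. \<Psi> j h * dist_of (v j) \<phi>)"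

context modulation_setting begin

context
  fixes v :: "nat \<Rightarrow> real ^ 'n \<Rightarrow> complex" and \<Psi> :: "nat \<Rightarrow> ((real ^ 'n \<Rightarrow> complex) \<Rightarrow> complex) \<Rightarrow> complex" and b :: "nat \<Rightarrow> real"
  assumes v: "\<And>j. sq_int (v j)" and vM: "\<And>j. dist_of (v j) \<in> Mspace"
    and \<Psi>: "\<And>j. bounded_functional Mspace Mrnorm (\<Psi> j)"
    and b0: "\<And>j. 0 \<le> b j" and b: "\<And>j h. h \<in> Mspace \<Longrightarrow> cmod (\<Psi> j h) \<le> b j * Mrnorm h"
    and sm: "summable (\<lambda>j. b j * Mrnorm (dist_of (v j)))"
begin

abbreviation "series \<equiv> rank_one_series v \<Psi>"

lemma series_term_bound:
  obtains C N where "0 \<le> C" "\<And>h j \<phi>. h \<in> Mspace \<Longrightarrow> \<phi> \<in> schwartz \<Longrightarrow>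
    cmod (\<Psi> j h * dist_of (v j) \<phi>) \<le> C * schwartz_norm N \<phi> * Mrnorm h * (b j * Mrnorm (dist_of (v j)))"
proof -
  obtain C N where C: "0 \<le> C" and le: "\<And>u \<phi>. sq_int u \<Longrightarrow> dist_of u \<in> Mspace \<Longrightarrow> \<phi> \<in> schwartz \<Longrightarrow>
      cmod (dist_of u \<phi>) \<le> C * schwartz_norm N \<phi> * Mrnorm (dist_of u)"
    using dist_of_le_Mrnorm by blast
  show thesis
  proof (rule that[OF C, of N])
    fix h j and \<phi> :: "real ^ 'n \<Rightarrow> complex" assume h: "h \<in> Mspace" "\<phi> \<in> schwartz"
    have "cmod (\<Psi> j h) * cmod (dist_of (v j) \<phi>) \<le> (b j * Mrnorm h) * (C * schwartz_norm N \<phi> * Mrnorm (dist_of (v j)))"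
      by (intro mult_mono b le v vM h mult_nonneg_nonneg b0 R_nonneg) simp
    thus "cmod (\<Psi> j h * dist_of (v j) \<phi>) \<le> C * schwartz_norm N \<phi> * Mrnorm h * (b j * Mrnorm (dist_of (v j)))"
      by (simp only: norm_mult mult_ac)
  qed
qed

lemma series_summable:
  assumes h: "h \<in> Mspace" shows "summable (\<lambda>j. cmod (\<Psi> j h * dist_of (v j) \<phi>))"
proof (cases "\<phi> \<in> schwartz")
  case True
  obtain C N where C: "0 \<le> C" and le: "\<And>h j \<phi>. h \<in> Mspace \<Longrightarrow> \<phi> \<in> schwartz \<Longrightarrow>
    cmod (\<Psi> j h * dist_of (v j) \<phi>) \<le> C * schwartz_norm N \<phi> * Mrnorm h * (b j * Mrnorm (dist_of (v j)))"
    by (rule series_term_bound) (rule that)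
  show ?thesis
    by (rule summable_comparison_test'[OF summable_mult[OF sm, of "C * schwartz_norm N \<phi> * Mrnorm h"]]) (use le[OF h True] in simp)
next
  case False
  thus ?thesis by (simp add: dist_of_def)
qed

lemma series_summable': "h \<in> Mspace \<Longrightarrow> summable (\<lambda>j. \<Psi> j h * dist_of (v j) \<phi>)"
  by (rule summable_norm_cancel[OF series_summable])

lemma series_tempered:
  assumes h: "h \<in> Mspace" shows "series h \<in> tempered"
proof -
  note t = dist_of_tempered[OF v]
  obtain C N where C: "0 \<le> C" and le: "\<And>h j \<phi>. h \<in> Mspace \<Longrightarrow> \<phi> \<in> schwartz \<Longrightarrow>
    cmod (\<Psi> j h * dist_of (v j) \<phi>) \<le> C * schwartz_norm N \<phi> * Mrnorm h * (b j * Mrnorm (dist_of (v j)))"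
    by (rule series_term_bound) (rule that)
  let ?S = "\<Sum>j. b j * Mrnorm (dist_of (v j))"
  have "series h (\<lambda>y. \<phi> y + \<psi> y) = series h \<phi> + series h \<psi>" if "\<phi> \<in> schwartz" "\<psi> \<in> schwartz" for \<phi> \<psi>
    unfolding rank_one_series_def suminf_add[OF series_summable'[OF h] series_summable'[OF h]]
    by (simp add: tempered_add[OF t that] distrib_left)
  moreover have "series h (\<lambda>y. c * \<phi> y) = c * series h \<phi>" if "\<phi> \<in> schwartz" for c \<phi>
    unfolding rank_one_series_def suminf_mult[OF series_summable'[OF h], symmetric]
    by (simp add: tempered_cmult[OF t that] mult_ac)
  moreover have "cmod (series h \<phi>) \<le> (C * Mrnorm h * ?S) * schwartz_norm N \<phi>" if s: "\<phi> \<in> schwartz" for \<phi>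
  proof -
    have "cmod (series h \<phi>) \<le> (\<Sum>j. C * schwartz_norm N \<phi> * Mrnorm h * (b j * Mrnorm (dist_of (v j))))"
      unfolding rank_one_series_def by (rule norm_suminf_le[OF le[OF h s] summable_mult[OF sm]])
    also have "\<dots> = C * schwartz_norm N \<phi> * Mrnorm h * ?S" by (rule suminf_mult[OF sm])
    finally show ?thesis by (simp only: mult_ac)
  qed
  moreover have "series h \<phi> = 0" if "\<phi> \<notin> schwartz" for \<phi> using that by (simp add: rank_one_series_def dist_of_def)
  ultimately show ?thesis unfolding tempered_def by blast
qed

text \<open>The transform of the remainder is dominated by the series of the transforms, to which Minkowski's inequality for
  series applies.\<close>

lemma series_tail:
  assumes h: "h \<in> Mspace"
  shows "Mnorm (\<lambda>\<phi>. series h \<phi> - (\<Sum>j<m. \<Psi> j h * dist_of (v j) \<phi>)) \<le>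
    ennreal (Mrnorm h * (\<Sum>j. b (j + m) * Mrnorm (dist_of (v (j + m)))))"
proof -
  let ?d = "\<lambda>\<phi>. series h \<phi> - (\<Sum>j<m. \<Psi> j h * dist_of (v j) \<phi>)"
  let ?F = "\<lambda>j z. ennreal (cmod (gstft (dist_of (v (j + m))) z) * w z)"
  let ?y = "\<lambda>j. b (j + m) * Mrnorm (dist_of (v (j + m)))"
  have S: "(\<lambda>\<phi>. \<Sum>j<m. \<Psi> j h * dist_of (v j) \<phi>) \<in> tempered"
    using sum_mem[of "\<lambda>j. dist_of (v j)" "\<lambda>j. \<Psi> j h" m] vM Mspace_tempered by blast
  have t: "?d \<in> tempered" using tempered_linear[OF series_tempered[OF h] S, of 1 "- 1"] by simp
  have m[measurable]: "?F j \<in> borel_measurable borel" for j by (rule integrand_measurable[OF Mspace_tempered[OF vM]])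
  have "ennreal (cmod (gstft ?d z) * w z) \<le> (\<Sum>j. ennreal (cmod (\<Psi> (j + m) h)) * ?F j z)" for z
  proof -
    let ?\<chi> = "\<lambda>y. cnj (gauss_window (y - fst z)) * exp (- \<i> * complex_of_real (y \<bullet> snd z))"
    let ?a = "\<lambda>j. \<Psi> j h * dist_of (v j) ?\<chi>"
    have sc: "summable (\<lambda>j. cmod (?a (j + m)))" by (rule summable_ignore_initial_segment[OF series_summable[OF h]])
    have "gstft ?d z = (\<Sum>j. ?a (j + m))"
      unfolding stft_def rank_one_series_def suminf_minus_initial_segment[OF series_summable'[OF h]] ..
    hence "cmod (gstft ?d z) * w z \<le> (\<Sum>j. cmod (?a (j + m))) * w z"
      using summable_norm[OF sc] w_pos[of z] by (intro mult_right_mono) auto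
    also have "\<dots> = (\<Sum>j. cmod (?a (j + m)) * w z)" by (rule suminf_mult2[OF sc])
    finally have "ennreal (cmod (gstft ?d z) * w z) \<le> ennreal (\<Sum>j. cmod (?a (j + m)) * w z)" by (rule ennreal_leI)
    also have "\<dots> = (\<Sum>j. ennreal (cmod (?a (j + m)) * w z))"
      using w_pos[of z] by (intro suminf_ennreal2[symmetric] summable_mult2 sc mult_nonneg_nonneg) auto
    also have "\<dots> = (\<Sum>j. ennreal (cmod (\<Psi> (j + m) h)) * ?F j z)"
      by (simp add: stft_def norm_mult mult.assoc flip: ennreal_mult')
    finally show ?thesis .
  qed
  hence "Mnorm ?d \<le> mixed_norm (ennreal P) (ennreal Q) (\<lambda>z. \<Sum>j. ennreal (cmod (\<Psi> (j + m) h)) * ?F j z)"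
    unfolding Mnorm_mixed[OF t] by (rule mixed_norm_mono[OF P Q])
  also have "\<dots> \<le> (\<Sum>j. mixed_norm (ennreal P) (ennreal Q) (\<lambda>z. ennreal (cmod (\<Psi> (j + m) h)) * ?F j z))"
    by (rule mixed_norm_suminf[OF P Q]) measurable
  also have "\<dots> \<le> (\<Sum>j. ennreal (Mrnorm h * ?y j))"
  proof (rule suminf_le)
    fix j
    have "mixed_norm (ennreal P) (ennreal Q) (\<lambda>z. ennreal (cmod (\<Psi> (j + m) h)) * ?F j z) = ennreal (cmod (\<Psi> (j + m) h)) * Mnorm (dist_of (v (j + m)))"
      unfolding mixed_norm_cmult[OF P Q m] Mnorm_mixed[OF Mspace_tempered[OF vM]] ..
    also have "\<dots> \<le> ennreal (b (j + m) * Mrnorm h) * ennreal (Mrnorm (dist_of (v (j + m))))"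
      unfolding Mnorm_Mrnorm[OF vM] by (intro mult_right_mono ennreal_leI b h) simp
    also have "\<dots> = ennreal (Mrnorm h * ?y j)" using R_nonneg by (simp add: mult_ac flip: ennreal_mult')
    finally show "mixed_norm (ennreal P) (ennreal Q) (\<lambda>z. ennreal (cmod (\<Psi> (j + m) h)) * ?F j z) \<le> ennreal (Mrnorm h * ?y j)" .
  qed auto
  also have "\<dots> = ennreal (\<Sum>j. Mrnorm h * ?y j)"
    by (intro suminf_ennreal2 mult_nonneg_nonneg R_nonneg b0 summable_mult summable_ignore_initial_segment[OF sm])
  also have "(\<Sum>j. Mrnorm h * ?y j) = Mrnorm h * (\<Sum>j. ?y j)"
    by (rule suminf_mult[OF summable_ignore_initial_segment[OF sm]])
  finally show ?thesis .
qed

lemma series_mem: "h \<in> Mspace \<Longrightarrow> series h \<in> Mspace"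
  and series_bound: "h \<in> Mspace \<Longrightarrow> Mrnorm (series h) \<le> (\<Sum>j. b j * Mrnorm (dist_of (v j))) * Mrnorm h"
proof -
  assume h: "h \<in> Mspace"
  have le: "Mnorm (series h) \<le> ennreal (Mrnorm h * (\<Sum>j. b j * Mrnorm (dist_of (v j))))"
    using series_tail[OF h, of 0] by simp
  show "series h \<in> Mspace" unfolding Mspace_iff using series_tempered[OF h] le_less_trans[OF le] by simp
  have "0 \<le> (\<Sum>j. b j * Mrnorm (dist_of (v j)))" by (intro suminf_nonneg sm mult_nonneg_nonneg b0 R_nonneg)
  thus "Mrnorm (series h) \<le> (\<Sum>j. b j * Mrnorm (dist_of (v j))) * Mrnorm h"
    using Mrnorm_le[OF le] R_nonneg[of h] by (simp add: mult.commute)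
qed

lemma series_converges:
  assumes h: "h \<in> Mspace"
  shows "(\<lambda>m. Mrnorm (\<lambda>\<phi>. series h \<phi> - (\<Sum>j<m. \<Psi> j h * dist_of (v j) \<phi>))) \<longlonglongrightarrow> 0"
proof (rule tendsto_sandwich[where f = "\<lambda>_. 0"])
  let ?y = "\<lambda>j. b j * Mrnorm (dist_of (v j))"
  have y0: "0 \<le> (\<Sum>j. ?y (j + m))" for m
    by (intro suminf_nonneg summable_ignore_initial_segment[OF sm] mult_nonneg_nonneg b0 R_nonneg)
  show "\<forall>\<^sub>F m in sequentially. 0 \<le> Mrnorm (\<lambda>\<phi>. series h \<phi> - (\<Sum>j<m. \<Psi> j h * dist_of (v j) \<phi>))"
    by (simp add: R_nonneg)
  show "\<forall>\<^sub>F m in sequentially. Mrnorm (\<lambda>\<phi>. series h \<phi> - (\<Sum>j<m. \<Psi> j h * dist_of (v j) \<phi>)) \<le> Mrnorm h * ((\<Sum>j. ?y j) - (\<Sum>j<m. ?y j))"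
    using series_tail[OF h] y0 R_nonneg unfolding suminf_minus_initial_segment[OF sm]
    by (intro always_eventually allI Mrnorm_le mult_nonneg_nonneg) auto
  have "(\<lambda>m. Mrnorm h * ((\<Sum>j. ?y j) - (\<Sum>j<m. ?y j))) \<longlonglongrightarrow> Mrnorm h * ((\<Sum>j. ?y j) - (\<Sum>j. ?y j))"
    by (intro tendsto_intros summable_LIMSEQ sm)
  thus "(\<lambda>m. Mrnorm h * ((\<Sum>j. ?y j) - (\<Sum>j<m. ?y j))) \<longlonglongrightarrow> 0" by simp
qed simp

lemma series_operator:
  assumes T: "\<And>h. h \<in> Mspace \<Longrightarrow> T h = series h"
  shows "bounded_operator Mspace Mrnorm T"
  unfolding bounded_operator_def
proof (intro conjI ballI allI)
  show "T h \<in> Mspace" if "h \<in> Mspace" for h using series_mem[OF that] T[OF that] by simp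
  show "T (\<lambda>\<phi>. h1 \<phi> + h2 \<phi>) = (\<lambda>\<phi>. T h1 \<phi> + T h2 \<phi>)" if h: "h1 \<in> Mspace" "h2 \<in> Mspace" for h1 h2
  proof -
    have m: "(\<lambda>\<phi>. h1 \<phi> + h2 \<phi>) \<in> Mspace" using lin_mem[OF h, of 1 1] by simp
    have "\<Psi> j (\<lambda>\<phi>. h1 \<phi> + h2 \<phi>) = \<Psi> j h1 + \<Psi> j h2" for j using functional_lin[OF \<Psi> h, of j 1 1] by simp
    thus ?thesis unfolding T[OF m] T[OF h(1)] T[OF h(2)] rank_one_series_def
      by (simp add: suminf_add[OF series_summable'[OF h(1)] series_summable'[OF h(2)]] distrib_right)
  qed
  show "T (\<lambda>\<phi>. c * h \<phi>) = (\<lambda>\<phi>. c * T h \<phi>)" if h: "h \<in> Mspace" for c h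
  proof -
    have "\<Psi> j (\<lambda>\<phi>. c * h \<phi>) = c * \<Psi> j h" for j using functional_lin[OF \<Psi> h h, of j c 0] by simp
    thus ?thesis unfolding T[OF cmult_mem[OF h]] T[OF h] rank_one_series_def
      by (simp add: suminf_mult[OF series_summable'[OF h], symmetric] mult.assoc)
  qed
  show "\<exists>C. \<forall>h\<in>Mspace. Mrnorm (T h) \<le> C * Mrnorm h" using series_bound T by auto
qed

lemma series_nuclear:
  assumes T: "\<And>h. h \<in> Mspace \<Longrightarrow> T h = series h" and r: "0 < r"
    and s: "summable (\<lambda>j. (b j * Mrnorm (dist_of (v j))) powr r)"
  shows "nuclear_representation Mspace Mrnorm r T (\<lambda>j. dist_of (v j)) \<Psi>"
  unfolding nuclear_representation_def
proof (intro conjI allI ballI)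
  show "summable (\<lambda>j. dual_norm Mspace Mrnorm (\<Psi> j) powr r * Mrnorm (dist_of (v j)) powr r)"
  proof (rule summable_comparison_test'[OF s])
    fix j
    have "dual_norm Mspace Mrnorm (\<Psi> j) powr r * Mrnorm (dist_of (v j)) powr r \<le> b j powr r * Mrnorm (dist_of (v j)) powr r"
      using r by (intro mult_right_mono powr_mono2 dual_norm_nonneg[OF \<Psi>] dual_norm_le b0 b) auto
    thus "norm (dual_norm Mspace Mrnorm (\<Psi> j) powr r * Mrnorm (dist_of (v j)) powr r) \<le> (b j * Mrnorm (dist_of (v j))) powr r"
      by (simp add: powr_mult b0 R_nonneg)
  qed
  show "(\<lambda>m. Mrnorm (\<lambda>\<phi>. T h \<phi> - (\<Sum>j<m. \<Psi> j h * dist_of (v j) \<phi>))) \<longlonglongrightarrow> 0" if "h \<in> Mspace" for h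
    using series_converges[OF that] unfolding T[OF that] .
qed (simp_all add: vM \<Psi>)

end

end

section \<open>The spectral function as a nuclear operator\<close>

text \<open>Neither the distribution of a member of \<open>L2\<close> nor its inner products change when it is modified on a null set.\<close>

lemma L2_representative:
  fixes v :: "real ^ 'n::finite \<Rightarrow> complex"
  assumes v: "v \<in> L2"
  obtains u where "sq_int u" "dist_of u = dist_of v" "\<And>\<phi>. \<phi> \<in> schwartz \<Longrightarrow> L2_inner \<phi> v = (LINT y|lborel. \<phi> y * cnj (u y))"
    "L2_inner v v = (LINT y|lborel. u y * cnj (u y))"
proof -
  have vm[measurable]: "v \<in> borel_measurable lebesgue" and vi: "integrable lebesgue (\<lambda>x. (cmod (v x))\<^sup>2)" using v by (auto simp: L2_def)
  have "(\<lambda>x. Re (v x)) \<in> borel_measurable lebesgue" "(\<lambda>x. Im (v x)) \<in> borel_measurable lebesgue" by measurable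
  from this[THEN completion_ex_borel_measurable_real] obtain a c
    where a[measurable]: "a \<in> borel_measurable lborel" and ae_a: "AE x in lborel. Re (v x) = a x"
      and c[measurable]: "c \<in> borel_measurable lborel" and ae_c: "AE x in lborel. Im (v x) = c x" by blast
  define u where "u = (\<lambda>x. Complex (a x) (c x))"
  have ueq: "u = (\<lambda>x. of_real (a x) + \<i> * of_real (c x))" by (simp add: u_def fun_eq_iff complex_eq_iff)
  have "u \<in> borel_measurable lborel" unfolding ueq by measurable
  hence um[measurable]: "u \<in> borel_measurable borel" by simp
  have um': "u \<in> borel_measurable lebesgue" by (rule measurable_completion) (use um in simp)
  have "AE x in lborel. v x = u x" using ae_a ae_c by eventually_elim (simp add: u_def complex_eq_iff)
  hence ae: "AE x in lebesgue. v x = u x" by (rule AE_completion)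
  have ui: "integrable lborel (\<lambda>x. (cmod (u x))\<^sup>2)"
  proof -
    have "(\<lambda>x. (cmod (u x))\<^sup>2) \<in> borel_measurable lebesgue" using um' by measurable
    hence "integrable lebesgue (\<lambda>x. (cmod (u x))\<^sup>2)"
      by (rule integrable_cong_AE_imp[OF vi]) (use ae in eventually_elim, simp)
    thus ?thesis using um by (subst (asm) integrable_completion) auto
  qed
  hence su: "sq_int u" using um by (simp add: sq_int_def)
  have sm: "\<phi> \<in> borel_measurable lebesgue" if "\<phi> \<in> schwartz" for \<phi> :: "real ^ 'n \<Rightarrow> complex"
    by (rule measurable_completion) (use schwartz_measurable[OF that] in simp)
  have cm: "(\<lambda>x. cnj (f x)) \<in> borel_measurable M" if "f \<in> borel_measurable M" for f and M :: "(real ^ 'n) measure"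
    using that by (rule measurable_compose[OF _ borel_measurable_continuous_onI[OF continuous_on_cnj[OF continuous_on_id]]])
  have "dist_of u \<phi> = dist_of v \<phi>" for \<phi>
  proof (cases "\<phi> \<in> schwartz")
    case True
    have "(LINT x|lebesgue. u x * \<phi> x) = (LINT x|lebesgue. v x * \<phi> x)"
      by (rule integral_cong_AE) (use um' vm sm[OF True] ae in \<open>auto elim!: eventually_mono\<close>)
    thus ?thesis by (simp add: dist_of_def)
  qed (simp add: dist_of_def)
  moreover have "L2_inner \<phi> v = (LINT y|lborel. \<phi> y * cnj (u y))" if s: "\<phi> \<in> schwartz" for \<phi>
  proof -
    have "L2_inner \<phi> v = (LINT x|lebesgue. \<phi> x * cnj (u x))" unfolding L2_inner_def
      by (rule integral_cong_AE) (use cm[OF um'] cm[OF vm] sm[OF s] ae in \<open>auto elim!: eventually_mono\<close>)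
    also have "\<dots> = (LINT y|lborel. \<phi> y * cnj (u y))"
      by (rule integral_completion) (use cm[OF um] schwartz_measurable[OF s] in simp)
    finally show ?thesis .
  qed
  moreover have "L2_inner v v = (LINT y|lborel. u y * cnj (u y))"
  proof -
    have "L2_inner v v = (LINT x|lebesgue. u x * cnj (u x))" unfolding L2_inner_def
      by (rule integral_cong_AE) (use um' vm cm[OF um'] cm[OF vm] ae in \<open>auto elim!: eventually_mono\<close>)
    also have "\<dots> = (LINT y|lborel. u y * cnj (u y))"
      by (rule integral_completion) (use cm[OF um] um in simp)
    finally show ?thesis .
  qed
  ultimately show thesis using su by (intro that[of u]) auto
qed

context modulation_setting begin

text \<open>As \<open>0 * \<infinity> = 0\<close>, a vanishing norm could hide an infinite one in a finite term of the nuclearity sum. Hoelder's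
  inequality for the pairing of the function with itself excludes this.\<close>

lemma norm_product_nonzero:
  assumes u: "sq_int u" and n: "(LINT y|lborel. u y * cnj (u y)) = 1"
  shows "Mnorm (dist_of u) \<noteq> 0" "Mdual (dist_of u) \<noteq> 0"
proof -
  note t = dist_of_tempered[OF u]
  have "0 < ennreal (cmod (LINT z|lborel. gstft (dist_of u) z * cnj (gstft (dist_of u) z)))"
    unfolding moyal(2)[OF u u] n using moyal_const_pos[where 'n = 'n] by simp
  also have "\<dots> \<le> (\<integral>\<^sup>+z. ennreal (cmod (gstft (dist_of u) z * cnj (gstft (dist_of u) z))) \<partial>lborel)"
    by (rule integral_norm_bound_ennreal[OF moyal(1)[OF u u]])
  also have "\<dots> \<le> Mnorm (dist_of u) * Mdual (dist_of u)" by (rule Holder_gstft[OF t t])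
  finally show "Mnorm (dist_of u) \<noteq> 0" "Mdual (dist_of u) \<noteq> 0" by auto
qed

context
  fixes u :: "nat \<Rightarrow> real ^ 'n \<Rightarrow> complex" and lam :: "nat \<Rightarrow> real" and f :: "real \<Rightarrow> complex"
  assumes uL: "\<And>j. u j \<in> L2" and un: "\<And>j. L2_inner (u j) (u j) = 1"
begin

abbreviation "spec \<equiv> spectral_function (ennreal P) (ennreal Q) w f lam u"

text \<open>The representation takes the eigenfunctions as left factors and their pairings, multiplied by the values of \<open>f\<close>, as
  right factors. It works for every \<open>r\<close>, and its diagonal values are the terms of the trace formula.\<close>

theorem spectral_nuclear:
  assumes r: "0 < r" "r \<le> 1" and fin: "nuclearity_sum (ennreal P) (ennreal Q) w f lam u r < \<infinity>"
  shows "\<exists>\<phi> \<psi>. bounded_operator Mspace Mrnorm spec \<and> nuclear_representation Mspace Mrnorm r spec \<phi> \<psi> \<and>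
     (\<forall>j. \<psi> j (\<phi> j) = f (lam j)) \<and> summable (\<lambda>j. cmod (\<psi> j (\<phi> j)))"
proof -
  define c where "c = moyal_const TYPE('n)"
  have c: "0 < c" unfolding c_def by (rule moyal_const_pos)
  have "\<forall>j. \<exists>g. sq_int g \<and> dist_of g = dist_of (u j) \<and> (\<forall>\<phi>\<in>schwartz. L2_inner \<phi> (u j) = (LINT y|lborel. \<phi> y * cnj (g y))) \<and>
     (LINT y|lborel. g y * cnj (g y)) = 1"
  proof
    fix j
    obtain g where "sq_int g" "dist_of g = dist_of (u j)" "\<And>\<phi>. \<phi> \<in> schwartz \<Longrightarrow> L2_inner \<phi> (u j) = (LINT y|lborel. \<phi> y * cnj (g y))"
      "L2_inner (u j) (u j) = (LINT y|lborel. g y * cnj (g y))" by (rule L2_representative[OF uL[of j]]) (rule that)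
    thus "\<exists>g. sq_int g \<and> dist_of g = dist_of (u j) \<and> (\<forall>\<phi>\<in>schwartz. L2_inner \<phi> (u j) = (LINT y|lborel. \<phi> y * cnj (g y))) \<and>
     (LINT y|lborel. g y * cnj (g y)) = 1" by (intro exI[of _ g] conjI ballI) (simp_all add: un)
  qed
  from choice[OF this] obtain g where G: "\<And>j. sq_int (g j) \<and> dist_of (g j) = dist_of (u j) \<and>
     (\<forall>\<phi>\<in>schwartz. L2_inner \<phi> (u j) = (LINT y|lborel. \<phi> y * cnj (g j y))) \<and> (LINT y|lborel. g j y * cnj (g j y)) = 1" by blast
  have g: "sq_int (g j)" "dist_of (g j) = dist_of (u j)" "\<phi> \<in> schwartz \<Longrightarrow> L2_inner \<phi> (u j) = (LINT y|lborel. \<phi> y * cnj (g j y))"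
    "(LINT y|lborel. g j y * cnj (g j y)) = 1" for j \<phi> using G[of j] by blast+
  let ?f = "\<lambda>j. f (lam j)"
  have pos: "Mnorm (dist_of (g j)) \<noteq> 0" "Mdual (dist_of (g j)) \<noteq> 0" for j
    by (rule norm_product_nonzero[OF g(1,4)])+
  let ?t = "\<lambda>j. ennreal (cmod (?f j) powr r) * enn_powr (Mnorm (dist_of (g j))) r * enn_powr (Mdual (dist_of (g j))) r"
  have tfin: "(\<Sum>j. ?t j) < \<infinity>" using fin by (simp add: nuclearity_sum_def g(2))
  have fin2: "Mnorm (dist_of (g j)) < \<infinity> \<and> Mdual (dist_of (g j)) < \<infinity>" if "?f j \<noteq> 0" for j
  proof -
    have "?t j < \<infinity>" by (rule ennreal_suminf_lessD[OF tfin])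
    moreover have "ennreal (cmod (?f j) powr r) \<noteq> 0" using that by simp
    ultimately have "enn_powr (Mnorm (dist_of (g j))) r < \<infinity>" "enn_powr (Mdual (dist_of (g j))) r < \<infinity>"
      using pos[of j] by (auto simp: ennreal_mult_less_top enn_powr_eq_0_iff)
    thus ?thesis by (auto simp: enn_powr_def less_top[symmetric])
  qed
  \<comment> \<open>Where \<open>f (lam j)\<close> vanishes, the eigenfunction may lie outside of the space, and the term is replaced by 0.\<close>
  define v where "v = (\<lambda>j. if ?f j = 0 then (\<lambda>_. 0) else g j)"
  define \<Psi> where "\<Psi> = (\<lambda>j h. if ?f j = 0 then 0 else ?f j * pairing (g j) h)"
  define d where "d = (\<lambda>j. if ?f j = 0 then 0 else enn2real (Mdual (dist_of (g j))))"
  define b where "b = (\<lambda>j. cmod (?f j) * (d j / c))"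
  have d0: "0 \<le> d j" for j by (simp add: d_def)
  have b0: "0 \<le> b j" for j using d0[of j] c by (simp add: b_def)
  have dz: "dist_of (\<lambda>_. 0) = (\<lambda>_. 0 :: complex)" by (simp add: dist_of_def fun_eq_iff)
  have v: "sq_int (v j)" for j using g(1) by (simp add: v_def sq_int_def)
  have vM: "dist_of (v j) \<in> Mspace" for j
    using fin2[of j] dist_of_tempered[OF g(1)] by (simp add: v_def dz zero_mem Mspace_iff[of "dist_of (g j)"])
  have \<Psi>: "bounded_functional Mspace Mrnorm (\<Psi> j)" for j
  proof (cases "?f j = 0")
    case True
    thus ?thesis by (auto simp: \<Psi>_def bounded_functional_def intro!: exI[of _ 0])
  next
    case False
    note pf = pairing_functional[OF g(1), of j] fin2[OF False]
    then obtain C where C: "\<And>h. h \<in> Mspace \<Longrightarrow> cmod (pairing (g j) h) \<le> C * Mrnorm h" using functional_bound by metis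
    have "cmod (?f j * pairing (g j) h) \<le> (cmod (?f j) * C) * Mrnorm h" if "h \<in> Mspace" for h
      using mult_left_mono[OF C[OF that], of "cmod (?f j)"] by (simp add: norm_mult mult.assoc)
    moreover have "\<forall>h1\<in>Mspace. \<forall>h2\<in>Mspace. pairing (g j) (\<lambda>b. h1 b + h2 b) = pairing (g j) h1 + pairing (g j) h2"
        "\<forall>c. \<forall>h\<in>Mspace. pairing (g j) (\<lambda>b. c * h b) = c * pairing (g j) h"
      using pf unfolding bounded_functional_def by blast+
    ultimately show ?thesis using False unfolding \<Psi>_def bounded_functional_def by (auto simp: distrib_left)
  qed
  have b: "cmod (\<Psi> j h) \<le> b j * Mrnorm h" if h: "h \<in> Mspace" for j h
  proof (cases "?f j = 0")
    case False
    have "cmod (?f j) * cmod (pairing (g j) h) \<le> cmod (?f j) * (enn2real (Mdual (dist_of (g j))) / c * Mrnorm h)"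
      unfolding c_def by (intro mult_left_mono pairing_bound(2)[OF g(1) _ h]) (use fin2[OF False] in auto)
    thus ?thesis using False by (simp add: \<Psi>_def b_def d_def norm_mult)
  qed (simp add: \<Psi>_def b_def d_def)
  let ?y = "\<lambda>j. b j * Mrnorm (dist_of (v j))"
  have y0: "0 \<le> ?y j" for j by (intro mult_nonneg_nonneg b0 R_nonneg)
  let ?s = "\<lambda>j. cmod (?f j) powr r * Mrnorm (dist_of (v j)) powr r * d j powr r"
  have "?t j = ennreal (?s j)" for j
  proof (cases "?f j = 0")
    case False
    thus ?thesis using fin2[OF False] by (simp add: v_def d_def enn_powr_def modulation_rnorm_def less_top[symmetric] ennreal_mult)
  qed simp
  hence "summable ?s" using tfin by (intro summable_suminf_not_top) auto
  hence "summable (\<lambda>j. (1 / c) powr r * ?s j)" by (rule summable_mult)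
  moreover have "(1 / c) powr r * ?s j = ?y j powr r" for j
    using c d0[of j] R_nonneg by (simp add: b_def powr_mult powr_divide mult_ac)
  ultimately have yr: "summable (\<lambda>j. ?y j powr r)" by simp
  have sm: "summable ?y" by (rule summable_of_summable_powr[OF y0 r yr])
  note S = v vM \<Psi> b0 b sm
  have T: "spec h = rank_one_series v \<Psi> h" if h: "h \<in> Mspace" for h
  proof -
    have "?f j * modulation_pairing (ennreal P) (ennreal Q) w h (u j) * dist_of (u j) \<phi> = \<Psi> j h * dist_of (v j) \<phi>" for j \<phi>
    proof (cases "?f j = 0")
      case False
      have "modulation_pairing (ennreal P) (ennreal Q) w h (u j) = pairing (g j) h"
        by (rule modulation_pairing_eq[OF g(1) _ h g(3)]) (use fin2[OF False] in auto)
      thus ?thesis using False by (simp add: \<Psi>_def v_def g(2))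
    qed (simp add: \<Psi>_def)
    thus ?thesis unfolding spectral_function_def rank_one_series_def by simp
  qed
  have tr: "\<Psi> j (dist_of (v j)) = ?f j" for j
    using pairing_dist_of[OF g(1) g(1), of j j] g(4)[of j] by (simp add: \<Psi>_def v_def)
  have "summable (\<lambda>j. cmod (\<Psi> j (dist_of (v j))))"
    by (rule summable_comparison_test'[OF sm]) (use b[OF vM] in simp)
  moreover have "bounded_operator Mspace Mrnorm spec" by (rule series_operator[OF S T])
  moreover have "nuclear_representation Mspace Mrnorm r spec (\<lambda>j. dist_of (v j)) \<Psi>"
    by (rule series_nuclear[OF S T r(1) yr])
  ultimately show ?thesis using tr by (intro exI[of _ "\<lambda>j. dist_of (v j)"] exI[of _ \<Psi>]) blast
qed

theorem spectral_trace:
  assumes fin: "nuclearity_sum (ennreal P) (ennreal Q) w f lam u 1 < \<infinity>"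
  shows "summable (\<lambda>j. cmod (f (lam j)))" "nuclear_trace Mspace Mrnorm spec = (\<Sum>j. f (lam j))"
proof -
  obtain \<phi> \<psi> where op: "bounded_operator Mspace Mrnorm spec" and rep: "nuclear_representation Mspace Mrnorm 1 spec \<phi> \<psi>"
    and tr: "\<And>j. \<psi> j (\<phi> j) = f (lam j)" and sm: "summable (\<lambda>j. cmod (\<psi> j (\<phi> j)))"
    using spectral_nuclear[OF zero_less_one order_refl fin] by blast
  show "summable (\<lambda>j. cmod (f (lam j)))" using sm by (simp add: tr)
  obtain M C where M: "\<And>m \<epsilon> g. (\<epsilon>, g) \<in> set (M m) \<Longrightarrow> bounded_functional Mspace Mrnorm \<epsilon>"
    "\<And>m \<epsilon> g. (\<epsilon>, g) \<in> set (M m) \<Longrightarrow> g \<in> dist_of ` schwartz \<inter> Mspace"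
    "\<And>h m. h \<in> Mspace \<Longrightarrow> Mrnorm (finite_rank (M m) h) \<le> C * Mrnorm h"
    "\<And>h. h \<in> Mspace \<Longrightarrow> (\<lambda>m::nat. Mrnorm (\<lambda>\<phi>. finite_rank (M m) h \<phi> - h \<phi>)) \<longlonglongrightarrow> 0"
    by (rule approximation_property) blast
  have "spec h \<in> Mspace" if "h \<in> Mspace" for h using op that unfolding bounded_operator_def by blast
  from nuclear_trace_eq[OF rep this M(1) IntD2[OF M(2)] M(3,4)]
  show "nuclear_trace Mspace Mrnorm spec = (\<Sum>j. f (lam j))" by (simp add: tr)
qed

end

end


section \<open>Functions of the anharmonic oscillator\<close>

theorem theorem1p4:
  fixes k l :: nat
    and G :: "((real ^ 'n::finite \<Rightarrow> complex) \<times> (real ^ 'n \<Rightarrow> complex)) set"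
    and u :: "nat \<Rightarrow> real ^ 'n \<Rightarrow> complex"
    and lam :: "nat \<Rightarrow> real"
    and f :: "real \<Rightarrow> complex"
    and r :: real
    and p q :: ennreal
    and w :: "(real ^ 'n) \<times> (real ^ 'n) \<Rightarrow> real"
  assumes "1 \<le> k" "1 \<le> l"
    and "selfadjoint_extension (anharmonic k l) G"
    and "orthonormal_basis_L2 u"
    and "\<And>j. (u j, \<lambda>x. complex_of_real (lam j) * u j x) \<in> G"
    and "0 < r" "r \<le> 1"
    and "1 \<le> p" "p < \<infinity>" "1 \<le> q" "q < \<infinity>"
    and "weight w" "submultiplicative w" "polynomially_moderate w"
    and "\<exists>z. w z \<noteq> 0"
  shows "(nuclearity_sum p q w f lam u r < \<infinity> \<longrightarrow>
            r_nuclear (modulation_space p q w) (modulation_rnorm p q w) r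
              (spectral_function p q w f lam u))
       \<and> (nuclearity_sum p q w f lam u 1 < \<infinity> \<longrightarrow>
            summable (\<lambda>j. cmod (f (lam j))) \<and>
            nuclear_trace (modulation_space p q w) (modulation_rnorm p q w)
              (spectral_function p q w f lam u) = (\<Sum>j. f (lam j)))"
proof -
  obtain s where s: "0 \<le> s" "\<And>z z'. w (z + z') \<le> poly_weight s z * w z'" "\<And>z. 1 \<le> w z" "continuous_on UNIV w"
    using moderate_weight_properties[OF assms(12-15)] by blast
  obtain P where p: "p = ennreal P" "0 \<le> P" using \<open>p < \<infinity>\<close> by (cases p) auto
  obtain Q where q: "q = ennreal Q" "0 \<le> Q" using \<open>q < \<infinity>\<close> by (cases q) auto
  have PQ: "1 \<le> P" "1 \<le> Q" using \<open>1 \<le> p\<close> \<open>1 \<le> q\<close> p q by (simp_all flip: ennreal_1)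
  interpret modulation_setting P Q s w by unfold_locales (use PQ s in auto)
  have u: "u j \<in> L2" "L2_inner (u j) (u j) = 1" for j using assms(4) by (auto simp: orthonormal_basis_L2_def)
  note nuc = spectral_nuclear[where u = u and lam = lam and f = f, OF u \<open>0 < r\<close> \<open>r \<le> 1\<close>, folded p(1) q(1)]
  note trace = spectral_trace[where u = u and lam = lam and f = f, OF u, folded p(1) q(1)]
  show ?thesis
  proof (intro conjI impI)
    assume "nuclearity_sum p q w f lam u r < \<infinity>"
    from nuc[OF this] show "r_nuclear (modulation_space p q w) (modulation_rnorm p q w) r (spectral_function p q w f lam u)"
      unfolding r_nuclear_def by blast
  next
    assume fin: "nuclearity_sum p q w f lam u 1 < \<infinity>"
    show "summable (\<lambda>j. cmod (f (lam j)))" by (rule trace(1)[OF fin])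
    show "nuclear_trace (modulation_space p q w) (modulation_rnorm p q w) (spectral_function p q w f lam u) = (\<Sum>j. f (lam j))"
      by (rule trace(2)[OF fin])
  qed
qed

end
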